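(* Assume the mortar condition (MC) stated in the context holds. Then there exists a constant $\beta_E>0$, independent of $h$ and $H$, such that for any $\mu^u\in\Lambda_H^u$, $$\|\mu^u\|_{\Gamma}\le \beta_E\sup_{0\ne\tau\in \mathbb{X}_h}\frac{\sum_{i=1}^N\langle \tau n_i,\mu^u\rangle_{\Gamma_i}}{\|\tau\|_{\mathbb{X}_h}}.$$
   Context: Geometry. $\Omega\subset\mathbb{R}^d$, $d\in\{2,3\}$, is a simply connected domain that is a union of non-overlapping polygonal subdomains $\Omega_1,\dots,\Omega_N$. $\partial\Omega=\Gamma_D^u\cup\Gamma_N^\sigma=\Gamma_D^p\cup\Gamma_N^z$ (two decompositions of the boundary). $\Gamma_{i,j}=\partial\Omega_i\cap\partial\Omega_j$, $\Gamma=\bigcup_{i,j}\Gamma_{i,j}$, $\Gamma_i=\partial\Omega_i\cap\Gamma=\partial\Omega_i\setminus\partial\Omega$, and $n_i$ is the outward unit normal on $\partial\Omega_i$. $\mathbb{M}$ and $\mathbb{N}$ denote $d\times d$ real matrices and skew-symmetric matrices. $(\cdot,\cdot)_G,\|\cdot\|_G$ are the $L^2(G)$ inner product and norm; $\langle\cdot,\cdot\rangle_S,\|\cdot\|_S$ the $L^2(S)$ inner product (or duality pairing) and norm on a hypersurface $S$; the divergence of a matrix field is taken row-wise; $\|\tau\|_{\mathrm{div},G}^2=\|\tau\|_G^2+\|\mathrm{div}\,\tau\|_G^2$. Spaces. $\mathbb{X}=\{\tau\in H(\mathrm{div};\Omega,\mathbb{M}):\tau n=0\text{ on }\Gamma_N^\sigma\}$,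 $V=L^2(\Omega,\mathbb{R}^d)$, $\mathbb{Q}=L^2(\Omega,\mathbb{N})$, $Z=\{q\in H(\mathrm{div};\Omega): q\cdot n=0\text{ on }\Gamma_N^z\}$; for a space $U$ on $\Omega$, $U_i=U|_{\Omega_i}$. Each $\Omega_i$ carries a shape regular simplicial or rectangular finite element partition of maximal element diameter $h$; partitions need not match across $\Gamma$. $\mathbb{X}_{h,i}\times V_{h,i}\times\mathbb{Q}_{h,i}\subset\mathbb{X}_i\times V_i\times\mathbb{Q}_i$ is a stable mixed finite element triplet for elasticity with weakly imposed stress symmetry: $\|v\|_{\Omega_i}+\|\xi\|_{\Omega_i}\le C\sup_{0\ne\tau\in\mathbb{X}_{h,i}}\frac{(\mathrm{div}\,\tau,v)_{\Omega_i}+(\tau,\xi)_{\Omega_i}}{\|\tau\|_{\mathrm{div},\Omega_i}}$ for all $v\in V_{h,i}$, $\xi\in\mathbb{Q}_{h,i}$, with $\mathrm{div}\,\mathbb{X}_{h,i}=V_{h,i}$. For every $\epsilon>0$ there is a canonical mixed interpolant $\Pi_i^\sigma:H^\epsilon(\Omega_i,\mathbb{M})\cap\mathbb{X}_i\to\mathbb{X}_{h,i}$ with $(\mathrm{div}(\Pi_i^\sigma\tau-\tau),v)_{\Omega_i}=0$ for all $v\in V_{h,i}$, $\langle(\Pi_i^\sigma\tau-\tau)n_i,\hat\tau n_i\rangle_{\Gamma_i}=0$ for all $\hat\tau\in\mathbb{X}_{h,i}$, and $\|\Pi_i^\sigma\tau\|_{\mathrm{div},\Omega_i}\le C(\|\tau\|_{H^\epsilon(\Omega_i)}+\|\mathrm{div}\,\tau\|_{\Omega_i})$.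 $Z_{h,i}\subset Z_i$ is the velocity space of a stable mixed finite element pair for Darcy flow. All constants $C$ are independent of $h,H$. Globally, $\mathbb{X}_h=\bigoplus_{i=1}^N\mathbb{X}_{h,i}$ with norm $\|\tau\|_{\mathbb{X}_h}^2=\|\tau\|^2+\|\mathrm{div}_h\tau\|^2$, where $(\mathrm{div}_h\tau)|_{\Omega_i}=\mathrm{div}(\tau|_{\Omega_i})$. Mortar spaces. Each $\Gamma_{i,j}$ carries a shape regular partition $\mathcal{T}_{H,i,j}$ (simplices or quadrilaterals in $d-1$ dimensions) with maximal element diameter $H$; $\Lambda_{H,i,j}^u\subset L^2(\Gamma_{i,j};\mathbb{R}^d)$ and $\Lambda^p_{H,i,j}\subset L^2(\Gamma_{i,j})$ consist of continuous or discontinuous piecewise polynomials on $\mathcal{T}_{H,i,j}$, and $\Lambda_H^\star=\bigoplus_{1\le i<j\le N}\Lambda_{H,i,j}^\star$, $\star\in\{u,p\}$. Mortar condition (MC). Let $\mathcal{Q}^u_{h,i}:L^2(\partial\Omega_i,\mathbb{R}^d)\to\mathbb{X}_{h,i}n_i$ and $\mathcal{Q}^p_{h,i}:L^2(\partial\Omega_i)\to Z_{h,i}\cdot n_i$ be the $L^2(\partial\Omega_i)$-orthogonal projections onto the spaces of normal traces (mortar functions are extended by zero to $\partial\Omega$). (MC) states: there is a constant $C>0$ independent of $h,H$ such that $\|\mu^\star\|_{\Gamma_{i,j}}\le C(\|\mathcal{Q}^\star_{h,i}\mu^\star\|_{\Gamma_{i,j}}+\|\mathcal{Q}^\star_{h,j}\mu^\star\|_{\Gamma_{i,j}})$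 for all $\mu^\star\in\Lambda_H^\star$, $1\le i<j\le N$, $\star\in\{p,u\}$. *)

theory Defs
  imports "HOL-Analysis.Analysis"
begin

section \<open>Surface measure\<close>

definition hyperplanes :: "'a::euclidean_space set set" where
  "hyperplanes = {P. affine P \<and> aff_dim P = int DIM('a) - 1}"

text \<open>
  The \<open>(d-1)\<close>-dimensional Lebesgue measure of \<open>A \<subseteq> P\<close>, \<open>P\<close> a hyperplane, is the volume of the
  prism of height 1 over \<open>A\<close>, i.e. of the set of points at distance at most \<open>1/2\<close> from \<open>P\<close> whose
  orthogonal projection onto \<open>P\<close> lies in \<open>A\<close>.
\<close>
definition hyperplane_measure :: "'a::euclidean_space set \<Rightarrow> 'a measure" where
  "hyperplane_measure P =
     distr (restrict_space lborel {x. infdist x P \<le> 1/2}) borel (closest_point P)"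

text \<open>
  On every Borel subset of a finite union of hyperplanes (in particular on boundaries of polyhedra)
  this is the \<open>(d-1)\<close>-dimensional surface measure: distinct hyperplanes meet in a null set, so
  the sum over all hyperplanes counts nothing twice.
\<close>
definition surface_measure :: "'a::euclidean_space measure" where
  "surface_measure = measure_of UNIV (sets borel)
     (\<lambda>A. \<integral>\<^sup>+P. emeasure (hyperplane_measure P) A \<partial>count_space hyperplanes)"

lemma sets_surface_measure [simp, measurable_cong]: "sets surface_measure = sets borel"
  unfolding surface_measure_def by (metis sets.sets_measure_of_eq space_borel)

lemma space_surface_measure [simp]: "space surface_measure = UNIV"
  unfolding surface_measure_def by (metis sets.space_measure_of_eq space_borel)

lemma emeasure_surface_measure:
  fixes A :: "'a::euclidean_space set"
  assumes "A \<in> sets borel"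
  shows "emeasure surface_measure A =
    (\<integral>\<^sup>+P. emeasure (hyperplane_measure P) A \<partial>count_space hyperplanes)"
proof (rule emeasure_measure_of[OF surface_measure_def])
  show "countably_additive (sets (surface_measure :: 'a measure))
      (\<lambda>A. \<integral>\<^sup>+P. emeasure (hyperplane_measure P) A \<partial>count_space hyperplanes)"
  proof (rule countably_additiveI)
    fix B :: "nat \<Rightarrow> 'a set"
    assume B: "range B \<subseteq> sets surface_measure" "disjoint_family B"
    have "(\<Sum>i. \<integral>\<^sup>+P. emeasure (hyperplane_measure P) (B i) \<partial>count_space hyperplanes) =
        (\<integral>\<^sup>+P. (\<Sum>i. emeasure (hyperplane_measure P) (B i)) \<partial>count_space hyperplanes)"
      by (rule nn_integral_suminf[symmetric]) simp
    also have "\<dots> = (\<integral>\<^sup>+P. emeasure (hyperplane_measure P) (\<Union>i. B i) \<partial>count_space hyperplanes)"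
      using B by (intro nn_integral_cong suminf_emeasure) (auto simp: hyperplane_measure_def)
    finally show "(\<Sum>i. \<integral>\<^sup>+P. emeasure (hyperplane_measure P) (B i) \<partial>count_space hyperplanes) =
        (\<integral>\<^sup>+P. emeasure (hyperplane_measure P) (\<Union>i. B i) \<partial>count_space hyperplanes)" .
  qed
qed (use assms in \<open>auto simp: positive_def\<close>)

abbreviation vol :: "'a::euclidean_space set \<Rightarrow> 'a measure" where
  "vol G \<equiv> restrict_space lborel G"

abbreviation surf :: "'a::euclidean_space set \<Rightarrow> 'a measure" where
  "surf S \<equiv> restrict_space surface_measure S"


section \<open>Square-integrable functions\<close>

text \<open>
  Elements of function spaces on \<open>G\<close> are functions on the whole space whose values outside \<open>G\<close> are
  irrelevant; equality in the function spaces is equality almost everywhere on \<open>G\<close>.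
\<close>
definition L2_space :: "'a measure \<Rightarrow> ('a \<Rightarrow> 'b::euclidean_space) set" where
  "L2_space M = {f \<in> borel_measurable M. integrable M (\<lambda>x. (norm (f x))\<^sup>2)}"

definition L2_inner :: "'a measure \<Rightarrow> ('a \<Rightarrow> 'b::euclidean_space) \<Rightarrow> ('a \<Rightarrow> 'b) \<Rightarrow> real" where
  "L2_inner M f g = (\<integral>x. f x \<bullet> g x \<partial>M)"

definition L2_norm :: "'a measure \<Rightarrow> ('a \<Rightarrow> 'b::euclidean_space) \<Rightarrow> real" where
  "L2_norm M f = sqrt (\<integral>x. (norm (f x))\<^sup>2 \<partial>M)"

definition is_L2_projection ::
  "'a measure \<Rightarrow> ('a \<Rightarrow> 'b::euclidean_space) set \<Rightarrow> ('a \<Rightarrow> 'b) \<Rightarrow> ('a \<Rightarrow> 'b) \<Rightarrow> bool" where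
  "is_L2_projection M S f g \<longleftrightarrow> g \<in> S \<and> (\<forall>s\<in>S. L2_inner M (\<lambda>x. f x - g x) s = 0)"

definition L2_projection ::
  "'a measure \<Rightarrow> ('a \<Rightarrow> 'b::euclidean_space) set \<Rightarrow> ('a \<Rightarrow> 'b) \<Rightarrow> ('a \<Rightarrow> 'b)" where
  "L2_projection M S f = (SOME g. is_L2_projection M S f g)"

definition restrict_functions :: "'a set \<Rightarrow> ('a \<Rightarrow> 'b) set \<Rightarrow> ('a \<Rightarrow> 'b) set" where
  "restrict_functions G U = {f. \<exists>g\<in>U. \<forall>x\<in>G. f x = g x}"

definition extend_by_zero :: "'a set \<Rightarrow> ('a \<Rightarrow> 'b::zero) \<Rightarrow> ('a \<Rightarrow> 'b)" where
  "extend_by_zero S f = (\<lambda>x. if x \<in> S then f x else 0)"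

definition function_subspace :: "('a \<Rightarrow> 'b::real_vector) set \<Rightarrow> bool" where
  "function_subspace U \<longleftrightarrow> (\<lambda>x. 0) \<in> U \<and> (\<forall>f\<in>U. \<forall>g\<in>U. (\<lambda>x. f x + g x) \<in> U) \<and>
     (\<forall>c. \<forall>f\<in>U. (\<lambda>x. c *\<^sub>R f x) \<in> U)"


section \<open>Weak derivatives, \<open>H(div)\<close> and fractional Sobolev spaces\<close>

definition gradient :: "(real^'n \<Rightarrow> real) \<Rightarrow> real^'n \<Rightarrow> real^'n" where
  "gradient \<phi> x = (\<chi> j. frechet_derivative \<phi> (at x) (axis j 1))"

definition C1_function :: "(real^'n \<Rightarrow> real) \<Rightarrow> bool" where
  "C1_function \<phi> \<longleftrightarrow> (\<forall>x. \<phi> differentiable at x) \<and> continuous_on UNIV (gradient \<phi>)"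

text \<open>
  Test functions are taken in \<open>C\<^sup>1\<close> with compact support; by mollification this gives the same
  weak derivatives as smooth test functions.
\<close>
definition test_function :: "(real^'n) set \<Rightarrow> (real^'n \<Rightarrow> real) \<Rightarrow> bool" where
  "test_function G \<phi> \<longleftrightarrow> C1_function \<phi> \<and> (\<exists>K. compact K \<and> K \<subseteq> G \<and> (\<forall>x. x \<notin> K \<longrightarrow> \<phi> x = 0))"

definition has_weak_div ::
  "(real^'n) set \<Rightarrow> (real^'n \<Rightarrow> real^'n) \<Rightarrow> (real^'n \<Rightarrow> real) \<Rightarrow> bool" where
  "has_weak_div G q f \<longleftrightarrow> f \<in> L2_space (vol G) \<and>
     (\<forall>\<phi>. test_function G \<phi> \<longrightarrow>
        (\<integral>x. q x \<bullet> gradient \<phi> x \<partial>vol G) = - (\<integral>x. f x * \<phi> x \<partial>vol G))"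

definition weak_div :: "(real^'n) set \<Rightarrow> (real^'n \<Rightarrow> real^'n) \<Rightarrow> real^'n \<Rightarrow> real" where
  "weak_div G q = (SOME f. has_weak_div G q f)"

definition Hdiv :: "(real^'n) set \<Rightarrow> (real^'n \<Rightarrow> real^'n) set" where
  "Hdiv G = {q \<in> L2_space (vol G). \<exists>f. has_weak_div G q f}"

definition Hdiv_norm :: "(real^'n) set \<Rightarrow> (real^'n \<Rightarrow> real^'n) \<Rightarrow> real" where
  "Hdiv_norm G q = sqrt ((L2_norm (vol G) q)\<^sup>2 + (L2_norm (vol G) (weak_div G q))\<^sup>2)"

text \<open>Matrix fields are treated row by row; \<open>\<tau> x $ r\<close> is row \<open>r\<close> of \<open>\<tau> x\<close>.\<close>

definition mat_div :: "(real^'n) set \<Rightarrow> (real^'n \<Rightarrow> real^'n^'n) \<Rightarrow> real^'n \<Rightarrow> real^'n" where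
  "mat_div G \<tau> x = (\<chi> r. weak_div G (\<lambda>y. \<tau> y $ r) x)"

definition mat_Hdiv :: "(real^'n) set \<Rightarrow> (real^'n \<Rightarrow> real^'n^'n) set" where
  "mat_Hdiv G = {\<tau>. \<forall>r. (\<lambda>x. \<tau> x $ r) \<in> Hdiv G}"

definition mat_Hdiv_norm :: "(real^'n) set \<Rightarrow> (real^'n \<Rightarrow> real^'n^'n) \<Rightarrow> real" where
  "mat_Hdiv_norm G \<tau> = sqrt ((L2_norm (vol G) \<tau>)\<^sup>2 + (L2_norm (vol G) (mat_div G \<tau>))\<^sup>2)"

definition has_weak_partial ::
  "(real^'n) set \<Rightarrow> 'n \<Rightarrow> (real^'n \<Rightarrow> 'b::euclidean_space) \<Rightarrow> (real^'n \<Rightarrow> 'b) \<Rightarrow> bool" where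
  "has_weak_partial G j f g \<longleftrightarrow> g \<in> L2_space (vol G) \<and>
     (\<forall>\<phi>. test_function G \<phi> \<longrightarrow>
        (\<integral>x. (gradient \<phi> x $ j) *\<^sub>R f x \<partial>vol G) = - (\<integral>x. \<phi> x *\<^sub>R g x \<partial>vol G))"

definition weak_partial ::
  "(real^'n) set \<Rightarrow> 'n \<Rightarrow> (real^'n \<Rightarrow> 'b::euclidean_space) \<Rightarrow> (real^'n \<Rightarrow> 'b)" where
  "weak_partial G j f = (SOME g. has_weak_partial G j f g)"

text \<open>
  The Sobolev--Slobodeckij space of order \<open>m + \<sigma>\<close>, \<open>m\<close> a natural number and \<open>0 \<le> \<sigma> < 1\<close>.
\<close>
definition slobodeckij :: "real \<Rightarrow> (real^'n) set \<Rightarrow> (real^'n \<Rightarrow> 'b::euclidean_space) \<Rightarrow> ennreal" where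
  "slobodeckij \<sigma> G f = (if \<sigma> = 0 then 0 else
     (\<integral>\<^sup>+x. \<integral>\<^sup>+y. ennreal ((norm (f x - f y))\<^sup>2 / dist x y powr (real CARD('n) + 2 * \<sigma>))
        \<partial>vol G \<partial>vol G))"

primrec sobolev_space_aux ::
  "nat \<Rightarrow> real \<Rightarrow> (real^'n) set \<Rightarrow> (real^'n \<Rightarrow> 'b::euclidean_space) set" where
  "sobolev_space_aux 0 \<sigma> G = {f \<in> L2_space (vol G). slobodeckij \<sigma> G f < \<infinity>}"
| "sobolev_space_aux (Suc m) \<sigma> G = {f \<in> L2_space (vol G).
     \<forall>j. (\<exists>g. has_weak_partial G j f g) \<and> weak_partial G j f \<in> sobolev_space_aux m \<sigma> G}"

primrec sobolev_norm2_aux ::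
  "nat \<Rightarrow> real \<Rightarrow> (real^'n) set \<Rightarrow> (real^'n \<Rightarrow> 'b::euclidean_space) \<Rightarrow> real" where
  "sobolev_norm2_aux 0 \<sigma> G = (\<lambda>f. (L2_norm (vol G) f)\<^sup>2 + enn2real (slobodeckij \<sigma> G f))"
| "sobolev_norm2_aux (Suc m) \<sigma> G = (\<lambda>f. (L2_norm (vol G) f)\<^sup>2 +
     (\<Sum>j\<in>UNIV. sobolev_norm2_aux m \<sigma> G (weak_partial G j f)))"

definition sobolev_space :: "real \<Rightarrow> (real^'n) set \<Rightarrow> (real^'n \<Rightarrow> 'b::euclidean_space) set" where
  "sobolev_space s G = sobolev_space_aux (nat \<lfloor>s\<rfloor>) (frac s) G"

definition sobolev_norm :: "real \<Rightarrow> (real^'n) set \<Rightarrow> (real^'n \<Rightarrow> 'b::euclidean_space) \<Rightarrow> real" where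
  "sobolev_norm s G f = sqrt (sobolev_norm2_aux (nat \<lfloor>s\<rfloor>) (frac s) G f)"


section \<open>Normal traces\<close>

text \<open>
  Normal traces of \<open>H(div)\<close> fields are defined by Green's formula; for a field smooth up to the
  boundary of a polyhedral domain \<open>G\<close> the normal trace is the product with the outward unit normal.
\<close>
definition green :: "(real^'n) set \<Rightarrow> (real^'n \<Rightarrow> real^'n) \<Rightarrow> (real^'n \<Rightarrow> real) \<Rightarrow> real" where
  "green G q \<phi> = (\<integral>x. weak_div G q x * \<phi> x + q x \<bullet> gradient \<phi> x \<partial>vol G)"

definition has_normal_trace ::
  "(real^'n) set \<Rightarrow> (real^'n \<Rightarrow> real^'n) \<Rightarrow> (real^'n \<Rightarrow> real) \<Rightarrow> bool" where
  "has_normal_trace G q g \<longleftrightarrow> g \<in> L2_space (surf (frontier G)) \<and>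
     (\<forall>\<phi>. C1_function \<phi> \<longrightarrow> green G q \<phi> = (\<integral>x. g x * \<phi> x \<partial>surf (frontier G)))"

definition normal_trace :: "(real^'n) set \<Rightarrow> (real^'n \<Rightarrow> real^'n) \<Rightarrow> real^'n \<Rightarrow> real" where
  "normal_trace G q = (SOME g. has_normal_trace G q g)"

definition mat_normal_trace ::
  "(real^'n) set \<Rightarrow> (real^'n \<Rightarrow> real^'n^'n) \<Rightarrow> real^'n \<Rightarrow> real^'n" where
  "mat_normal_trace G \<tau> x = (\<chi> r. normal_trace G (\<lambda>y. \<tau> y $ r) x)"

text \<open>
  Vanishing of the (distributional) normal trace of \<open>q \<in> H(div)\<close> on a part \<open>S\<close> of the boundary: it is
  tested with functions that vanish on the complementary part.
\<close>
definition normal_trace_zero_on ::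
  "(real^'n) set \<Rightarrow> (real^'n) set \<Rightarrow> (real^'n \<Rightarrow> real^'n) \<Rightarrow> bool" where
  "normal_trace_zero_on G S q \<longleftrightarrow>
     (\<forall>\<phi>. C1_function \<phi> \<and> (\<forall>x\<in>frontier G - S. \<phi> x = 0) \<longrightarrow> green G q \<phi> = 0)"

text \<open>
  The duality pairing of the normal trace of \<open>q\<close> with \<open>w\<close> over the boundary of \<open>G\<close> has the value
  \<open>c\<close>. For \<open>q \<in> L\<^sup>t\<close>, \<open>t \<ge> 2\<close>, \<open>w\<close> may be the trace of any function in \<open>L\<^sup>2 \<inter> W\<^sup>1\<^sup>,\<^sup>s\<close> with
  \<open>1/s + 1/t = 1\<close>, and Green's formula is extended to it by continuity. For \<open>t = 2\<close> this is the pairing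
  of \<open>H\<^sup>-\<^sup>1\<^sup>/\<^sup>2\<close> and \<open>H\<^sup>1\<^sup>/\<^sup>2\<close>; \<open>t > 2\<close> (available for \<open>q\<close> in a fractional Sobolev space) admits
  discontinuous piecewise polynomials \<open>w\<close>. If the normal trace is in \<open>L\<^sup>2\<close>, then \<open>c\<close> can only be the
  \<open>L\<^sup>2\<close> inner product.
\<close>
definition has_normal_pairing ::
  "(real^'n) set \<Rightarrow> (real^'n \<Rightarrow> real^'n) \<Rightarrow> (real^'n \<Rightarrow> real) \<Rightarrow> real \<Rightarrow> bool" where
  "has_normal_pairing G q w c \<longleftrightarrow> w \<in> L2_space (surf (frontier G)) \<and>
     (\<exists>s t \<phi> \<Phi> \<Psi>. 2 \<le> t \<and> 1 / s + 1 / t = 1 \<and>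
        integrable (vol G) (\<lambda>x. norm (q x) powr t) \<and>
        (\<forall>k::nat. C1_function (\<phi> k)) \<and>
        \<Phi> \<in> L2_space (vol G) \<and>
        \<Psi> \<in> borel_measurable (vol G) \<and> integrable (vol G) (\<lambda>x. norm (\<Psi> x) powr s) \<and>
        (\<lambda>k. \<integral>x. (\<phi> k x - \<Phi> x)\<^sup>2 \<partial>vol G) \<longlonglongrightarrow> 0 \<and>
        (\<lambda>k. \<integral>x. norm (gradient (\<phi> k) x - \<Psi> x) powr s \<partial>vol G) \<longlonglongrightarrow> 0 \<and>
        (\<lambda>k. \<integral>x. (\<phi> k x - w x)\<^sup>2 \<partial>surf (frontier G)) \<longlonglongrightarrow> 0 \<and>
        (\<lambda>k. green G q (\<phi> k)) \<longlonglongrightarrow> c)"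

text \<open>Pairing over a part \<open>S\<close> of the boundary: \<open>w\<close> is extended by zero.\<close>
definition has_mat_normal_pairing ::
  "(real^'n) set \<Rightarrow> (real^'n) set \<Rightarrow> (real^'n \<Rightarrow> real^'n^'n) \<Rightarrow> (real^'n \<Rightarrow> real^'n) \<Rightarrow> real \<Rightarrow> bool"
  where
  "has_mat_normal_pairing G S \<tau> w c \<longleftrightarrow>
     (\<exists>a. (\<forall>r. has_normal_pairing G (\<lambda>x. \<tau> x $ r) (extend_by_zero S (\<lambda>x. w x $ r)) (a r)) \<and>
          c = (\<Sum>r\<in>UNIV. a r))"


section \<open>Geometry\<close>

text \<open>
  Bounded polygonal (polyhedral) domains. The last condition excludes slits.
\<close>
definition polyhedral_domain :: "'a::euclidean_space set \<Rightarrow> bool" where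
  "polyhedral_domain G \<longleftrightarrow> open G \<and> connected G \<and> G \<noteq> {} \<and>
     (\<exists>\<P>. finite \<P> \<and> (\<forall>P\<in>\<P>. polytope P) \<and> closure G = \<Union>\<P>) \<and> G = interior (closure G)"

record 'n geometry =
  num_sub :: nat
  domain :: "(real^'n) set"
  subdomain :: "nat \<Rightarrow> (real^'n) set"
  Gamma_D_u :: "(real^'n) set"
  Gamma_N_sigma :: "(real^'n) set"
  Gamma_D_p :: "(real^'n) set"
  Gamma_N_z :: "(real^'n) set"

definition valid_geometry :: "'n::finite geometry \<Rightarrow> bool" where
  "valid_geometry g \<longleftrightarrow>
     1 \<le> num_sub g \<and>
     simply_connected (domain g) \<and> connected (domain g) \<and>
     (\<forall>i\<in>{1..num_sub g}. polyhedral_domain (subdomain g i)) \<and>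
     (\<forall>i\<in>{1..num_sub g}. \<forall>j\<in>{1..num_sub g}. i \<noteq> j \<longrightarrow> subdomain g i \<inter> subdomain g j = {}) \<and>
     domain g = interior (\<Union>i\<in>{1..num_sub g}. closure (subdomain g i)) \<and>
     frontier (domain g) = Gamma_D_u g \<union> Gamma_N_sigma g \<and>
     Gamma_D_u g \<inter> Gamma_N_sigma g \<in> null_sets surface_measure \<and>
     frontier (domain g) = Gamma_D_p g \<union> Gamma_N_z g \<and>
     Gamma_D_p g \<inter> Gamma_N_z g \<in> null_sets surface_measure"

definition interface :: "'n::finite geometry \<Rightarrow> nat \<Rightarrow> nat \<Rightarrow> (real^'n) set" where
  "interface g i j = frontier (subdomain g i) \<inter> frontier (subdomain g j)"

definition Gamma_all :: "'n::finite geometry \<Rightarrow> (real^'n) set" where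
  "Gamma_all g = (\<Union>i\<in>{1..num_sub g}. \<Union>j\<in>{1..num_sub g} - {i}. interface g i j)"

definition Gamma_sub :: "'n::finite geometry \<Rightarrow> nat \<Rightarrow> (real^'n) set" where
  "Gamma_sub g i = frontier (subdomain g i) \<inter> Gamma_all g"

definition X_space :: "'n::finite geometry \<Rightarrow> (real^'n \<Rightarrow> real^'n^'n) set" where
  "X_space g = {\<tau> \<in> mat_Hdiv (domain g).
     \<forall>r. normal_trace_zero_on (domain g) (Gamma_N_sigma g) (\<lambda>x. \<tau> x $ r)}"

definition V_space :: "'n::finite geometry \<Rightarrow> (real^'n \<Rightarrow> real^'n) set" where
  "V_space g = L2_space (vol (domain g))"

definition Q_space :: "'n::finite geometry \<Rightarrow> (real^'n \<Rightarrow> real^'n^'n) set" where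
  "Q_space g = {\<xi> \<in> L2_space (vol (domain g)). \<forall>x\<in>domain g. transpose (\<xi> x) = - \<xi> x}"

definition Z_space :: "'n::finite geometry \<Rightarrow> (real^'n \<Rightarrow> real^'n) set" where
  "Z_space g = {q \<in> Hdiv (domain g). normal_trace_zero_on (domain g) (Gamma_N_z g) q}"


section \<open>Partitions and piecewise polynomials\<close>

definition rectangular_cell :: "(real^'n) set \<Rightarrow> bool" where
  "rectangular_cell E \<longleftrightarrow> (\<exists>(f :: real^'n \<Rightarrow> real^'n) p a.
     orthogonal_transformation f \<and> (\<forall>j. 0 < a $ j) \<and> E = (\<lambda>x. p + f x) ` cbox 0 a)"

definition fe_partition :: "(real^'n) set \<Rightarrow> (real^'n) set set \<Rightarrow> bool" where
  "fe_partition G \<T> \<longleftrightarrow> finite \<T> \<and> \<Union>\<T> = closure G \<and>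
     ((\<forall>E\<in>\<T>. int CARD('n) simplex E) \<or> (\<forall>E\<in>\<T>. rectangular_cell E)) \<and>
     (\<forall>E\<in>\<T>. \<forall>E'\<in>\<T>. E \<inter> E' face_of E \<and> E \<inter> E' face_of E')"

definition quadrilateral :: "'a::euclidean_space set \<Rightarrow> bool" where
  "quadrilateral E \<longleftrightarrow> polytope E \<and> aff_dim E = 2 \<and> card {x. x extreme_point_of E} = 4"

text \<open>
  An interface may have lower-dimensional components (the subdomains may touch in a vertex or an
  edge); these are not partitioned.
\<close>
definition mortar_partition :: "(real^'n) set \<Rightarrow> (real^'n) set set \<Rightarrow> bool" where
  "mortar_partition S \<T> \<longleftrightarrow> finite \<T> \<and> \<Union>\<T> \<subseteq> S \<and> S - \<Union>\<T> \<in> null_sets surface_measure \<and>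
     (\<forall>E\<in>\<T>. (int CARD('n) - 1) simplex E \<or> (quadrilateral E \<and> CARD('n) = 3)) \<and>
     (\<forall>E\<in>\<T>. \<forall>E'\<in>\<T>. E \<noteq> E' \<longrightarrow> rel_interior E \<inter> rel_interior E' = {})"

definition shape_regular_cell :: "real \<Rightarrow> 'a::euclidean_space set \<Rightarrow> bool" where
  "shape_regular_cell \<kappa> E \<longleftrightarrow>
     (\<exists>x\<in>E. cball x (\<kappa> * diameter E) \<inter> affine hull E \<subseteq> E)"

definition polynomial_deg_le :: "nat \<Rightarrow> (real^'n \<Rightarrow> real) \<Rightarrow> bool" where
  "polynomial_deg_le k p \<longleftrightarrow>
     (\<exists>c. \<forall>x. p x = (\<Sum>\<alpha> | sum \<alpha> (UNIV::'n set) \<le> k. c \<alpha> * (\<Prod>j\<in>UNIV. (x $ j) ^ \<alpha> j)))"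

definition piecewise_polynomial ::
  "nat \<Rightarrow> (real^'n) set set \<Rightarrow> (real^'n \<Rightarrow> 'b::euclidean_space) \<Rightarrow> bool" where
  "piecewise_polynomial k \<T> f \<longleftrightarrow> (\<forall>E\<in>\<T>. \<forall>b\<in>Basis. \<exists>p. polynomial_deg_le k p \<and>
     (\<forall>x\<in>rel_interior E. f x \<bullet> b = p x))"

definition fe_space ::
  "(real^'n) set set \<Rightarrow> (real^'n \<Rightarrow> 'b::euclidean_space) set \<Rightarrow> bool" where
  "fe_space \<T> U \<longleftrightarrow> function_subspace U \<and> (\<exists>k. \<forall>f\<in>U. piecewise_polynomial k \<T> f)"


section \<open>Discretizations\<close>

text \<open>
  \<open>Wh\<close> is the pressure space that forms a stable pair with the Darcy velocity space \<open>Zh\<close>.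
\<close>
record 'n discretization =
  mesh_h :: real
  mesh_H :: real
  Th :: "nat \<Rightarrow> (real^'n) set set"
  Xh :: "nat \<Rightarrow> (real^'n \<Rightarrow> real^'n^'n) set"
  Vh :: "nat \<Rightarrow> (real^'n \<Rightarrow> real^'n) set"
  Qh :: "nat \<Rightarrow> (real^'n \<Rightarrow> real^'n^'n) set"
  Zh :: "nat \<Rightarrow> (real^'n \<Rightarrow> real^'n) set"
  Wh :: "nat \<Rightarrow> (real^'n \<Rightarrow> real) set"
  TH :: "nat \<Rightarrow> nat \<Rightarrow> (real^'n) set set"
  Lambda_u_loc :: "nat \<Rightarrow> nat \<Rightarrow> (real^'n \<Rightarrow> real^'n) set"
  Lambda_p_loc :: "nat \<Rightarrow> nat \<Rightarrow> (real^'n \<Rightarrow> real) set"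

definition interface_pairs :: "'n::finite geometry \<Rightarrow> (nat \<times> nat) set" where
  "interface_pairs g = {(i, j). 1 \<le> i \<and> i < j \<and> j \<le> num_sub g}"

text \<open>
  Piecewise polynomial \<open>H(div)\<close> fields have square-integrable normal traces; the conditions on
  \<open>has_normal_trace\<close> record that the spaces of normal traces are subspaces of \<open>L\<^sup>2\<close> of the boundary.
\<close>
definition valid_discretization ::
  "'n::finite geometry \<Rightarrow> 'n discretization \<Rightarrow> bool" where
  "valid_discretization g D \<longleftrightarrow>
     (\<forall>i\<in>{1..num_sub g}.
        fe_partition (subdomain g i) (Th D i) \<and>
        fe_space (Th D i) (Xh D i) \<and> Xh D i \<subseteq> restrict_functions (subdomain g i) (X_space g) \<and>
        fe_space (Th D i) (Vh D i) \<and> Vh D i \<subseteq> restrict_functions (subdomain g i) (V_space g) \<and>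
        fe_space (Th D i) (Qh D i) \<and> Qh D i \<subseteq> restrict_functions (subdomain g i) (Q_space g) \<and>
        fe_space (Th D i) (Zh D i) \<and> Zh D i \<subseteq> restrict_functions (subdomain g i) (Z_space g) \<and>
        fe_space (Th D i) (Wh D i) \<and> Wh D i \<subseteq> L2_space (vol (subdomain g i)) \<and>
        (\<forall>\<tau>\<in>Xh D i. \<forall>r. \<exists>w. has_normal_trace (subdomain g i) (\<lambda>x. \<tau> x $ r) w) \<and>
        (\<forall>q\<in>Zh D i. \<exists>w. has_normal_trace (subdomain g i) q w)) \<and>
     mesh_h D = Max (diameter ` (\<Union>i\<in>{1..num_sub g}. Th D i)) \<and>
     (\<forall>(i, j)\<in>interface_pairs g.
        mortar_partition (interface g i j) (TH D i j) \<and>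
        fe_space (TH D i j) (Lambda_u_loc D i j) \<and>
        Lambda_u_loc D i j \<subseteq> L2_space (surf (interface g i j)) \<and>
        fe_space (TH D i j) (Lambda_p_loc D i j) \<and>
        Lambda_p_loc D i j \<subseteq> L2_space (surf (interface g i j))) \<and>
     ((\<Union>(i, j)\<in>interface_pairs g. TH D i j) \<noteq> {} \<longrightarrow>
        mesh_H D = Max (diameter ` (\<Union>(i, j)\<in>interface_pairs g. TH D i j)))"

definition shape_regular_family ::
  "'n::finite geometry \<Rightarrow> 'n discretization set \<Rightarrow> bool" where
  "shape_regular_family g \<D> \<longleftrightarrow> (\<exists>\<kappa>>0. \<forall>D\<in>\<D>.
     (\<forall>i\<in>{1..num_sub g}. \<forall>E\<in>Th D i. shape_regular_cell \<kappa> E) \<and>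
     (\<forall>(i, j)\<in>interface_pairs g. \<forall>E\<in>TH D i j. shape_regular_cell \<kappa> E))"

definition elasticity_stable ::
  "'n::finite geometry \<Rightarrow> 'n discretization set \<Rightarrow> bool" where
  "elasticity_stable g \<D> \<longleftrightarrow>
     (\<exists>C>0. \<forall>D\<in>\<D>. \<forall>i\<in>{1..num_sub g}. \<forall>v\<in>Vh D i. \<forall>\<xi>\<in>Qh D i.
        ereal (L2_norm (vol (subdomain g i)) v + L2_norm (vol (subdomain g i)) \<xi>) \<le>
        ereal C * (SUP \<tau>\<in>{\<tau>\<in>Xh D i. \<not> (AE x in vol (subdomain g i). \<tau> x = 0)}.
          ereal ((L2_inner (vol (subdomain g i)) (mat_div (subdomain g i) \<tau>) v +
                  L2_inner (vol (subdomain g i)) \<tau> \<xi>) / mat_Hdiv_norm (subdomain g i) \<tau>))) \<and>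
     (\<forall>D\<in>\<D>. \<forall>i\<in>{1..num_sub g}.
        (\<forall>\<tau>\<in>Xh D i. \<exists>v\<in>Vh D i. AE x in vol (subdomain g i). mat_div (subdomain g i) \<tau> x = v x) \<and>
        (\<forall>v\<in>Vh D i. \<exists>\<tau>\<in>Xh D i. AE x in vol (subdomain g i). mat_div (subdomain g i) \<tau> x = v x))"

definition darcy_stable ::
  "'n::finite geometry \<Rightarrow> 'n discretization set \<Rightarrow> bool" where
  "darcy_stable g \<D> \<longleftrightarrow>
     (\<exists>C>0. \<forall>D\<in>\<D>. \<forall>i\<in>{1..num_sub g}. \<forall>w\<in>Wh D i.
        ereal (L2_norm (vol (subdomain g i)) w) \<le>
        ereal C * (SUP q\<in>{q\<in>Zh D i. \<not> (AE x in vol (subdomain g i). q x = 0)}.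
          ereal (L2_inner (vol (subdomain g i)) (weak_div (subdomain g i) q) w /
                 Hdiv_norm (subdomain g i) q)))"

definition canonical_interpolants ::
  "'n::finite geometry \<Rightarrow> 'n discretization set \<Rightarrow> bool" where
  "canonical_interpolants g \<D> \<longleftrightarrow>
     (\<forall>\<epsilon>>0. \<exists>C>0. \<forall>D\<in>\<D>. \<forall>i\<in>{1..num_sub g}. \<exists>P\<^sub>\<sigma>.
        \<forall>\<tau> \<in> sobolev_space \<epsilon> (subdomain g i) \<inter> restrict_functions (subdomain g i) (X_space g).
          P\<^sub>\<sigma> \<tau> \<in> Xh D i \<and>
          (\<forall>v\<in>Vh D i. L2_inner (vol (subdomain g i))
             (mat_div (subdomain g i) (\<lambda>x. P\<^sub>\<sigma> \<tau> x - \<tau> x)) v = 0) \<and>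
          (\<forall>\<tau>'\<in>Xh D i. has_mat_normal_pairing (subdomain g i) (Gamma_sub g i)
             (\<lambda>x. P\<^sub>\<sigma> \<tau> x - \<tau> x) (mat_normal_trace (subdomain g i) \<tau>') 0) \<and>
          mat_Hdiv_norm (subdomain g i) (P\<^sub>\<sigma> \<tau>) \<le>
            C * (sobolev_norm \<epsilon> (subdomain g i) \<tau> +
                 L2_norm (vol (subdomain g i)) (mat_div (subdomain g i) \<tau>)))"


section \<open>Global discrete spaces and the mortar condition\<close>

definition Xh_space ::
  "'n::finite geometry \<Rightarrow> 'n discretization \<Rightarrow> (real^'n \<Rightarrow> real^'n^'n) set" where
  "Xh_space g D = {\<tau>. \<forall>i\<in>{1..num_sub g}. \<tau> \<in> restrict_functions (subdomain g i) (Xh D i)}"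

definition div_h ::
  "'n::finite geometry \<Rightarrow> (real^'n \<Rightarrow> real^'n^'n) \<Rightarrow> real^'n \<Rightarrow> real^'n" where
  "div_h g \<tau> x = (\<Sum>i\<in>{1..num_sub g}. extend_by_zero (subdomain g i) (mat_div (subdomain g i) \<tau>) x)"

text \<open>
  The domain differs from the union of the subdomains by a null set, on which elements of \<open>Xh_space\<close>
  are unconstrained (and possibly not measurable), so the norms over the domain are taken over the
  union.
\<close>
definition Xh_norm :: "'n::finite geometry \<Rightarrow> (real^'n \<Rightarrow> real^'n^'n) \<Rightarrow> real" where
  "Xh_norm g \<tau> = sqrt ((L2_norm (vol (\<Union>i\<in>{1..num_sub g}. subdomain g i)) \<tau>)\<^sup>2 +
     (L2_norm (vol (\<Union>i\<in>{1..num_sub g}. subdomain g i)) (div_h g \<tau>))\<^sup>2)"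

text \<open>
  Distinct interfaces overlap in null sets only, so an element of the direct sum of the local mortar
  spaces is a single function on their union.
\<close>
definition mortar_space ::
  "'n::finite geometry \<Rightarrow> (nat \<Rightarrow> nat \<Rightarrow> (real^'n \<Rightarrow> 'b::euclidean_space) set) \<Rightarrow>
     (real^'n \<Rightarrow> 'b) set" where
  "mortar_space g \<Lambda> = {\<mu> \<in> L2_space (surf (Gamma_all g)).
     \<forall>(i, j)\<in>interface_pairs g. \<exists>\<nu>\<in>\<Lambda> i j. AE x in surf (interface g i j). \<mu> x = \<nu> x}"

abbreviation Lambda_u ::
  "'n::finite geometry \<Rightarrow> 'n discretization \<Rightarrow> (real^'n \<Rightarrow> real^'n) set" where
  "Lambda_u g D \<equiv> mortar_space g (Lambda_u_loc D)"

abbreviation Lambda_p ::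
  "'n::finite geometry \<Rightarrow> 'n discretization \<Rightarrow> (real^'n \<Rightarrow> real) set" where
  "Lambda_p g D \<equiv> mortar_space g (Lambda_p_loc D)"

definition proj_u ::
  "'n::finite geometry \<Rightarrow> 'n discretization \<Rightarrow> nat \<Rightarrow> (real^'n \<Rightarrow> real^'n) \<Rightarrow> (real^'n \<Rightarrow> real^'n)" where
  "proj_u g D i = L2_projection (surf (frontier (subdomain g i)))
     (mat_normal_trace (subdomain g i) ` Xh D i)"

definition proj_p ::
  "'n::finite geometry \<Rightarrow> 'n discretization \<Rightarrow> nat \<Rightarrow> (real^'n \<Rightarrow> real) \<Rightarrow> (real^'n \<Rightarrow> real)" where
  "proj_p g D i = L2_projection (surf (frontier (subdomain g i)))
     (normal_trace (subdomain g i) ` Zh D i)"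

definition mortar_condition ::
  "'n::finite geometry \<Rightarrow> 'n discretization set \<Rightarrow> bool" where
  "mortar_condition g \<D> \<longleftrightarrow> (\<exists>C>0. \<forall>D\<in>\<D>. \<forall>(i, j)\<in>interface_pairs g.
     (\<forall>\<mu>\<in>Lambda_u g D. L2_norm (surf (interface g i j)) \<mu> \<le>
        C * (L2_norm (surf (interface g i j)) (proj_u g D i (extend_by_zero (Gamma_all g) \<mu>)) +
             L2_norm (surf (interface g i j)) (proj_u g D j (extend_by_zero (Gamma_all g) \<mu>)))) \<and>
     (\<forall>\<mu>\<in>Lambda_p g D. L2_norm (surf (interface g i j)) \<mu> \<le>
        C * (L2_norm (surf (interface g i j)) (proj_p g D i (extend_by_zero (Gamma_all g) \<mu>)) +
             L2_norm (surf (interface g i j)) (proj_p g D j (extend_by_zero (Gamma_all g) \<mu>)))))"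

end

theory Submission
  imports Defs
begin

text \<open>
  On each subdomain \<open>\<mu>\<close> is lifted to a field with normal trace \<open>\<mu>\<close> on the interface that is bounded in
  \<open>H(div)\<close> and in \<open>H\<^sup>1\<^sup>/\<^sup>8\<close> by the \<open>L\<^sup>2\<close> norm of \<open>\<mu>\<close>. The lift is explicit and needs no
  elliptic regularity: mass \<open>f(y)\<close> is carried from each point \<open>y\<close> of the interface along
  straight segments to a bump around \<open>c(y)\<close> (as in Bogovskii's operator). Using one ball in the
  subdomain and one in a neighbour, the flow crosses the interface and stays away from the outer
  boundary, so that the boundary condition of \<open>X_space\<close> holds.

  Let \<open>\<tau>\<close> be the canonical interpolant of the lift. It is bounded by \<open>\<mu>\<close>, and \<open>\<tau>n - \<mu>\<close> is
  orthogonal to all discrete normal traces. With the projection \<open>Q\<mu>\<close> this gives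
  \<open>\<langle>\<mu>, \<tau>n\<rangle> = \<parallel>\<tau>n\<parallel>\<^sup>2\<close> and \<open>\<parallel>Q\<mu>\<parallel>\<^sup>2 = \<langle>\<mu>, Q\<mu>\<rangle> = \<langle>\<tau>n, Q\<mu>\<rangle>\<close>, hence
  \<open>\<parallel>Q\<mu>\<parallel>\<^sup>2 \<le> \<langle>\<tau>n, \<mu>\<rangle>\<close>. Sum over the subdomains and apply the mortar condition.
\<close>


section \<open>Test functions\<close>

text \<open>Two demands shape the lift. The interpolant is available only for restrictions of fields
  in \<open>X_space\<close>, so a field on one subdomain does not suffice: it has to continue across
  the interface into an \<open>Hdiv\<close> field of the whole domain. Moreover \<mu>, extended by
  zero, is merely square integrable, so its lift has little smoothness. Any positive Sobolev order
  is enough for the interpolant, however: the kernel of the flow yields a pointwise Hoelder bound of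
  exponent 1/4 whose factor is square integrable by a Schur test, hence order 1/8.
  \<open>weak_div\<close>, \<open>normal_trace\<close> and \<open>L2_projection\<close> are choices
  by \<open>SOME\<close>. Uniqueness up to null sets comes from testing with C1 bumps, for volume
  and surface measure alike. Existence of the projection comes from a Riesz argument on the
  piecewise polynomial fields, where the trace form is only semidefinite. Every constant is fixed
  before a discretization is chosen: those of the lift come from the geometry, the others from the
  interpolants and from (MC).\<close>

lemma
  fixes \<phi> :: "real^'n \<Rightarrow> real"
  assumes "\<And>x. (\<phi> has_derivative (\<lambda>v. g x \<bullet> v)) (at x)" "continuous_on UNIV g"
  shows C1_function_if_derivative: "C1_function \<phi>" and gradient_eq_if_derivative: "gradient \<phi> = g"
proof -
  have "frechet_derivative \<phi> (at x) = (\<lambda>v. g x \<bullet> v)" for x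
    using frechet_derivative_at[OF assms(1)] by simp
  then show *: "gradient \<phi> = g"
    by (auto simp: gradient_def fun_eq_iff inner_axis vec_eq_iff)
  show "C1_function \<phi>"
    unfolding C1_function_def * using assms by (auto simp: differentiable_def)
qed

lemma C1_function_has_derivative:
  fixes \<phi> :: "real^'n \<Rightarrow> real"
  assumes "C1_function \<phi>"
  shows "(\<phi> has_derivative (\<lambda>v. gradient \<phi> x \<bullet> v)) (at x)"
proof -
  have d: "(\<phi> has_derivative frechet_derivative \<phi> (at x)) (at x)"
    using assms by (simp add: C1_function_def frechet_derivative_works)
  interpret f: linear "frechet_derivative \<phi> (at x)"
    using d has_derivative_linear by blast
  have "frechet_derivative \<phi> (at x) v = gradient \<phi> x \<bullet> v" for v
  proof -
    have "frechet_derivative \<phi> (at x) v = frechet_derivative \<phi> (at x) (\<Sum>i\<in>UNIV. v $ i *\<^sub>R axis i 1)"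
      using basis_expansion[of v] by (simp add: scalar_mult_eq_scaleR)
    also have "\<dots> = gradient \<phi> x \<bullet> v"
      by (simp add: f.sum f.scaleR gradient_def inner_vec_def mult.commute)
    finally show ?thesis .
  qed
  with d show ?thesis by (metis (no_types, lifting) ext)
qed

lemma C1_function_continuous_on: "C1_function \<phi> \<Longrightarrow> continuous_on S \<phi>"
  by (meson C1_function_has_derivative continuous_at_imp_continuous_on has_derivative_continuous)

lemma gradient_continuous_on: "C1_function \<phi> \<Longrightarrow> continuous_on S (gradient \<phi>)"
  unfolding C1_function_def using continuous_on_subset by blast

lemma C1_function_borel_measurable [measurable_dest]:
  "C1_function \<phi> \<Longrightarrow> \<phi> \<in> borel_measurable borel"
  by (intro borel_measurable_continuous_onI C1_function_continuous_on)

lemma gradient_borel_measurable [measurable_dest]: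
  "C1_function \<phi> \<Longrightarrow> gradient \<phi> \<in> borel_measurable borel"
  by (intro borel_measurable_continuous_onI gradient_continuous_on)

lemma C1_function_const: "C1_function (\<lambda>x. c :: real)"
  by (rule C1_function_if_derivative[where g = "\<lambda>x. 0"]) auto

lemma C1_function_mult:
  fixes f g :: "real^'n \<Rightarrow> real"
  assumes "C1_function f" "C1_function g"
  shows "C1_function (\<lambda>x. f x * g x)"
proof (rule C1_function_if_derivative[where g = "\<lambda>x. f x *\<^sub>R gradient g x + g x *\<^sub>R gradient f x"])
  show "((\<lambda>x. f x * g x) has_derivative (\<lambda>v. (f x *\<^sub>R gradient g x + g x *\<^sub>R gradient f x) \<bullet> v)) (at x)" for x
    by (rule derivative_eq_intros C1_function_has_derivative assms refl)+
      (auto simp: inner_add_left algebra_simps)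
qed (intro continuous_intros C1_function_continuous_on gradient_continuous_on assms)

lemma C1_function_prod:
  fixes f :: "'i \<Rightarrow> real^'n \<Rightarrow> real"
  assumes "\<And>i. i \<in> I \<Longrightarrow> C1_function (f i)"
  shows "C1_function (\<lambda>x. \<Prod>i\<in>I. f i x)"
  using assms
  by (induction I rule: infinite_finite_induct) (auto intro!: C1_function_const C1_function_mult)

lemma C1_function_coordinate:
  fixes f :: "real \<Rightarrow> real"
  assumes f: "\<And>s. (f has_real_derivative f' s) (at s)" and "continuous_on UNIV f'"
  shows "C1_function (\<lambda>x :: real^'n. f (x $ j))"
proof (rule C1_function_if_derivative[where g = "\<lambda>x. f' (x $ j) *\<^sub>R axis j 1"])
  show "((\<lambda>x :: real^'n. f (x $ j)) has_derivative (\<lambda>v. (f' (x $ j) *\<^sub>R axis j 1) \<bullet> v)) (at x)" for x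
  proof -
    have "((\<lambda>x :: real^'n. x $ j) has_derivative (\<lambda>v. v $ j)) (at x)"
      by (simp add: bounded_linear_imp_has_derivative bounded_linear_vec_nth)
    from has_derivative_compose[OF this] f[of "x $ j"]
    show ?thesis
      by (auto simp: has_field_derivative_def inner_axis' )
  qed
  show "continuous_on UNIV (\<lambda>x :: real^'n. f' (x $ j) *\<^sub>R (axis j 1 :: real^'n))"
    by (intro continuous_intros continuous_on_compose2[OF assms(2)]) auto
qed

section \<open>C1 bumps that converge to the indicator of a box\<close>

lemma has_real_derivative_max_0_power2:
  "((\<lambda>s::real. (max 0 s)\<^sup>2) has_real_derivative 2 * max 0 s) (at s)"
proof (cases "s = 0")
  case True
  have "((\<lambda>s::real. (max 0 s)\<^sup>2 / s) \<longlongrightarrow> 0) (at 0)"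
  proof (rule Lim_null_comparison[where g = "\<lambda>s. \<bar>s\<bar>"])
    have "norm ((max 0 s)\<^sup>2 / s) \<le> \<bar>s\<bar>" for s :: real
      by (cases "s \<ge> 0") (auto simp: power2_eq_square)
    then show "\<forall>\<^sub>F s in at 0. norm ((max 0 s)\<^sup>2 / s) \<le> \<bar>s::real\<bar>" by simp
    show "((\<lambda>s. \<bar>s::real\<bar>) \<longlongrightarrow> 0) (at 0)"
      using tendsto_rabs[OF tendsto_ident_at[of "0::real" UNIV]] by simp
  qed
  then show ?thesis using True by (simp add: has_field_derivative_iff)
next
  case False
  show ?thesis
  proof (cases "s > 0")
    case True
    have "((\<lambda>s. s\<^sup>2) has_real_derivative 2 * s) (at s)"
      by (auto intro!: derivative_eq_intros)
    then have "((\<lambda>s. (max 0 s)\<^sup>2) has_real_derivative 2 * s) (at s)"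
      by (rule has_field_derivative_transform_within_open[where S = "{0<..}"]) (use True in auto)
    then show ?thesis using True by simp
  next
    case f: False
    have "((\<lambda>s. 0) has_real_derivative 0) (at s)"
      by (auto intro!: derivative_eq_intros)
    then have "((\<lambda>s. (max 0 s)\<^sup>2) has_real_derivative 0) (at s)"
      by (rule has_field_derivative_transform_within_open[where S = "{..<0}"]) (use f False in auto)
    then show ?thesis using f by simp
  qed
qed

text \<open>The shape n u / (1 + n u), with u the squared positive part of (s - a) (b - s), is C1,
  stays in [0, 1], vanishes outside (a, b) for a <= b, and tends to 1 inside as n grows. The square
  removes the kink of \<open>max\<close>.\<close>

definition interval_bump :: "real \<Rightarrow> real \<Rightarrow> nat \<Rightarrow> real \<Rightarrow> real" where
  "interval_bump a b n s =
     real n * (max 0 ((s - a) * (b - s)))\<^sup>2 / (1 + real n * (max 0 ((s - a) * (b - s)))\<^sup>2)"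

definition box_bump :: "real^'n \<Rightarrow> real^'n \<Rightarrow> nat \<Rightarrow> real^'n \<Rightarrow> real" where
  "box_bump a b n x = (\<Prod>j\<in>UNIV. interval_bump (a $ j) (b $ j) n (x $ j))"

lemma C1_function_box_bump:
  fixes a b :: "real^'n"
  shows "C1_function (box_bump a b n)"
  unfolding box_bump_def
proof (intro C1_function_prod)
  fix j :: 'n
  define A B where "A = a $ j" and "B = b $ j"
  define w where "w = (\<lambda>s. (max 0 ((s - A) * (B - s)))\<^sup>2)"
  define w' where "w' = (\<lambda>s. 2 * max 0 ((s - A) * (B - s)) * (B - s - (s - A)))"
  have w: "(w has_real_derivative w' s) (at s)" for s
  proof -
    have "((\<lambda>s. (s - A) * (B - s)) has_real_derivative (B - s - (s - A))) (at s)"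
      by (auto intro!: derivative_eq_intros)
    from DERIV_chain2[OF has_real_derivative_max_0_power2 this] show ?thesis
      by (simp add: w_def w'_def)
  qed
  have pos: "1 + real n * w s > 0" for s
    by (smt (verit) w_def mult_nonneg_nonneg of_nat_0_le_iff zero_le_power2)
  have "((\<lambda>s. real n * w s / (1 + real n * w s)) has_real_derivative
     (real n * w' s * (1 + real n * w s) - real n * w s * (real n * w' s)) / (1 + real n * w s)\<^sup>2) (at s)" for s
    using pos[of s] by (auto intro!: derivative_eq_intros w simp: power2_eq_square)
  moreover have "continuous_on UNIV (\<lambda>s. (real n * w' s * (1 + real n * w s) - real n * w s * (real n * w' s)) / (1 + real n * w s)\<^sup>2)"
    using pos by (auto simp: w_def w'_def less_imp_neq[symmetric] intro!: continuous_intros)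
  ultimately have "C1_function (\<lambda>x :: real^'n. real n * w (x $ j) / (1 + real n * w (x $ j)))"
    by (rule C1_function_coordinate)
  then show "C1_function (\<lambda>x. interval_bump (a $ j) (b $ j) n (x $ j))"
    by (simp add: interval_bump_def w_def A_def B_def)
qed

lemma interval_bump_bounds: "0 \<le> interval_bump a b n s" "interval_bump a b n s \<le> 1"
proof -
  define u where "u = (max 0 ((s - a) * (b - s)))\<^sup>2"
  have "0 \<le> real n * u" by (simp add: u_def)
  then show "0 \<le> interval_bump a b n s" "interval_bump a b n s \<le> 1"
    unfolding interval_bump_def u_def[symmetric] by (auto simp: divide_le_eq)
qed

lemma interval_bump_eq_0: "s \<le> a \<or> b \<le> s \<Longrightarrow> a \<le> b \<Longrightarrow> interval_bump a b n s = 0"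
proof -
  assume "s \<le> a \<or> b \<le> s" "a \<le> b"
  then have "(s - a) * (b - s) \<le> 0"
    by (auto intro: mult_nonneg_nonpos mult_nonpos_nonneg)
  then show ?thesis by (simp add: interval_bump_def max_absorb1)
qed

lemma interval_bump_tendsto_1:
  assumes "a < s" "s < b" shows "(\<lambda>n. interval_bump a b n s) \<longlonglongrightarrow> 1"
proof -
  define u where "u = (max 0 ((s - a) * (b - s)))\<^sup>2"
  have u: "u > 0" using assms by (simp add: u_def max_def)
  have "((\<lambda>n. 1 - 1 / (1 + real n * u)) \<longlongrightarrow> 1 - 0) sequentially"
  proof (intro tendsto_intros)
    have "LIM n sequentially. 1 + real n * u :> at_top"
      using u by (intro filterlim_tendsto_add_at_top[OF tendsto_const]
        filterlim_at_top_mult_tendsto_pos[OF tendsto_const] filterlim_real_sequentially) auto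
    then show "(\<lambda>n. 1 / (1 + real n * u)) \<longlonglongrightarrow> 0"
      by (intro tendsto_divide_0[OF tendsto_const] filterlim_at_top_imp_at_infinity)
  qed
  moreover have "1 - 1 / (1 + real n * u) = interval_bump a b n s" for n
  proof -
    have "1 + real n * u > 0" using u by (simp add: add_pos_nonneg)
    then show ?thesis unfolding interval_bump_def u_def[symmetric] by (simp add: field_simps)
  qed
  ultimately show ?thesis by simp
qed

lemma box_bump_bounds:
  fixes a b :: "real^'n"
  shows "0 \<le> box_bump a b n x" "box_bump a b n x \<le> 1"
  unfolding box_bump_def by (auto intro!: prod_nonneg prod_le_1 interval_bump_bounds)

lemma box_bump_eq_0:
  fixes a b :: "real^'n"
  assumes "box a b \<noteq> {}" "x \<notin> box a b" shows "box_bump a b n x = 0"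
proof -
  have ab: "a $ j < b $ j" for j using assms(1) by (simp add: interval_ne_empty_cart)
  obtain j where "x $ j \<le> a $ j \<or> b $ j \<le> x $ j"
    using assms(2) by (auto simp: mem_box_cart not_less)
  then have "interval_bump (a $ j) (b $ j) n (x $ j) = 0"
    using ab[of j] by (intro interval_bump_eq_0) auto
  then show ?thesis unfolding box_bump_def by (intro prod_zero) auto
qed

lemma box_bump_tendsto:
  fixes a b :: "real^'n"
  assumes "box a b \<noteq> {}"
  shows "(\<lambda>n. box_bump a b n x) \<longlonglongrightarrow> indicator (box a b) x"
proof (cases "x \<in> box a b")
  case True
  have "(\<lambda>n. box_bump a b n x) \<longlonglongrightarrow> (\<Prod>j\<in>(UNIV::'n set). 1)"
    unfolding box_bump_def using True
    by (intro tendsto_prod interval_bump_tendsto_1) (auto simp: mem_box_cart)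
  then show ?thesis using True by simp
qed (simp add: box_bump_eq_0[OF assms])

lemma test_function_box_bump:
  fixes a b :: "real^'n"
  assumes "box a b \<noteq> {}" "cbox a b \<subseteq> G" shows "test_function G (box_bump a b n)"
  unfolding test_function_def using assms box_subset_cbox[of a b]
  by (intro conjI C1_function_box_bump exI[of _ "cbox a b"]) (auto intro!: box_bump_eq_0)

text \<open>The fundamental lemma of the calculus of variations, for any Borel measure, since it has
  to serve volume and surface measure. Bumps give boxes by dominated convergence, a Dynkin argument
  gives the Borel subsets of a box, and the sets where h has one sign give h = 0.\<close>

lemma AE_zero_if_test_integrals_zero:
  fixes h :: "real^'n \<Rightarrow> real"
  assumes M: "sets M = sets borel" and G: "open G" and h: "integrable M h"
    and test: "\<And>\<phi>. test_function G \<phi> \<Longrightarrow> (\<integral>x. h x * \<phi> x \<partial>M) = 0"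
  shows "AE x in M. x \<in> G \<longrightarrow> h x = 0"
proof -
  note M[measurable_cong]
  have hm [measurable]: "h \<in> borel_measurable borel"
    using h M by (metis borel_measurable_integrable measurable_cong_sets)
  have spc: "space M = UNIV" using M by (metis sets_eq_imp_space_eq space_borel)
  have ind: "integrable M (\<lambda>x. indicator A x * h x)" if "A \<in> sets borel" for A
    using integrable_mult_indicator[OF _ h, of A] that M by simp
  have box0: "(\<integral>x. indicator (box a b) x * h x \<partial>M) = 0" if "cbox a b \<subseteq> G" for a b
  proof (cases "box a b = {}")
    case False
    have "(\<lambda>n. \<integral>x. h x * box_bump a b n x \<partial>M) \<longlonglongrightarrow> (\<integral>x. h x * indicator (box a b) x \<partial>M)"
    proof (rule integral_dominated_convergence[where w = "\<lambda>x. \<bar>h x\<bar>"])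
      show "AE x in M. (\<lambda>n. h x * box_bump a b n x) \<longlonglongrightarrow> h x * indicator (box a b) x"
        by (intro AE_I2 tendsto_intros box_bump_tendsto False)
      show "AE x in M. norm (h x * box_bump a b n x) \<le> \<bar>h x\<bar>" for n
        using box_bump_bounds[of a b n] by (auto simp: abs_mult intro!: mult_left_le)
      show "(\<lambda>x. h x * box_bump a b n x) \<in> borel_measurable M" for n
        using C1_function_borel_measurable[OF C1_function_box_bump[of a b n]] by measurable
    qed (use h in \<open>auto\<close>)
    moreover have "(\<integral>x. h x * box_bump a b n x \<partial>M) = 0" for n
      by (intro test test_function_box_bump False that)
    ultimately show ?thesis by (simp add: LIMSEQ_const_iff mult.commute)
  qed auto
  \<comment> \<open>The sets A with this property form a Dynkin system that contains the boxes. The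
    fixed box inside G plays the role of the whole space when complements are taken.\<close>
  have all0: "(\<integral>x. indicator (A \<inter> box u v) x * h x \<partial>M) = 0"
    if uv: "cbox u v \<subseteq> G" and A: "A \<in> sets borel" for u v A
  proof -
    have AS: "A \<in> sigma_sets UNIV (range (\<lambda>(a, b). box a b))"
      using A by (simp add: borel_eq_box sets_measure_of)
    have IS: "Int_stable (range (\<lambda>(a, b). box a b :: (real^'n) set))"
      by (auto simp: Int_stable_def Int_interval box_Int_box)
    show ?thesis
    proof (rule sigma_sets_induct_disjoint[OF IS _ AS])
      show "range (\<lambda>(a, b). box a b :: (real^'n) set) \<subseteq> Pow UNIV" by auto
    next
      fix A assume "A \<in> range (\<lambda>(a, b). box a b :: (real^'n) set)"
      then obtain a b where A: "A = box a b" by auto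
      obtain a' b' where ab: "box a b \<inter> box u v = box a' b'" "cbox a b \<inter> cbox u v = cbox a' b'"
        unfolding box_Int_box Int_interval by blast
      show "(\<integral>x. indicator (A \<inter> box u v) x * h x \<partial>M) = 0"
        unfolding A ab(1) by (rule box0) (use ab(2) uv in auto)
    next
      show "(\<integral>x. indicator ({} \<inter> box u v) x * h x \<partial>M) = 0" by simp
    next
      fix A assume A: "A \<in> sigma_sets UNIV (range (\<lambda>(a, b). box a b :: (real^'n) set))"
        and IH: "(\<integral>x. indicator (A \<inter> box u v) x * h x \<partial>M) = 0"
      from A have [measurable]: "A \<in> sets borel" by (simp add: borel_eq_box sets_measure_of)
      have "(\<integral>x. indicator ((UNIV - A) \<inter> box u v) x * h x \<partial>M) =
         (\<integral>x. indicator (box u v) x * h x - indicator (A \<inter> box u v) x * h x \<partial>M)"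
        by (intro Bochner_Integration.integral_cong) (auto simp: indicator_def)
      also have "\<dots> = 0"
        by (subst Bochner_Integration.integral_diff) (auto intro!: ind simp: IH box0[OF uv])
      finally show "(\<integral>x. indicator ((UNIV - A) \<inter> box u v) x * h x \<partial>M) = 0" .
    next
      fix A :: "nat \<Rightarrow> (real^'n) set"
      assume dis: "disjoint_family A"
        and A: "range A \<subseteq> sigma_sets UNIV (range (\<lambda>(a, b). box a b :: (real^'n) set))"
        and IH: "\<And>i. (\<integral>x. indicator (A i \<inter> box u v) x * h x \<partial>M) = 0"
      from A have Am [measurable]: "A i \<in> sets borel" for i by (auto simp: borel_eq_box sets_measure_of)
      have "(\<integral>x. indicator ((\<Union>i. A i) \<inter> box u v) x * h x \<partial>M) =
        (LINT x:(\<Union>i. A i \<inter> box u v)|M. h x)"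
        by (simp add: set_lebesgue_integral_def)
      also have "\<dots> = (\<Sum>i. LINT x:(A i \<inter> box u v)|M. h x)"
      proof (rule lebesgue_integral_countable_add)
        show "A i \<inter> box u v \<in> sets M" for i by measurable
        show "set_integrable M (\<Union>i. A i \<inter> box u v) h"
          using ind[of "\<Union>i. A i \<inter> box u v"] by (simp add: set_integrable_def)
        show "(A i \<inter> box u v) \<inter> (A j \<inter> box u v) = {}" if "i \<noteq> j" for i j
          using dis that by (auto simp: disjoint_family_on_def)
      qed
      also have "\<dots> = 0" using IH by (simp add: set_lebesgue_integral_def)
      finally show "(\<integral>x. indicator ((\<Union>i. A i) \<inter> box u v) x * h x \<partial>M) = 0" .
    qed
  qed
  have AEbox: "AE x in M. x \<in> box u v \<longrightarrow> h x = 0" if uv: "cbox u v \<subseteq> G" for u v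
  proof -
    \<comment> \<open>Both signs are treated at once: s = 1 excludes h > 0 on the box and s = -1
      excludes h < 0.\<close>
    have nn: "AE x in M. indicator ({x. 0 < s * h x} \<inter> box u v) x * (s * h x) = 0" for s
    proof -
      have *: "integrable M (\<lambda>x. indicator ({x. 0 < s * h x} \<inter> box u v) x * (s * h x))"
        using integrable_mult_right[OF ind[of "{x. 0 < s * h x} \<inter> box u v"], of s] by (simp add: ac_simps)
      have "(\<integral>x. indicator ({x. 0 < s * h x} \<inter> box u v) x * (s * h x) \<partial>M) =
          s * (\<integral>x. indicator ({x. 0 < s * h x} \<inter> box u v) x * h x \<partial>M)"
        by (subst integral_mult_right_zero[symmetric]) (simp add: ac_simps)
      also have "\<dots> = 0" using all0[OF uv] by simp
      finally show ?thesis
        by (subst (asm) integral_nonneg_eq_0_iff_AE[OF *]) (auto simp: indicator_def)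
    qed
    show ?thesis using nn[of 1] nn[of "-1"]
      by eventually_elim (auto simp: indicator_def split: if_splits)
  qed
  \<comment> \<open>Lindelof reduces the cover of G by boxes to a countable one, so that the
    exceptional null sets can be united.\<close>
  define \<F> where "\<F> = {box u v | u v. cbox u v \<subseteq> G}"
  have "\<Union>\<F> = G"
  proof (intro equalityI subsetI)
    fix x assume "x \<in> G"
    then obtain e where e: "e > 0" "ball x e \<subseteq> G" using G openE by blast
    obtain a b where "x \<in> box a b" "cbox a b \<subseteq> ball x e"
    proof -
      obtain a b where ab: "x \<in> box a b" "box a b \<subseteq> ball x (e/2)"
        using rational_boxes[of "e/2" x] e by auto
      then have "box a b \<noteq> {}" by auto
      then have "cbox a b \<subseteq> closure (ball x (e/2))"
        using closure_mono[OF ab(2)] by (simp add: closure_box)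
      then have "cbox a b \<subseteq> ball x e" using e by (auto simp: closure_ball)
      with ab that show ?thesis by blast
    qed
    then show "x \<in> \<Union>\<F>" using e unfolding \<F>_def by blast
  qed (use box_subset_cbox in \<open>fastforce simp: \<F>_def\<close>)
  moreover obtain \<F>' where F': "\<F>' \<subseteq> \<F>" "countable \<F>'" "\<Union>\<F>' = \<Union>\<F>"
    using Lindelof[of \<F>] by (auto simp: \<F>_def open_box)
  ultimately have un: "\<Union>\<F>' = G" by simp
  have "AE x in M. \<forall>B\<in>\<F>'. x \<in> B \<longrightarrow> h x = 0"
    using F' AEbox by (subst AE_ball_countable) (auto simp: \<F>_def)
  then show ?thesis using un by (auto elim!: eventually_mono)
qed

section \<open>Square-integrable functions\<close>

lemma L2_space_measurable: "f \<in> L2_space M \<Longrightarrow> f \<in> borel_measurable M"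
  by (simp add: L2_space_def)

lemma L2_space_integrable_square: "f \<in> L2_space M \<Longrightarrow> integrable M (\<lambda>x. (norm (f x))\<^sup>2)"
  by (simp add: L2_space_def)

lemma L2_space_integrable_inner:
  assumes "f \<in> L2_space M" "g \<in> L2_space M"
  shows "integrable M (\<lambda>x. f x \<bullet> g x)"
proof (rule Bochner_Integration.integrable_bound)
  show "integrable M (\<lambda>x. (norm (f x))\<^sup>2 + (norm (g x))\<^sup>2)"
    using assms by (intro Bochner_Integration.integrable_add L2_space_integrable_square)
  show "(\<lambda>x. f x \<bullet> g x) \<in> borel_measurable M"
    using assms by (intro borel_measurable_inner L2_space_measurable)
  have "\<bar>f x \<bullet> g x\<bar> \<le> (norm (f x))\<^sup>2 + (norm (g x))\<^sup>2" for x
  proof -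
    have "\<bar>f x \<bullet> g x\<bar> \<le> norm (f x) * norm (g x)" by (rule Cauchy_Schwarz_ineq2)
    moreover have "0 \<le> norm (f x) * norm (g x)" by simp
    ultimately show ?thesis
      using sum_squares_bound[of "norm (f x)" "norm (g x)"] by linarith
  qed
  then show "AE x in M. norm (f x \<bullet> g x) \<le> norm ((norm (f x))\<^sup>2 + (norm (g x))\<^sup>2)"
    by simp
qed

lemma L2_space_integrable_mult:
  fixes f g :: "'a \<Rightarrow> real"
  assumes "f \<in> L2_space M" "g \<in> L2_space M"
  shows "integrable M (\<lambda>x. f x * g x)"
  using L2_space_integrable_inner[OF assms] by (simp add: inner_real_def)

lemma L2_space_add:
  assumes "f \<in> L2_space M" "g \<in> L2_space M"
  shows "(\<lambda>x. f x + g x) \<in> L2_space M"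
proof -
  have "integrable M (\<lambda>x. (norm (f x))\<^sup>2 + 2 * (f x \<bullet> g x) + (norm (g x))\<^sup>2)"
    using assms by (intro Bochner_Integration.integrable_add L2_space_integrable_square
      integrable_mult_right L2_space_integrable_inner)
  then have "integrable M (\<lambda>x. (norm (f x + g x))\<^sup>2)"
    by (simp add: power2_norm_eq_inner inner_add_left inner_add_right inner_commute algebra_simps)
  then show ?thesis using assms by (auto simp: L2_space_def)
qed

lemma L2_space_scaleR: "f \<in> L2_space M \<Longrightarrow> (\<lambda>x. c *\<^sub>R f x) \<in> L2_space M"
  by (auto simp: L2_space_def power_mult_distrib)

lemma L2_space_zero: "(\<lambda>x. 0) \<in> L2_space M"
  by (simp add: L2_space_def)

lemma L2_space_diff:
  assumes "f \<in> L2_space M" "g \<in> L2_space M"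
  shows "(\<lambda>x. f x - g x) \<in> L2_space M"
  using L2_space_add[OF assms(1) L2_space_scaleR[OF assms(2), of "-1"]] by simp

lemma L2_space_sum:
  assumes "\<And>i. i \<in> I \<Longrightarrow> f i \<in> L2_space M"
  shows "(\<lambda>x. \<Sum>i\<in>I. f i x) \<in> L2_space M"
  using assms
  by (induction I rule: infinite_finite_induct) (auto intro!: L2_space_zero L2_space_add)

lemma L2_space_bounded:
  assumes "f \<in> borel_measurable M" "emeasure M (space M) < \<infinity>" "\<And>x. x \<in> space M \<Longrightarrow> norm (f x) \<le> B"
  shows "f \<in> L2_space M"
proof -
  interpret finite_measure M using assms(2) by (intro finite_measureI) auto
  have "integrable M (\<lambda>x. (norm (f x))\<^sup>2)"
    by (rule integrable_const_bound[of _ "B\<^sup>2"]) (use assms in \<open>auto intro!: power_mono\<close>)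
  with assms show ?thesis by (simp add: L2_space_def)
qed

lemma L2_space_integrable:
  assumes "f \<in> L2_space M" "emeasure M (space M) < \<infinity>"
  shows "integrable M f"
proof -
  interpret finite_measure M using assms(2) by (intro finite_measureI) auto
  show ?thesis
  proof (rule Bochner_Integration.integrable_bound)
    show "integrable M (\<lambda>x. 1 + (norm (f x))\<^sup>2)"
      using assms by (intro Bochner_Integration.integrable_add L2_space_integrable_square) auto
    have "norm (f x) \<le> 1 + (norm (f x))\<^sup>2" for x
    proof -
      have "2 * norm (f x) \<le> 1 + (norm (f x))\<^sup>2"
        using sum_squares_bound[of 1 "norm (f x)"] by simp
      then show ?thesis using norm_ge_zero[of "f x"] by linarith
    qed
    then show "AE x in M. norm (f x) \<le> norm (1 + (norm (f x))\<^sup>2)"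
      by simp
  qed (use assms in \<open>simp add: L2_space_measurable\<close>)
qed

lemma borel_measurable_component [measurable]:
  fixes f :: "'a \<Rightarrow> ('b::euclidean_space)^'m"
  assumes "f \<in> borel_measurable M" shows "(\<lambda>x. f x $ r) \<in> borel_measurable M"
  by (rule measurable_compose[OF assms]) (intro borel_measurable_continuous_onI continuous_intros)

lemma L2_space_vec_iff:
  fixes f :: "'a \<Rightarrow> ('b::euclidean_space)^'m"
  shows "f \<in> L2_space M \<longleftrightarrow> (\<forall>r. (\<lambda>x. f x $ r) \<in> L2_space M)"
proof
  assume f: "f \<in> L2_space M"
  show "\<forall>r. (\<lambda>x. f x $ r) \<in> L2_space M"
  proof
    fix r
    have m: "(\<lambda>x. f x $ r) \<in> borel_measurable M"
      by (rule borel_measurable_component[OF L2_space_measurable[OF f]])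
    have "integrable M (\<lambda>x. (norm (f x $ r))\<^sup>2)"
      by (rule Bochner_Integration.integrable_bound[OF L2_space_integrable_square[OF f]])
        (use m in \<open>auto intro!: AE_I2 Finite_Cartesian_Product.norm_nth_le\<close>)
    with m show "(\<lambda>x. f x $ r) \<in> L2_space M" by (simp add: L2_space_def)
  qed
next
  assume f: "\<forall>r. (\<lambda>x. f x $ r) \<in> L2_space M"
  have m: "f \<in> borel_measurable M"
  proof (rule borel_measurable_euclidean_space[THEN iffD2], rule ballI)
    fix b :: "'b^'m" assume "b \<in> Basis"
    then obtain r u where b: "b = axis r u" "u \<in> Basis" by (auto simp: Basis_vec_def)
    show "(\<lambda>x. f x \<bullet> b) \<in> borel_measurable M"
      unfolding b inner_axis using f L2_space_measurable by (intro borel_measurable_inner) auto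
  qed
  have "(norm (f x))\<^sup>2 = (\<Sum>r\<in>UNIV. (norm (f x $ r))\<^sup>2)" for x
    by (simp add: norm_vec_def L2_set_def sum_nonneg)
  then show "f \<in> L2_space M"
    using m f by (simp add: L2_space_def)
qed

lemma L2_inner_vec:
  fixes f g :: "'a \<Rightarrow> ('b::euclidean_space)^'m"
  assumes "f \<in> L2_space M" "g \<in> L2_space M"
  shows "L2_inner M f g = (\<Sum>r\<in>UNIV. L2_inner M (\<lambda>x. f x $ r) (\<lambda>x. g x $ r))"
  unfolding L2_inner_def inner_vec_def
  using assms by (subst Bochner_Integration.integral_sum)
    (auto intro!: L2_space_integrable_inner simp: L2_space_vec_iff)

lemma L2_inner_add_left:
  assumes "f \<in> L2_space M" "f' \<in> L2_space M" "g \<in> L2_space M"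
  shows "L2_inner M (\<lambda>x. f x + f' x) g = L2_inner M f g + L2_inner M f' g"
  unfolding L2_inner_def inner_add_left using assms
  by (intro Bochner_Integration.integral_add L2_space_integrable_inner)

lemma L2_inner_scaleR_left: "L2_inner M (\<lambda>x. c *\<^sub>R f x) g = c * L2_inner M f g"
  unfolding L2_inner_def by simp

lemma L2_inner_commute: "L2_inner M f g = L2_inner M g f"
  unfolding L2_inner_def by (simp add: inner_commute)

lemma L2_inner_diff_left:
  assumes "f \<in> L2_space M" "f' \<in> L2_space M" "g \<in> L2_space M"
  shows "L2_inner M (\<lambda>x. f x - f' x) g = L2_inner M f g - L2_inner M f' g"
  unfolding L2_inner_def inner_diff_left using assms
  by (intro Bochner_Integration.integral_diff L2_space_integrable_inner)

lemma L2_inner_cong_AE: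
  assumes "AE x in M. f x = f' x" "AE x in M. g x = g' x"
    "f \<in> borel_measurable M" "f' \<in> borel_measurable M" "g \<in> borel_measurable M" "g' \<in> borel_measurable M"
  shows "L2_inner M f g = L2_inner M f' g'"
  unfolding L2_inner_def
  by (rule integral_cong_AE) (use assms in \<open>auto intro!: borel_measurable_inner elim: eventually_elim2\<close>)

lemma L2_inner_self: "L2_inner M f f = (L2_norm M f)\<^sup>2"
  by (simp add: L2_inner_def L2_norm_def power2_norm_eq_inner)

lemma L2_norm_power2: "(L2_norm M f)\<^sup>2 = (\<integral>x. (norm (f x))\<^sup>2 \<partial>M)"
  by (simp add: L2_norm_def)

lemma L2_norm_nonneg [simp]: "0 \<le> L2_norm M f"
  by (simp add: L2_norm_def)

lemma L2_norm_eq_0_iff: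
  assumes "f \<in> L2_space M"
  shows "L2_norm M f = 0 \<longleftrightarrow> (AE x in M. f x = 0)"
  using integral_nonneg_eq_0_iff_AE[OF L2_space_integrable_square[OF assms]]
  by (simp add: L2_norm_def)

text \<open>The discriminant argument, kept apart because it serves both \<open>L2_inner\<close> and
  the abstract form in \<open>finite_span_Riesz\<close>.\<close>

lemma quadratic_nonneg_imp_le:
  fixes A B C :: real
  assumes "\<And>t. 0 \<le> A * t\<^sup>2 - 2 * B * t + C" "0 \<le> A"
  shows "B\<^sup>2 \<le> A * C"
proof (cases "A = 0")
  case True
  have "B = 0"
  proof (rule ccontr)
    assume "B \<noteq> 0"
    \<comment> \<open>With A = 0 the polynomial is linear in t, and at this t it equals -1.\<close>
    then show False using assms(1)[of "(C + 1) / (2 * B)"] True by simp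
  qed
  then show ?thesis using True by simp
next
  case False
  then have "A > 0" using assms(2) by simp
  have "0 \<le> A * (B / A)\<^sup>2 - 2 * B * (B / A) + C" by (rule assms(1))
  also have "\<dots> = (A * C - B\<^sup>2) / A"
    using False by (simp add: field_simps power2_eq_square)
  finally show ?thesis using \<open>A > 0\<close> by (simp add: zero_le_divide_iff)
qed

lemma L2_Cauchy_Schwarz:
  assumes "f \<in> L2_space M" "g \<in> L2_space M"
  shows "\<bar>L2_inner M f g\<bar> \<le> L2_norm M f * L2_norm M g"
proof -
  have "0 \<le> (L2_norm M f)\<^sup>2 * t\<^sup>2 - 2 * L2_inner M f g * t + (L2_norm M g)\<^sup>2" for t
  proof -
    have tf: "(\<lambda>x. t *\<^sub>R f x) \<in> L2_space M" using assms by (intro L2_space_scaleR)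
    have "0 \<le> L2_inner M (\<lambda>x. t *\<^sub>R f x - g x) (\<lambda>x. t *\<^sub>R f x - g x)"
      by (simp add: L2_inner_self)
    also have "\<dots> = L2_inner M (\<lambda>x. t *\<^sub>R f x) (\<lambda>x. t *\<^sub>R f x - g x) - L2_inner M g (\<lambda>x. t *\<^sub>R f x - g x)"
      using assms tf by (intro L2_inner_diff_left L2_space_diff)
    also have "\<dots> = t * L2_inner M (\<lambda>x. t *\<^sub>R f x - g x) f - L2_inner M (\<lambda>x. t *\<^sub>R f x - g x) g"
      by (simp only: L2_inner_scaleR_left L2_inner_commute[of M _ "\<lambda>x. t *\<^sub>R f x - g x"])
    also have "\<dots> = (L2_norm M f)\<^sup>2 * t\<^sup>2 - 2 * L2_inner M f g * t + (L2_norm M g)\<^sup>2"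
      using assms tf by (simp add: L2_inner_diff_left L2_inner_scaleR_left L2_inner_self
        L2_inner_commute[of M g f] power2_eq_square algebra_simps)
    finally show ?thesis .
  qed
  then have "(L2_inner M f g)\<^sup>2 \<le> (L2_norm M f)\<^sup>2 * (L2_norm M g)\<^sup>2"
    by (rule quadratic_nonneg_imp_le) simp
  then show ?thesis
    by (metis L2_norm_nonneg abs_le_square_iff abs_of_nonneg mult_nonneg_nonneg power_mult_distrib)
qed

text \<open>
  Riesz representation for a positive semidefinite form on a function space that is spanned, up to
  null functions, by finitely many functions which need not belong to the space.
\<close>

lemma finite_span_Riesz:
  fixes V :: "('a \<Rightarrow> 'b::real_vector) set" and b :: "('a \<Rightarrow> 'b) \<Rightarrow> ('a \<Rightarrow> 'b) \<Rightarrow> real"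
    and e :: "nat \<Rightarrow> 'a \<Rightarrow> 'b"
  assumes V: "function_subspace V"
    and span: "\<And>v. v \<in> V \<Longrightarrow> \<exists>c. AE x in M. v x = (\<Sum>k<n. c k *\<^sub>R e k x)"
    and add: "\<And>u v w. u \<in> V \<Longrightarrow> v \<in> V \<Longrightarrow> w \<in> V \<Longrightarrow> b (\<lambda>x. u x + v x) w = b u w + b v w"
    and scale: "\<And>c u w. u \<in> V \<Longrightarrow> w \<in> V \<Longrightarrow> b (\<lambda>x. c *\<^sub>R u x) w = c * b u w"
    and sym: "\<And>u v. u \<in> V \<Longrightarrow> v \<in> V \<Longrightarrow> b u v = b v u"
    and pos: "\<And>u. u \<in> V \<Longrightarrow> 0 \<le> b u u"
    and null: "\<And>u. u \<in> V \<Longrightarrow> AE x in M. u x = 0 \<Longrightarrow> b u u = 0"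
    and l_add: "\<And>u v. u \<in> V \<Longrightarrow> v \<in> V \<Longrightarrow> l (\<lambda>x. u x + v x) = l u + l v"
    and l_scale: "\<And>c u. u \<in> V \<Longrightarrow> l (\<lambda>x. c *\<^sub>R u x) = c * l u"
    and l_null: "\<And>u. u \<in> V \<Longrightarrow> b u u = 0 \<Longrightarrow> l u = 0"
  shows "\<exists>v\<in>V. \<forall>w\<in>V. b v w = l w"
  using assms
proof (induction n arbitrary: V l)
  case 0
  have zero: "(\<lambda>x. 0) \<in> V" using "0.prems"(1) by (simp add: function_subspace_def)
  have n: "b u u = 0" if "u \<in> V" for u
    using "0.prems"(2)[OF that] "0.prems"(7)[OF that] by simp
  show ?case
  proof (intro bexI[OF _ zero] ballI)
    fix w assume w: "w \<in> V"
    have "b (\<lambda>x. 0) w = 0" using "0.prems"(4)[OF zero w, of 0] by simp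
    then show "b (\<lambda>x. 0) w = l w" using "0.prems"(10)[OF w n[OF w]] by simp
  qed
next
  case (Suc n)
  note add = Suc.prems(3) and scale = Suc.prems(4) and sym = Suc.prems(5) and pos = Suc.prems(6)
    and null = Suc.prems(7) and l_add = Suc.prems(8) and l_scale = Suc.prems(9) and l_null = Suc.prems(10)
  have Vadd: "(\<lambda>x. u x + v x) \<in> V" if "u \<in> V" "v \<in> V" for u v
    using Suc.prems(1) that by (simp add: function_subspace_def)
  have Vscale: "(\<lambda>x. c *\<^sub>R u x) \<in> V" if "u \<in> V" for u c
    using Suc.prems(1) that by (simp add: function_subspace_def)
  have add2: "b w (\<lambda>x. u x + v x) = b w u + b w v" if "u \<in> V" "v \<in> V" "w \<in> V" for u v w
    using add[OF that] sym Vadd that by metis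
  have scale2: "b w (\<lambda>x. c *\<^sub>R u x) = c * b w u" if "u \<in> V" "w \<in> V" for u w c
    using scale[OF that] sym Vscale that by metis
  have lin: "b (\<lambda>x. u x + c *\<^sub>R v x) w = b u w + c * b v w" if "u \<in> V" "v \<in> V" "w \<in> V" for u v w c
    using add[OF that(1) Vscale[OF that(2)] that(3), of c] scale[OF that(2,3), of c] by simp
  have lin2: "b w (\<lambda>x. u x + c *\<^sub>R v x) = b w u + c * b w v" if "u \<in> V" "v \<in> V" "w \<in> V" for u v w c
    using add2[OF that(1) Vscale[OF that(2)] that(3), of c] scale2[OF that(2,3), of c] by simp
  \<comment> \<open>Null vectors of a semidefinite form are orthogonal to everything; this takes the
    place of definiteness below.\<close>
  have CS: "b u v = 0" if "b v v = 0" "u \<in> V" "v \<in> V" for u v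
  proof -
    have "0 \<le> b u u * t\<^sup>2 - 2 * b u v * t + b v v" for t
    proof -
      let ?w = "\<lambda>x. t *\<^sub>R u x + (-1) *\<^sub>R v x"
      have "0 \<le> b ?w ?w" by (intro pos Vadd Vscale that)
      also have "b ?w ?w = b (\<lambda>x. t *\<^sub>R u x) ?w + (-1) * b v ?w"
        by (intro lin Vadd Vscale that)
      also have "b (\<lambda>x. t *\<^sub>R u x) ?w = t * b u ?w"
        by (intro scale Vadd Vscale that)
      also have "b u ?w = b u (\<lambda>x. t *\<^sub>R u x) + (-1) * b u v"
        by (intro lin2 Vscale that)
      also have "b u (\<lambda>x. t *\<^sub>R u x) = t * b u u"
        by (intro scale2 that)
      also have "b v ?w = b v (\<lambda>x. t *\<^sub>R u x) + (-1) * b v v"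
        by (intro lin2 Vscale that)
      also have "b v (\<lambda>x. t *\<^sub>R u x) = t * b v u"
        by (intro scale2 that)
      finally show ?thesis using sym[OF that(2,3)] by (simp add: power2_eq_square algebra_simps)
    qed
    from quadratic_nonneg_imp_le[OF this pos] that show ?thesis by simp
  qed
  \<comment> \<open>Dropping the last spanning function leaves a subspace of codimension at most
    one, see \<open>decomp\<close>.\<close>
  define V' where "V' = {v\<in>V. \<exists>c. AE x in M. v x = (\<Sum>k<n. c k *\<^sub>R e k x)}"
  have sub: "u \<in> V" if "u \<in> V'" for u using that by (simp add: V'_def)
  have V'I: "v \<in> V'" if "v \<in> V" "AE x in M. v x = (\<Sum>k<n. c k *\<^sub>R e k x)" for v c
    unfolding V'_def using that by (intro CollectI conjI exI)
  have V'add: "(\<lambda>x. u x + v x) \<in> V'" if uv: "u \<in> V'" "v \<in> V'" for u v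
  proof -
    obtain c d where "AE x in M. u x = (\<Sum>k<n. c k *\<^sub>R e k x)" "AE x in M. v x = (\<Sum>k<n. d k *\<^sub>R e k x)"
      using uv by (auto simp: V'_def)
    then have "AE x in M. u x + v x = (\<Sum>k<n. (c k + d k) *\<^sub>R e k x)"
      by eventually_elim (simp add: scaleR_add_left sum.distrib)
    then show ?thesis by (rule V'I[OF Vadd[OF sub[OF uv(1)] sub[OF uv(2)]]])
  qed
  have V'scale: "(\<lambda>x. s *\<^sub>R u x) \<in> V'" if u: "u \<in> V'" for u s
  proof -
    obtain c where "AE x in M. u x = (\<Sum>k<n. c k *\<^sub>R e k x)" using u by (auto simp: V'_def)
    then have "AE x in M. s *\<^sub>R u x = (\<Sum>k<n. (s * c k) *\<^sub>R e k x)"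
      by eventually_elim (simp add: scaleR_sum_right)
    then show ?thesis by (rule V'I[OF Vscale[OF sub[OF u]]])
  qed
  have V'zero: "(\<lambda>x. 0) \<in> V'"
    using Suc.prems(1) by (intro V'I[where c = "\<lambda>k. 0"]) (simp_all add: function_subspace_def)
  have V': "function_subspace V'"
    unfolding function_subspace_def using V'add V'scale V'zero by auto
  have IH: "\<exists>v\<in>V'. \<forall>w\<in>V'. b v w = f w"
    if "\<And>u v. u \<in> V' \<Longrightarrow> v \<in> V' \<Longrightarrow> f (\<lambda>x. u x + v x) = f u + f v"
      "\<And>c u. u \<in> V' \<Longrightarrow> f (\<lambda>x. c *\<^sub>R u x) = c * f u"
      "\<And>u. u \<in> V' \<Longrightarrow> b u u = 0 \<Longrightarrow> f u = 0" for f
    by (rule Suc.IH[OF V'])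
      (auto simp: sub add scale pos null that intro: sym[OF sub sub], simp add: V'_def)
  obtain v1 where v1: "v1 \<in> V'" "\<And>w. w \<in> V' \<Longrightarrow> b v1 w = l w"
    using IH[of l] by (auto simp: sub l_add l_scale l_null)
  show ?case
  proof (cases "V \<subseteq> V'")
    case True
    then show ?thesis using v1 sub by blast
  next
    case False
    then obtain u where u: "u \<in> V" "u \<notin> V'" by blast
    obtain cu where cu: "AE x in M. u x = (\<Sum>k<Suc n. cu k *\<^sub>R e k x)"
      using Suc.prems(2)[OF u(1)] by blast
    have cun: "cu n \<noteq> 0"
    proof
      assume "cu n = 0"
      then have "u \<in> V'" using cu by (intro V'I[OF u(1), where c = cu]) simp
      with u show False by simp
    qed
    have decomp: "\<exists>s. (\<lambda>x. v x + s *\<^sub>R u x) \<in> V'" if v: "v \<in> V" for v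
    proof -
      obtain c where c: "AE x in M. v x = (\<Sum>k<Suc n. c k *\<^sub>R e k x)"
        using Suc.prems(2)[OF v] by blast
      define s where "s = - c n / cu n"
      have "AE x in M. v x + s *\<^sub>R u x = (\<Sum>k<n. (c k + s * cu k) *\<^sub>R e k x)"
        using c cu
      proof eventually_elim
        case (elim x)
        have "v x + s *\<^sub>R u x = (\<Sum>k<Suc n. (c k + s * cu k) *\<^sub>R e k x)"
          unfolding elim by (simp only: scaleR_sum_right scaleR_add_left sum.distrib scaleR_scaleR)
        then show ?case using cun by (simp add: s_def)
      qed
      then show ?thesis by (intro exI[of _ s] V'I[OF Vadd[OF v Vscale[OF u(1)]]])
    qed
    \<comment> \<open>The induction hypothesis, applied to the functional \<open>b u\<close>, gives
      the projection p of u onto \<open>V'\<close>; hence q = u - p is orthogonal to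
      \<open>V'\<close>.\<close>
    obtain p where p: "p \<in> V'" "\<And>w. w \<in> V' \<Longrightarrow> b p w = b u w"
      using IH[of "b u"] by (auto simp: sub add2 scale2 u(1) CS)
    define q where "q = (\<lambda>x. u x + (-1) *\<^sub>R p x)"
    have q: "q \<in> V" unfolding q_def by (intro Vadd Vscale u sub p)
    have q0: "b q w = 0" if "w \<in> V'" for w
    proof -
      have "b q w = b u w + (-1) * b p w"
        unfolding q_def by (intro lin u sub p that)
      then show ?thesis using p(2)[OF that] by simp
    qed
    \<comment> \<open>If \<open>b q q\<close> is 0, then r is 0 by the convention for division, and
      \<open>l_null\<close> gives \<open>l q = 0\<close>; so \<open>r * b q q = l q\<close> holds in
      this case too.\<close>
    define r where "r = l q / b q q"
    have r: "r * b q q = l q" using l_null[OF q] by (auto simp: r_def)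
    have vr: "(\<lambda>x. v1 x + r *\<^sub>R q x) \<in> V" by (intro Vadd Vscale sub v1 q)
    show ?thesis
    proof (intro bexI[OF _ vr] ballI)
      fix w assume w: "w \<in> V"
      obtain s where s: "(\<lambda>x. w x + s *\<^sub>R u x) \<in> V'" using decomp[OF w] by blast
      define w' where "w' = (\<lambda>x. (w x + s *\<^sub>R u x) + (- s) *\<^sub>R p x)"
      have w': "w' \<in> V'" unfolding w'_def by (intro V'add V'scale s p)
      have ww: "w = (\<lambda>x. w' x + (- s) *\<^sub>R q x)"
        by (simp add: w'_def q_def fun_eq_iff algebra_simps)
      have bw: "b v w = b v w' + (- s) * b v q" if v: "v \<in> V" for v
        unfolding ww by (intro lin2 sub w' q v)
      have lw: "l w = l w' + (- s) * l q"
        unfolding ww using l_add[OF sub[OF w'] Vscale[OF q], of "- s"] l_scale[OF q, of "- s"] by simp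
      have "b (\<lambda>x. v1 x + r *\<^sub>R q x) w = b v1 w + r * b q w"
        by (intro lin sub v1 q w)
      also have "\<dots> = l w' + (- s) * (r * b q q)"
        using bw[OF sub[OF v1(1)]] bw[OF q] v1(2)[OF w'] q0[OF w'] q0[OF v1(1)] sym[OF q sub[OF v1(1)]]
        by (simp add: algebra_simps)
      also have "\<dots> = l w" using r lw by simp
      finally show "b (\<lambda>x. v1 x + r *\<^sub>R q x) w = l w" .
    qed
  qed
qed

section \<open>Surface measure on polyhedral boundaries\<close>

lemma hyperplanes_unit_normal:
  fixes P :: "'a::euclidean_space set"
  assumes "P \<in> hyperplanes"
  obtains a b where "norm a = 1" "P = {x. a \<bullet> x = b}"
proof -
  have P: "affine hull P = P" "aff_dim P = int DIM('a) - 1"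
    using assms affine_hull_eq[of P] by (auto simp: hyperplanes_def)
  have "\<exists>a b. a \<noteq> 0 \<and> affine hull P = {x. a \<bullet> x = b}"
    by (subst aff_dim_eq_hyperplane[symmetric]) (simp add: P(2))
  then obtain a b where ab: "a \<noteq> 0" "P = {x. a \<bullet> x = b}"
    unfolding P(1) by (elim exE conjE)
  have "(a /\<^sub>R norm a) \<bullet> x = b / norm a \<longleftrightarrow> a \<bullet> x = b" for x
  proof -
    have "(a /\<^sub>R norm a) \<bullet> x = (a \<bullet> x) / norm a"
      by (simp only: inner_scaleR_left divide_inverse mult.commute)
    then show ?thesis using ab(1) divide_cancel_right[of "a \<bullet> x" "norm a" b]
      by (metis norm_eq_zero)
  qed
  then have "P = {x. (a /\<^sub>R norm a) \<bullet> x = b / norm a}"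
    using ab(2) by simp
  moreover have "norm (a /\<^sub>R norm a) = 1" using ab(1) by simp
  ultimately show ?thesis by (intro that[of "a /\<^sub>R norm a" "b / norm a"])
qed

lemma hyperplanes_borel: "P \<in> hyperplanes \<Longrightarrow> P \<in> sets borel"
  by (metis borel_closed closed_hyperplane hyperplanes_unit_normal)

lemma hyperplane_in_hyperplanes:
  fixes a :: "'a::euclidean_space"
  shows "a \<noteq> 0 \<Longrightarrow> {x. a \<bullet> x = b} \<in> hyperplanes"
  by (simp add: hyperplanes_def affine_hyperplane)

lemma hyperplane_distance_le:
  fixes a x z :: "'a::euclidean_space"
  assumes "norm a = 1" "a \<bullet> z = b" shows "\<bar>a \<bullet> x - b\<bar> \<le> dist x z"
proof -
  have "\<bar>a \<bullet> x - b\<bar> = \<bar>a \<bullet> (x - z)\<bar>" using assms by (simp add: inner_diff_right)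
  also have "\<dots> \<le> dist x z"
    using Cauchy_Schwarz_ineq2[of a "x - z"] assms by (simp add: dist_norm)
  finally show ?thesis .
qed

lemma closest_point_hyperplane:
  fixes a x :: "'a::euclidean_space"
  assumes "norm a = 1" shows "closest_point {x. a \<bullet> x = b} x = x - (a \<bullet> x - b) *\<^sub>R a"
proof (rule closest_point_unique[symmetric])
  show "x - (a \<bullet> x - b) *\<^sub>R a \<in> {x. a \<bullet> x = b}"
    using assms by (simp add: inner_diff_right dot_square_norm)
  show "\<forall>z\<in>{x. a \<bullet> x = b}. dist x (x - (a \<bullet> x - b) *\<^sub>R a) \<le> dist x z"
    using hyperplane_distance_le[OF assms] assms by (auto simp: dist_norm)
qed (auto simp: convex_hyperplane closed_hyperplane)

text \<open>The later estimates ask for an upper bound. It replaces the slab around the hyperplane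
  by an explicit condition on \<open>a \<bullet> x\<close>, which takes just the easy bound of
  \<open>infdist\<close> from below.\<close>

lemma emeasure_hyperplane_measure_le:
  fixes a :: "'a::euclidean_space"
  assumes a: "norm a = 1" and A: "A \<in> sets borel"
  shows "emeasure (hyperplane_measure {x. a \<bullet> x = b}) A
    \<le> emeasure lborel {x. \<bar>a \<bullet> x - b\<bar> \<le> 1/2 \<and> x - (a \<bullet> x - b) *\<^sub>R a \<in> A}" (is "_ \<le> emeasure lborel ?B")
proof -
  let ?P = "{x. a \<bullet> x = b}" and ?S = "{x. infdist x {x. a \<bullet> x = b} \<le> 1/2}"
  have S: "closed ?S" by (intro closed_Collect_le continuous_intros)
  have ne: "?P \<noteq> {}"
  proof -
    have "b *\<^sub>R a \<in> ?P" using a by (simp add: dot_square_norm)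
    then show ?thesis by blast
  qed
  have cm [measurable]: "closest_point ?P \<in> borel_measurable borel"
    by (intro borel_measurable_continuous_onI continuous_on_closest_point ne
      convex_hyperplane closed_hyperplane)
  have "emeasure (hyperplane_measure ?P) A
      = emeasure (restrict_space lborel ?S) (closest_point ?P -` A \<inter> ?S)"
    unfolding hyperplane_measure_def using A S
    by (subst emeasure_distr) (auto intro!: measurable_restrict_space1 simp: space_restrict_space)
  also have "\<dots> = emeasure lborel (closest_point ?P -` A \<inter> ?S)"
    using S by (intro emeasure_restrict_space) (auto simp: borel_closed)
  also have "\<dots> \<le> emeasure lborel ?B"
  proof (rule emeasure_mono)
    show "closest_point ?P -` A \<inter> ?S \<subseteq> ?B"
    proof
      fix x assume x: "x \<in> closest_point ?P -` A \<inter> ?S"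
      have "\<bar>a \<bullet> x - b\<bar> \<le> infdist x ?P"
        unfolding infdist_notempty[OF ne]
        by (rule cINF_greatest[OF ne]) (use hyperplane_distance_le[OF a] in auto)
      with x show "x \<in> ?B" by (auto simp: closest_point_hyperplane[OF a])
    qed
    have "{x. \<bar>a \<bullet> x - b\<bar> \<le> 1/2} \<inter> (\<lambda>x. x - (a \<bullet> x - b) *\<^sub>R a) -` A \<inter> space borel \<in> sets borel"
      using A by measurable
    then show "?B \<in> sets lborel" by (simp add: vimage_def Collect_conj_eq Int_assoc)
  qed
  finally show ?thesis .
qed

text \<open>The points of the slab that project into both P and H lie in a hyperplane perpendicular
  to P, or there are none if P and H are parallel: a null set in either case.\<close>

lemma hyperplane_measure_other_hyperplane:
  fixes P H :: "'a::euclidean_space set"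
  assumes P: "P \<in> hyperplanes" and H: "H \<in> hyperplanes" and PH: "P \<noteq> H"
    and A: "A \<in> sets borel" "A \<subseteq> H"
  shows "emeasure (hyperplane_measure P) A = 0"
proof -
  obtain a b where a: "norm a = 1" and Pab: "P = {x. a \<bullet> x = b}"
    using hyperplanes_unit_normal[OF P] by blast
  obtain c e where c: "norm c = 1" and Hce: "H = {x. c \<bullet> x = e}"
    using hyperplanes_unit_normal[OF H] by blast
  \<comment> \<open>\<open>c' \<bullet> x = e'\<close> says that the projection of x onto P lies in
    H; \<open>c'\<close> is the part of c tangential to P. For parallel P and H, \<open>c'\<close>
    is 0 and \<open>e'\<close> is not.\<close>
  define c' where "c' = c - (c \<bullet> a) *\<^sub>R a"
  define e' where "e' = e - (c \<bullet> a) * b"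
  have nz: "c' \<noteq> 0 \<or> e' \<noteq> 0"
  proof (rule ccontr)
    assume "\<not> ?thesis"
    then have ca: "c = (c \<bullet> a) *\<^sub>R a" and e: "e = (c \<bullet> a) * b" by (auto simp: c'_def e'_def)
    define s where "s = c \<bullet> a"
    have "s \<noteq> 0" using ca c by (auto simp: s_def)
    moreover have "H = {x. s * (a \<bullet> x) = s * b}"
      unfolding Hce s_def by (subst ca, subst e) simp
    ultimately show False using PH Pab by auto
  qed
  have "emeasure (hyperplane_measure P) A \<le> emeasure lborel {x. \<bar>a \<bullet> x - b\<bar> \<le> 1/2 \<and> x - (a \<bullet> x - b) *\<^sub>R a \<in> A}"
    unfolding Pab by (rule emeasure_hyperplane_measure_le[OF a A(1)])
  also have "\<dots> \<le> emeasure lborel {x. c' \<bullet> x = e'}"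
  proof (rule emeasure_mono)
    have "c' \<bullet> x = e'" if "c \<bullet> (x - (a \<bullet> x - b) *\<^sub>R a) = e" for x
      using that by (simp add: c'_def e'_def inner_diff_left inner_diff_right algebra_simps)
    then show "{x. \<bar>a \<bullet> x - b\<bar> \<le> 1/2 \<and> x - (a \<bullet> x - b) *\<^sub>R a \<in> A} \<subseteq> {x. c' \<bullet> x = e'}"
      using A(2) by (auto simp: Hce)
  qed (simp add: closed_hyperplane)
  also have "\<dots> = 0"
    using negligible_hyperplane[OF nz] closed_hyperplane[of c' e']
    by (auto simp: negligible_iff_null_sets null_sets_completion_iff)
  finally show ?thesis by simp
qed

text \<open>The sum over the uncountable family \<open>hyperplanes\<close> reduces to finitely many
  terms, since every other hyperplane meets A in a set that is null for its own measure.\<close>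

lemma emeasure_surface_measure_finite_hyperplanes:
  fixes A :: "'a::euclidean_space set"
  assumes fin: "finite \<H>" "\<H> \<subseteq> hyperplanes" and A: "A \<in> sets borel" "A \<subseteq> \<Union>\<H>"
  shows "emeasure surface_measure A = (\<Sum>P\<in>\<H>. emeasure (hyperplane_measure P) A)"
  unfolding emeasure_surface_measure[OF A(1)]
proof (rule nn_integral_count_space'[OF fin(1) _ fin(2)])
  fix P :: "'a set" assume P: "P \<in> hyperplanes" "P \<notin> \<H>"
  have Hb: "H \<in> sets borel" if "H \<in> \<H>" for H
    using that fin(2) by (intro hyperplanes_borel) auto
  have "emeasure (hyperplane_measure P) A \<le> emeasure (hyperplane_measure P) (\<Union>H\<in>\<H>. A \<inter> H)"
    using A fin(1) Hb by (intro emeasure_mono) (auto simp: hyperplane_measure_def)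
  also have "\<dots> \<le> (\<Sum>H\<in>\<H>. emeasure (hyperplane_measure P) (A \<inter> H))"
    using A fin(1) Hb by (intro emeasure_subadditive_finite) (auto simp: hyperplane_measure_def)
  also have "\<dots> = 0"
  proof (rule sum.neutral, rule ballI)
    fix H assume "H \<in> \<H>"
    then show "emeasure (hyperplane_measure P) (A \<inter> H) = 0"
      using P fin(2) A Hb by (intro hyperplane_measure_other_hyperplane[of P H]) auto
  qed
  finally show "emeasure (hyperplane_measure P) A = 0" by simp
qed

text \<open>The cylinder over a disc of radius \<open>r\<close> is covered by order of \<open>1/r\<close> balls of radius \<open>2r\<close>.\<close>

lemma hyperplane_measure_cball_le:
  fixes x :: "'a::euclidean_space"
  assumes P: "P \<in> hyperplanes" and r: "0 < r" "r \<le> R"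
  shows "emeasure (hyperplane_measure P) (cball x r)
    \<le> ennreal ((2 + 5 * R) * unit_ball_vol DIM('a) * 2 ^ DIM('a) * r ^ (DIM('a) - 1))"
proof -
  obtain a b where a: "norm a = 1" and Pab: "P = {x. a \<bullet> x = b}"
    using hyperplanes_unit_normal[OF P] by blast
  \<comment> \<open>The prism has height 1, so the offsets \<open>k * r\<close> with k between -N
    and N reach every height from -1/2 to 1/2. There are 2 N + 1 of them, and (2 N + 1) r <= 1 + 5
    r: this costs one power of r and is the source of the factor 2 + 5 R.\<close>
  define N where "N = \<lceil>1 / (2 * r)\<rceil> + 1"
  have "0 < 1 / (2 * r)" using r by simp
  then have N0: "N \<ge> 1" unfolding N_def by linarith
  have "emeasure (hyperplane_measure P) (cball x r) \<le>
      emeasure lborel {y. \<bar>a \<bullet> y - b\<bar> \<le> 1/2 \<and> y - (a \<bullet> y - b) *\<^sub>R a \<in> cball x r}"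
    unfolding Pab by (rule emeasure_hyperplane_measure_le[OF a]) simp
  also have "\<dots> \<le> emeasure lborel (\<Union>k\<in>{-N..N}. cball (x + (of_int k * r) *\<^sub>R a) (2 * r))"
  proof (rule emeasure_mono, rule subsetI)
    fix y assume y: "y \<in> {y. \<bar>a \<bullet> y - b\<bar> \<le> 1/2 \<and> y - (a \<bullet> y - b) *\<^sub>R a \<in> cball x r}"
    define s where "s = a \<bullet> y - b"
    define k where "k = \<lfloor>s / r\<rfloor>"
    have s: "\<bar>s\<bar> \<le> 1/2" using y by (simp add: s_def)
    have k: "of_int k * r \<le> s" "s \<le> of_int k * r + r"
    proof -
      have "of_int k \<le> s / r" "s / r \<le> of_int k + 1" unfolding k_def by linarith+
      then show "of_int k * r \<le> s" "s \<le> of_int k * r + r" using r by (simp_all add: field_simps)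
    qed
    have "\<bar>s / r\<bar> \<le> 1 / (2 * r)" using s r by (simp add: field_simps)
    then have "- N \<le> k" "k \<le> N" unfolding N_def k_def by linarith+
    moreover have "dist (x + (of_int k * r) *\<^sub>R a) y \<le> 2 * r"
    proof -
      have "y - (x + (of_int k * r) *\<^sub>R a) = (y - s *\<^sub>R a - x) + (s - of_int k * r) *\<^sub>R a"
        by (simp add: algebra_simps)
      also have "norm \<dots> \<le> norm (y - s *\<^sub>R a - x) + norm ((s - of_int k * r) *\<^sub>R a)"
        by (rule norm_triangle_ineq)
      also have "\<dots> \<le> r + r"
      proof (rule add_mono)
        show "norm (y - s *\<^sub>R a - x) \<le> r"
          using y by (simp add: s_def dist_norm norm_minus_commute)
        show "norm ((s - of_int k * r) *\<^sub>R a) \<le> r" using k a by simp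
      qed
      finally show ?thesis by (simp add: dist_norm norm_minus_commute)
    qed
    ultimately show "y \<in> (\<Union>k\<in>{-N..N}. cball (x + (of_int k * r) *\<^sub>R a) (2 * r))"
      by (auto simp: dist_commute)
  qed auto
  also have "\<dots> \<le> (\<Sum>k\<in>{-N..N}. emeasure lborel (cball (x + (of_int k * r) *\<^sub>R a) (2 * r)))"
    by (intro emeasure_subadditive_finite) auto
  also have "\<dots> = (\<Sum>k\<in>{-N..N}. ennreal (unit_ball_vol DIM('a) * (2 * r) ^ DIM('a)))"
    using r by (intro sum.cong) (auto simp: emeasure_cball)
  also have "\<dots> = ennreal (of_int (2 * N + 1) * (unit_ball_vol DIM('a) * (2 * r) ^ DIM('a)))"
  proof -
    have "real (card {-N..N}) = of_int (2 * N + 1)" using N0 by simp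
    then show ?thesis
      using r by (simp only: sum_constant ennreal_of_nat_eq_real_of_nat) (simp add: ennreal_mult'')
  qed
  also have "\<dots> \<le> ennreal ((2 + 5 * R) * unit_ball_vol DIM('a) * 2 ^ DIM('a) * r ^ (DIM('a) - 1))"
  proof (rule ennreal_leI)
    have rd: "r ^ DIM('a) = r * r ^ (DIM('a) - 1)"
      by (metis DIM_positive Suc_diff_1 power_Suc)
    have "of_int N \<le> 1 / (2 * r) + 2" unfolding N_def by linarith
    then have "of_int (2 * N + 1) * r \<le> (2 * (1 / (2 * r) + 2) + 1) * r"
      using r by (intro mult_right_mono) auto
    also have "\<dots> = 1 + 5 * r" using r by (simp add: field_simps)
    also have "\<dots> \<le> 2 + 5 * R" using r by simp
    finally have *: "of_int (2 * N + 1) * r \<le> 2 + 5 * R" .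
    have "of_int (2 * N + 1) * (unit_ball_vol DIM('a) * (2 * r) ^ DIM('a)) =
      (of_int (2 * N + 1) * r) * (unit_ball_vol DIM('a) * 2 ^ DIM('a) * r ^ (DIM('a) - 1))"
      by (simp add: power_mult_distrib rd)
    also have "\<dots> \<le> (2 + 5 * R) * (unit_ball_vol DIM('a) * 2 ^ DIM('a) * r ^ (DIM('a) - 1))"
      using r by (intro mult_right_mono[OF *]) auto
    finally show "of_int (2 * N + 1) * (unit_ball_vol DIM('a) * (2 * r) ^ DIM('a))
      \<le> (2 + 5 * R) * unit_ball_vol DIM('a) * 2 ^ DIM('a) * r ^ (DIM('a) - 1)"
      by (simp add: mult.assoc)
  qed
  finally show ?thesis .
qed

text \<open>A flat polytope lies in a single hyperplane; the frontier of a solid one is covered by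
  the affine hulls of its facets.\<close>

lemma polytope_frontier_subset_hyperplanes:
  fixes P :: "'a::euclidean_space set"
  assumes "polytope P"
  obtains \<H> where "finite \<H>" "\<H> \<subseteq> hyperplanes" "frontier P \<subseteq> \<Union>\<H>"
proof (cases "interior P = {}")
  case True
  then have "aff_dim P \<noteq> DIM('a)"
    using interior_rel_interior[of P] rel_interior_eq_empty[of P] polytope_imp_convex[OF assms]
    by (metis aff_dim_empty of_nat_0_le_iff not_one_le_zero neg_equal_0_iff_equal
      aff_dim_negative_iff linorder_not_le)
  then have "aff_dim P < DIM('a)" using aff_dim_le_DIM[of P] by simp
  then obtain a b where ab: "a \<noteq> 0" "P \<subseteq> {x. a \<bullet> x = b}"
    using aff_lowdim_subset_hyperplane by blast
  have "frontier P \<subseteq> P" using polytope_imp_closed[OF assms] by (simp add: frontier_subset_closed)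
  with ab show ?thesis
    by (intro that[of "{{x. a \<bullet> x = b}}"]) (auto simp: hyperplane_in_hyperplanes)
next
  case False
  have dim: "aff_dim P = DIM('a)" using False by (simp add: aff_dim_nonempty_interior)
  have "frontier P = \<Union>{F. F facet_of P}"
    using rel_frontier_nonempty_interior[OF False]
      rel_frontier_of_polyhedron[OF polytope_imp_polyhedron[OF assms]] by simp
  moreover have "F \<subseteq> affine hull F" for F :: "'a set" by (rule hull_subset)
  ultimately show ?thesis
    using finite_polytope_facets[OF assms] dim
    by (intro that[of "(\<lambda>F. affine hull F) ` {F. F facet_of P}"])
      (auto simp: hyperplanes_def facet_of_def)
qed

text \<open>A frontier point of G lies in some polytope of the cover but not in the interior of that
  polytope: otherwise it would belong to \<open>interior (closure G) = G\<close>. So it lies on the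
  frontier of the polytope.\<close>

lemma polyhedral_domain_frontier_subset_hyperplanes:
  fixes G :: "'a::euclidean_space set"
  assumes "polyhedral_domain G"
  obtains \<H> where "finite \<H>" "\<H> \<subseteq> hyperplanes" "frontier G \<subseteq> \<Union>\<H>"
proof -
  obtain \<P> where P: "finite \<P>" "\<forall>P\<in>\<P>. polytope P" "closure G = \<Union>\<P>" and G: "G = interior (closure G)"
    using assms unfolding polyhedral_domain_def by blast
  obtain h where h: "\<And>P. P \<in> \<P> \<Longrightarrow> finite (h P) \<and> h P \<subseteq> hyperplanes \<and> frontier P \<subseteq> \<Union>(h P)"
    using polytope_frontier_subset_hyperplanes P(2) by metis
  show ?thesis
  proof (rule that[of "\<Union>P\<in>\<P>. h P"])
    show "frontier G \<subseteq> \<Union>(\<Union>P\<in>\<P>. h P)"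
    proof
      fix x assume x: "x \<in> frontier G"
      then have "x \<in> closure G" by (simp add: frontier_def)
      then obtain Q where Q: "Q \<in> \<P>" "x \<in> Q" using P(3) by auto
      have "x \<notin> interior (closure G)"
        using x G interior_interior[of "closure G"] by (metis DiffE frontier_def)
      then have "x \<notin> interior Q" using interior_mono[of Q "closure G"] Q P(3) by blast
      then have "x \<in> frontier Q" using Q closure_subset by (auto simp: frontier_def)
      then have "x \<in> \<Union>(h Q)" using h[OF Q(1)] by auto
      then show "x \<in> \<Union>(\<Union>P\<in>\<P>. h P)" using Q(1) by blast
    qed
  qed (use h P(1) in auto)
qed

lemma polyhedral_domain_bounded:
  assumes "polyhedral_domain G" shows "bounded G"
proof -
  obtain \<P> where "finite \<P>" "\<forall>P\<in>\<P>. polytope P" "closure G = \<Union>\<P>"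
    using assms unfolding polyhedral_domain_def by blast
  then have "bounded (closure G)" by (metis bounded_Union polytope_imp_bounded)
  then show ?thesis using closure_subset bounded_subset by blast
qed

text \<open>Upper Ahlfors regularity of dimension d - 1. This growth is the geometric input of the
  flow estimates, where it enters as the locale assumption \<open>growth\<close>; the constant may
  depend on the bound R for the radii.\<close>

lemma surface_measure_frontier_cball_le:
  fixes G :: "'a::euclidean_space set"
  assumes "polyhedral_domain G" "0 \<le> R"
  obtains K where "0 \<le> K"
    "\<And>x r. 0 < r \<Longrightarrow> r \<le> R \<Longrightarrow>
       emeasure surface_measure (frontier G \<inter> cball x r) \<le> ennreal (K * r ^ (DIM('a) - 1))"
proof -
  obtain \<H> where H: "finite \<H>" "\<H> \<subseteq> hyperplanes" "frontier G \<subseteq> \<Union>\<H>"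
    using polyhedral_domain_frontier_subset_hyperplanes[OF assms(1)] by blast
  define K where "K = real (card \<H>) * ((2 + 5 * R) * unit_ball_vol DIM('a) * 2 ^ DIM('a))"
  show ?thesis
  proof (rule that[of K])
    show "0 \<le> K" using assms(2) by (simp add: K_def)
    fix x :: 'a and r :: real assume r: "0 < r" "r \<le> R"
    have "emeasure surface_measure (frontier G \<inter> cball x r) =
        (\<Sum>P\<in>\<H>. emeasure (hyperplane_measure P) (frontier G \<inter> cball x r))"
      using H by (intro emeasure_surface_measure_finite_hyperplanes) auto
    also have "\<dots> \<le> (\<Sum>P\<in>\<H>. emeasure (hyperplane_measure P) (cball x r))"
      by (intro sum_mono emeasure_mono) (auto simp: hyperplane_measure_def)
    also have "\<dots> \<le> (\<Sum>P\<in>\<H>. ennreal ((2 + 5 * R) * unit_ball_vol DIM('a) * 2 ^ DIM('a) * r ^ (DIM('a) - 1)))"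
      using H r by (intro sum_mono hyperplane_measure_cball_le) auto
    also have "\<dots> = ennreal (K * r ^ (DIM('a) - 1))"
      using r by (simp add: K_def ennreal_mult ennreal_of_nat_eq_real_of_nat[symmetric] mult.assoc)
    finally show "emeasure surface_measure (frontier G \<inter> cball x r) \<le> ennreal (K * r ^ (DIM('a) - 1))" .
  qed
qed

lemma surface_measure_frontier_finite:
  fixes G :: "'a::euclidean_space set"
  assumes "polyhedral_domain G"
  shows "emeasure surface_measure (frontier G) < \<infinity>"
proof -
  have "bounded (frontier G)"
    using polyhedral_domain_bounded[OF assms] bounded_closure frontier_def by (metis bounded_diff)
  then obtain r where r: "0 < r" "frontier G \<subseteq> cball 0 r"
    unfolding bounded_pos by (auto simp: subset_eq)
  obtain K where K: "emeasure surface_measure (frontier G \<inter> cball 0 r) \<le> ennreal (K * r ^ (DIM('a) - 1))"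
    using surface_measure_frontier_cball_le[OF assms, of r] r by (metis less_imp_le order_refl)
  then show ?thesis
    using r(2) by (simp add: Int_absorb2 order.strict_trans1)
qed

section \<open>Flow along segments\<close>

lemma nn_integral_powr_quarter:
  assumes "0 \<le> b"
  shows "(\<integral>\<^sup>+t. ennreal (if 0 < t \<and> t < b then t powr (-3/4) else 0) \<partial>lborel) \<le> ennreal (4 * b powr (1/4))"
proof -
  have "((\<lambda>t. t powr (-3/4)) has_integral (b powr (1/4) / (1/4))) {0..b}"
    using has_integral_powr_from_0[of "-3/4" b] assms by simp
  then have *: "(\<integral>\<^sup>+t. ennreal (indicator {0..b} t * t powr (-3/4)) \<partial>lborel) = ennreal (4 * b powr (1/4))"
    using nn_integral_has_integral_lebesgue[of "{0..b}" "\<lambda>t. t powr (-3/4)" "b powr (1/4) / (1/4)"]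
    by (simp add: mult.commute)
  have "(\<integral>\<^sup>+t. ennreal (if 0 < t \<and> t < b then t powr (-3/4) else 0) \<partial>lborel)
      \<le> (\<integral>\<^sup>+t. ennreal (indicator {0..b} t * t powr (-3/4)) \<partial>lborel)"
    by (intro nn_integral_mono) (auto simp: indicator_def)
  with * show ?thesis by simp
qed

text \<open>A segment that starts at y and has length at most m is at time t within distance m t of
  y. The estimates of the flow reduce to such weights with various exponents p.\<close>

definition cone_weight :: "real \<Rightarrow> real \<Rightarrow> real \<Rightarrow> 'a::metric_space \<Rightarrow> 'a \<Rightarrow> real" where
  "cone_weight m p t x y = (if 0 < t \<and> t < 1 \<and> dist x y \<le> m * t then t powr (- p) else 0)"

lemma cone_weight_nonneg [simp]: "0 \<le> cone_weight m p t x y"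
  by (simp add: cone_weight_def)

lemma cone_weight_commute: "cone_weight m p t x y = cone_weight m p t y x"
  by (simp add: cone_weight_def dist_commute)

lemma cone_weight_mono:
  "p \<le> q \<Longrightarrow> cone_weight m p t x y \<le> cone_weight m q t x y"
proof (cases "0 < t \<and> t < 1")
  case True
  assume "p \<le> q"
  then have "t powr (- p) \<le> t powr (- q)"
    using True powr_mono'[of "- q" "- p" t] by simp
  then show ?thesis by (simp add: cone_weight_def)
qed (auto simp: cone_weight_def)

lemma cone_weight_mult: "cone_weight m p t x y * cone_weight m q t x y = cone_weight m (p + q) t x y"
  by (simp add: cone_weight_def flip: powr_add)

lemma cone_weight_measurable [measurable]:
  fixes f g :: "'b \<Rightarrow> 'a::{metric_space, second_countable_topology}"
  assumes [measurable]: "f \<in> borel_measurable M" "g \<in> borel_measurable M" "h \<in> borel_measurable M"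
  shows "(\<lambda>z. cone_weight m p (h z) (f z) (g z)) \<in> borel_measurable M"
  unfolding cone_weight_def by measurable

text \<open>
  Any exponent above \<open>-1\<close> would do in place of \<open>-3/4\<close>; the exponents \<open>1/4\<close> and \<open>1/8\<close> below are
  tuned to this choice.
\<close>

lemma nn_integral_cone_weight_le:
  fixes \<mu> :: "'a::{metric_space, second_countable_topology} measure"
  assumes [measurable_cong]: "sets \<mu> = sets borel"
    and growth: "\<And>t. 0 < t \<Longrightarrow> t < 1 \<Longrightarrow> emeasure \<mu> (cball x (m * t)) \<le> ennreal (B * t powr e)"
    and p: "p \<le> e + 3/4" and B: "0 \<le> B"
  shows "(\<integral>\<^sup>+t. \<integral>\<^sup>+y. ennreal (cone_weight m p t x y) \<partial>\<mu> \<partial>lborel) \<le> ennreal (4 * B)"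
proof -
  have "(\<integral>\<^sup>+y. ennreal (cone_weight m p t x y) \<partial>\<mu>) \<le> ennreal B * ennreal (if 0 < t \<and> t < 1 then t powr (-3/4) else 0)" for t
  proof (cases "0 < t \<and> t < 1")
    case True
    have "(\<integral>\<^sup>+y. ennreal (cone_weight m p t x y) \<partial>\<mu>) = (\<integral>\<^sup>+y. ennreal (t powr (- p)) * indicator (cball x (m * t)) y \<partial>\<mu>)"
      using True by (intro nn_integral_cong) (auto simp: cone_weight_def indicator_def)
    also have "\<dots> = ennreal (t powr (- p)) * emeasure \<mu> (cball x (m * t))"
      by (rule nn_integral_cmult_indicator) (simp add: assms(1))
    also have "\<dots> \<le> ennreal (t powr (- p)) * ennreal (B * t powr e)"
      using True by (intro mult_left_mono growth) auto
    also have "\<dots> = ennreal (B * t powr (e - p))"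
    proof -
      have "t powr (e - p) = t powr e * t powr (- p)" by (simp flip: powr_add)
      then show ?thesis using B by (simp add: mult_ac flip: ennreal_mult)
    qed
    also have "\<dots> \<le> ennreal (B * t powr (-3/4))"
      using True B p powr_mono'[of "-3/4" "e - p" t] by (intro ennreal_leI mult_left_mono) auto
    finally show ?thesis using True B by (simp add: ennreal_mult)
  qed (auto simp: cone_weight_def)
  then have "(\<integral>\<^sup>+t. \<integral>\<^sup>+y. ennreal (cone_weight m p t x y) \<partial>\<mu> \<partial>lborel)
      \<le> (\<integral>\<^sup>+t. ennreal B * ennreal (if 0 < t \<and> t < 1 then t powr (-3/4) else 0) \<partial>lborel)"
    by (intro nn_integral_mono)
  also have "\<dots> = ennreal B * (\<integral>\<^sup>+t. ennreal (if 0 < t \<and> t < 1 then t powr (-3/4) else 0) \<partial>lborel)"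
    by (rule nn_integral_cmult) measurable
  also have "\<dots> \<le> ennreal B * ennreal 4"
    using nn_integral_powr_quarter[of 1] by (intro mult_left_mono) auto
  also have "\<dots> = ennreal (4 * B)" using B by (simp add: ennreal_mult mult.commute)
  finally show ?thesis .
qed

lemma emeasure_lborel_cball_scaled:
  fixes x :: "'a::euclidean_space"
  assumes "0 \<le> m" "0 < t"
  shows "emeasure lborel (cball x (m * t)) \<le> ennreal (unit_ball_vol DIM('a) * m ^ DIM('a) * t powr DIM('a))"
  using assms by (simp add: emeasure_cball power_mult_distrib powr_realpow mult.assoc)

text \<open>Local integrability of a Riesz-type kernel without polar coordinates: the power of the
  distance is bounded by the time integral of a cone weight, and Fubini leaves the estimate for
  cones with volume growth.\<close>

lemma nn_integral_dist_powr_le: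
  assumes R: "0 < R"
  obtains C where "0 \<le> C" "\<And>x :: 'a::euclidean_space.
    (\<integral>\<^sup>+y. ennreal (if dist x y \<le> R then dist x y powr (1/4 - DIM('a)) else 0) \<partial>lborel) \<le> ennreal C"
proof -
  define d where "d = real DIM('a)"
  define V where "V = unit_ball_vol DIM('a) * (2 * R) ^ DIM('a)"
  have V: "0 \<le> V" using R by (simp add: V_def)
  define B where "B = 2 * R powr (1/4 - d)"
  have B: "0 \<le> B" by (simp add: B_def)
  show ?thesis
  proof (rule that)
    fix x :: 'a
    \<comment> \<open>Let r be the distance. For t between r / (2 R) and r / R the point y lies in
      the cone and the weight is at least (r / R) powr (-(d + 3/4)). The length r / (2 R) of this
      interval raises the exponent to 1/4 - d, and B repairs the scaling. For r = 0 the left side is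
      0 by the convention for \<open>powr\<close>.\<close>
    have pt: "ennreal (if dist x y \<le> R then dist x y powr (1/4 - d) else 0)
      \<le> ennreal B * (\<integral>\<^sup>+t. ennreal (cone_weight (2 * R) (d + 3/4) t x y) \<partial>lborel)" for y
    proof (cases "0 < dist x y \<and> dist x y \<le> R")
      case True
      define r where "r = dist x y"
      have r: "0 < r" "r \<le> R" using True by (auto simp: r_def)
      have "ennreal (r powr (1/4 - d)) = ennreal B * (ennreal ((r / R) powr (- (d + 3/4))) * ennreal (r / (2 * R)))"
      proof -
        have "(r / R) powr (- (d + 3/4)) * (r / (2 * R)) = (r / R) powr (1/4 - d) / 2"
          using r R powr_add[of "r / R" "- (d + 3/4)" 1] by simp
        also have "B * \<dots> = r powr (1/4 - d)"
          using r R by (simp add: B_def powr_divide)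
        finally show ?thesis using r R B by (simp flip: ennreal_mult)
      qed
      also have "ennreal (r / (2 * R)) = emeasure lborel {r / (2 * R)<..<r / R}"
        using r R by (simp add: field_simps)
      also have "ennreal ((r / R) powr (- (d + 3/4))) * emeasure lborel {r / (2 * R)<..<r / R} =
          (\<integral>\<^sup>+t. ennreal ((r / R) powr (- (d + 3/4))) * indicator {r / (2 * R)<..<r / R} t \<partial>lborel)"
        by (rule nn_integral_cmult_indicator[symmetric]) simp
      also have "\<dots> \<le> (\<integral>\<^sup>+t. ennreal (cone_weight (2 * R) (d + 3/4) t x y) \<partial>lborel)"
      proof (rule nn_integral_mono)
        fix t
        show "ennreal ((r / R) powr (- (d + 3/4))) * indicator {r / (2 * R)<..<r / R} t
          \<le> ennreal (cone_weight (2 * R) (d + 3/4) t x y)"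
        proof (cases "t \<in> {r / (2 * R)<..<r / R}")
          case t: True
          have t0: "0 < t" using t r R by (auto intro: less_trans[of 0 "r / (2 * R)"])
          have t1: "t < 1" using t r R by (auto intro: less_le_trans[of t "r / R"])
          have tr: "r \<le> 2 * R * t" using t R by (simp add: field_simps)
          have "(r / R) powr (- (d + 3/4)) \<le> t powr (- (d + 3/4))"
            using t t0 by (intro powr_mono2') (auto simp: d_def)
          then show ?thesis using t t0 t1 tr by (simp add: cone_weight_def r_def)
        qed simp
      qed
      finally show ?thesis using True by (simp add: r_def mult_left_mono)
    qed auto
    have "(\<integral>\<^sup>+y. \<integral>\<^sup>+t. ennreal (cone_weight (2 * R) (d + 3/4) t x y) \<partial>lborel \<partial>lborel)
      = (\<integral>\<^sup>+t. \<integral>\<^sup>+y. ennreal (cone_weight (2 * R) (d + 3/4) t x y) \<partial>lborel \<partial>lborel)"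
      by (rule lborel_pair.Fubini') measurable
    also have "\<dots> \<le> ennreal (4 * V)"
      using R V by (intro nn_integral_cone_weight_le[where e = d])
        (auto simp: V_def d_def intro: order_trans[OF emeasure_lborel_cball_scaled])
    finally have *: "(\<integral>\<^sup>+y. \<integral>\<^sup>+t. ennreal (cone_weight (2 * R) (d + 3/4) t x y) \<partial>lborel \<partial>lborel)
      \<le> ennreal (4 * V)" .
    have "(\<integral>\<^sup>+y. ennreal (if dist x y \<le> R then dist x y powr (1/4 - d) else 0) \<partial>lborel)
      \<le> (\<integral>\<^sup>+y. ennreal B * (\<integral>\<^sup>+t. ennreal (cone_weight (2 * R) (d + 3/4) t x y) \<partial>lborel) \<partial>lborel)"
      by (intro nn_integral_mono pt)
    also have "\<dots> = ennreal B * (\<integral>\<^sup>+y. \<integral>\<^sup>+t. ennreal (cone_weight (2 * R) (d + 3/4) t x y) \<partial>lborel \<partial>lborel)"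
      by (rule nn_integral_cmult) measurable
    also have "\<dots> \<le> ennreal B * ennreal (4 * V)"
      by (intro mult_left_mono *) simp
    finally show "(\<integral>\<^sup>+y. ennreal (if dist x y \<le> R then dist x y powr (1/4 - DIM('a)) else 0) \<partial>lborel)
      \<le> ennreal (B * (4 * V))"
      unfolding d_def using B V by (simp add: ennreal_mult)
  qed (use V B in simp)
qed

text \<open>Each point y sends its mass to a bump of radius \<rho> around \<open>c y\<close>, and m
  bounds the lengths of the segments used. The locale serves two choices of c with the same N and
  \<omega>: balls inside a subdomain and balls in its neighbours.\<close>

locale segment_flow =
  fixes N :: "(real^'n) measure" and c :: "real^'n \<Rightarrow> real^'n" and \<omega> :: "real^'n \<Rightarrow> real"
    and \<rho> m W L K :: real
  assumes sets_N [measurable_cong, simp]: "sets N = sets borel"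
    and finite_N: "finite_measure N"
    and c_measurable [measurable]: "c \<in> borel_measurable borel"
    and \<omega>_measurable [measurable]: "\<omega> \<in> borel_measurable borel"
    and growth: "\<And>x r. 0 < r \<Longrightarrow> r \<le> m \<Longrightarrow> emeasure N (cball x r) \<le> ennreal (K * r ^ (CARD('n) - 1))"
    and K: "0 \<le> K"
    and \<omega>_bounds: "\<And>z. 0 \<le> \<omega> z" "\<And>z. \<omega> z \<le> W"
    and \<omega>_Lipschitz: "\<And>z z'. \<bar>\<omega> z - \<omega> z'\<bar> \<le> L * dist z z'"
    and \<omega>_support: "\<And>z. \<rho> < norm z \<Longrightarrow> \<omega> z = 0"
    and \<omega>_integral: "(\<integral>z. \<omega> z \<partial>lborel) = 1"
    and centre_near: "\<And>y. dist (c y) y + \<rho> \<le> m"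
    and W: "0 < W" and L: "0 \<le> L" and \<rho>: "0 < \<rho>"
begin

text \<open>The point z of the bump is reached along x = y + t (z - y). With z expressed through x
  and n the dimension, the mass density at time t is \<open>\<omega> (z - c y) / t ^ n\<close> and
  the velocity z - y is (x - y) / t; the kernel is their product. Integration over t in
  \<open>flow\<close> gives the total flux through x.\<close>

definition kernel :: "real^'n \<Rightarrow> real \<Rightarrow> real^'n \<Rightarrow> real^'n" where
  "kernel y t x =
     (if 0 < t \<and> t < 1 then \<omega> (y + (x - y) /\<^sub>R t - c y) / t ^ (CARD('n) + 1) else 0) *\<^sub>R (x - y)"

definition flow :: "(real^'n \<Rightarrow> real) \<Rightarrow> real^'n \<Rightarrow> real^'n" where
  "flow f x = (\<integral>(y, t). f y *\<^sub>R kernel y t x \<partial>(N \<Otimes>\<^sub>M lborel))"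

text \<open>The density of the deposited mass. In the weak sense the divergence of
  \<open>flow f\<close> is the surface source f minus this density, see
  \<open>integral_flow_gradient_boundary\<close>.\<close>

definition sink :: "(real^'n \<Rightarrow> real) \<Rightarrow> real^'n \<Rightarrow> real" where
  "sink f x = (\<integral>y. f y * \<omega> (x - c y) \<partial>N)"

text \<open>Dominates L m + W, the constant of the difference bound, and 2 W m, twice the constant
  of the size bound, so that the two cases in \<open>kernel_diff_le\<close> share one
  factor.\<close>

definition A :: real where "A = L * m + 2 * W * m + W"

section \<open>Pointwise bounds for the kernel\<close>

lemma m_pos: "0 < m"
  using centre_near[of 0] \<rho> zero_le_dist[of "c 0" 0] by linarith

lemma A_pos: "0 < A"
  using m_pos W L by (simp add: A_def add_nonneg_pos)

text \<open>Outside the cone the endpoint \<open>y + (x - y) /\<^sub>R t\<close> is farther than m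
  from y, hence by \<open>centre_near\<close> farther than \<rho> from \<open>c y\<close>, where
  \<omega> vanishes.\<close>

lemma kernel_eq_0:
  assumes "\<not> (0 < t \<and> t < 1 \<and> dist x y \<le> m * t)"
  shows "kernel y t x = 0"
proof (cases "0 < t \<and> t < 1")
  case True
  then have "m * t < dist x y" using assms by auto
  then have "m < dist x y / t"
    using True by (simp add: pos_less_divide_eq)
  also have "dist x y / t = norm ((x - y) /\<^sub>R t)"
    using True by (simp add: dist_norm divide_inverse mult.commute del: scaleR_right_diff_distrib)
  also have "norm ((x - y) /\<^sub>R t) \<le> norm (y + (x - y) /\<^sub>R t - c y) + dist (c y) y"
    using norm_triangle_ineq[of "y + (x - y) /\<^sub>R t - c y" "c y - y"] by (simp add: dist_norm)
  finally have "\<rho> < norm (y + (x - y) /\<^sub>R t - c y)"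
    using centre_near[of y] by linarith
  then show ?thesis by (simp add: kernel_def \<omega>_support)
qed (auto simp: kernel_def)

text \<open>On the cone the factor x - y has size at most m t and cancels one of the n + 1 powers of
  t.\<close>

lemma kernel_norm_le: "norm (kernel y t x) \<le> W * m * cone_weight m CARD('n) t x y"
proof (cases "0 < t \<and> t < 1 \<and> dist x y \<le> m * t")
  case True
  have "norm (kernel y t x) = \<omega> (y + (x - y) /\<^sub>R t - c y) / t ^ (CARD('n) + 1) * dist x y"
    using True \<omega>_bounds by (simp add: kernel_def dist_norm)
  also have "\<dots> \<le> W / t ^ (CARD('n) + 1) * (m * t)"
    using True \<omega>_bounds W by (intro mult_mono divide_right_mono) auto
  also have "\<dots> = W * m * t powr (- CARD('n))"
    using True by (simp add: powr_minus powr_realpow field_simps)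
  finally show ?thesis using True by (simp add: cone_weight_def)
qed (simp add: kernel_eq_0 W m_pos less_imp_le)

text \<open>The Lipschitz bound for \<omega> costs a factor 1/t, which the size m t of x - y
  compensates. One point in the cone is enough, so either of the two can take this role in
  \<open>kernel_diff_le\<close>.\<close>

lemma kernel_diff_le_aux:
  assumes t: "0 < t" "t < 1" and x: "dist x y \<le> m * t"
  shows "norm (kernel y t x - kernel y t x') \<le> (L * m + W) * dist x x' / t ^ (CARD('n) + 1)"
proof -
  define a a' where "a = \<omega> (y + (x - y) /\<^sub>R t - c y)" and "a' = \<omega> (y + (x' - y) /\<^sub>R t - c y)"
  have "kernel y t x - kernel y t x' = (1 / t ^ (CARD('n) + 1)) *\<^sub>R ((a - a') *\<^sub>R (x - y) + a' *\<^sub>R (x - x'))"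
    using t by (simp add: kernel_def a_def a'_def algebra_simps divide_inverse)
  also have "norm \<dots> \<le> (1 / t ^ (CARD('n) + 1)) * (\<bar>a - a'\<bar> * dist x y + \<bar>a'\<bar> * dist x x')"
    using t norm_triangle_ineq[of "(a - a') *\<^sub>R (x - y)" "a' *\<^sub>R (x - x')"]
    by (simp add: dist_norm divide_right_mono)
  also have "\<dots> \<le> (1 / t ^ (CARD('n) + 1)) * ((L * (dist x x' / t)) * (m * t) + W * dist x x')"
  proof (intro mult_left_mono add_mono mult_mono mult_right_mono)
    have "\<bar>a - a'\<bar> \<le> L * dist (y + (x - y) /\<^sub>R t - c y) (y + (x' - y) /\<^sub>R t - c y)"
      unfolding a_def a'_def by (rule \<omega>_Lipschitz)
    also have "(y + (x - y) /\<^sub>R t - c y) - (y + (x' - y) /\<^sub>R t - c y) = (x - x') /\<^sub>R t"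
      by (simp add: algebra_simps)
    then have "dist (y + (x - y) /\<^sub>R t - c y) (y + (x' - y) /\<^sub>R t - c y) = dist x x' / t"
      using t by (simp add: dist_norm divide_inverse mult.commute)
    finally show "\<bar>a - a'\<bar> \<le> L * (dist x x' / t)" .
    show "\<bar>a'\<bar> \<le> W" using \<omega>_bounds by (simp add: a'_def)
  qed (use t x L W in auto)
  also have "\<dots> = (L * m + W) * dist x x' / t ^ (CARD('n) + 1)"
    using t by (simp add: field_simps)
  finally show ?thesis .
qed

text \<open>Interpolation with exponent \<open>1/4\<close> between the bounds on the kernel and on its gradient.\<close>

lemma kernel_diff_le:
  "norm (kernel y t x - kernel y t x') \<le> A * dist x x' powr (1/4) *
     (cone_weight m (CARD('n) + 1/4) t x y + cone_weight m (CARD('n) + 1/4) t x' y)"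
proof (cases "0 < t \<and> t < 1 \<and> (dist x y \<le> m * t \<or> dist x' y \<le> m * t)")
  case True
  then have t: "0 < t" "t < 1" by auto
  define \<delta> where "\<delta> = dist x x'"
  have e: "t powr (- (CARD('n) + 1/4)) = t powr (- CARD('n)) * t powr (- (1/4))"
    by (simp flip: powr_add)
  have e': "(\<delta> / t) powr (1/4) = \<delta> powr (1/4) * t powr (- (1/4))"
    using t by (simp add: powr_divide powr_minus_divide \<delta>_def)
  have s1: "t powr (- (CARD('n) + 1/4)) \<le> cone_weight m (CARD('n) + 1/4) t x y + cone_weight m (CARD('n) + 1/4) t x' y"
    using True by (auto simp: cone_weight_def)
  \<comment> \<open>For \<delta> <= t the difference bound yields the ratio \<delta> / t, which is
    at most its own fourth root. For \<delta> > t the size bound suffices, because that fourth root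
    is at least 1.\<close>
  have "norm (kernel y t x - kernel y t x') \<le> A * \<delta> powr (1/4) * t powr (- (CARD('n) + 1/4))"
  proof (cases "\<delta> \<le> t")
    case le: True
    have "norm (kernel y t x - kernel y t x') \<le> (L * m + W) * \<delta> / t ^ (CARD('n) + 1)"
      using True kernel_diff_le_aux[OF t, of x y x'] kernel_diff_le_aux[OF t, of x' y x]
      by (auto simp: \<delta>_def norm_minus_commute dist_commute)
    also have "\<dots> \<le> A * \<delta> / t ^ (CARD('n) + 1)"
      using W m_pos t by (intro divide_right_mono mult_right_mono) (auto simp: A_def \<delta>_def)
    also have "\<dots> = A * (t powr (- CARD('n)) * (\<delta> / t))"
      using t by (simp add: powr_minus powr_realpow field_simps)
    also have "\<dots> \<le> A * (t powr (- CARD('n)) * (\<delta> / t) powr (1/4))"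
    proof (intro mult_left_mono)
      show "\<delta> / t \<le> (\<delta> / t) powr (1/4)"
        using powr_mono'[of "1/4" 1 "\<delta> / t"] le t by (simp add: \<delta>_def)
    qed (use A_pos in auto)
    also have "\<dots> = A * \<delta> powr (1/4) * t powr (- (CARD('n) + 1/4))"
      by (simp only: e e' mult_ac)
    finally show ?thesis .
  next
    case gt: False
    have "norm (kernel y t x - kernel y t x') \<le> norm (kernel y t x) + norm (kernel y t x')"
      by (rule norm_triangle_ineq4)
    also have "\<dots> \<le> W * m * cone_weight m CARD('n) t x y + W * m * cone_weight m CARD('n) t x' y"
      by (intro add_mono kernel_norm_le)
    also have "\<dots> \<le> W * m * t powr (- CARD('n)) + W * m * t powr (- CARD('n))"
      using W m_pos by (intro add_mono mult_left_mono) (auto simp: cone_weight_def)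
    also have "\<dots> \<le> A * t powr (- CARD('n))"
      using W m_pos L by (simp add: A_def algebra_simps)
    also have "\<dots> \<le> A * (t powr (- CARD('n)) * (\<delta> / t) powr (1/4))"
      using gt t A_pos by (intro mult_left_mono) (auto simp: ge_one_powr_ge_zero)
    also have "\<dots> = A * \<delta> powr (1/4) * t powr (- (CARD('n) + 1/4))"
      by (simp only: e e' mult_ac)
    finally show ?thesis .
  qed
  also have "\<dots> \<le> A * \<delta> powr (1/4) * (cone_weight m (CARD('n) + 1/4) t x y + cone_weight m (CARD('n) + 1/4) t x' y)"
    using A_pos by (intro mult_left_mono s1) auto
  finally show ?thesis by (simp add: \<delta>_def)
next
  case False
  then have "kernel y t x = 0" "kernel y t x' = 0" by (auto intro!: kernel_eq_0)
  then show ?thesis using A_pos by simp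
qed

lemma kernel_measurable [measurable]:
  assumes [measurable]: "f \<in> borel_measurable M" "g \<in> borel_measurable M" "h \<in> borel_measurable M"
  shows "(\<lambda>z. kernel (f z) (h z) (g z)) \<in> borel_measurable M"
  unfolding kernel_def by measurable

section \<open>Integral bounds for the flow\<close>

sublocale finite_measure N
  by (rule finite_N)

sublocale U: pair_sigma_finite N "lborel :: real measure" ..

sublocale UU: sigma_finite_measure "N \<Otimes>\<^sub>M (lborel :: real measure)"
  by (rule sigma_finite_pair_measure) unfold_locales

definition V :: real where "V = unit_ball_vol CARD('n) * m ^ CARD('n)"

lemma V_nonneg: "0 \<le> V"
  using m_pos by (simp add: V_def)

text \<open>Balls of radius m t have surface mass of order n - 1 in t, which admits exponents up to
  (n - 1) + 3/4. The volume counterpart \<open>nn_integral_cone_weight_volume\<close> gains one and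
  admits n + 3/4; this gap is the room for the Schur test.\<close>

lemma nn_integral_cone_weight_surface:
  assumes p: "p \<le> CARD('n) - 1/4"
  shows "(\<integral>\<^sup>+z. ennreal (cone_weight m p (snd z) x (fst z)) \<partial>(N \<Otimes>\<^sub>M lborel))
    \<le> ennreal (4 * (K * m ^ (CARD('n) - 1)))"
proof -
  have "(\<integral>\<^sup>+z. ennreal (cone_weight m p (snd z) x (fst z)) \<partial>(N \<Otimes>\<^sub>M lborel))
      = (\<integral>\<^sup>+t. \<integral>\<^sup>+y. ennreal (cone_weight m p t x y) \<partial>N \<partial>lborel)"
    by (subst U.nn_integral_snd[symmetric]) auto
  also have "\<dots> \<le> ennreal (4 * (K * m ^ (CARD('n) - 1)))"
  proof (rule nn_integral_cone_weight_le[where e = "real (CARD('n) - 1)"])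
    fix t :: real assume t: "0 < t" "t < 1"
    have "emeasure N (cball x (m * t)) \<le> ennreal (K * (m * t) ^ (CARD('n) - 1))"
      using t m_pos by (intro growth) auto
    also have "K * (m * t) ^ (CARD('n) - 1) = K * m ^ (CARD('n) - 1) * t powr (real (CARD('n) - 1))"
      by (simp only: powr_realpow[OF t(1)] power_mult_distrib mult.assoc)
    finally show "emeasure N (cball x (m * t)) \<le> ennreal (K * m ^ (CARD('n) - 1) * t powr (real (CARD('n) - 1)))" .
  next
    have "real (CARD('n) - 1) = real CARD('n) - 1" by (simp add: of_nat_diff Suc_leI)
    then show "p \<le> real (CARD('n) - 1) + 3/4" using p by simp
  qed (use K m_pos in auto)
  finally show ?thesis .
qed

lemma nn_integral_cone_weight_volume:
  fixes y :: "real^'n"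
  assumes p: "p \<le> CARD('n) + 3/4"
  shows "(\<integral>\<^sup>+t. \<integral>\<^sup>+x. ennreal (cone_weight m p t x y) \<partial>lborel \<partial>lborel) \<le> ennreal (4 * V)"
proof -
  have "(\<integral>\<^sup>+t. \<integral>\<^sup>+x. ennreal (cone_weight m p t y x) \<partial>lborel \<partial>lborel) \<le> ennreal (4 * V)"
  proof (rule nn_integral_cone_weight_le[where e = "CARD('n)"])
    fix t :: real assume t: "0 < t" "t < 1"
    show "emeasure lborel (cball y (m * t)) \<le> ennreal (V * t powr CARD('n))"
      using emeasure_lborel_cball_scaled[of m t y] t m_pos by (simp add: V_def)
  qed (use p V_nonneg in auto)
  then show ?thesis by (simp add: cone_weight_commute[of m p _ y])
qed

text \<open>The size of the kernel accounts for the exponent n; the extra 1/4 pays for differences.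
  The sum exceeds the range of \<open>nn_integral_cone_weight_surface\<close>, so the value may be
  infinite at some points, hence the type \<open>ennreal\<close>.\<close>

definition majorant :: "(real^'n \<Rightarrow> real) \<Rightarrow> real^'n \<Rightarrow> ennreal" where
  "majorant f x = (\<integral>\<^sup>+z. ennreal (\<bar>f (fst z)\<bar> * cone_weight m (CARD('n) + 1/4) (snd z) x (fst z)) \<partial>(N \<Otimes>\<^sub>M lborel))"

text \<open>Integrating over x first leaves, for each y, a cone with volume growth; hence the larger
  range of p.\<close>

lemma nn_integral_weighted_cone:
  assumes [measurable]: "g \<in> borel_measurable borel" and p: "p \<le> CARD('n) + 3/4"
  shows "(\<integral>\<^sup>+x. \<integral>\<^sup>+z. g (fst z) * ennreal (cone_weight m p (snd z) x (fst z)) \<partial>(N \<Otimes>\<^sub>M lborel) \<partial>lborel)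
    \<le> ennreal (4 * V) * (\<integral>\<^sup>+y. g y \<partial>N)"
proof -
  interpret pair_sigma_finite "lborel :: (real^'n) measure" "N \<Otimes>\<^sub>M (lborel :: real measure)" ..
  have "(\<integral>\<^sup>+x. \<integral>\<^sup>+z. g (fst z) * ennreal (cone_weight m p (snd z) x (fst z)) \<partial>(N \<Otimes>\<^sub>M lborel) \<partial>lborel)
      = (\<integral>\<^sup>+z. \<integral>\<^sup>+x. g (fst z) * ennreal (cone_weight m p (snd z) x (fst z)) \<partial>lborel \<partial>(N \<Otimes>\<^sub>M lborel))"
    by (rule Fubini'[symmetric]) measurable
  also have "\<dots> = (\<integral>\<^sup>+z. g (fst z) * (\<integral>\<^sup>+x. ennreal (cone_weight m p (snd z) x (fst z)) \<partial>lborel) \<partial>(N \<Otimes>\<^sub>M lborel))"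
    by (intro nn_integral_cong nn_integral_cmult) measurable
  also have "\<dots> = (\<integral>\<^sup>+y. \<integral>\<^sup>+t. g y * (\<integral>\<^sup>+x. ennreal (cone_weight m p t x y) \<partial>lborel) \<partial>lborel \<partial>N)"
    by (subst lborel.nn_integral_fst[symmetric]) auto
  also have "\<dots> = (\<integral>\<^sup>+y. g y * (\<integral>\<^sup>+t. \<integral>\<^sup>+x. ennreal (cone_weight m p t x y) \<partial>lborel \<partial>lborel) \<partial>N)"
    by (intro nn_integral_cong nn_integral_cmult) measurable
  also have "\<dots> \<le> (\<integral>\<^sup>+y. g y * ennreal (4 * V) \<partial>N)"
    by (intro nn_integral_mono mult_left_mono nn_integral_cone_weight_volume p) auto
  also have "\<dots> = ennreal (4 * V) * (\<integral>\<^sup>+y. g y \<partial>N)"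
    by (subst nn_integral_multc) (auto simp: mult.commute)
  finally show ?thesis .
qed

text \<open>
  The Schur test: \<open>p1\<close> and \<open>p2\<close> split the weight so that the integrals of both squares are of the
  type of \<open>nn_integral_cone_weight_le\<close>.
\<close>

lemma nn_integral_majorant_square:
  assumes [measurable]: "f \<in> borel_measurable borel"
  shows "(\<integral>\<^sup>+x. (majorant f x)\<^sup>2 \<partial>lborel)
    \<le> ennreal (16 * K * m ^ (CARD('n) - 1) * V) * (\<integral>\<^sup>+y. ennreal ((f y)\<^sup>2) \<partial>N)"
proof -
  define p1 p2 :: real where "p1 = CARD('n) / 2 + 3/8" and "p2 = CARD('n) / 2 - 1/8"
  have pt: "(majorant f x)\<^sup>2 \<le> ennreal (4 * (K * m ^ (CARD('n) - 1))) *
      (\<integral>\<^sup>+z. ennreal ((f (fst z))\<^sup>2) * ennreal (cone_weight m (CARD('n) + 3/4) (snd z) x (fst z)) \<partial>(N \<Otimes>\<^sub>M lborel))" for x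
  proof -
    have "majorant f x = (\<integral>\<^sup>+z. ennreal (\<bar>f (fst z)\<bar> * cone_weight m p1 (snd z) x (fst z)) *
        ennreal (cone_weight m p2 (snd z) x (fst z)) \<partial>(N \<Otimes>\<^sub>M lborel))"
      unfolding majorant_def
      by (intro nn_integral_cong) (simp add: p1_def p2_def cone_weight_mult mult.assoc flip: ennreal_mult)
    then have "(majorant f x)\<^sup>2 \<le>
        (\<integral>\<^sup>+z. (ennreal (\<bar>f (fst z)\<bar> * cone_weight m p1 (snd z) x (fst z)))\<^sup>2 \<partial>(N \<Otimes>\<^sub>M lborel)) *
        (\<integral>\<^sup>+z. (ennreal (cone_weight m p2 (snd z) x (fst z)))\<^sup>2 \<partial>(N \<Otimes>\<^sub>M lborel))"
      by (simp only:) (rule Cauchy_Schwarz_nn_integral; measurable)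
    also have "\<dots> = (\<integral>\<^sup>+z. ennreal ((f (fst z))\<^sup>2) * ennreal (cone_weight m (CARD('n) + 3/4) (snd z) x (fst z)) \<partial>(N \<Otimes>\<^sub>M lborel)) *
        (\<integral>\<^sup>+z. ennreal (cone_weight m (CARD('n) - 1/4) (snd z) x (fst z)) \<partial>(N \<Otimes>\<^sub>M lborel))"
      by (intro arg_cong2[where f = "(*)"] nn_integral_cong)
        (simp_all add: p1_def p2_def ennreal_power power_mult_distrib power2_eq_square[of "cone_weight _ _ _ _ _"]
          cone_weight_mult flip: ennreal_mult)
    also have "\<dots> \<le> (\<integral>\<^sup>+z. ennreal ((f (fst z))\<^sup>2) * ennreal (cone_weight m (CARD('n) + 3/4) (snd z) x (fst z)) \<partial>(N \<Otimes>\<^sub>M lborel)) *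
        ennreal (4 * (K * m ^ (CARD('n) - 1)))"
      by (intro mult_left_mono nn_integral_cone_weight_surface) auto
    finally show ?thesis by (simp add: mult.commute)
  qed
  have "(\<integral>\<^sup>+x. (majorant f x)\<^sup>2 \<partial>lborel) \<le> (\<integral>\<^sup>+x. ennreal (4 * (K * m ^ (CARD('n) - 1))) *
      (\<integral>\<^sup>+z. ennreal ((f (fst z))\<^sup>2) * ennreal (cone_weight m (CARD('n) + 3/4) (snd z) x (fst z)) \<partial>(N \<Otimes>\<^sub>M lborel)) \<partial>lborel)"
    by (intro nn_integral_mono pt)
  also have "\<dots> = ennreal (4 * (K * m ^ (CARD('n) - 1))) * (\<integral>\<^sup>+x.
      (\<integral>\<^sup>+z. ennreal ((f (fst z))\<^sup>2) * ennreal (cone_weight m (CARD('n) + 3/4) (snd z) x (fst z)) \<partial>(N \<Otimes>\<^sub>M lborel)) \<partial>lborel)"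
    by (rule nn_integral_cmult) measurable
  also have "\<dots> \<le> ennreal (4 * (K * m ^ (CARD('n) - 1))) * (ennreal (4 * V) * (\<integral>\<^sup>+y. ennreal ((f y)\<^sup>2) \<partial>N))"
    by (intro mult_left_mono nn_integral_weighted_cone) auto
  also have "\<dots> = ennreal (16 * K * m ^ (CARD('n) - 1) * V) * (\<integral>\<^sup>+y. ennreal ((f y)\<^sup>2) \<partial>N)"
    using K m_pos V_nonneg by (simp add: mult.assoc[symmetric] flip: ennreal_mult)
  finally show ?thesis .
qed

lemma flow_integrable:
  assumes [measurable]: "f \<in> borel_measurable borel" and "majorant f x < \<infinity>"
  shows "integrable (N \<Otimes>\<^sub>M lborel) (\<lambda>(y, t). f y *\<^sub>R kernel y t x)"
proof (rule integrableI_bounded)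
  have "(\<integral>\<^sup>+z. ennreal (norm (case z of (y, t) \<Rightarrow> f y *\<^sub>R kernel y t x)) \<partial>(N \<Otimes>\<^sub>M lborel))
    \<le> (\<integral>\<^sup>+z. ennreal (W * m) * ennreal (\<bar>f (fst z)\<bar> * cone_weight m (CARD('n) + 1/4) (snd z) x (fst z)) \<partial>(N \<Otimes>\<^sub>M lborel))"
  proof (intro nn_integral_mono, clarsimp simp flip: ennreal_mult)
    fix y t
    have "norm (kernel y t x) \<le> W * m * cone_weight m CARD('n) t x y" by (rule kernel_norm_le)
    also have "\<dots> \<le> W * m * cone_weight m (CARD('n) + 1/4) t x y"
      using W m_pos by (intro mult_left_mono cone_weight_mono) auto
    finally have "\<bar>f y\<bar> * norm (kernel y t x) \<le> \<bar>f y\<bar> * (W * m * cone_weight m (CARD('n) + 1/4) t x y)"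
      by (intro mult_left_mono) auto
    then show "ennreal (\<bar>f y\<bar> * norm (kernel y t x))
        \<le> ennreal (W * m) * ennreal (\<bar>f y\<bar> * cone_weight m (CARD('n) + 1/4) t x y)"
      using W m_pos by (simp add: mult_ac flip: ennreal_mult)
  qed
  also have "\<dots> = ennreal (W * m) * majorant f x"
    unfolding majorant_def by (rule nn_integral_cmult) measurable
  also have "\<dots> < \<infinity>" using assms(2) by (simp add: ennreal_mult_less_top)
  finally show "(\<integral>\<^sup>+z. ennreal (norm (case z of (y, t) \<Rightarrow> f y *\<^sub>R kernel y t x)) \<partial>(N \<Otimes>\<^sub>M lborel)) < \<infinity>" .
qed measurable

lemma flow_norm_le:
  assumes [measurable]: "f \<in> borel_measurable borel"
  shows "ennreal (norm (flow f x)) \<le> ennreal A * majorant f x"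
proof (cases "majorant f x < \<infinity>")
  case True
  have "ennreal (norm (flow f x)) \<le> (\<integral>\<^sup>+z. ennreal (norm (case z of (y, t) \<Rightarrow> f y *\<^sub>R kernel y t x)) \<partial>(N \<Otimes>\<^sub>M lborel))"
    unfolding flow_def by (rule integral_norm_bound_ennreal[OF flow_integrable[OF assms True]])
  also have "\<dots> \<le> (\<integral>\<^sup>+z. ennreal A * ennreal (\<bar>f (fst z)\<bar> * cone_weight m (CARD('n) + 1/4) (snd z) x (fst z)) \<partial>(N \<Otimes>\<^sub>M lborel))"
  proof (intro nn_integral_mono, clarsimp simp flip: ennreal_mult)
    fix y t
    have "norm (kernel y t x) \<le> W * m * cone_weight m CARD('n) t x y" by (rule kernel_norm_le)
    also have "\<dots> \<le> A * cone_weight m (CARD('n) + 1/4) t x y"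
      using W m_pos L by (intro mult_mono cone_weight_mono) (auto simp: A_def add_nonneg_nonneg)
    finally have "\<bar>f y\<bar> * norm (kernel y t x) \<le> \<bar>f y\<bar> * (A * cone_weight m (CARD('n) + 1/4) t x y)"
      by (intro mult_left_mono) auto
    then show "ennreal (\<bar>f y\<bar> * norm (kernel y t x))
        \<le> ennreal A * ennreal (\<bar>f y\<bar> * cone_weight m (CARD('n) + 1/4) t x y)"
      using A_pos by (simp add: mult_ac flip: ennreal_mult)
  qed
  also have "\<dots> = ennreal A * majorant f x"
    unfolding majorant_def by (rule nn_integral_cmult) measurable
  finally show ?thesis .
next
  case False
  then show ?thesis using A_pos by (simp add: ennreal_mult_top less_top[symmetric])
qed

text \<open>A Hajlasz-type inequality: Hoelder continuity of exponent 1/4 with a factor that depends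
  on the two points but is square integrable for square integrable f. On bounded sets this controls
  Slobodeckij seminorms of order below 1/4.\<close>

lemma flow_diff_le:
  assumes [measurable]: "f \<in> borel_measurable borel"
  shows "ennreal (norm (flow f x - flow f x')) \<le> ennreal (A * dist x x' powr (1/4)) * (majorant f x + majorant f x')"
proof (cases "majorant f x < \<infinity> \<and> majorant f x' < \<infinity>")
  case True
  then have i: "integrable (N \<Otimes>\<^sub>M lborel) (\<lambda>(y, t). f y *\<^sub>R kernel y t x)"
     "integrable (N \<Otimes>\<^sub>M lborel) (\<lambda>(y, t). f y *\<^sub>R kernel y t x')"
    by (auto intro!: flow_integrable)
  have "flow f x - flow f x' = (\<integral>(y, t). f y *\<^sub>R (kernel y t x - kernel y t x') \<partial>(N \<Otimes>\<^sub>M lborel))"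
    unfolding flow_def
    by (subst Bochner_Integration.integral_diff[OF i, symmetric])
      (auto intro!: Bochner_Integration.integral_cong simp: scaleR_diff_right)
  moreover have "integrable (N \<Otimes>\<^sub>M lborel) (\<lambda>(y, t). f y *\<^sub>R (kernel y t x - kernel y t x'))"
    using Bochner_Integration.integrable_diff[OF i] by (simp add: scaleR_diff_right case_prod_beta')
  ultimately have "ennreal (norm (flow f x - flow f x')) \<le>
      (\<integral>\<^sup>+z. ennreal (norm (case z of (y, t) \<Rightarrow> f y *\<^sub>R (kernel y t x - kernel y t x'))) \<partial>(N \<Otimes>\<^sub>M lborel))"
    by (simp only: integral_norm_bound_ennreal)
  also have "\<dots> \<le> (\<integral>\<^sup>+z. ennreal (A * dist x x' powr (1/4)) *
      (ennreal (\<bar>f (fst z)\<bar> * cone_weight m (CARD('n) + 1/4) (snd z) x (fst z)) +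
       ennreal (\<bar>f (fst z)\<bar> * cone_weight m (CARD('n) + 1/4) (snd z) x' (fst z))) \<partial>(N \<Otimes>\<^sub>M lborel))"
  proof (intro nn_integral_mono, clarsimp)
    fix y t
    have "\<bar>f y\<bar> * norm (kernel y t x - kernel y t x') \<le> \<bar>f y\<bar> * (A * dist x x' powr (1/4) *
       (cone_weight m (CARD('n) + 1/4) t x y + cone_weight m (CARD('n) + 1/4) t x' y))"
      by (intro mult_left_mono kernel_diff_le) auto
    then show "ennreal (\<bar>f y\<bar> * norm (kernel y t x - kernel y t x')) \<le> ennreal (A * dist x x' powr (1/4)) *
      (ennreal (\<bar>f y\<bar> * cone_weight m (CARD('n) + 1/4) t x y) +
       ennreal (\<bar>f y\<bar> * cone_weight m (CARD('n) + 1/4) t x' y))"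
      using A_pos by (simp add: algebra_simps flip: ennreal_mult ennreal_plus)
  qed
  also have "\<dots> = ennreal (A * dist x x' powr (1/4)) * (majorant f x + majorant f x')"
    unfolding majorant_def
    by (subst nn_integral_cmult, measurable, subst nn_integral_add) auto
  finally show ?thesis .
next
  case False
  \<comment> \<open>If x = x' the product is 0 times \<open>top\<close>, which is 0, so this case is
    treated apart; otherwise the right side is \<open>top\<close>.\<close>
  show ?thesis
  proof (cases "x = x'")
    case ne: False
    have tp: "majorant f x + majorant f x' = top" using False by (auto simp: less_top[symmetric])
    show ?thesis unfolding tp using A_pos ne by (simp add: ennreal_mult_top)
  qed simp
qed

end

section \<open>Square norm and fractional Sobolev bound of the flow\<close>

lemma ennreal_square_add_le:
  fixes a b :: ennreal
  shows "(a + b)\<^sup>2 \<le> 2 * a\<^sup>2 + 2 * b\<^sup>2"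
proof (cases "a = top \<or> b = top")
  case True
  then show ?thesis by (auto simp: power2_eq_square ennreal_mult_top)
next
  case False
  then obtain x y where xy: "a = ennreal x" "0 \<le> x" "b = ennreal y" "0 \<le> y"
    by (metis ennreal_cases top_neq_ennreal)
  have "(x + y)\<^sup>2 \<le> 2 * x\<^sup>2 + 2 * y\<^sup>2"
    using sum_squares_bound[of x y] by (simp add: power2_sum)
  then have "ennreal ((x + y)\<^sup>2) \<le> ennreal (2 * x\<^sup>2 + 2 * y\<^sup>2)" by (rule ennreal_leI)
  moreover have "ennreal (2 * x\<^sup>2 + 2 * y\<^sup>2) = 2 * ennreal (x\<^sup>2) + 2 * ennreal (y\<^sup>2)"
    by (simp add: ennreal_plus ennreal_mult)
  ultimately show ?thesis using xy by (simp add: ennreal_power flip: ennreal_plus)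
qed

context segment_flow
begin

definition C\<^sub>S :: real where "C\<^sub>S = 16 * K * m ^ (CARD('n) - 1) * V"

lemma CS_nonneg: "0 \<le> C\<^sub>S"
  using K m_pos V_nonneg by (simp add: C\<^sub>S_def)

lemma flow_measurable [measurable]:
  assumes [measurable]: "f \<in> borel_measurable borel"
  shows "flow f \<in> borel_measurable borel"
  unfolding flow_def by measurable

lemma majorant_measurable [measurable]:
  assumes [measurable]: "f \<in> borel_measurable borel"
  shows "majorant f \<in> borel_measurable borel"
  unfolding majorant_def by measurable

lemma nn_integral_flow_square:
  assumes [measurable]: "f \<in> borel_measurable borel"
  shows "(\<integral>\<^sup>+x. ennreal ((norm (flow f x))\<^sup>2) \<partial>lborel)
    \<le> ennreal (A\<^sup>2 * C\<^sub>S) * (\<integral>\<^sup>+y. ennreal ((f y)\<^sup>2) \<partial>N)"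
proof -
  have "ennreal ((norm (flow f x))\<^sup>2) \<le> ennreal (A\<^sup>2) * (majorant f x)\<^sup>2" for x
  proof -
    have "(ennreal (norm (flow f x)))\<^sup>2 \<le> (ennreal A * majorant f x)\<^sup>2"
      by (intro power_mono flow_norm_le) auto
    then show ?thesis using A_pos by (simp add: power_mult_distrib ennreal_power)
  qed
  then have "(\<integral>\<^sup>+x. ennreal ((norm (flow f x))\<^sup>2) \<partial>lborel) \<le> (\<integral>\<^sup>+x. ennreal (A\<^sup>2) * (majorant f x)\<^sup>2 \<partial>lborel)"
    by (intro nn_integral_mono)
  also have "\<dots> = ennreal (A\<^sup>2) * (\<integral>\<^sup>+x. (majorant f x)\<^sup>2 \<partial>lborel)"
    by (rule nn_integral_cmult) measurable
  also have "\<dots> \<le> ennreal (A\<^sup>2) * (ennreal C\<^sub>S * (\<integral>\<^sup>+y. ennreal ((f y)\<^sup>2) \<partial>N))"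
    unfolding C\<^sub>S_def by (intro mult_left_mono nn_integral_majorant_square) auto
  also have "\<dots> = ennreal (A\<^sup>2 * C\<^sub>S) * (\<integral>\<^sup>+y. ennreal ((f y)\<^sup>2) \<partial>N)"
    using CS_nonneg by (simp add: ennreal_mult mult.assoc)
  finally show ?thesis .
qed

text \<open>Squaring \<open>flow_diff_le\<close> and dividing by the power n + 1/4 of the distance
  leaves the power 1/4 - n, which is locally integrable. The weight is symmetric, so both halves
  reduce to the integral of the squared \<open>majorant\<close>.\<close>

lemma slobodeckij_flow_le:
  assumes [measurable]: "f \<in> borel_measurable borel" "G \<in> sets borel"
    and G: "\<And>x x'. x \<in> G \<Longrightarrow> x' \<in> G \<Longrightarrow> dist x x' \<le> R"
    and C: "0 \<le> C" "\<And>x :: real^'n. (\<integral>\<^sup>+y. ennreal (if dist x y \<le> R then dist x y powr (1/4 - CARD('n)) else 0) \<partial>lborel) \<le> ennreal C"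
  shows "slobodeckij (1/8) G (flow f) \<le> ennreal (4 * A\<^sup>2 * C * C\<^sub>S) * (\<integral>\<^sup>+y. ennreal ((f y)\<^sup>2) \<partial>N)"
proof -
  define w where "w = (\<lambda>x x' :: real^'n. if dist x x' \<le> R then dist x x' powr (1/4 - CARD('n)) else 0)"
  have w_measurable [measurable]: "(\<lambda>z. w (g z) (h z)) \<in> borel_measurable M"
    if [measurable]: "g \<in> borel_measurable M" "h \<in> borel_measurable M" for g h and M :: "'z measure"
    unfolding w_def by measurable
  have w_meas2: "(\<lambda>z. w (fst z) (snd z)) \<in> borel_measurable (lborel \<Otimes>\<^sub>M lborel)"
    unfolding w_def by measurable
  have w_meas1: "w x \<in> borel_measurable borel" "(\<lambda>x'. w x' x) \<in> borel_measurable borel" for x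
    unfolding w_def by measurable
  have wc: "w x x' = w x' x" for x x' by (simp add: w_def dist_commute)
  define E where "E = ennreal (2 * A\<^sup>2)"
  have pt: "ennreal ((norm (flow f x - flow f x'))\<^sup>2 / dist x x' powr (real CARD('n) + 2 * (1/8)))
      \<le> E * (ennreal (w x x') * (majorant f x)\<^sup>2 + ennreal (w x x') * (majorant f x')\<^sup>2)"
    if xx: "dist x x' \<le> R" for x x'
  proof (cases "x = x'")
    case False
    define \<delta> where "\<delta> = dist x x'"
    have \<delta>: "0 < \<delta>" using False by (simp add: \<delta>_def)
    define P where "P = \<delta> powr (real CARD('n) + 2 * (1/8))"
    have P: "0 < P" using \<delta> by (simp add: P_def)
    have e: "(A * \<delta> powr (1/4))\<^sup>2 / P = A\<^sup>2 * w x x'"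
    proof -
      have "(\<delta> powr (1/4))\<^sup>2 = \<delta> powr (1/2)" using \<delta> by (simp add: powr_power)
      then have a: "(A * \<delta> powr (1/4))\<^sup>2 / P = A\<^sup>2 * (\<delta> powr (1/2) / P)"
        by (simp add: power_mult_distrib)
      have b: "\<delta> powr (1/2) / P = \<delta> powr (1/4 - CARD('n))"
        unfolding P_def by (simp add: powr_diff[symmetric])
      show ?thesis unfolding a b using xx by (simp add: w_def \<delta>_def)
    qed
    have "ennreal ((norm (flow f x - flow f x'))\<^sup>2 / P) = (ennreal (norm (flow f x - flow f x')))\<^sup>2 * ennreal (1 / P)"
      using P by (simp add: ennreal_power flip: ennreal_mult)
    also have "\<dots> \<le> (ennreal (A * \<delta> powr (1/4)) * (majorant f x + majorant f x'))\<^sup>2 * ennreal (1 / P)"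
      unfolding \<delta>_def by (intro mult_right_mono power_mono flow_diff_le) auto
    also have "\<dots> = (ennreal ((A * \<delta> powr (1/4))\<^sup>2) * ennreal (1 / P)) * (majorant f x + majorant f x')\<^sup>2"
      using A_pos by (simp add: power_mult_distrib ennreal_power mult_ac)
    also have "ennreal ((A * \<delta> powr (1/4))\<^sup>2) * ennreal (1 / P) = ennreal (A\<^sup>2 * w x x')"
      using P by (simp flip: ennreal_mult e)
    also have "ennreal (A\<^sup>2 * w x x') * (majorant f x + majorant f x')\<^sup>2
        \<le> ennreal (A\<^sup>2 * w x x') * (2 * (majorant f x)\<^sup>2 + 2 * (majorant f x')\<^sup>2)"
      by (intro mult_left_mono ennreal_square_add_le) auto
    also have "\<dots> = E * (ennreal (w x x') * (majorant f x)\<^sup>2 + ennreal (w x x') * (majorant f x')\<^sup>2)"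
      by (simp add: E_def w_def ennreal_mult algebra_simps)
    finally show ?thesis by (simp add: P_def \<delta>_def)
  qed simp
  have half: "(\<integral>\<^sup>+x. \<integral>\<^sup>+x'. ennreal (w x x') * (majorant f x)\<^sup>2 \<partial>lborel \<partial>lborel)
      \<le> ennreal C * (\<integral>\<^sup>+x. (majorant f x)\<^sup>2 \<partial>lborel)"
  proof -
    have "(\<integral>\<^sup>+x. \<integral>\<^sup>+x'. ennreal (w x x') * (majorant f x)\<^sup>2 \<partial>lborel \<partial>lborel) =
        (\<integral>\<^sup>+x. (\<integral>\<^sup>+x'. ennreal (w x x') \<partial>lborel) * (majorant f x)\<^sup>2 \<partial>lborel)"
      by (intro nn_integral_cong nn_integral_multc) (use w_meas1 in measurable)
    also have "\<dots> \<le> (\<integral>\<^sup>+x. ennreal C * (majorant f x)\<^sup>2 \<partial>lborel)"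
      using C(2) by (intro nn_integral_mono mult_right_mono) (auto simp: w_def)
    also have "\<dots> = ennreal C * (\<integral>\<^sup>+x. (majorant f x)\<^sup>2 \<partial>lborel)"
      by (rule nn_integral_cmult) measurable
    finally show ?thesis .
  qed
  have swap: "(\<integral>\<^sup>+x. \<integral>\<^sup>+x'. ennreal (w x x') * (majorant f x')\<^sup>2 \<partial>lborel \<partial>lborel) =
      (\<integral>\<^sup>+x. \<integral>\<^sup>+x'. ennreal (w x x') * (majorant f x)\<^sup>2 \<partial>lborel \<partial>lborel)"
    using w_meas2 by (subst lborel_pair.Fubini') (auto simp: case_prod_beta' wc[of _ "_ :: real^'n"])
  have "slobodeckij (1/8) G (flow f) = (\<integral>\<^sup>+x. (\<integral>\<^sup>+x'. ennreal ((norm (flow f x - flow f x'))\<^sup>2 /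
      dist x x' powr (real CARD('n) + 2 * (1/8))) * indicator G x' \<partial>lborel) * indicator G x \<partial>lborel)"
    unfolding slobodeckij_def by (simp add: nn_integral_restrict_space)
  also have "\<dots> \<le> (\<integral>\<^sup>+x. (\<integral>\<^sup>+x'. E * (ennreal (w x x') * (majorant f x)\<^sup>2 + ennreal (w x x') * (majorant f x')\<^sup>2) \<partial>lborel) \<partial>lborel)"
  proof (intro nn_integral_mono)
    fix x
    show "(\<integral>\<^sup>+x'. ennreal ((norm (flow f x - flow f x'))\<^sup>2 /
        dist x x' powr (real CARD('n) + 2 * (1/8))) * indicator G x' \<partial>lborel) * indicator G x
      \<le> (\<integral>\<^sup>+x'. E * (ennreal (w x x') * (majorant f x)\<^sup>2 + ennreal (w x x') * (majorant f x')\<^sup>2) \<partial>lborel)"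
    proof (cases "x \<in> G")
      case True
      have "(\<integral>\<^sup>+x'. ennreal ((norm (flow f x - flow f x'))\<^sup>2 /
        dist x x' powr (real CARD('n) + 2 * (1/8))) * indicator G x' \<partial>lborel) \<le>
        (\<integral>\<^sup>+x'. E * (ennreal (w x x') * (majorant f x)\<^sup>2 + ennreal (w x x') * (majorant f x')\<^sup>2) \<partial>lborel)"
      proof (rule nn_integral_mono)
        fix x'
        show "ennreal ((norm (flow f x - flow f x'))\<^sup>2 / dist x x' powr (real CARD('n) + 2 * (1/8))) * indicator G x'
           \<le> E * (ennreal (w x x') * (majorant f x)\<^sup>2 + ennreal (w x x') * (majorant f x')\<^sup>2)"
          using pt[OF G[OF True], of x'] by (cases "x' \<in> G") auto
      qed
      then show ?thesis using True by simp
    qed simp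
  qed
  also have "\<dots> = E * ((\<integral>\<^sup>+x. \<integral>\<^sup>+x'. ennreal (w x x') * (majorant f x)\<^sup>2 \<partial>lborel \<partial>lborel) +
      (\<integral>\<^sup>+x. \<integral>\<^sup>+x'. ennreal (w x x') * (majorant f x')\<^sup>2 \<partial>lborel \<partial>lborel))"
  proof -
    have [measurable]: "(\<lambda>x. \<integral>\<^sup>+x'. ennreal (w x x') * (majorant f x)\<^sup>2 \<partial>lborel) \<in> borel_measurable borel"
      "(\<lambda>x. \<integral>\<^sup>+x'. ennreal (w x x') * (majorant f x')\<^sup>2 \<partial>lborel) \<in> borel_measurable borel"
      unfolding w_def by measurable
    have "(\<integral>\<^sup>+x'. E * (ennreal (w x x') * (majorant f x)\<^sup>2 + ennreal (w x x') * (majorant f x')\<^sup>2) \<partial>lborel) =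
        E * ((\<integral>\<^sup>+x'. ennreal (w x x') * (majorant f x)\<^sup>2 \<partial>lborel) + (\<integral>\<^sup>+x'. ennreal (w x x') * (majorant f x')\<^sup>2 \<partial>lborel))" for x
      using w_meas1 by (subst nn_integral_cmult, measurable, subst nn_integral_add) auto
    then show ?thesis by (simp add: nn_integral_cmult nn_integral_add)
  qed
  also have "\<dots> \<le> E * (ennreal C * (\<integral>\<^sup>+x. (majorant f x)\<^sup>2 \<partial>lborel) + ennreal C * (\<integral>\<^sup>+x. (majorant f x)\<^sup>2 \<partial>lborel))"
    unfolding swap by (intro mult_left_mono add_mono half) auto
  also have "\<dots> = ennreal (4 * A\<^sup>2 * C) * (\<integral>\<^sup>+x. (majorant f x)\<^sup>2 \<partial>lborel)"
  proof -
    have "E * (a + a) = ennreal (4 * A\<^sup>2) * a" for a :: ennreal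
    proof -
      have "E = 2 * ennreal (A\<^sup>2)" "ennreal (4 * A\<^sup>2) = (2 * 2) * ennreal (A\<^sup>2)"
        by (simp_all add: E_def ennreal_mult)
      then show ?thesis by (simp only: mult_2[symmetric] mult_ac)
    qed
    then show ?thesis using C(1) by (simp add: ennreal_mult mult.assoc)
  qed
  also have "\<dots> \<le> ennreal (4 * A\<^sup>2 * C) * (ennreal C\<^sub>S * (\<integral>\<^sup>+y. ennreal ((f y)\<^sup>2) \<partial>N))"
    unfolding C\<^sub>S_def by (intro mult_left_mono nn_integral_majorant_square) auto
  also have "\<dots> = ennreal (4 * A\<^sup>2 * C * C\<^sub>S) * (\<integral>\<^sup>+y. ennreal ((f y)\<^sup>2) \<partial>N)"
    using CS_nonneg C(1) by (simp add: ennreal_mult mult.assoc)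
  finally show ?thesis .
qed

end

section \<open>Green's formula for the flow and its sink\<close>

lemma lborel_integral_affine:
  fixes h :: "'a::euclidean_space \<Rightarrow> real"
  assumes [measurable]: "h \<in> borel_measurable borel" and "0 < s"
  shows "(\<integral>x. h x \<partial>lborel) = (\<integral>x. s ^ DIM('a) * h (v + s *\<^sub>R x) \<partial>lborel)"
proof -
  have "(\<integral>x. h x \<partial>lborel) = (\<integral>x. h x \<partial>density (distr lborel borel (\<lambda>x. v + s *\<^sub>R x)) (\<lambda>_. \<bar>s\<bar> ^ DIM('a)))"
    using lborel_affine[of s v] assms(2) by simp
  also have "\<dots> = (\<integral>x. s ^ DIM('a) * h (v + s *\<^sub>R x) \<partial>lborel)"
    using assms(2) by (subst integral_density) (auto simp: integral_distr)
  finally show ?thesis .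
qed

lemma continuous_on_bounded_imp_bound:
  fixes g :: "'a::euclidean_space \<Rightarrow> 'b::real_normed_vector"
  assumes "bounded G" "continuous_on UNIV g"
  obtains B where "0 < B" "\<And>x. x \<in> G \<Longrightarrow> norm (g x) \<le> B"
proof -
  have "compact (closure G)" using assms(1) by (simp add: compact_closure)
  moreover have "continuous_on (closure G) g" by (rule continuous_on_subset[OF assms(2)]) simp
  ultimately have "bounded (g ` closure G)" by (intro compact_imp_bounded compact_continuous_image)
  then obtain B where B: "0 < B" "\<And>x. x \<in> closure G \<Longrightarrow> norm (g x) \<le> B"
    unfolding bounded_pos by auto
  show ?thesis
    by (rule that[OF B(1)]) (use B(2) closure_subset in auto)
qed

lemma segment_integral_gradient:
  assumes "C1_function \<psi>"
  shows "(\<integral>t. (if 0 < t \<and> t < 1 then (z - y) \<bullet> gradient \<psi> (y + t *\<^sub>R (z - y)) else 0) \<partial>lborel) = \<psi> z - \<psi> y"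
proof -
  note [measurable] = gradient_borel_measurable[OF assms]
  have "(\<integral>t. (if 0 < t \<and> t < 1 then (z - y) \<bullet> gradient \<psi> (y + t *\<^sub>R (z - y)) else 0) \<partial>lborel)
    = (\<integral>t. (z - y) \<bullet> gradient \<psi> (y + t *\<^sub>R (z - y)) * indicator {0..1} t \<partial>lborel)"
  proof (rule integral_cong_AE)
    show "AE t in lborel. (if 0 < t \<and> t < 1 then (z - y) \<bullet> gradient \<psi> (y + t *\<^sub>R (z - y)) else 0) =
        (z - y) \<bullet> gradient \<psi> (y + t *\<^sub>R (z - y)) * indicator {0..1} t"
      using AE_lborel_singleton[of "0::real"] AE_lborel_singleton[of "1::real"]
      by eventually_elim (auto simp: indicator_def)
  qed measurable
  also have "\<dots> = \<psi> (y + 1 *\<^sub>R (z - y)) - \<psi> (y + 0 *\<^sub>R (z - y))"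
  proof (rule integral_FTC_Icc_real)
    fix t :: real
    have "((\<lambda>t. y + t *\<^sub>R (z - y)) has_derivative (\<lambda>s. s *\<^sub>R (z - y))) (at t)"
      by (auto intro!: derivative_eq_intros)
    from has_derivative_compose[OF this C1_function_has_derivative[OF assms]]
    show "((\<lambda>t. \<psi> (y + t *\<^sub>R (z - y))) has_real_derivative (z - y) \<bullet> gradient \<psi> (y + t *\<^sub>R (z - y))) (at t)"
      by (simp add: has_field_derivative_def inner_commute mult_commute_abs)
    show "isCont (\<lambda>t. (z - y) \<bullet> gradient \<psi> (y + t *\<^sub>R (z - y))) t"
    proof -
      have "isCont (gradient \<psi>) x" for x
        using gradient_continuous_on[OF assms, of UNIV] by (simp add: continuous_on_eq_continuous_at)
      then have "isCont (\<lambda>t. gradient \<psi> (y + t *\<^sub>R (z - y))) t"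
        by (rule isCont_o2[rotated]) (intro continuous_intros)
      then show ?thesis by (intro continuous_intros)
    qed
  qed simp
  finally show ?thesis by simp
qed

context segment_flow
begin

lemma \<omega>_eq_0: "z \<notin> cball (c y) \<rho> \<Longrightarrow> \<omega> (z - c y) = 0"
  by (rule \<omega>_support) (simp add: dist_norm norm_minus_commute)

lemma cball_finite: "emeasure lborel (cball z \<rho>) < top"
  using emeasure_bounded_finite[of "cball z \<rho>"] by simp

lemma \<omega>_integrable_mult:
  assumes [measurable]: "h \<in> borel_measurable borel" and B: "\<And>z. z \<in> cball (c y) \<rho> \<Longrightarrow> \<bar>h z\<bar> \<le> B"
  shows "integrable lborel (\<lambda>z. \<omega> (z - c y) * h z)"
proof (rule Bochner_Integration.integrable_bound)
  show "integrable lborel (\<lambda>z. (W * B) * indicator (cball (c y) \<rho>) z)"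
    by (intro integrable_mult_right integrable_real_indicator) (auto simp: cball_finite)
  have "\<bar>\<omega> (z - c y) * h z\<bar> \<le> \<bar>W * B * indicator (cball (c y) \<rho>) z\<bar>" for z
  proof (cases "z \<in> cball (c y) \<rho>")
    case True
    have "\<bar>\<omega> (z - c y)\<bar> * \<bar>h z\<bar> \<le> W * B"
      using \<omega>_bounds B[OF True] W by (intro mult_mono) auto
    then show ?thesis using True abs_ge_self[of "W * B"] by (simp add: abs_mult)
  qed (simp add: \<omega>_eq_0)
  then show "AE z in lborel. norm (\<omega> (z - c y) * h z) \<le> norm (W * B * indicator (cball (c y) \<rho>) z)" by simp
qed measurable

lemma \<omega>_integral_centre: "(\<integral>z. \<omega> (z - c y) \<partial>lborel) = 1"
  using lborel_integral_affine[of "\<lambda>z. \<omega> (z - c y)" 1 "c y"] \<omega>_integral by simp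

text \<open>The substitution x = y + t (z - y) has a Jacobian that turns the kernel into
  \<open>\<omega> (z - c y)\<close> times z - y. Fubini and the fundamental theorem on each segment
  then give the average of \<psi> over the bump minus the value at y.\<close>

lemma integral_kernel_gradient:
  assumes \<psi>: "C1_function \<psi>" and G: "bounded G" "G \<in> sets borel"
    and seg: "\<And>z t. norm (z - c y) \<le> \<rho> \<Longrightarrow> 0 < t \<Longrightarrow> t < 1 \<Longrightarrow> y + t *\<^sub>R (z - y) \<in> G"
  shows "(\<integral>t. \<integral>x. kernel y t x \<bullet> (indicator G x *\<^sub>R gradient \<psi> x) \<partial>lborel \<partial>lborel)
    = (\<integral>z. \<omega> (z - c y) * \<psi> z \<partial>lborel) - \<psi> y"
proof -
  note [measurable] = gradient_borel_measurable[OF \<psi>] C1_function_borel_measurable[OF \<psi>] G(2)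
  obtain B where B: "0 < B" "\<And>x. x \<in> G \<Longrightarrow> norm (gradient \<psi> x) \<le> B"
    using continuous_on_bounded_imp_bound[OF G(1) gradient_continuous_on[OF \<psi>, of UNIV]] by blast
  \<comment> \<open>The integrand in the coordinates (t, z). The singular power of t has
    disappeared, and a bounded function with bounded support makes Fubini elementary.\<close>
  define Q where "Q = (\<lambda>t z. if 0 < t \<and> t < 1 then \<omega> (z - c y) * ((z - y) \<bullet> gradient \<psi> (y + t *\<^sub>R (z - y))) else 0)"
  have "(\<integral>x. kernel y t x \<bullet> (indicator G x *\<^sub>R gradient \<psi> x) \<partial>lborel) = (\<integral>z. Q t z \<partial>lborel)" for t
  proof (cases "0 < t \<and> t < 1")
    case True
    then have t: "0 < t" "t < 1" by auto
    have "(\<integral>x. kernel y t x \<bullet> (indicator G x *\<^sub>R gradient \<psi> x) \<partial>lborel) =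
      (\<integral>z. t ^ CARD('n) * (kernel y t ((y - t *\<^sub>R y) + t *\<^sub>R z) \<bullet>
         (indicator G ((y - t *\<^sub>R y) + t *\<^sub>R z) *\<^sub>R gradient \<psi> ((y - t *\<^sub>R y) + t *\<^sub>R z))) \<partial>lborel)"
      using t by (subst lborel_integral_affine[of _ t "y - t *\<^sub>R y"]) auto
    also have "\<dots> = (\<integral>z. Q t z \<partial>lborel)"
    proof (rule Bochner_Integration.integral_cong[OF refl])
      fix z
      define x where "x = y + t *\<^sub>R (z - y)"
      have x: "(y - t *\<^sub>R y) + t *\<^sub>R z = x" by (simp add: x_def algebra_simps)
      have "(x - y) /\<^sub>R t = z - y" using t by (simp add: x_def)
      then have k: "kernel y t x = (\<omega> (z - c y) / t ^ CARD('n)) *\<^sub>R (z - y)"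
        using t by (simp add: kernel_def x_def)
      show "t ^ CARD('n) * (kernel y t ((y - t *\<^sub>R y) + t *\<^sub>R z) \<bullet>
         (indicator G ((y - t *\<^sub>R y) + t *\<^sub>R z) *\<^sub>R gradient \<psi> ((y - t *\<^sub>R y) + t *\<^sub>R z))) = Q t z"
      proof (cases "norm (z - c y) \<le> \<rho>")
        case True
        then have "x \<in> G" using seg t by (simp add: x_def)
        then show ?thesis unfolding x k using t by (simp add: Q_def x_def)
      next
        case False
        then show ?thesis unfolding x k by (simp add: Q_def \<omega>_support)
      qed
    qed
    finally show ?thesis .
  next
    case False
    then have "kernel y t x = 0" for x by (auto simp: kernel_def)
    then show ?thesis using False by (auto simp: Q_def)
  qed
  then have "(\<integral>t. \<integral>x. kernel y t x \<bullet> (indicator G x *\<^sub>R gradient \<psi> x) \<partial>lborel \<partial>lborel) = (\<integral>t. \<integral>z. Q t z \<partial>lborel \<partial>lborel)"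
    by simp
  also have "\<dots> = (\<integral>z. \<integral>t. Q t z \<partial>lborel \<partial>lborel)"
  proof (rule lborel_pair.Fubini_integral[symmetric])
    have Qm [measurable]: "case_prod Q \<in> borel_measurable (lborel \<Otimes>\<^sub>M lborel)"
      unfolding Q_def by measurable
    show "integrable (lborel \<Otimes>\<^sub>M lborel) (case_prod Q)"
    proof (rule Bochner_Integration.integrable_bound)
      show "integrable (lborel \<Otimes>\<^sub>M lborel) (\<lambda>p. (W * (m * B)) * indicator ({0<..<1::real} \<times> cball (c y) \<rho>) p)"
        by (intro integrable_mult_right integrable_real_indicator)
          (auto simp: lborel.emeasure_pair_measure_Times cball_finite intro!: ennreal_mult_less_top[THEN iffD2])
      have "\<bar>Q t z\<bar> \<le> \<bar>(W * (m * B)) * indicator ({0<..<1::real} \<times> cball (c y) \<rho>) (t, z)\<bar>" for t z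
      proof (cases "(0 < t \<and> t < 1) \<and> norm (z - c y) \<le> \<rho>")
        case True
        have "norm (z - y) \<le> m"
          using norm_triangle_ineq[of "z - c y" "c y - y"] True centre_near[of y] by (simp add: dist_norm)
        moreover have "norm (gradient \<psi> (y + t *\<^sub>R (z - y))) \<le> B" using True by (intro B(2) seg) auto
        ultimately have "\<bar>(z - y) \<bullet> gradient \<psi> (y + t *\<^sub>R (z - y))\<bar> \<le> m * B"
          using Cauchy_Schwarz_ineq2[of "z - y" "gradient \<psi> (y + t *\<^sub>R (z - y))"] m_pos
          by (meson mult_mono norm_ge_zero order_trans less_imp_le)
        then have "\<omega> (z - c y) * \<bar>(z - y) \<bullet> gradient \<psi> (y + t *\<^sub>R (z - y))\<bar> \<le> W * (m * B)"
          using \<omega>_bounds W by (intro mult_mono) auto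
        moreover have "z \<in> cball (c y) \<rho>" using True by (simp add: dist_norm norm_minus_commute)
        ultimately show ?thesis using True \<omega>_bounds W m_pos B by (simp add: Q_def abs_mult)
      next
        case False
        then have "Q t z = 0" by (auto simp: Q_def \<omega>_support)
        then show ?thesis by simp
      qed
      then show "AE p in lborel \<Otimes>\<^sub>M lborel. norm (case p of (t, z) \<Rightarrow> Q t z)
          \<le> norm ((W * (m * B)) * indicator ({0<..<1::real} \<times> cball (c y) \<rho>) p)"
        by (auto intro!: AE_I2 simp del: abs_mult)
    qed (use Qm in simp)
  qed
  also have "\<dots> = (\<integral>z. \<omega> (z - c y) * \<psi> z - \<omega> (z - c y) * \<psi> y \<partial>lborel)"
  proof (rule Bochner_Integration.integral_cong[OF refl])
    fix z
    have "(\<integral>t. Q t z \<partial>lborel) = (\<integral>t. \<omega> (z - c y) * (if 0 < t \<and> t < 1 then (z - y) \<bullet> gradient \<psi> (y + t *\<^sub>R (z - y)) else 0) \<partial>lborel)"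
      by (intro Bochner_Integration.integral_cong) (auto simp: Q_def)
    also have "\<dots> = \<omega> (z - c y) * (\<psi> z - \<psi> y)"
      by (subst integral_mult_right_zero) (simp add: segment_integral_gradient[OF \<psi>])
    finally show "(\<integral>t. Q t z \<partial>lborel) = \<omega> (z - c y) * \<psi> z - \<omega> (z - c y) * \<psi> y"
      by (simp add: algebra_simps)
  qed
  also have "\<dots> = (\<integral>z. \<omega> (z - c y) * \<psi> z \<partial>lborel) - (\<integral>z. \<omega> (z - c y) * \<psi> y \<partial>lborel)"
  proof (rule Bochner_Integration.integral_diff)
    obtain B' where "\<And>x. x \<in> cball (c y) \<rho> \<Longrightarrow> norm (\<psi> x) \<le> B'"
      using continuous_on_bounded_imp_bound[OF bounded_cball C1_function_continuous_on[OF \<psi>]] by metis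
    then show "integrable lborel (\<lambda>z. \<omega> (z - c y) * \<psi> z)" by (intro \<omega>_integrable_mult) auto
    show "integrable lborel (\<lambda>z. \<omega> (z - c y) * \<psi> y)" by (intro \<omega>_integrable_mult) auto
  qed
  also have "(\<integral>z. \<omega> (z - c y) * \<psi> y \<partial>lborel) = \<psi> y"
    by (simp add: \<omega>_integral_centre)
  finally show ?thesis .
qed

lemma integrable_if_square:
  assumes [measurable]: "f \<in> borel_measurable borel" and "(\<integral>\<^sup>+y. ennreal ((f y)\<^sup>2) \<partial>N) < \<infinity>"
  shows "(\<integral>\<^sup>+y. ennreal \<bar>f y\<bar> \<partial>N) < \<infinity>"
proof -
  have "(\<integral>\<^sup>+y. ennreal \<bar>f y\<bar> \<partial>N) \<le> (\<integral>\<^sup>+y. 1 + ennreal ((f y)\<^sup>2) \<partial>N)"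
  proof (rule nn_integral_mono)
    fix y
    have "\<bar>f y\<bar> \<le> 1 + (f y)\<^sup>2" using sum_squares_bound[of 1 "\<bar>f y\<bar>"] by simp
    then show "ennreal \<bar>f y\<bar> \<le> 1 + ennreal ((f y)\<^sup>2)"
      by (metis ennreal_1 ennreal_leI ennreal_plus zero_le_one zero_le_power2)
  qed
  also have "\<dots> = emeasure N (space N) + (\<integral>\<^sup>+y. ennreal ((f y)\<^sup>2) \<partial>N)"
    by (subst nn_integral_add) auto
  also have "\<dots> < \<infinity>" using assms(2) by (simp add: less_top[symmetric])
  finally show ?thesis .
qed

text \<open>Fubini reduces the identity to a single source point y, that is, to
  \<open>integral_kernel_gradient\<close>. The segments must stay in G just where f does not vanish,
  which suits centres that are meaningful on the interface alone.\<close>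

lemma integral_flow_gradient:
  assumes [measurable]: "f \<in> borel_measurable borel" and f2: "(\<integral>\<^sup>+y. ennreal ((f y)\<^sup>2) \<partial>N) < \<infinity>"
    and \<psi>: "C1_function \<psi>" and G: "bounded G" "G \<in> sets borel"
    and seg: "\<And>y z t. f y \<noteq> 0 \<Longrightarrow> norm (z - c y) \<le> \<rho> \<Longrightarrow> 0 < t \<Longrightarrow> t < 1 \<Longrightarrow> y + t *\<^sub>R (z - y) \<in> G"
  shows "(\<integral>x. flow f x \<bullet> gradient \<psi> x \<partial>vol G) = (\<integral>y. f y * ((\<integral>z. \<omega> (z - c y) * \<psi> z \<partial>lborel) - \<psi> y) \<partial>N)"
proof -
  note [measurable] = gradient_borel_measurable[OF \<psi>] C1_function_borel_measurable[OF \<psi>] G(2)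
  obtain B where B: "0 < B" "\<And>x. x \<in> G \<Longrightarrow> norm (gradient \<psi> x) \<le> B"
    using continuous_on_bounded_imp_bound[OF G(1) gradient_continuous_on[OF \<psi>, of UNIV]] by blast
  define g where "g = (\<lambda>x. indicator G x *\<^sub>R gradient \<psi> x)"
  have gB: "norm (g x) \<le> B" for x using B by (auto simp: g_def indicator_def)
  have [measurable]: "g \<in> borel_measurable borel" unfolding g_def by measurable
  define F where "F = (\<lambda>x z. f (fst z) * (kernel (fst z) (snd z) x \<bullet> g x))"
  have Fm [measurable]: "case_prod F \<in> borel_measurable (lborel \<Otimes>\<^sub>M (N \<Otimes>\<^sub>M lborel))"
    unfolding F_def by measurable
  interpret P: pair_sigma_finite "lborel :: (real^'n) measure" "N \<Otimes>\<^sub>M (lborel :: real measure)" ..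
  have F_int: "integrable (lborel \<Otimes>\<^sub>M (N \<Otimes>\<^sub>M lborel)) (case_prod F)"
  proof (rule integrableI_bounded[OF Fm])
    have "(\<integral>\<^sup>+p. ennreal (norm (case_prod F p)) \<partial>(lborel \<Otimes>\<^sub>M (N \<Otimes>\<^sub>M lborel))) =
       (\<integral>\<^sup>+x. \<integral>\<^sup>+z. ennreal (norm (F x z)) \<partial>(N \<Otimes>\<^sub>M lborel) \<partial>lborel)"
      by (subst sigma_finite_measure.nn_integral_fst[symmetric, OF sigma_finite_pair_measure])
        (auto intro!: sigma_finite_lborel simp: sigma_finite_measure_axioms)
    also have "\<dots> \<le> (\<integral>\<^sup>+x. \<integral>\<^sup>+z. ennreal (W * m * B * \<bar>f (fst z)\<bar>) * ennreal (cone_weight m CARD('n) (snd z) x (fst z)) \<partial>(N \<Otimes>\<^sub>M lborel) \<partial>lborel)"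
    proof (intro nn_integral_mono)
      fix x z
      have "\<bar>kernel (fst z) (snd z) x \<bullet> g x\<bar> \<le> norm (kernel (fst z) (snd z) x) * norm (g x)"
        by (rule Cauchy_Schwarz_ineq2)
      also have "\<dots> \<le> (W * m * cone_weight m CARD('n) (snd z) x (fst z)) * B"
        using W m_pos by (intro mult_mono kernel_norm_le gB) auto
      finally have "\<bar>f (fst z)\<bar> * \<bar>kernel (fst z) (snd z) x \<bullet> g x\<bar> \<le> \<bar>f (fst z)\<bar> * ((W * m * cone_weight m CARD('n) (snd z) x (fst z)) * B)"
        by (intro mult_left_mono) auto
      then have "norm (F x z) \<le> W * m * B * \<bar>f (fst z)\<bar> * cone_weight m CARD('n) (snd z) x (fst z)"
        by (simp add: F_def abs_mult mult_ac)
      then show "ennreal (norm (F x z)) \<le> ennreal (W * m * B * \<bar>f (fst z)\<bar>) * ennreal (cone_weight m CARD('n) (snd z) x (fst z))"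
        using W m_pos B by (simp flip: ennreal_mult)
    qed
    also have "\<dots> \<le> ennreal (4 * V) * (\<integral>\<^sup>+y. ennreal (W * m * B * \<bar>f y\<bar>) \<partial>N)"
      by (rule nn_integral_weighted_cone) auto
    also have "(\<integral>\<^sup>+y. ennreal (W * m * B * \<bar>f y\<bar>) \<partial>N) = ennreal (W * m * B) * (\<integral>\<^sup>+y. ennreal \<bar>f y\<bar> \<partial>N)"
      using W m_pos B by (subst nn_integral_cmult[symmetric]) (auto simp: ennreal_mult)
    also have "ennreal (4 * V) * (ennreal (W * m * B) * (\<integral>\<^sup>+y. ennreal \<bar>f y\<bar> \<partial>N)) < \<infinity>"
      using integrable_if_square[OF assms(1) f2] by (simp add: ennreal_mult_less_top)
    finally show "(\<integral>\<^sup>+p. ennreal (norm (case_prod F p)) \<partial>(lborel \<Otimes>\<^sub>M (N \<Otimes>\<^sub>M lborel))) < \<infinity>" .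
  qed
  \<comment> \<open>Where the majorant is infinite, the Bochner integral in \<open>flow\<close> may
    take its default value 0. Exchanging it with the inner product is therefore justified almost
    everywhere.\<close>
  have fin: "AE x in lborel. majorant f x < \<infinity>"
  proof -
    have "(\<integral>\<^sup>+x. (majorant f x)\<^sup>2 \<partial>lborel) \<noteq> \<infinity>"
      using nn_integral_majorant_square[OF assms(1)] f2
      by (metis ennreal_mult_less_top ennreal_less_top infinity_ennreal_def order.strict_trans1 less_irrefl)
    then have "AE x in lborel. (majorant f x)\<^sup>2 \<noteq> \<infinity>"
      by (intro nn_integral_PInf_AE) auto
    then show ?thesis
      by eventually_elim (auto simp: less_top[symmetric] power2_eq_square)
  qed
  have "(\<integral>x. flow f x \<bullet> gradient \<psi> x \<partial>vol G) = (\<integral>x. flow f x \<bullet> g x \<partial>lborel)"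
    using G(2) by (simp add: integral_restrict_space g_def)
  also have "\<dots> = (\<integral>x. \<integral>z. F x z \<partial>(N \<Otimes>\<^sub>M lborel) \<partial>lborel)"
  proof (rule integral_cong_AE)
    show "AE x in lborel. flow f x \<bullet> g x = (\<integral>z. F x z \<partial>(N \<Otimes>\<^sub>M lborel))"
      using fin
    proof eventually_elim
      case (elim x)
      have "(\<integral>z. F x z \<partial>(N \<Otimes>\<^sub>M lborel)) = (\<integral>z. (case z of (y, t) \<Rightarrow> f y *\<^sub>R kernel y t x) \<bullet> g x \<partial>(N \<Otimes>\<^sub>M lborel))"
        by (intro Bochner_Integration.integral_cong) (auto simp: F_def)
      also have "\<dots> = flow f x \<bullet> g x"
        unfolding flow_def by (intro integral_inner_left flow_integrable assms elim)
      finally show ?case by simp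
    qed
  qed measurable
  also have "\<dots> = (\<integral>z. \<integral>x. F x z \<partial>lborel \<partial>(N \<Otimes>\<^sub>M lborel))"
    by (rule P.Fubini_integral[symmetric, OF F_int])
  also have "\<dots> = (\<integral>y. \<integral>t. \<integral>x. F x (y, t) \<partial>lborel \<partial>lborel \<partial>N)"
    using U.integral_fst'[OF P.integrable_snd[OF F_int]] by simp
  also have "\<dots> = (\<integral>y. f y * ((\<integral>z. \<omega> (z - c y) * \<psi> z \<partial>lborel) - \<psi> y) \<partial>N)"
  proof (rule Bochner_Integration.integral_cong[OF refl])
    fix y
    show "(\<integral>t. \<integral>x. F x (y, t) \<partial>lborel \<partial>lborel) = f y * ((\<integral>z. \<omega> (z - c y) * \<psi> z \<partial>lborel) - \<psi> y)"
    proof (cases "f y = 0")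
      case False
      have "(\<integral>t. \<integral>x. F x (y, t) \<partial>lborel \<partial>lborel) = f y * (\<integral>t. \<integral>x. kernel y t x \<bullet> (indicator G x *\<^sub>R gradient \<psi> x) \<partial>lborel \<partial>lborel)"
        by (simp add: F_def g_def)
      also have "\<dots> = f y * ((\<integral>z. \<omega> (z - c y) * \<psi> z \<partial>lborel) - \<psi> y)"
        by (subst integral_kernel_gradient[OF \<psi> G seg[OF False]]) auto
      finally show ?thesis .
    qed (simp add: F_def)
  qed
  finally show ?thesis .
qed

lemma sink_measurable [measurable]:
  assumes [measurable]: "f \<in> borel_measurable borel"
  shows "sink f \<in> borel_measurable borel"
  unfolding sink_def by measurable

text \<open>Fubini again; where f does not vanish the bump lies in G, so restricting to G loses no
  mass.\<close>

lemma sink_integral: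
  assumes [measurable]: "f \<in> borel_measurable borel" and f2: "(\<integral>\<^sup>+y. ennreal ((f y)\<^sup>2) \<partial>N) < \<infinity>"
    and \<psi>: "C1_function \<psi>" and G: "bounded G" "G \<in> sets borel"
    and ball: "\<And>y z. f y \<noteq> 0 \<Longrightarrow> norm (z - c y) \<le> \<rho> \<Longrightarrow> z \<in> G"
  shows "(\<integral>x. sink f x * \<psi> x \<partial>vol G) = (\<integral>y. f y * (\<integral>z. \<omega> (z - c y) * \<psi> z \<partial>lborel) \<partial>N)"
    and "integrable (vol G) (\<lambda>x. sink f x * \<psi> x)"
    and "integrable N (\<lambda>y. f y * (\<integral>z. \<omega> (z - c y) * \<psi> z \<partial>lborel))"
proof -
  note [measurable] = C1_function_borel_measurable[OF \<psi>] G(2)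
  obtain B where B: "0 < B" "\<And>x. x \<in> G \<Longrightarrow> norm (\<psi> x) \<le> B"
    using continuous_on_bounded_imp_bound[OF G(1) C1_function_continuous_on[OF \<psi>, of UNIV]] by blast
  define g where "g = (\<lambda>x. indicator G x * \<psi> x)"
  have gB: "\<bar>g x\<bar> \<le> B * indicator G x" for x using B by (auto simp: g_def indicator_def)
  have [measurable]: "g \<in> borel_measurable borel" unfolding g_def by measurable
  define F where "F = (\<lambda>x y. (f y * \<omega> (x - c y)) * g x)"
  have Fm [measurable]: "case_prod F \<in> borel_measurable (lborel \<Otimes>\<^sub>M N)"
    unfolding F_def by measurable
  interpret P: pair_sigma_finite "lborel :: (real^'n) measure" N ..
  have F_int: "integrable (lborel \<Otimes>\<^sub>M N) (case_prod F)"
  proof (rule integrableI_bounded[OF Fm])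
    have "(\<integral>\<^sup>+p. ennreal (norm (case_prod F p)) \<partial>(lborel \<Otimes>\<^sub>M N)) = (\<integral>\<^sup>+x. \<integral>\<^sup>+y. ennreal (norm (F x y)) \<partial>N \<partial>lborel)"
      by (subst nn_integral_fst[symmetric]) auto
    also have "\<dots> \<le> (\<integral>\<^sup>+x. \<integral>\<^sup>+y. ennreal (W * B * indicator G x) * ennreal \<bar>f y\<bar> \<partial>N \<partial>lborel)"
    proof (intro nn_integral_mono)
      fix x y
      have "\<bar>f y\<bar> * (\<bar>\<omega> (x - c y)\<bar> * \<bar>g x\<bar>) \<le> \<bar>f y\<bar> * (W * (B * indicator G x))"
        using \<omega>_bounds W by (intro mult_left_mono mult_mono gB) auto
      then have "norm (F x y) \<le> W * B * indicator G x * \<bar>f y\<bar>"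
        by (simp add: F_def abs_mult mult_ac)
      then show "ennreal (norm (F x y)) \<le> ennreal (W * B * indicator G x) * ennreal \<bar>f y\<bar>"
        using W B by (simp flip: ennreal_mult)
    qed
    also have "\<dots> = (\<integral>\<^sup>+x. ennreal (W * B) * indicator G x \<partial>lborel) * (\<integral>\<^sup>+y. ennreal \<bar>f y\<bar> \<partial>N)"
      using W B by (simp add: nn_integral_cmult nn_integral_multc ennreal_mult ennreal_indicator)
    also have "(\<integral>\<^sup>+x. ennreal (W * B) * indicator G x \<partial>lborel) = ennreal (W * B) * emeasure lborel G"
      by (rule nn_integral_cmult_indicator) simp
    also have "ennreal (W * B) * emeasure lborel G * (\<integral>\<^sup>+y. ennreal \<bar>f y\<bar> \<partial>N) < \<infinity>"
      using integrable_if_square[OF assms(1) f2] emeasure_bounded_finite[OF G(1)] by (simp add: ennreal_mult_less_top)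
    finally show "(\<integral>\<^sup>+p. ennreal (norm (case_prod F p)) \<partial>(lborel \<Otimes>\<^sub>M N)) < \<infinity>" .
  qed
  have i1: "(\<integral>y. F x y \<partial>N) = indicator G x *\<^sub>R (sink f x * \<psi> x)" for x
    unfolding F_def sink_def by (subst integral_mult_left_zero) (simp add: g_def)
  have i2: "(\<integral>x. F x y \<partial>lborel) = f y * (\<integral>z. \<omega> (z - c y) * \<psi> z \<partial>lborel)" for y
  proof (cases "f y = 0")
    case False
    have "(\<integral>x. F x y \<partial>lborel) = (\<integral>x. f y * (\<omega> (x - c y) * \<psi> x) \<partial>lborel)"
      using ball[OF False] \<omega>_support
      by (intro Bochner_Integration.integral_cong) (auto simp: F_def g_def indicator_def not_le[symmetric])
    then show ?thesis by simp
  qed (simp add: F_def)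
  show "integrable (vol G) (\<lambda>x. sink f x * \<psi> x)"
    using P.integrable_fst[OF F_int] G(2) unfolding i1 by (simp add: integrable_restrict_space)
  show "integrable N (\<lambda>y. f y * (\<integral>z. \<omega> (z - c y) * \<psi> z \<partial>lborel))"
    using P.integrable_snd[OF F_int] unfolding i2 by simp
  have "(\<integral>x. sink f x * \<psi> x \<partial>vol G) = (\<integral>x. \<integral>y. F x y \<partial>N \<partial>lborel)"
    using G(2) unfolding i1 by (simp add: integral_restrict_space)
  also have "\<dots> = (\<integral>y. \<integral>x. F x y \<partial>lborel \<partial>N)" by (rule P.Fubini_integral[symmetric, OF F_int])
  finally show "(\<integral>x. sink f x * \<psi> x \<partial>vol G) = (\<integral>y. f y * (\<integral>z. \<omega> (z - c y) * \<psi> z \<partial>lborel) \<partial>N)"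
    unfolding i2 .
qed

text \<open>Cauchy-Schwarz in N, with \<omega> bounded by W and N finite. The bound is uniform in x
  and thus gives a square norm bound on every bounded set.\<close>

lemma sink_bound:
  assumes [measurable]: "f \<in> borel_measurable borel" and f2: "(\<integral>\<^sup>+y. ennreal ((f y)\<^sup>2) \<partial>N) < \<infinity>"
  shows "(sink f x)\<^sup>2 \<le> W\<^sup>2 * measure N UNIV * (\<integral>y. (f y)\<^sup>2 \<partial>N)"
proof -
  have fL: "f \<in> L2_space N"
    unfolding L2_space_def using f2 by (auto intro!: integrableI_bounded)
  have gL: "(\<lambda>y. \<omega> (x - c y)) \<in> L2_space N"
    using \<omega>_bounds by (intro L2_space_bounded[where B = W]) (auto simp: less_top[symmetric])
  have "\<bar>sink f x\<bar> \<le> L2_norm N f * L2_norm N (\<lambda>y. \<omega> (x - c y))"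
    using L2_Cauchy_Schwarz[OF fL gL] by (simp add: sink_def L2_inner_def)
  then have "(sink f x)\<^sup>2 \<le> (L2_norm N f * L2_norm N (\<lambda>y. \<omega> (x - c y)))\<^sup>2"
    by (metis abs_ge_zero power2_abs power_mono)
  also have "\<dots> = (\<integral>y. (f y)\<^sup>2 \<partial>N) * (\<integral>y. (\<omega> (x - c y))\<^sup>2 \<partial>N)"
    by (simp add: power_mult_distrib L2_norm_power2)
  also have "\<dots> \<le> (\<integral>y. (f y)\<^sup>2 \<partial>N) * (\<integral>y. W\<^sup>2 \<partial>N)"
  proof (intro mult_left_mono integral_mono)
    show "integrable N (\<lambda>y. (\<omega> (x - c y))\<^sup>2)"
      using L2_space_integrable_square[OF gL] by simp
    show "(\<omega> (x - c y))\<^sup>2 \<le> W\<^sup>2" for y using \<omega>_bounds by (intro power_mono) auto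
  qed auto
  also have "(\<integral>y. W\<^sup>2 \<partial>N) = W\<^sup>2 * measure N UNIV"
    using sets_eq_imp_space_eq[OF sets_N] by simp
  finally show ?thesis by (simp add: mult_ac)
qed

end

section \<open>Lifting of interface data\<close>

text \<open>Flat polytopes are null sets, so the part of G outside the closed union of the solid
  ones is open and negligible, hence empty. The solid pieces have room for the balls of
  \<open>interface_centres\<close>.\<close>

lemma polyhedral_domain_solid_cover:
  fixes G :: "'a::euclidean_space set"
  assumes "polyhedral_domain G"
  obtains \<P> where "finite \<P>" "\<And>P. P \<in> \<P> \<Longrightarrow> polytope P \<and> interior P \<noteq> {} \<and> interior P \<subseteq> G" "closure G = \<Union>\<P>"
proof -
  obtain \<P> where P: "finite \<P>" "\<forall>P\<in>\<P>. polytope P" "closure G = \<Union>\<P>" and G: "G = interior (closure G)" "open G"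
    using assms unfolding polyhedral_domain_def by blast
  define \<Q> where "\<Q> = {P \<in> \<P>. interior P \<noteq> {}}"
  have cl: "closed (\<Union>\<Q>)"
    using P by (intro closed_Union) (auto simp: \<Q>_def polytope_imp_closed)
  have "negligible (G - \<Union>\<Q>)"
  proof (rule negligible_subset)
    show "negligible (\<Union>(\<P> - \<Q>))"
    proof (rule negligible_Union)
      fix Q assume Q: "Q \<in> \<P> - \<Q>"
      then have "Q \<subseteq> frontier Q"
        using P(2) closure_subset by (auto simp: \<Q>_def frontier_def)
      then show "negligible Q"
        using negligible_convex_frontier[of Q] polytope_imp_convex P(2) Q negligible_subset by blast
    qed (use P in auto)
    have "G \<subseteq> \<Union>\<P>" using closure_subset[of G] unfolding P(3) .
    then show "G - \<Union>\<Q> \<subseteq> \<Union>(\<P> - \<Q>)" by blast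
  qed
  moreover have "open (G - \<Union>\<Q>)" using G(2) cl by (rule open_Diff)
  ultimately have "G - \<Union>\<Q> = {}" using open_not_negligible by blast
  then have "closure G \<subseteq> \<Union>\<Q>" using cl by (intro closure_minimal) auto
  moreover have "\<Union>\<Q> \<subseteq> closure G" unfolding P(3) by (auto simp: \<Q>_def)
  ultimately have eq: "closure G = \<Union>\<Q>" by blast
  show ?thesis
  proof (rule that)
    show "finite \<Q>" using P(1) by (simp add: \<Q>_def)
    show "closure G = \<Union>\<Q>" by (rule eq)
    fix Q assume Q: "Q \<in> \<Q>"
    then have "interior Q \<subseteq> interior (closure G)" unfolding eq by (intro interior_mono) auto
    then have "interior Q \<subseteq> G" using G(1) by simp
    then show "polytope Q \<and> interior Q \<noteq> {} \<and> interior Q \<subseteq> G"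
      using Q P(2) by (simp add: \<Q>_def)
  qed
qed

text \<open>A measurable choice of a set that contains y: each newly inserted index takes precedence
  on its closed set. It makes the centre maps below Borel measurable.\<close>

lemma finite_closed_cover_selection:
  fixes A :: "'i \<Rightarrow> 'a::topological_space set"
  assumes "finite I" "\<And>k. k \<in> I \<Longrightarrow> closed (A k)"
  obtains \<kappa> where "\<kappa> \<in> borel \<rightarrow>\<^sub>M count_space UNIV" "\<And>y. y \<in> (\<Union>k\<in>I. A k) \<Longrightarrow> \<kappa> y \<in> I \<and> y \<in> A (\<kappa> y)"
proof -
  have "\<exists>\<kappa>. \<kappa> \<in> borel \<rightarrow>\<^sub>M count_space UNIV \<and> (\<forall>y\<in>(\<Union>k\<in>I. A k). \<kappa> y \<in> I \<and> y \<in> A (\<kappa> y))"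
    using assms
  proof (induction I rule: finite_induct)
    case empty
    show ?case by (intro exI[of _ "\<lambda>y. undefined"]) auto
  next
    case (insert k I)
    obtain \<kappa> where [measurable]: "\<kappa> \<in> borel \<rightarrow>\<^sub>M count_space UNIV"
      and \<kappa>: "\<forall>y\<in>(\<Union>k\<in>I. A k). \<kappa> y \<in> I \<and> y \<in> A (\<kappa> y)"
      using insert by auto
    have [measurable]: "A k \<in> sets borel" using insert.prems by (intro borel_closed) auto
    have "(\<lambda>y. if y \<in> A k then k else \<kappa> y) \<in> borel \<rightarrow>\<^sub>M count_space UNIV" by measurable
    then show ?case using \<kappa> by (intro exI[of _ "\<lambda>y. if y \<in> A k then k else \<kappa> y"]) auto
  qed
  then show ?thesis using that by blast
qed

text \<open>The tent \<open>max 0 (\<rho> - norm z)\<close>, scaled to mass 1. Lipschitz continuity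
  is all the smoothness that the kernel estimates use.\<close>

lemma tent_function:
  assumes "0 < \<rho>"
  obtains \<omega> :: "'a::euclidean_space \<Rightarrow> real" and W L where
    "\<omega> \<in> borel_measurable borel" "\<And>z. 0 \<le> \<omega> z" "\<And>z. \<omega> z \<le> W" "0 < W" "0 \<le> L"
    "\<And>z z'. \<bar>\<omega> z - \<omega> z'\<bar> \<le> L * dist z z'" "\<And>z. \<rho> < norm z \<Longrightarrow> \<omega> z = 0" "(\<integral>z. \<omega> z \<partial>lborel) = 1"
proof -
  define T where "T = (\<lambda>z :: 'a. max 0 (\<rho> - norm z))"
  have T_meas [measurable]: "T \<in> borel_measurable borel" unfolding T_def by measurable
  have T_int: "integrable lborel T"
  proof (rule Bochner_Integration.integrable_bound)
    show "integrable lborel (\<lambda>z. \<rho> * indicator (cball (0::'a) \<rho>) z)"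
      using emeasure_bounded_finite[of "cball (0::'a) \<rho>"]
      by (intro integrable_mult_right integrable_real_indicator) auto
    show "AE z in lborel. norm (T z) \<le> norm (\<rho> * indicator (cball 0 \<rho>) z)"
      using assms by (auto simp: T_def indicator_def)
  qed measurable
  have "0 < (\<integral>z. T z \<partial>lborel)"
  proof -
    have "0 < \<rho> / 2 * measure lborel (cball (0::'a) (\<rho> / 2))"
      using assms by (simp add: content_cball)
    also have "\<dots> = (\<integral>z. \<rho> / 2 * indicator (cball (0::'a) (\<rho> / 2)) z \<partial>lborel)" by simp
    also have "\<dots> \<le> (\<integral>z. T z \<partial>lborel)"
    proof (rule integral_mono)
      show "integrable lborel (\<lambda>z. \<rho> / 2 * indicator (cball (0::'a) (\<rho> / 2)) z)"
        using emeasure_bounded_finite[of "cball (0::'a) (\<rho> / 2)"]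
        by (intro integrable_mult_right integrable_real_indicator) auto
    qed (use T_int in \<open>auto simp: T_def indicator_def max_def\<close>)
    finally show ?thesis .
  qed
  then obtain a where a: "0 < a" "a * (\<integral>z. T z \<partial>lborel) = 1"
    by (metis divide_pos_pos nonzero_eq_divide_eq less_irrefl zero_less_one)
  show ?thesis
  proof (rule that[of "\<lambda>z. a * T z" "a * \<rho>" a])
    fix z z'
    have "\<bar>T z - T z'\<bar> \<le> norm (z - z')"
      using norm_triangle_ineq3[of z z'] by (auto simp: T_def max_def)
    then show "\<bar>a * T z - a * T z'\<bar> \<le> a * dist z z'"
      using a(1) by (simp add: dist_norm abs_mult flip: right_diff_distrib)
  qed (use a assms in \<open>auto simp: T_def\<close>)
qed

lemma L2_space_restrict:
  assumes "f \<in> L2_space M" "G \<inter> space M \<in> sets M"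
  shows "f \<in> L2_space (restrict_space M G)"
proof -
  have "integrable M (\<lambda>x. indicator (G \<inter> space M) x *\<^sub>R (norm (f x))\<^sup>2)"
    by (rule integrable_mult_indicator[OF assms(2) L2_space_integrable_square[OF assms(1)]])
  moreover have "integrable M (\<lambda>x. indicator (G \<inter> space M) x *\<^sub>R (norm (f x))\<^sup>2)
     \<longleftrightarrow> integrable M (\<lambda>x. indicator G x *\<^sub>R (norm (f x))\<^sup>2)"
    by (intro Bochner_Integration.integrable_cong) (auto simp: indicator_def)
  ultimately show ?thesis
    using assms by (auto simp: L2_space_def integrable_restrict_space intro: measurable_restrict_space1)
qed

lemma L2_norm_restrict_le:
  assumes "f \<in> L2_space M" "G \<inter> space M \<in> sets M"
  shows "(L2_norm (restrict_space M G) f)\<^sup>2 \<le> (L2_norm M f)\<^sup>2"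
  unfolding L2_norm_power2 integral_restrict_space[OF assms(2)]
proof (rule integral_mono)
  show "integrable M (\<lambda>x. indicator G x *\<^sub>R (norm (f x))\<^sup>2)"
    using L2_space_integrable_square[OF L2_space_restrict[OF assms]] assms(2)
    by (simp add: integrable_restrict_space)
qed (use L2_space_integrable_square[OF assms(1)] in \<open>auto simp: indicator_def\<close>)

text \<open>Nothing flows through a point that no segment meets. This keeps the flow towards the
  neighbours out of the subdomain itself.\<close>

lemma (in segment_flow) flow_eq_0:
  assumes "\<And>y z t. f y \<noteq> 0 \<Longrightarrow> norm (z - c y) \<le> \<rho> \<Longrightarrow> 0 < t \<Longrightarrow> t < 1 \<Longrightarrow> y + t *\<^sub>R (z - y) \<noteq> x"
  shows "flow f x = 0"
proof -
  have "f y *\<^sub>R kernel y t x = 0" for y t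
  proof (cases "f y = 0 \<or> \<not> (0 < t \<and> t < 1)")
    case False
    define z where "z = y + (x - y) /\<^sub>R t"
    have "y + t *\<^sub>R (z - y) = x" using False by (simp add: z_def)
    then have "\<rho> < norm (z - c y)" using assms[of y z t] False by force
    then show ?thesis by (simp add: kernel_def \<omega>_support z_def)
  qed (auto simp: kernel_def)
  then have zero: "(\<lambda>(y, t). f y *\<^sub>R kernel y t x) = (\<lambda>p. 0)" by (auto simp: fun_eq_iff)
  show ?thesis unfolding flow_def zero by simp
qed

lemma (in segment_flow) flow_L2_space:
  assumes [measurable]: "f \<in> borel_measurable borel" and f2: "integrable N (\<lambda>y. (f y)\<^sup>2)"
  shows "flow f \<in> L2_space lborel" "(L2_norm lborel (flow f))\<^sup>2 \<le> A\<^sup>2 * C\<^sub>S * (\<integral>y. (f y)\<^sup>2 \<partial>N)"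
proof -
  have e: "(\<integral>\<^sup>+y. ennreal ((f y)\<^sup>2) \<partial>N) = ennreal (\<integral>y. (f y)\<^sup>2 \<partial>N)"
    by (rule nn_integral_eq_integral[OF f2]) auto
  have le: "(\<integral>\<^sup>+x. ennreal ((norm (flow f x))\<^sup>2) \<partial>lborel) \<le> ennreal (A\<^sup>2 * C\<^sub>S * (\<integral>y. (f y)\<^sup>2 \<partial>N))"
    using nn_integral_flow_square[OF assms(1)] CS_nonneg unfolding e
    by (simp add: ennreal_mult')
  have i: "integrable lborel (\<lambda>x. (norm (flow f x))\<^sup>2)"
    by (rule integrableI_bounded) (use le in \<open>auto intro: order.strict_trans1\<close>)
  then show "flow f \<in> L2_space lborel" by (auto simp: L2_space_def)
  have "ennreal ((L2_norm lborel (flow f))\<^sup>2) \<le> ennreal (A\<^sup>2 * C\<^sub>S * (\<integral>y. (f y)\<^sup>2 \<partial>N))"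
    using le nn_integral_eq_integral[OF i] by (simp add: L2_norm_power2)
  then show "(L2_norm lborel (flow f))\<^sup>2 \<le> A\<^sup>2 * C\<^sub>S * (\<integral>y. (f y)\<^sup>2 \<partial>N)"
    by (subst (asm) ennreal_le_iff) (auto intro!: mult_nonneg_nonneg CS_nonneg)
qed


lemma segment_in_interior:
  fixes y z :: "'a::euclidean_space"
  assumes "convex P" "y \<in> P" "z \<in> interior P" "0 < t" "t \<le> 1"
  shows "y + t *\<^sub>R (z - y) \<in> interior P"
proof -
  have "y - t *\<^sub>R (y - z) \<in> interior P"
    using assms closure_subset by (intro mem_interior_closure_convex_shrink) auto
  then show ?thesis by (simp add: algebra_simps)
qed

text \<open>
  To every point of the interface of subdomain \<open>i\<close> we assign the centre of a ball in subdomain \<open>i\<close>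
  and the centre of a ball in a neighbouring subdomain. Convexity of the polytopes that make up the
  subdomains keeps the segments from the point to the balls inside the subdomains.
\<close>

lemma interface_centres:
  fixes g :: "'n::finite geometry"
  assumes g: "valid_geometry g" and i: "i \<in> {1..num_sub g}"
  obtains c\<^sub>1 c\<^sub>2 :: "real^'n \<Rightarrow> real^'n" and \<rho> m where
    "c\<^sub>1 \<in> borel_measurable borel" "c\<^sub>2 \<in> borel_measurable borel" "0 < \<rho>"
    "\<And>y. dist (c\<^sub>1 y) y + \<rho> \<le> m" "\<And>y. dist (c\<^sub>2 y) y + \<rho> \<le> m"
    "\<And>y z t. y \<in> Gamma_sub g i \<Longrightarrow> norm (z - c\<^sub>1 y) \<le> \<rho> \<Longrightarrow> 0 < t \<Longrightarrow> t \<le> 1 \<Longrightarrow>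
       y + t *\<^sub>R (z - y) \<in> subdomain g i"
    "\<And>y z t. y \<in> Gamma_sub g i \<Longrightarrow> norm (z - c\<^sub>2 y) \<le> \<rho> \<Longrightarrow> 0 < t \<Longrightarrow> t \<le> 1 \<Longrightarrow>
       \<exists>j\<in>{1..num_sub g} - {i}. y + t *\<^sub>R (z - y) \<in> subdomain g j"
proof -
  let ?J = "{1..num_sub g}"
  have poly: "polyhedral_domain (subdomain g j)" if "j \<in> ?J" for j
    using g that by (simp add: valid_geometry_def)
  have "\<exists>\<P>. finite \<P> \<and> (\<forall>P\<in>\<P>. polytope P \<and> interior P \<noteq> {} \<and> interior P \<subseteq> subdomain g j) \<and>
      closure (subdomain g j) = \<Union>\<P>" if "j \<in> ?J" for j
    using polyhedral_domain_solid_cover[OF poly[OF that]] by metis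
  then obtain \<P> where P: "\<And>j. j \<in> ?J \<Longrightarrow> finite (\<P> j)"
    "\<And>j P. j \<in> ?J \<Longrightarrow> P \<in> \<P> j \<Longrightarrow> polytope P \<and> interior P \<noteq> {} \<and> interior P \<subseteq> subdomain g j"
    "\<And>j. j \<in> ?J \<Longrightarrow> closure (subdomain g j) = \<Union>(\<P> j)"
    by metis
  define \<A> where "\<A> = (\<Union>j\<in>?J. \<P> j)"
  have finA: "finite \<A>" using P(1) by (auto simp: \<A>_def)
  have PA: "polytope P \<and> interior P \<noteq> {}" if "P \<in> \<A>" for P
    using that P(2) unfolding \<A>_def by (metis UN_E)
  have inA: "P \<in> \<A>" if "P \<in> \<P> j" "j \<in> ?J" for P j using that by (auto simp: \<A>_def)
  have "\<exists>z r. 0 < r \<and> cball z r \<subseteq> interior P" if P\<A>: "P \<in> \<A>" for P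
  proof -
    obtain z where "z \<in> interior P" using PA[OF P\<A>] by blast
    then show ?thesis using open_contains_cball[of "interior P"] open_interior by blast
  qed
  then obtain zc rr where zr: "\<And>P. P \<in> \<A> \<Longrightarrow> 0 < rr P \<and> cball (zc P) (rr P) \<subseteq> interior P"
    by metis
  \<comment> \<open>One radius that fits all of the finitely many polytopes; inserting 1 keeps
    \<open>Min\<close> away from the empty set.\<close>
  define \<rho> where "\<rho> = Min (insert 1 (rr ` \<A>))"
  have \<rho>: "0 < \<rho>" using finA zr by (auto simp: \<rho>_def)
  have \<rho>_le: "\<rho> \<le> rr P" if "P \<in> \<A>" for P using finA that by (auto simp: \<rho>_def)
  \<comment> \<open>An index (j, P, P') pairs a piece P of subdomain i with a piece P' of a
    neighbour j. The intersections of such pairs are closed and cover the interface, so a measurable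
    selection yields one piece on either side of each point.\<close>
  define I where "I = (SIGMA j:?J - {i}. \<P> i \<times> \<P> j)"
  have finI: "finite I" using P(1) i by (auto simp: I_def)
  define A where "A = (\<lambda>(j :: nat, P, P' :: (real^'n) set). P \<inter> P')"
  have "closed (A k)" if "k \<in> I" for k
  proof -
    obtain j P P' where k: "k = (j, P, P')" by (metis prod_cases3)
    then have "P \<in> \<A>" "P' \<in> \<A>" using that i inA by (auto simp: I_def)
    then have "closed P" "closed P'" using PA polytope_imp_closed by blast+
    then show ?thesis by (simp add: k A_def closed_Int)
  qed
  then obtain \<kappa> where \<kappa> [measurable]: "\<kappa> \<in> borel \<rightarrow>\<^sub>M count_space UNIV"
    and \<kappa>A: "\<And>y. y \<in> (\<Union>k\<in>I. A k) \<Longrightarrow> \<kappa> y \<in> I \<and> y \<in> A (\<kappa> y)"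
    using finite_closed_cover_selection[OF finI] by metis
  let ?S = "Gamma_sub g i"
  have Scl: "closed ?S"
    unfolding Gamma_sub_def Gamma_all_def interface_def by (intro closed_Int closed_UN closed_Int) auto
  have [measurable]: "?S \<in> sets borel" using Scl by (rule borel_closed)
  have cover: "?S \<subseteq> (\<Union>k\<in>I. A k)"
  proof
    fix y assume y: "y \<in> ?S"
    then obtain a b where ab: "a \<in> ?J" "b \<in> ?J - {a}" "y \<in> frontier (subdomain g a)" "y \<in> frontier (subdomain g b)"
      and yi: "y \<in> frontier (subdomain g i)"
      unfolding Gamma_sub_def Gamma_all_def interface_def by blast
    \<comment> \<open>y lies on the frontiers of two different subdomains, and at least one of these
      is not i.\<close>
    then obtain j where j: "j \<in> ?J - {i}" "y \<in> frontier (subdomain g j)" by (metis DiffI DiffD1 DiffD2 singletonD singletonI)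
    have "y \<in> closure (subdomain g i)" "y \<in> closure (subdomain g j)"
      using yi j(2) by (auto simp: frontier_def)
    then obtain P P' where "P \<in> \<P> i" "y \<in> P" "P' \<in> \<P> j" "y \<in> P'"
      using P(3) i j(1) by blast
    then show "y \<in> (\<Union>k\<in>I. A k)"
      using j(1) by (intro UN_I[of "(j, P, P')"]) (auto simp: I_def A_def)
  qed
  \<comment> \<open>Off the interface the centre is y itself, merely so that the distance bound
    holds for every y; the data to be lifted vanish there.\<close>
  define c\<^sub>1 c\<^sub>2 where "c\<^sub>1 = (\<lambda>y. if y \<in> ?S then zc (fst (snd (\<kappa> y))) else y)"
    and "c\<^sub>2 = (\<lambda>y. if y \<in> ?S then zc (snd (snd (\<kappa> y))) else y)"
  have sel: "\<exists>j P P'. j \<in> ?J - {i} \<and> P \<in> \<P> i \<and> P' \<in> \<P> j \<and> y \<in> P \<and> y \<in> P' \<and> c\<^sub>1 y = zc P \<and> c\<^sub>2 y = zc P'"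
    if "y \<in> ?S" for y
  proof -
    obtain j P P' where k: "\<kappa> y = (j, P, P')" by (metis prod_cases3)
    have "\<kappa> y \<in> I" "y \<in> A (\<kappa> y)" using \<kappa>A[OF subsetD[OF cover that]] by auto
    then show ?thesis using that
      by (intro exI[of _ j] exI[of _ P] exI[of _ P']) (auto simp: k I_def A_def c\<^sub>1_def c\<^sub>2_def)
  qed
  have seg: "y + t *\<^sub>R (z - y) \<in> subdomain g j"
    if "P \<in> \<P> j" "j \<in> ?J" "y \<in> P" "norm (z - zc P) \<le> \<rho>" "0 < t" "t \<le> 1" for P j y z t
  proof -
    have "z \<in> cball (zc P) (rr P)"
      using that(4) \<rho>_le[OF inA[OF that(1,2)]] by (simp add: dist_norm norm_minus_commute)
    then have "z \<in> interior P" using zr[OF inA[OF that(1,2)]] by auto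
    then have "y + t *\<^sub>R (z - y) \<in> interior P"
      using that P(2)[OF that(2,1)] by (intro segment_in_interior) (auto simp: polytope_imp_convex)
    then show ?thesis using P(2)[OF that(2,1)] by auto
  qed
  have "bounded (\<Union>\<A>)"
    using finA PA by (intro bounded_Union) (auto intro!: polytope_imp_bounded)
  then obtain M where M: "0 < M" "\<And>x. x \<in> \<Union>\<A> \<Longrightarrow> norm x \<le> M" unfolding bounded_pos by auto
  have near: "dist (zc P) y + \<rho> \<le> 2 * M + \<rho>" if "P \<in> \<A>" "y \<in> P" for P y
  proof -
    have "zc P \<in> cball (zc P) (rr P)" using zr[OF that(1)] by simp
    then have "zc P \<in> P" using zr[OF that(1)] interior_subset by blast
    then have "norm (zc P) \<le> M" "norm y \<le> M" using that by (auto intro!: M(2))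
    then show ?thesis using norm_triangle_ineq4[of "zc P" y] by (simp add: dist_norm)
  qed
  show ?thesis
  proof (rule that[of c\<^sub>1 c\<^sub>2 \<rho> "2 * M + \<rho>"])
    have "(\<lambda>y. zc (fst (snd (\<kappa> y)))) \<in> borel_measurable borel" "(\<lambda>y. zc (snd (snd (\<kappa> y)))) \<in> borel_measurable borel"
      by (rule measurable_compose[OF \<kappa>], simp)+
    then show "c\<^sub>1 \<in> borel_measurable borel" "c\<^sub>2 \<in> borel_measurable borel"
      unfolding c\<^sub>1_def c\<^sub>2_def by measurable
    show "0 < \<rho>" by (rule \<rho>)
    show "dist (c\<^sub>1 y) y + \<rho> \<le> 2 * M + \<rho>" for y
    proof (cases "y \<in> ?S")
      case True
      then obtain P where "P \<in> \<P> i" "y \<in> P" "c\<^sub>1 y = zc P" using sel by metis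
      then show ?thesis using near[of P y] inA i by auto
    qed (use M in \<open>simp add: c\<^sub>1_def\<close>)
    show "dist (c\<^sub>2 y) y + \<rho> \<le> 2 * M + \<rho>" for y
    proof (cases "y \<in> ?S")
      case True
      then obtain j P where "j \<in> ?J" "P \<in> \<P> j" "y \<in> P" "c\<^sub>2 y = zc P" using sel by (metis DiffD1)
      then show ?thesis using near[of P y] inA by auto
    qed (use M in \<open>simp add: c\<^sub>2_def\<close>)
  next
    fix y z t assume y: "y \<in> ?S" and z: "norm (z - c\<^sub>1 y) \<le> \<rho>" and t: "0 < t" "t \<le> (1::real)"
    obtain P where "P \<in> \<P> i" "y \<in> P" "c\<^sub>1 y = zc P" using sel[OF y] by metis
    then show "y + t *\<^sub>R (z - y) \<in> subdomain g i" using seg[of P i y z t] i z t by simp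
  next
    fix y z t assume y: "y \<in> ?S" and z: "norm (z - c\<^sub>2 y) \<le> \<rho>" and t: "0 < t" "t \<le> (1::real)"
    obtain j P where j: "j \<in> ?J - {i}" "P \<in> \<P> j" "y \<in> P" "c\<^sub>2 y = zc P" using sel[OF y] by metis
    then have "y + t *\<^sub>R (z - y) \<in> subdomain g j" using seg[of P j y z t] z t by simp
    then show "\<exists>j\<in>?J - {i}. y + t *\<^sub>R (z - y) \<in> subdomain g j" using j(1) by blast
  qed
qed

lemma C1_function_L2_space:
  assumes "C1_function \<phi>" "bounded G" "G \<in> sets borel"
  shows "\<phi> \<in> L2_space (vol G)" "gradient \<phi> \<in> L2_space (vol G)"
proof -
  have fin: "emeasure (vol G) (space (vol G)) < \<infinity>"
    using emeasure_bounded_finite[OF assms(2)] assms(3) by (simp add: space_restrict_space emeasure_restrict_space)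
  obtain B where B: "0 < B" "\<And>x. x \<in> G \<Longrightarrow> norm (\<phi> x) \<le> B"
    using continuous_on_bounded_imp_bound[OF assms(2) C1_function_continuous_on[OF assms(1), of UNIV]] by blast
  obtain B' where B': "0 < B'" "\<And>x. x \<in> G \<Longrightarrow> norm (gradient \<phi> x) \<le> B'"
    using continuous_on_bounded_imp_bound[OF assms(2) gradient_continuous_on[OF assms(1), of UNIV]] by blast
  show "\<phi> \<in> L2_space (vol G)"
    by (rule L2_space_bounded[OF _ fin, where B = B])
      (use B C1_function_borel_measurable[OF assms(1)] in \<open>auto simp: space_restrict_space intro!: measurable_restrict_space1\<close>)
  show "gradient \<phi> \<in> L2_space (vol G)"
    by (rule L2_space_bounded[OF _ fin, where B = B'])
      (use B' gradient_borel_measurable[OF assms(1)] in \<open>auto simp: space_restrict_space intro!: measurable_restrict_space1\<close>)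
qed

lemma valid_geometry_facts:
  fixes g :: "'n::finite geometry"
  assumes g: "valid_geometry g"
  shows "open (domain g)" "bounded (domain g)"
    and "\<And>i. i \<in> {1..num_sub g} \<Longrightarrow> polyhedral_domain (subdomain g i)"
    and "\<And>i. i \<in> {1..num_sub g} \<Longrightarrow> open (subdomain g i)"
    and "\<And>i. i \<in> {1..num_sub g} \<Longrightarrow> bounded (subdomain g i)"
    and "\<And>i. i \<in> {1..num_sub g} \<Longrightarrow> subdomain g i \<subseteq> domain g"
    and "\<And>i j. i \<in> {1..num_sub g} \<Longrightarrow> j \<in> {1..num_sub g} - {i} \<Longrightarrow> subdomain g i \<inter> subdomain g j = {}"
proof -
  have d: "domain g = interior (\<Union>i\<in>{1..num_sub g}. closure (subdomain g i))"
    using g by (simp add: valid_geometry_def)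
  show p: "polyhedral_domain (subdomain g i)" if "i \<in> {1..num_sub g}" for i
    using g that by (simp add: valid_geometry_def)
  show o: "open (subdomain g i)" if "i \<in> {1..num_sub g}" for i
    using p[OF that] by (simp add: polyhedral_domain_def)
  show b: "bounded (subdomain g i)" if "i \<in> {1..num_sub g}" for i
    by (rule polyhedral_domain_bounded[OF p[OF that]])
  show "open (domain g)" by (simp add: d)
  have "bounded (\<Union>i\<in>{1..num_sub g}. closure (subdomain g i))"
    using b by (intro bounded_UN) auto
  then show "bounded (domain g)" unfolding d by (rule bounded_subset) (rule interior_subset)
  show "subdomain g i \<subseteq> domain g" if i: "i \<in> {1..num_sub g}" for i
    unfolding d
  proof (rule interior_maximal[OF _ o[OF i]])
    show "subdomain g i \<subseteq> (\<Union>i\<in>{1..num_sub g}. closure (subdomain g i))"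
      using i closure_subset by fastforce
  qed
  show "subdomain g i \<inter> subdomain g j = {}" if "i \<in> {1..num_sub g}" "j \<in> {1..num_sub g} - {i}" for i j
    using g that unfolding valid_geometry_def by auto
qed

lemma closed_Gamma_all: "closed (Gamma_all g)"
  unfolding Gamma_all_def interface_def by (intro closed_UN closed_Int) auto

lemma closed_Gamma_sub: "closed (Gamma_sub g i)"
  unfolding Gamma_sub_def by (intro closed_Int closed_Gamma_all) auto

text \<open>The weak form of div (flow F) = F - sink F, tested also with functions that do not
  vanish on the boundary. Splitting the average of \<psi> from its boundary value takes the
  integrability of both parts; the bounded support of F provides the second.\<close>

lemma (in segment_flow) integral_flow_gradient_boundary:
  assumes Fm [measurable]: "F \<in> borel_measurable borel" and Ffin: "(\<integral>\<^sup>+y. ennreal ((F y)\<^sup>2) \<partial>N) < \<infinity>"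
    and bdd: "bounded {y. F y \<noteq> 0}"
    and \<psi>: "C1_function \<psi>" and G: "bounded G" "G \<in> sets borel"
    and seg: "\<And>y z t. F y \<noteq> 0 \<Longrightarrow> norm (z - c y) \<le> \<rho> \<Longrightarrow> 0 < t \<Longrightarrow> t \<le> 1 \<Longrightarrow> y + t *\<^sub>R (z - y) \<in> G"
  shows "(\<integral>x. flow F x \<bullet> gradient \<psi> x \<partial>vol G) = (\<integral>x. sink F x * \<psi> x \<partial>vol G) - (\<integral>y. F y * \<psi> y \<partial>N)"
proof -
  note [measurable] = C1_function_borel_measurable[OF \<psi>]
  \<comment> \<open>The endpoint t = 1 of the segments covers the bump itself.\<close>
  have ball: "z \<in> G" if "F y \<noteq> 0" "norm (z - c y) \<le> \<rho>" for y z
    using seg[of y z 1] that by simp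
  note a = sink_integral[OF Fm Ffin \<psi> G ball]
  have b: "integrable N (\<lambda>y. F y * \<psi> y)"
  proof -
    obtain B where B: "0 < B" "\<And>x. x \<in> {y. F y \<noteq> 0} \<Longrightarrow> norm (\<psi> x) \<le> B"
      using continuous_on_bounded_imp_bound[OF bdd C1_function_continuous_on[OF \<psi>, of UNIV]] by metis
    have "integrable N (\<lambda>y. B * \<bar>F y\<bar>)"
      using integrable_if_square[OF Fm Ffin] by (intro integrable_mult_right integrableI_bounded) auto
    then show ?thesis
    proof (rule Bochner_Integration.integrable_bound)
      have "\<bar>F y * \<psi> y\<bar> \<le> \<bar>B * \<bar>F y\<bar>\<bar>" for y
      proof (cases "F y = 0")
        case False
        then have "\<bar>F y\<bar> * \<bar>\<psi> y\<bar> \<le> \<bar>F y\<bar> * B" using B(2)[of y] by (intro mult_left_mono) auto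
        then show ?thesis using B(1) by (simp add: abs_mult mult.commute)
      qed simp
      then show "AE y in N. norm (F y * \<psi> y) \<le> norm (B * \<bar>F y\<bar>)" by simp
    qed measurable
  qed
  have "(\<integral>x. flow F x \<bullet> gradient \<psi> x \<partial>vol G) = (\<integral>y. F y * ((\<integral>z. \<omega> (z - c y) * \<psi> z \<partial>lborel) - \<psi> y) \<partial>N)"
    by (rule integral_flow_gradient[OF Fm Ffin \<psi> G]) (simp add: seg)
  also have "\<dots> = (\<integral>y. F y * (\<integral>z. \<omega> (z - c y) * \<psi> z \<partial>lborel) \<partial>N) - (\<integral>y. F y * \<psi> y \<partial>N)"
    using Bochner_Integration.integral_diff[OF a(3) b] by (simp add: right_diff_distrib)
  finally show ?thesis using a(1) by simp
qed

text \<open>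
  A scalar flux \<open>f\<close> on the interface is lifted to the field that carries it along segments from a
  neighbouring subdomain across the interface into subdomain \<open>i\<close>. The field has no normal component
  on the outer boundary.
\<close>

lemma scalar_lift:
  fixes g :: "'n::finite geometry"
  assumes g: "valid_geometry g" and i: "i \<in> {1..num_sub g}"
  obtains C where "0 \<le> C"
    "\<And>f :: real^'n \<Rightarrow> real. f \<in> borel_measurable borel \<Longrightarrow> (\<And>y. y \<notin> Gamma_sub g i \<Longrightarrow> f y = 0) \<Longrightarrow>
       integrable surface_measure (\<lambda>y. (f y)\<^sup>2) \<Longrightarrow>
     \<exists>q D. q \<in> L2_space (vol (domain g)) \<and>
       (\<exists>D0. has_weak_div (domain g) q D0 \<and>
         (\<forall>\<phi>. C1_function \<phi> \<longrightarrow> (\<integral>x. D0 x * \<phi> x + q x \<bullet> gradient \<phi> x \<partial>vol (domain g)) = 0)) \<and>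
       has_weak_div (subdomain g i) q D \<and>
       (\<forall>\<phi>. C1_function \<phi> \<longrightarrow>
         (\<integral>x. D x * \<phi> x + q x \<bullet> gradient \<phi> x \<partial>vol (subdomain g i)) = (\<integral>y. f y * \<phi> y \<partial>surface_measure)) \<and>
       (L2_norm (vol (subdomain g i)) q)\<^sup>2 \<le> C * (\<integral>y. (f y)\<^sup>2 \<partial>surface_measure) \<and>
       slobodeckij (1/8) (subdomain g i) q \<le> ennreal (C * (\<integral>y. (f y)\<^sup>2 \<partial>surface_measure)) \<and>
       (L2_norm (vol (subdomain g i)) D)\<^sup>2 \<le> C * (\<integral>y. (f y)\<^sup>2 \<partial>surface_measure)"
proof -
  let ?\<Omega> = "domain g" and ?G = "subdomain g i" and ?S = "Gamma_sub g i"
  note geo = valid_geometry_facts[OF g]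
  obtain c\<^sub>1 c\<^sub>2 :: "real^'n \<Rightarrow> real^'n" and \<rho> m where
    c: "c\<^sub>1 \<in> borel_measurable borel" "c\<^sub>2 \<in> borel_measurable borel" "0 < \<rho>"
    "\<And>y. dist (c\<^sub>1 y) y + \<rho> \<le> m" "\<And>y. dist (c\<^sub>2 y) y + \<rho> \<le> m"
    and seg1: "\<And>y z t. y \<in> ?S \<Longrightarrow> norm (z - c\<^sub>1 y) \<le> \<rho> \<Longrightarrow> 0 < t \<Longrightarrow> t \<le> 1 \<Longrightarrow> y + t *\<^sub>R (z - y) \<in> ?G"
    and seg2: "\<And>y z t. y \<in> ?S \<Longrightarrow> norm (z - c\<^sub>2 y) \<le> \<rho> \<Longrightarrow> 0 < t \<Longrightarrow> t \<le> 1 \<Longrightarrow>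
       \<exists>j\<in>{1..num_sub g} - {i}. y + t *\<^sub>R (z - y) \<in> subdomain g j"
    using interface_centres[OF g i] by metis
  have m: "0 \<le> m" using c(3) c(4)[of 0] zero_le_dist[of "c\<^sub>1 0" 0] by linarith
  obtain \<omega> :: "real^'n \<Rightarrow> real" and W L where \<omega>:
    "\<omega> \<in> borel_measurable borel" "\<And>z. 0 \<le> \<omega> z" "\<And>z. \<omega> z \<le> W" "0 < W" "0 \<le> L"
    "\<And>z z'. \<bar>\<omega> z - \<omega> z'\<bar> \<le> L * dist z z'" "\<And>z. \<rho> < norm z \<Longrightarrow> \<omega> z = 0" "(\<integral>z. \<omega> z \<partial>lborel) = 1"
    using tent_function[OF c(3)] by metis
  obtain K where K: "0 \<le> K" "\<And>x r. 0 < r \<Longrightarrow> r \<le> m \<Longrightarrow>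
       emeasure surface_measure (frontier ?G \<inter> cball x r) \<le> ennreal (K * r ^ (CARD('n) - 1))"
    using surface_measure_frontier_cball_le[OF geo(3)[OF i] m] by (auto simp: DIM_cart)
  \<comment> \<open>A density keeps the Borel sets of the whole space, as the locale demands,
    whereas \<open>surf\<close> would change the underlying space.\<close>
  define N :: "(real^'n) measure" where "N = density surface_measure (\<lambda>x. ennreal (indicator (frontier ?G) x))"
  have sN: "sets N = sets borel" by (simp add: N_def)
  have eN: "emeasure N A = emeasure surface_measure (frontier ?G \<inter> A)" if "A \<in> sets borel" for A
  proof -
    have [measurable]: "frontier ?G \<in> sets borel" "A \<in> sets borel" using that by auto
    have "emeasure N A = (\<integral>\<^sup>+x. ennreal (indicator (frontier ?G) x) * indicator A x \<partial>surface_measure)"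
      unfolding N_def by (rule emeasure_density) measurable
    also have "\<dots> = (\<integral>\<^sup>+x. indicator (frontier ?G \<inter> A) x \<partial>surface_measure)"
      by (intro nn_integral_cong) (simp split: split_indicator)
    also have "\<dots> = emeasure surface_measure (frontier ?G \<inter> A)"
      by (rule nn_integral_indicator) measurable
    finally show ?thesis .
  qed
  have fN: "finite_measure N"
    using surface_measure_frontier_finite[OF geo(3)[OF i]] eN[of UNIV] sets_eq_imp_space_eq[OF sN]
    by (intro finite_measureI) auto
  have growth: "emeasure N (cball x r) \<le> ennreal (K * r ^ (CARD('n) - 1))" if "0 < r" "r \<le> m" for x r
    using K(2)[OF that] by (simp add: eN)
  have sf: "segment_flow N c \<omega> \<rho> m W L K"
    if "c \<in> borel_measurable borel" "\<And>y. dist (c y) y + \<rho> \<le> m" for c :: "real^'n \<Rightarrow> real^'n"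
  proof (rule segment_flow.intro)
    show "emeasure N (cball x r) \<le> ennreal (K * r ^ (CARD('n) - 1))" if "0 < r" "r \<le> m" for x r
      by (rule growth[OF that])
    show "dist (c y) y + \<rho> \<le> m" for y by (rule that)
    show "\<bar>\<omega> z - \<omega> z'\<bar> \<le> L * dist z z'" for z z' by (rule \<omega>)
    show "0 \<le> \<omega> z" "\<omega> z \<le> W" for z by (rule \<omega>)+
    show "\<omega> z = 0" if "\<rho> < norm z" for z by (rule \<omega>(7)[OF that])
  qed (rule sN fN that(1) \<omega>(1,4,5,8) K(1) c(3))+
  interpret A: segment_flow N c\<^sub>1 \<omega> \<rho> m W L K
    by (rule sf[OF c(1,4)])
  interpret B: segment_flow N c\<^sub>2 \<omega> \<rho> m W L K
    by (rule sf[OF c(2,5)])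
  obtain R where R: "0 < R" "\<And>x x'. x \<in> ?G \<Longrightarrow> x' \<in> ?G \<Longrightarrow> dist x x' \<le> R"
  proof -
    have "dist x x' \<le> diameter ?G + 1" if "x \<in> ?G" "x' \<in> ?G" for x x'
      using diameter_bounded_bound[OF geo(5)[OF i] that] by simp
    then show ?thesis using diameter_ge_0[OF geo(5)[OF i]] that[of "diameter ?G + 1"] by auto
  qed
  have dim: "DIM(real^'n) = CARD('n)" by simp
  obtain C0 where C0: "0 \<le> C0" "\<And>x :: real^'n.
      (\<integral>\<^sup>+y. ennreal (if dist x y \<le> R then dist x y powr (1/4 - CARD('n)) else 0) \<partial>lborel) \<le> ennreal C0"
  proof (rule nn_integral_dist_powr_le[OF R(1), where 'a = "real^'n", unfolded dim], goal_cases)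
    case (1 C)
    show ?thesis by (rule 1(1)) (fact 1(2,3))+
  qed
  \<comment> \<open>The summands bound, in this order, the field, its Slobodeckij seminorm and its
    divergence. N, the balls, the bump and R are fixed before f is given, so C depends on the
    geometry alone.\<close>
  define C where "C = A.A\<^sup>2 * A.C\<^sub>S + 4 * A.A\<^sup>2 * C0 * A.C\<^sub>S + W\<^sup>2 * measure N UNIV * measure lborel ?G"
  have "0 \<le> A.A\<^sup>2 * A.C\<^sub>S" by (rule mult_nonneg_nonneg[OF zero_le_power2 A.CS_nonneg])
  moreover have "0 \<le> 4 * A.A\<^sup>2 * C0 * A.C\<^sub>S"
    by (rule mult_nonneg_nonneg[OF mult_nonneg_nonneg[OF _ C0(1)] A.CS_nonneg]) simp
  moreover have "0 \<le> W\<^sup>2 * measure N UNIV * measure lborel ?G" by simp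
  ultimately have C_nonneg: "0 \<le> A.A\<^sup>2 * A.C\<^sub>S" "0 \<le> 4 * A.A\<^sup>2 * C0 * A.C\<^sub>S"
    "0 \<le> W\<^sup>2 * measure N UNIV * measure lborel ?G" .
  show ?thesis
  proof (rule that[of C])
    show "0 \<le> C" unfolding C_def by (intro add_nonneg_nonneg C_nonneg)
    fix f :: "real^'n \<Rightarrow> real"
    assume fm [measurable]: "f \<in> borel_measurable borel" and f0: "\<And>y. y \<notin> ?S \<Longrightarrow> f y = 0"
      and f2: "integrable surface_measure (\<lambda>y. (f y)\<^sup>2)"
    define Q where "Q = (\<integral>y. (f y)\<^sup>2 \<partial>surface_measure)"
    have Q0: "0 \<le> Q" by (simp add: Q_def)
    have im: "indicator (frontier ?G) \<in> borel_measurable (surface_measure :: (real^'n) measure)"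
      by (rule borel_measurable_indicator) simp
    have ind: "indicator (frontier ?G) y * (f y * h y) = f y * h y" for h :: "real^'n \<Rightarrow> real" and y
      using f0[of y] by (auto simp: indicator_def Gamma_sub_def)
    have N_int: "(\<integral>y. f y * h y \<partial>N) = (\<integral>y. f y * h y \<partial>surface_measure)"
      if [measurable]: "h \<in> borel_measurable borel" for h
      unfolding N_def using im by (subst integral_density) (auto simp: ind)
    have N_integrable: "integrable N (\<lambda>y. f y * h y) \<longleftrightarrow> integrable surface_measure (\<lambda>y. f y * h y)"
      if [measurable]: "h \<in> borel_measurable borel" for h
      unfolding N_def using im by (subst integrable_density) (auto simp: ind)
    have QN: "(\<integral>y. (f y)\<^sup>2 \<partial>N) = Q" using N_int[OF fm] by (simp add: Q_def power2_eq_square)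
    have f2N: "integrable N (\<lambda>y. (f y)\<^sup>2)" using N_integrable[OF fm] f2 by (simp add: power2_eq_square)
    \<comment> \<open>An outward normal trace f means that the mass -f enters subdomain i, hence the
      sign.\<close>
    define F where "F = (\<lambda>y. - f y)"
    have Fm [measurable]: "F \<in> borel_measurable borel" unfolding F_def by measurable
    have F2: "(\<lambda>y. (F y)\<^sup>2) = (\<lambda>y. (f y)\<^sup>2)" by (simp add: F_def)
    have enn: "(\<integral>\<^sup>+y. ennreal ((F y)\<^sup>2) \<partial>N) = ennreal Q"
      unfolding QN[symmetric] F2[THEN fun_cong] by (rule nn_integral_eq_integral[OF f2N]) auto
    then have Ffin: "(\<integral>\<^sup>+y. ennreal ((F y)\<^sup>2) \<partial>N) < \<infinity>" by simp
    have FS: "y \<in> ?S" if "F y \<noteq> 0" for y using f0[of y] that by (auto simp: F_def)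
    \<comment> \<open>Both flows have the source F on the interface. In the difference the two
      sources cancel, so the divergence on the whole domain is a function; inside subdomain i just
      the first flow is present, and there F remains visible as a normal trace.\<close>
    define q where "q = (\<lambda>x. A.flow F x - B.flow F x)"
    have segA: "y + t *\<^sub>R (z - y) \<in> ?G" if "F y \<noteq> 0" "norm (z - c\<^sub>1 y) \<le> \<rho>" "0 < t" "t \<le> 1" for y z t
      using seg1[OF FS] that by simp
    have segB: "y + t *\<^sub>R (z - y) \<in> ?\<Omega>" "y + t *\<^sub>R (z - y) \<notin> ?G"
      if h: "F y \<noteq> 0" "norm (z - c\<^sub>2 y) \<le> \<rho>" "0 < t" "t \<le> 1" for y z t
    proof -
      obtain j where j: "j \<in> {1..num_sub g} - {i}" "y + t *\<^sub>R (z - y) \<in> subdomain g j"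
        using seg2[OF FS[OF h(1)] h(2-4)] by blast
      then show "y + t *\<^sub>R (z - y) \<in> ?\<Omega>" using geo(6) by blast
      show "y + t *\<^sub>R (z - y) \<notin> ?G" using geo(7)[OF i j(1)] j(2) by blast
    qed
    have B0: "B.flow F x = 0" if "x \<in> ?G" for x
      proof (rule B.flow_eq_0)
      fix y z t assume h: "F y \<noteq> 0" "norm (z - c\<^sub>2 y) \<le> \<rho>" "0 < t" "t < (1::real)"
      show "y + t *\<^sub>R (z - y) \<noteq> x" using segB(2)[OF h(1-3)] h(4) that by auto
    qed
    have qG: "q x = A.flow F x" if "x \<in> ?G" for x by (simp add: q_def B0[OF that])
    have [simp]: "?\<Omega> \<in> sets borel" "?G \<in> sets borel" using geo(1) geo(4)[OF i] by auto
    note LA = A.flow_L2_space[OF Fm, unfolded F2, OF f2N] and LB = B.flow_L2_space[OF Fm, unfolded F2, OF f2N]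
    have q\<Omega>: "q \<in> L2_space (vol ?\<Omega>)"
      unfolding q_def by (intro L2_space_diff L2_space_restrict LA LB) auto
    have flowG: "A.flow F \<in> L2_space (vol ?G)" by (intro L2_space_restrict LA) auto
    have sinkL2: "A.sink F \<in> L2_space (vol G)" "B.sink F \<in> L2_space (vol G)"
      if G: "bounded G" "G \<in> sets borel" for G
    proof -
      have fin: "emeasure (vol G) (space (vol G)) < \<infinity>"
        using emeasure_bounded_finite[OF G(1)] G(2) by (simp add: space_restrict_space emeasure_restrict_space)
      have "\<bar>A.sink F x\<bar> \<le> sqrt (W\<^sup>2 * measure N UNIV * Q)" "\<bar>B.sink F x\<bar> \<le> sqrt (W\<^sup>2 * measure N UNIV * Q)" for x
        using A.sink_bound[OF Fm Ffin, of x] B.sink_bound[OF Fm Ffin, of x] unfolding F2 QN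
        by (auto intro!: real_le_rsqrt simp: power2_abs)
      then show "A.sink F \<in> L2_space (vol G)" "B.sink F \<in> L2_space (vol G)"
        by (auto intro!: L2_space_bounded[OF _ fin] measurable_restrict_space1)
    qed
    have "bounded (frontier ?G)"
      unfolding frontier_def by (rule bounded_diff[OF bounded_closure[OF geo(5)[OF i]]])
    then have bdd: "bounded {y. F y \<noteq> 0}"
      by (rule bounded_subset) (use FS in \<open>auto simp: Gamma_sub_def\<close>)
    have F_int: "(\<integral>y. F y * \<psi> y \<partial>N) = - (\<integral>y. f y * \<psi> y \<partial>surface_measure)" if "C1_function \<psi>" for \<psi>
      using N_int[OF C1_function_borel_measurable[OF that]] by (simp add: F_def)
    \<comment> \<open>Stated for every G that contains the subdomain, because it is applied both to
      the subdomain and to the whole domain.\<close>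
    have gA: "(\<integral>x. A.flow F x \<bullet> gradient \<psi> x \<partial>vol G) = (\<integral>x. A.sink F x * \<psi> x \<partial>vol G) + (\<integral>y. f y * \<psi> y \<partial>surface_measure)"
      if \<psi>: "C1_function \<psi>" and G: "bounded G" "G \<in> sets borel" "?G \<subseteq> G" for \<psi> G
      using A.integral_flow_gradient_boundary[OF Fm Ffin bdd \<psi> G(1,2) subsetD[OF G(3) segA]] F_int[OF \<psi>] by simp
    have gB: "(\<integral>x. B.flow F x \<bullet> gradient \<psi> x \<partial>vol ?\<Omega>) = (\<integral>x. B.sink F x * \<psi> x \<partial>vol ?\<Omega>) + (\<integral>y. f y * \<psi> y \<partial>surface_measure)"
      if \<psi>: "C1_function \<psi>" for \<psi>
      using B.integral_flow_gradient_boundary[OF Fm Ffin bdd \<psi> geo(2) _ segB(1)] F_int[OF \<psi>] by simp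
    define D0 where "D0 = (\<lambda>x. B.sink F x - A.sink F x)"
    define D where "D = (\<lambda>x. - A.sink F x)"
    have D0_L2: "D0 \<in> L2_space (vol ?\<Omega>)" unfolding D0_def by (intro L2_space_diff sinkL2 geo) auto
    have sG: "A.sink F \<in> L2_space (vol ?G)" by (intro sinkL2 geo i) auto
    have D_L2: "D \<in> L2_space (vol ?G)" using L2_space_scaleR[OF sG, of "-1"] by (simp add: D_def)
    have green\<Omega>: "(\<integral>x. D0 x * \<phi> x + q x \<bullet> gradient \<phi> x \<partial>vol ?\<Omega>) = 0"
      and split\<Omega>: "(\<integral>x. D0 x * \<phi> x + q x \<bullet> gradient \<phi> x \<partial>vol ?\<Omega>) =
        (\<integral>x. D0 x * \<phi> x \<partial>vol ?\<Omega>) + (\<integral>x. q x \<bullet> gradient \<phi> x \<partial>vol ?\<Omega>)" if \<phi>: "C1_function \<phi>" for \<phi>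
    proof -
      note \<phi>L = C1_function_L2_space[OF \<phi> geo(2), simplified]
      have fA: "A.flow F \<in> L2_space (vol ?\<Omega>)" "B.flow F \<in> L2_space (vol ?\<Omega>)"
        by (intro L2_space_restrict LA LB; simp)+
      have sA: "A.sink F \<in> L2_space (vol ?\<Omega>)" "B.sink F \<in> L2_space (vol ?\<Omega>)"
        by (intro sinkL2 geo; simp)+
      show s: "(\<integral>x. D0 x * \<phi> x + q x \<bullet> gradient \<phi> x \<partial>vol ?\<Omega>) =
        (\<integral>x. D0 x * \<phi> x \<partial>vol ?\<Omega>) + (\<integral>x. q x \<bullet> gradient \<phi> x \<partial>vol ?\<Omega>)"
        by (intro Bochner_Integration.integral_add L2_space_integrable_mult L2_space_integrable_inner D0_L2 q\<Omega> \<phi>L)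
      have "(\<integral>x. D0 x * \<phi> x \<partial>vol ?\<Omega>) = (\<integral>x. B.sink F x * \<phi> x \<partial>vol ?\<Omega>) - (\<integral>x. A.sink F x * \<phi> x \<partial>vol ?\<Omega>)"
        unfolding D0_def left_diff_distrib
        by (intro Bochner_Integration.integral_diff L2_space_integrable_mult sA \<phi>L)
      moreover have "(\<integral>x. q x \<bullet> gradient \<phi> x \<partial>vol ?\<Omega>) =
          (\<integral>x. A.flow F x \<bullet> gradient \<phi> x \<partial>vol ?\<Omega>) - (\<integral>x. B.flow F x \<bullet> gradient \<phi> x \<partial>vol ?\<Omega>)"
        unfolding q_def inner_diff_left
        by (intro Bochner_Integration.integral_diff L2_space_integrable_inner fA \<phi>L)
      ultimately show "(\<integral>x. D0 x * \<phi> x + q x \<bullet> gradient \<phi> x \<partial>vol ?\<Omega>) = 0"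
        using s gA[OF \<phi> geo(2) _ geo(6)[OF i]] gB[OF \<phi>] by simp
    qed
    have greenG: "(\<integral>x. D x * \<phi> x + q x \<bullet> gradient \<phi> x \<partial>vol ?G) = (\<integral>y. f y * \<phi> y \<partial>surface_measure)"
      and splitG: "(\<integral>x. D x * \<phi> x + q x \<bullet> gradient \<phi> x \<partial>vol ?G) =
        (\<integral>x. D x * \<phi> x \<partial>vol ?G) + (\<integral>x. q x \<bullet> gradient \<phi> x \<partial>vol ?G)" if \<phi>: "C1_function \<phi>" for \<phi>
    proof -
      note \<phi>L = C1_function_L2_space[OF \<phi> geo(5)[OF i], simplified]
      have qe: "(\<integral>x. q x \<bullet> gradient \<phi> x \<partial>vol ?G) = (\<integral>x. A.flow F x \<bullet> gradient \<phi> x \<partial>vol ?G)"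
        by (intro Bochner_Integration.integral_cong) (auto simp: space_restrict_space qG)
      have "(\<integral>x. D x * \<phi> x + q x \<bullet> gradient \<phi> x \<partial>vol ?G) = (\<integral>x. D x * \<phi> x + A.flow F x \<bullet> gradient \<phi> x \<partial>vol ?G)"
        by (intro Bochner_Integration.integral_cong) (auto simp: space_restrict_space qG)
      also have "\<dots> = (\<integral>x. D x * \<phi> x \<partial>vol ?G) + (\<integral>x. A.flow F x \<bullet> gradient \<phi> x \<partial>vol ?G)"
        by (intro Bochner_Integration.integral_add L2_space_integrable_mult L2_space_integrable_inner D_L2 flowG \<phi>L)
      finally show s: "(\<integral>x. D x * \<phi> x + q x \<bullet> gradient \<phi> x \<partial>vol ?G) =
        (\<integral>x. D x * \<phi> x \<partial>vol ?G) + (\<integral>x. q x \<bullet> gradient \<phi> x \<partial>vol ?G)" by (simp add: qe)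
      show "(\<integral>x. D x * \<phi> x + q x \<bullet> gradient \<phi> x \<partial>vol ?G) = (\<integral>y. f y * \<phi> y \<partial>surface_measure)"
        unfolding s qe using gA[OF \<phi> geo(5)[OF i] _ order_refl] by (simp add: D_def)
    qed
    have wd\<Omega>: "has_weak_div ?\<Omega> q D0"
      unfolding has_weak_div_def
    proof (intro conjI D0_L2 allI impI)
      fix \<phi> assume "test_function ?\<Omega> \<phi>"
      then have \<phi>: "C1_function \<phi>" by (simp add: test_function_def)
      show "(\<integral>x. q x \<bullet> gradient \<phi> x \<partial>vol ?\<Omega>) = - (\<integral>x. D0 x * \<phi> x \<partial>vol ?\<Omega>)"
        using green\<Omega>[OF \<phi>] split\<Omega>[OF \<phi>] by linarith
    qed
    have wdG: "has_weak_div ?G q D"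
      unfolding has_weak_div_def
    proof (intro conjI D_L2 allI impI)
      fix \<phi> assume t: "test_function ?G \<phi>"
      then have \<phi>: "C1_function \<phi>" by (simp add: test_function_def)
      \<comment> \<open>A test function of the open subdomain vanishes on the interface, so the
        boundary term drops out and D is the weak divergence.\<close>
      have fz: "f y * \<phi> y = 0" for y
      proof (cases "y \<in> ?S")
        case True
        then have "y \<notin> ?G" using geo(4)[OF i] by (auto simp: Gamma_sub_def frontier_def interior_open)
        then show ?thesis using t by (auto simp: test_function_def)
      qed (simp add: f0)
      show "(\<integral>x. q x \<bullet> gradient \<phi> x \<partial>vol ?G) = - (\<integral>x. D x * \<phi> x \<partial>vol ?G)"
        using greenG[OF \<phi>] splitG[OF \<phi>] unfolding fz integral_zero by linarith
    qed
    have b1: "(L2_norm (vol ?G) q)\<^sup>2 \<le> C * Q"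
    proof -
      have "(L2_norm (vol ?G) q)\<^sup>2 = (L2_norm (vol ?G) (A.flow F))\<^sup>2"
        unfolding L2_norm_power2 by (intro Bochner_Integration.integral_cong) (auto simp: space_restrict_space qG)
      also have "\<dots> \<le> (L2_norm lborel (A.flow F))\<^sup>2" by (intro L2_norm_restrict_le LA) simp
      also have "\<dots> \<le> A.A\<^sup>2 * A.C\<^sub>S * Q" using LA(2) by (simp add: QN)
      also have "\<dots> \<le> C * Q" using C_nonneg Q0 by (intro mult_right_mono) (auto simp: C_def)
      finally show ?thesis .
    qed
    have b2: "slobodeckij (1/8) ?G q \<le> ennreal (C * Q)"
    proof -
      have "slobodeckij (1/8) ?G q = slobodeckij (1/8) ?G (A.flow F)"
        unfolding slobodeckij_def by (auto intro!: nn_integral_cong simp: space_restrict_space qG)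
      also have "\<dots> \<le> ennreal (4 * A.A\<^sup>2 * C0 * A.C\<^sub>S) * ennreal Q"
        using A.slobodeckij_flow_le[OF Fm _ R(2) C0] unfolding enn by simp
      also have "\<dots> = ennreal (4 * A.A\<^sup>2 * C0 * A.C\<^sub>S * Q)" using C_nonneg Q0 by (simp add: ennreal_mult)
      also have "\<dots> \<le> ennreal (C * Q)"
        using C_nonneg Q0 by (intro ennreal_leI mult_right_mono) (auto simp: C_def)
      finally show ?thesis .
    qed
    have b3: "(L2_norm (vol ?G) D)\<^sup>2 \<le> C * Q"
    proof -
      have "(L2_norm (vol ?G) D)\<^sup>2 \<le> (\<integral>x. W\<^sup>2 * measure N UNIV * Q \<partial>vol ?G)"
        unfolding L2_norm_power2
      proof (rule integral_mono)
        show "integrable (vol ?G) (\<lambda>x. (norm (D x))\<^sup>2)" by (rule L2_space_integrable_square[OF D_L2])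
        show "integrable (vol ?G) (\<lambda>x. W\<^sup>2 * measure N UNIV * Q)"
          using emeasure_bounded_finite[OF geo(5)[OF i]]
          by (simp add: integrable_restrict_space integrable_real_indicator)
        show "(norm (D x))\<^sup>2 \<le> W\<^sup>2 * measure N UNIV * Q" for x
          using A.sink_bound[OF Fm Ffin, of x] unfolding F2 QN by (simp add: D_def)
      qed
      also have "\<dots> = W\<^sup>2 * measure N UNIV * measure lborel ?G * Q"
        by (simp add: measure_restrict_space space_restrict_space)
      also have "\<dots> \<le> C * Q" using C_nonneg Q0 by (intro mult_right_mono) (auto simp: C_def)
      finally show ?thesis .
    qed
    show "\<exists>q D. q \<in> L2_space (vol (domain g)) \<and>
       (\<exists>D0. has_weak_div (domain g) q D0 \<and>
         (\<forall>\<phi>. C1_function \<phi> \<longrightarrow> (\<integral>x. D0 x * \<phi> x + q x \<bullet> gradient \<phi> x \<partial>vol (domain g)) = 0)) \<and>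
       has_weak_div (subdomain g i) q D \<and>
       (\<forall>\<phi>. C1_function \<phi> \<longrightarrow>
         (\<integral>x. D x * \<phi> x + q x \<bullet> gradient \<phi> x \<partial>vol (subdomain g i)) = (\<integral>y. f y * \<phi> y \<partial>surface_measure)) \<and>
       (L2_norm (vol (subdomain g i)) q)\<^sup>2 \<le> C * (\<integral>y. (f y)\<^sup>2 \<partial>surface_measure) \<and>
       slobodeckij (1/8) (subdomain g i) q \<le> ennreal (C * (\<integral>y. (f y)\<^sup>2 \<partial>surface_measure)) \<and>
       (L2_norm (vol (subdomain g i)) D)\<^sup>2 \<le> C * (\<integral>y. (f y)\<^sup>2 \<partial>surface_measure)"
      unfolding Q_def[symmetric]
      using q\<Omega> wd\<Omega> green\<Omega> wdG greenG b1 b2 b3 by (intro exI[of _ q] exI[of _ D] conjI exI[of _ D0]) auto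
  qed
qed

section \<open>Weak divergence and normal traces\<close>

text \<open>F carries the measure and G the test functions. For weak divergences the two coincide;
  for normal traces F is the boundary and G the whole space.\<close>

lemma AE_zero_if_orthogonal_to_test_functions:
  fixes h :: "real^'n \<Rightarrow> real"
  assumes sets: "sets M = sets borel" and F: "F \<in> sets borel" "emeasure M F < \<infinity>"
    and h: "h \<in> L2_space (restrict_space M F)" and G: "open G"
    and test: "\<And>\<phi>. test_function G \<phi> \<Longrightarrow> (\<integral>x. h x * \<phi> x \<partial>restrict_space M F) = 0"
  shows "AE x in restrict_space M F. x \<in> G \<longrightarrow> h x = 0"
proof -
  have sp: "space M = UNIV" using sets by (metis sets_eq_imp_space_eq space_borel)
  have FM: "F \<inter> space M \<in> sets M" using F sets sp by simp
  have "emeasure (restrict_space M F) (space (restrict_space M F)) < \<infinity>"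
    using F(2) FM sp by (simp add: space_restrict_space emeasure_restrict_space)
  then have "integrable (restrict_space M F) h" by (rule L2_space_integrable[OF h])
  then have "integrable M (\<lambda>x. indicator F x * h x)" using FM by (simp add: integrable_restrict_space)
  then have "AE x in M. x \<in> G \<longrightarrow> indicator F x * h x = 0"
  proof (rule AE_zero_if_test_integrals_zero[OF sets G])
    fix \<phi> assume "test_function G \<phi>"
    from test[OF this] show "(\<integral>x. indicator F x * h x * \<phi> x \<partial>M) = 0"
      using FM by (simp add: integral_restrict_space mult.assoc)
  qed
  then show ?thesis using FM by (subst AE_restrict_space_iff) (auto elim: eventually_mono)
qed

section \<open>Linearity and uniqueness of the weak divergence\<close>

lemma has_weak_div_add:
  assumes "has_weak_div G q f" "has_weak_div G q' f'" "q \<in> L2_space (vol G)" "q' \<in> L2_space (vol G)"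
    and G: "bounded G" "G \<in> sets borel"
  shows "has_weak_div G (\<lambda>x. q x + q' x) (\<lambda>x. f x + f' x)"
  unfolding has_weak_div_def
proof (intro conjI allI impI)
  have f: "f \<in> L2_space (vol G)" "f' \<in> L2_space (vol G)" using assms by (auto simp: has_weak_div_def)
  then show "(\<lambda>x. f x + f' x) \<in> L2_space (vol G)" by (rule L2_space_add)
  fix \<phi> assume t: "test_function G \<phi>"
  then have "C1_function \<phi>" by (simp add: test_function_def)
  note \<phi> = C1_function_L2_space[OF this G]
  have "(\<integral>x. (q x + q' x) \<bullet> gradient \<phi> x \<partial>vol G) = (\<integral>x. q x \<bullet> gradient \<phi> x \<partial>vol G) + (\<integral>x. q' x \<bullet> gradient \<phi> x \<partial>vol G)"
    unfolding inner_add_left by (intro Bochner_Integration.integral_add L2_space_integrable_inner assms \<phi>)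
  moreover have "(\<integral>x. (f x + f' x) * \<phi> x \<partial>vol G) = (\<integral>x. f x * \<phi> x \<partial>vol G) + (\<integral>x. f' x * \<phi> x \<partial>vol G)"
    unfolding distrib_right by (intro Bochner_Integration.integral_add L2_space_integrable_mult f \<phi>)
  ultimately show "(\<integral>x. (q x + q' x) \<bullet> gradient \<phi> x \<partial>vol G) = - (\<integral>x. (f x + f' x) * \<phi> x \<partial>vol G)"
    using assms(1,2) t by (simp add: has_weak_div_def)
qed

lemma has_weak_div_scaleR:
  assumes "has_weak_div G q f"
  shows "has_weak_div G (\<lambda>x. s *\<^sub>R q x) (\<lambda>x. s * f x)"
  using assms L2_space_scaleR[of f "vol G" s] unfolding has_weak_div_def
  by (auto simp: mult.assoc)

text \<open>\<open>weak_div\<close> is a choice by \<open>SOME\<close>; uniqueness up to null sets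
  lets it be replaced by any weak divergence at hand.\<close>

lemma has_weak_div_unique:
  assumes "has_weak_div G q f" "has_weak_div G q f'" and G: "bounded G" "open G"
  shows "AE x in vol G. f x = f' x"
proof -
  have f: "f \<in> L2_space (vol G)" "f' \<in> L2_space (vol G)" using assms by (auto simp: has_weak_div_def)
  have Gb: "G \<in> sets borel" using G(2) by simp
  have "AE x in vol G. x \<in> G \<longrightarrow> f x - f' x = 0"
  proof (rule AE_zero_if_orthogonal_to_test_functions[OF _ Gb _ _ G(2)])
    show "emeasure lborel G < \<infinity>" using G(1) emeasure_bounded_finite by auto
    show "(\<lambda>x. f x - f' x) \<in> L2_space (vol G)" by (rule L2_space_diff[OF f])
    fix \<phi> assume t: "test_function G \<phi>"
    then have "C1_function \<phi>" by (simp add: test_function_def)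
    note \<phi> = C1_function_L2_space[OF this G(1) Gb]
    have "(\<integral>x. (f x - f' x) * \<phi> x \<partial>vol G) = (\<integral>x. f x * \<phi> x \<partial>vol G) - (\<integral>x. f' x * \<phi> x \<partial>vol G)"
      unfolding left_diff_distrib by (intro Bochner_Integration.integral_diff L2_space_integrable_mult f \<phi>)
    also have "\<dots> = 0" using assms(1,2) t by (auto simp: has_weak_div_def)
    finally show "(\<integral>x. (f x - f' x) * \<phi> x \<partial>vol G) = 0" .
  qed simp
  then show ?thesis using AE_space by eventually_elim (simp add: space_restrict_space)
qed

lemma has_weak_div_weak_div: "q \<in> Hdiv G \<Longrightarrow> has_weak_div G q (weak_div G q)"
  unfolding Hdiv_def weak_div_def using someI[where P = "has_weak_div G q"] by auto

text \<open>\<open>green\<close> is defined through the chosen \<open>weak_div\<close>; this permits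
  its computation from an explicit divergence, such as that of the lift.\<close>

lemma green_eq:
  assumes w: "has_weak_div G q f" and \<phi>: "C1_function \<phi>" and q: "q \<in> L2_space (vol G)" and G: "bounded G" "open G"
  shows "green G q \<phi> = (\<integral>x. f x * \<phi> x + q x \<bullet> gradient \<phi> x \<partial>vol G)"
    "(\<integral>x. f x * \<phi> x + q x \<bullet> gradient \<phi> x \<partial>vol G) = (\<integral>x. f x * \<phi> x \<partial>vol G) + (\<integral>x. q x \<bullet> gradient \<phi> x \<partial>vol G)"
proof -
  have Gb: "G \<in> sets borel" using G(2) by simp
  note \<phi>L = C1_function_L2_space[OF \<phi> G(1) Gb]
  have w': "has_weak_div G q (weak_div G q)" using w q by (intro has_weak_div_weak_div) (auto simp: Hdiv_def)
  have f: "f \<in> L2_space (vol G)" "weak_div G q \<in> L2_space (vol G)" using w w' by (auto simp: has_weak_div_def)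
  have ae: "AE x in vol G. weak_div G q x = f x" by (rule has_weak_div_unique[OF w' w G])
  show "green G q \<phi> = (\<integral>x. f x * \<phi> x + q x \<bullet> gradient \<phi> x \<partial>vol G)"
    unfolding green_def
  proof (rule integral_cong_AE)
    show "(\<lambda>x. weak_div G q x * \<phi> x + q x \<bullet> gradient \<phi> x) \<in> borel_measurable (vol G)"
      "(\<lambda>x. f x * \<phi> x + q x \<bullet> gradient \<phi> x) \<in> borel_measurable (vol G)"
      using f q \<phi>L by (auto intro!: borel_measurable_add borel_measurable_times borel_measurable_inner dest!: L2_space_measurable)
    show "AE x in vol G. weak_div G q x * \<phi> x + q x \<bullet> gradient \<phi> x = f x * \<phi> x + q x \<bullet> gradient \<phi> x"
      using ae by eventually_elim simp
  qed
  show "(\<integral>x. f x * \<phi> x + q x \<bullet> gradient \<phi> x \<partial>vol G) = (\<integral>x. f x * \<phi> x \<partial>vol G) + (\<integral>x. q x \<bullet> gradient \<phi> x \<partial>vol G)"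
    by (intro Bochner_Integration.integral_add L2_space_integrable_mult L2_space_integrable_inner f q \<phi>L)
qed

lemma HdivI: "has_weak_div G q f \<Longrightarrow> q \<in> L2_space (vol G) \<Longrightarrow> q \<in> Hdiv G"
  by (auto simp: Hdiv_def)

lemma Hdiv_L2_space: "q \<in> Hdiv G \<Longrightarrow> q \<in> L2_space (vol G)"
  by (simp add: Hdiv_def)

lemma Hdiv_add:
  assumes "q \<in> Hdiv G" "q' \<in> Hdiv G" "bounded G" "open G"
  shows "(\<lambda>x. q x + q' x) \<in> Hdiv G"
  by (rule HdivI[OF has_weak_div_add[OF has_weak_div_weak_div has_weak_div_weak_div] L2_space_add])
    (use assms in \<open>auto intro: Hdiv_L2_space\<close>)

lemma Hdiv_scaleR:
  assumes "q \<in> Hdiv G" shows "(\<lambda>x. s *\<^sub>R q x) \<in> Hdiv G"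
  by (rule HdivI[OF has_weak_div_scaleR[OF has_weak_div_weak_div] L2_space_scaleR])
    (use assms in \<open>auto intro: Hdiv_L2_space\<close>)

lemma green_add:
  assumes q: "q \<in> Hdiv G" "q' \<in> Hdiv G" and G: "bounded G" "open G" and \<phi>: "C1_function \<phi>"
  shows "green G (\<lambda>x. q x + q' x) \<phi> = green G q \<phi> + green G q' \<phi>"
proof -
  have Gb: "G \<in> sets borel" using G(2) by simp
  note L = Hdiv_L2_space[OF q(1)] Hdiv_L2_space[OF q(2)]
  note w = has_weak_div_weak_div[OF q(1)] has_weak_div_weak_div[OF q(2)]
  note \<phi>L = C1_function_L2_space[OF \<phi> G(1) Gb]
  have f: "weak_div G q \<in> L2_space (vol G)" "weak_div G q' \<in> L2_space (vol G)"
    using w by (auto simp: has_weak_div_def)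
  have i: "integrable (vol G) (\<lambda>x. weak_div G q x * \<phi> x + q x \<bullet> gradient \<phi> x)"
    "integrable (vol G) (\<lambda>x. weak_div G q' x * \<phi> x + q' x \<bullet> gradient \<phi> x)"
    by (intro Bochner_Integration.integrable_add L2_space_integrable_mult L2_space_integrable_inner f L \<phi>L)+
  have "green G (\<lambda>x. q x + q' x) \<phi> = (\<integral>x. (weak_div G q x + weak_div G q' x) * \<phi> x + (q x + q' x) \<bullet> gradient \<phi> x \<partial>vol G)"
    by (rule green_eq[OF has_weak_div_add[OF w L G(1) Gb] \<phi> L2_space_add[OF L] G])
  also have "\<dots> = (\<integral>x. (weak_div G q x * \<phi> x + q x \<bullet> gradient \<phi> x) + (weak_div G q' x * \<phi> x + q' x \<bullet> gradient \<phi> x) \<partial>vol G)"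
    by (intro Bochner_Integration.integral_cong) (auto simp: inner_add_left algebra_simps)
  also have "\<dots> = green G q \<phi> + green G q' \<phi>"
    unfolding green_def by (rule Bochner_Integration.integral_add[OF i])
  finally show ?thesis .
qed

lemma green_scaleR:
  assumes q: "q \<in> Hdiv G" and G: "bounded G" "open G" and \<phi>: "C1_function \<phi>"
  shows "green G (\<lambda>x. s *\<^sub>R q x) \<phi> = s * green G q \<phi>"
proof -
  have "green G (\<lambda>x. s *\<^sub>R q x) \<phi> = (\<integral>x. (s * weak_div G q x) * \<phi> x + (s *\<^sub>R q x) \<bullet> gradient \<phi> x \<partial>vol G)"
    by (rule green_eq[OF has_weak_div_scaleR[OF has_weak_div_weak_div[OF q]] \<phi> L2_space_scaleR[OF Hdiv_L2_space[OF q]] G])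
  also have "\<dots> = (\<integral>x. s * (weak_div G q x * \<phi> x + q x \<bullet> gradient \<phi> x) \<partial>vol G)"
    by (intro Bochner_Integration.integral_cong) (auto simp: algebra_simps)
  also have "\<dots> = s * green G q \<phi>" unfolding green_def by simp
  finally show ?thesis .
qed

lemma green_AE_zero:
  assumes q: "q \<in> L2_space (vol G)" "AE x in vol G. q x = 0" and G: "bounded G" "open G" and \<phi>: "C1_function \<phi>"
  shows "green G q \<phi> = 0"
proof -
  have Gb: "G \<in> sets borel" using G(2) by simp
  have z: "(\<integral>x. q x \<bullet> gradient \<psi> x \<partial>vol G) = 0" if "C1_function \<psi>" for \<psi>
  proof -
    have "(\<integral>x. q x \<bullet> gradient \<psi> x \<partial>vol G) = (\<integral>x. 0 \<partial>vol G)"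
    proof (rule integral_cong_AE)
      show "(\<lambda>x. q x \<bullet> gradient \<psi> x) \<in> borel_measurable (vol G)"
        by (intro borel_measurable_inner L2_space_measurable q C1_function_L2_space[OF that G(1) Gb])
      show "AE x in vol G. q x \<bullet> gradient \<psi> x = 0" using q(2) by eventually_elim simp
    qed simp
    then show ?thesis by simp
  qed
  then have "has_weak_div G q (\<lambda>x. 0)"
    unfolding has_weak_div_def by (auto simp: L2_space_zero test_function_def)
  from green_eq[OF this \<phi> q(1) G] z[OF \<phi>] show ?thesis by simp
qed

section \<open>Square integrable normal traces\<close>

lemma C1_function_L2_space_surf:
  fixes G :: "(real^'n) set"
  assumes "C1_function \<phi>" and G: "polyhedral_domain G"
  shows "\<phi> \<in> L2_space (surf (frontier G))"
proof -
  have b: "bounded (frontier G)"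
    unfolding frontier_def by (rule bounded_diff[OF bounded_closure[OF polyhedral_domain_bounded[OF G]]])
  obtain B where B: "0 < B" "\<And>x. x \<in> frontier G \<Longrightarrow> norm (\<phi> x) \<le> B"
    using continuous_on_bounded_imp_bound[OF b C1_function_continuous_on[OF assms(1), of UNIV]] by blast
  have fin: "emeasure (surf (frontier G)) (space (surf (frontier G))) < \<infinity>"
    using surface_measure_frontier_finite[OF G] by (simp add: space_restrict_space emeasure_restrict_space)
  have "\<phi> \<in> borel_measurable (surface_measure)"
    using C1_function_borel_measurable[OF assms(1)] by simp
  then show ?thesis
    by (intro L2_space_bounded[OF _ fin, where B = B] measurable_restrict_space1) (use B(2) in \<open>auto simp: space_restrict_space\<close>)
qed

text \<open>The C1 functions with compact support in the whole space already determine a function on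
  the boundary, because the fundamental lemma holds for surface measure.\<close>

lemma has_normal_trace_unique:
  fixes G :: "(real^'n) set"
  assumes "has_normal_trace G q w" "has_normal_trace G q w'" and G: "polyhedral_domain G"
  shows "AE x in surf (frontier G). w x = w' x"
proof -
  have w: "w \<in> L2_space (surf (frontier G))" "w' \<in> L2_space (surf (frontier G))"
    using assms by (auto simp: has_normal_trace_def)
  have fin: "emeasure surface_measure (frontier G) < \<infinity>" by (rule surface_measure_frontier_finite[OF G])
  have "AE x in surf (frontier G). x \<in> UNIV \<longrightarrow> w x - w' x = 0"
  proof (rule AE_zero_if_orthogonal_to_test_functions[OF _ _ fin])
    show "(\<lambda>x. w x - w' x) \<in> L2_space (surf (frontier G))" by (rule L2_space_diff[OF w])
    fix \<phi> :: "real^'n \<Rightarrow> real" assume "test_function UNIV \<phi>"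
    then have \<phi>: "C1_function \<phi>" by (simp add: test_function_def)
    have \<phi>L: "\<phi> \<in> L2_space (surf (frontier G))"
      by (rule C1_function_L2_space_surf[OF \<phi> G])
    have "(\<integral>x. (w x - w' x) * \<phi> x \<partial>surf (frontier G)) = (\<integral>x. w x * \<phi> x \<partial>surf (frontier G)) - (\<integral>x. w' x * \<phi> x \<partial>surf (frontier G))"
      unfolding left_diff_distrib by (intro Bochner_Integration.integral_diff L2_space_integrable_mult w \<phi>L)
    also have "\<dots> = 0" using assms(1,2) \<phi> by (metis diff_self has_normal_trace_def)
    finally show "(\<integral>x. (w x - w' x) * \<phi> x \<partial>surf (frontier G)) = 0" .
  qed auto
  then show ?thesis by simp
qed

lemma has_normal_trace_add:
  fixes G :: "(real^'n) set"
  assumes "has_normal_trace G q w" "has_normal_trace G q' w'" "q \<in> Hdiv G" "q' \<in> Hdiv G"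
    and G: "polyhedral_domain G"
  shows "has_normal_trace G (\<lambda>x. q x + q' x) (\<lambda>x. w x + w' x)"
  unfolding has_normal_trace_def
proof (intro conjI allI impI)
  have w: "w \<in> L2_space (surf (frontier G))" "w' \<in> L2_space (surf (frontier G))"
    using assms by (auto simp: has_normal_trace_def)
  then show "(\<lambda>x. w x + w' x) \<in> L2_space (surf (frontier G))" by (rule L2_space_add)
  fix \<phi> :: "real^'n \<Rightarrow> real" assume \<phi>: "C1_function \<phi>"
  have o: "open G" using G by (simp add: polyhedral_domain_def)
  have "(\<integral>x. (w x + w' x) * \<phi> x \<partial>surf (frontier G)) = (\<integral>x. w x * \<phi> x \<partial>surf (frontier G)) + (\<integral>x. w' x * \<phi> x \<partial>surf (frontier G))"
    unfolding distrib_right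
    by (intro Bochner_Integration.integral_add L2_space_integrable_mult w C1_function_L2_space_surf[OF \<phi> G])
  then show "green G (\<lambda>x. q x + q' x) \<phi> = (\<integral>x. (w x + w' x) * \<phi> x \<partial>surf (frontier G))"
    using green_add[OF assms(3,4) polyhedral_domain_bounded[OF G] o \<phi>] assms(1,2) \<phi> by (simp add: has_normal_trace_def)
qed

lemma has_normal_trace_scaleR:
  fixes G :: "(real^'n) set"
  assumes "has_normal_trace G q w" "q \<in> Hdiv G" and G: "polyhedral_domain G"
  shows "has_normal_trace G (\<lambda>x. s *\<^sub>R q x) (\<lambda>x. s * w x)"
  unfolding has_normal_trace_def
proof (intro conjI allI impI)
  have "w \<in> L2_space (surf (frontier G))" using assms by (auto simp: has_normal_trace_def)
  from L2_space_scaleR[OF this, of s] show "(\<lambda>x. s * w x) \<in> L2_space (surf (frontier G))" by simp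
  fix \<phi> :: "real^'n \<Rightarrow> real" assume \<phi>: "C1_function \<phi>"
  have o: "open G" using G by (simp add: polyhedral_domain_def)
  show "green G (\<lambda>x. s *\<^sub>R q x) \<phi> = (\<integral>x. (s * w x) * \<phi> x \<partial>surf (frontier G))"
    using green_scaleR[OF assms(2) polyhedral_domain_bounded[OF G] o \<phi>] assms(1) \<phi>
    by (simp add: has_normal_trace_def mult.assoc)
qed

lemma has_normal_trace_AE_zero:
  fixes G :: "(real^'n) set"
  assumes "q \<in> L2_space (vol G)" "AE x in vol G. q x = 0" and G: "polyhedral_domain G"
  shows "has_normal_trace G q (\<lambda>x. 0)"
proof -
  have o: "open G" using G by (simp add: polyhedral_domain_def)
  show ?thesis
    unfolding has_normal_trace_def
    using green_AE_zero[OF assms(1,2) polyhedral_domain_bounded[OF G] o] by (simp add: L2_space_zero)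
qed

lemma has_normal_trace_normal_trace: "has_normal_trace G q w \<Longrightarrow> has_normal_trace G q (normal_trace G q)"
  unfolding normal_trace_def by (rule someI[where P = "has_normal_trace G q"])

lemma L2_space_restrict_mono:
  assumes "f \<in> L2_space (restrict_space M A)" "B \<subseteq> A" "A \<in> sets M" "B \<in> sets M"
  shows "f \<in> L2_space (restrict_space M B)"
    and "(L2_norm (restrict_space M B) f)\<^sup>2 \<le> (L2_norm (restrict_space M A) f)\<^sup>2"
proof -
  have sp: "A \<subseteq> space M" "B \<subseteq> space M" using assms sets.sets_into_space by blast+
  have B: "B \<inter> space (restrict_space M A) \<in> sets (restrict_space M A)"
    using assms(2-4) sp by (auto simp: space_restrict_space sets_restrict_space intro!: image_eqI[of _ _ B])
  have e: "restrict_space (restrict_space M A) B = restrict_space M B"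
    using assms(2-4) sp by (subst restrict_restrict_space) (auto simp: Int_absorb1 Int_absorb2)
  show "f \<in> L2_space (restrict_space M B)"
    using L2_space_restrict[OF assms(1) B] by (simp add: e)
  show "(L2_norm (restrict_space M B) f)\<^sup>2 \<le> (L2_norm (restrict_space M A) f)\<^sup>2"
    using L2_norm_restrict_le[OF assms(1) B] by (simp add: e)
qed

lemma gradient_eq_0:
  assumes \<phi>: "C1_function \<phi>" and K: "closed K" "\<And>x. x \<notin> K \<Longrightarrow> \<phi> x = 0" and x: "x \<notin> K"
  shows "gradient \<phi> x = 0"
proof -
  have "(\<phi> has_derivative (\<lambda>v. 0)) (at x)"
  proof (rule has_derivative_transform_within_open[of "\<lambda>x. 0"])
    show "((\<lambda>x. 0) has_derivative (\<lambda>v. 0)) (at x)" by simp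
    show "open (- K)" using K by (simp add: open_Compl)
  qed (use x K(2) in auto)
  then have "(\<lambda>v. gradient \<phi> x \<bullet> v) = (\<lambda>v. 0)"
    using has_derivative_unique[OF C1_function_has_derivative[OF \<phi>]] by metis
  then show ?thesis by (metis inner_eq_zero_iff)
qed

text \<open>A test function on B is zero off a compact subset of B, and so is its gradient; hence it
  is a test function on A, and the weak divergence on A restricts to B.\<close>

lemma Hdiv_restrict:
  assumes q: "q \<in> Hdiv A" and BA: "B \<subseteq> A" "A \<in> sets borel" "B \<in> sets borel"
    and p: "\<And>x. x \<in> B \<Longrightarrow> p x = q x"
  shows "p \<in> Hdiv B"
proof -
  obtain f where f: "has_weak_div A q f" using q by (auto simp: Hdiv_def)
  have qB: "q \<in> L2_space (vol B)" using L2_space_restrict_mono(1)[OF Hdiv_L2_space[OF q] BA(1)] BA by simp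
  have "p \<in> L2_space (vol B) \<longleftrightarrow> q \<in> L2_space (vol B)"
    unfolding L2_space_def
    using measurable_cong[of "vol B" p q borel] Bochner_Integration.integrable_cong[of "vol B" "vol B" "\<lambda>x. (norm (p x))\<^sup>2" "\<lambda>x. (norm (q x))\<^sup>2"] p
    by (auto simp: space_restrict_space)
  with qB have pB: "p \<in> L2_space (vol B)" by simp
  have "has_weak_div B p f"
    unfolding has_weak_div_def
  proof (intro conjI allI impI)
    show "f \<in> L2_space (vol B)"
      using f L2_space_restrict_mono(1)[OF _ BA(1), of f lborel] BA by (simp add: has_weak_div_def)
    fix \<phi> assume t: "test_function B \<phi>"
    then obtain K where K: "compact K" "K \<subseteq> B" "\<And>x. x \<notin> K \<Longrightarrow> \<phi> x = 0" and \<phi>: "C1_function \<phi>"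
      by (auto simp: test_function_def)
    have g0: "gradient \<phi> x = 0" if "x \<notin> K" for x
      using gradient_eq_0[OF \<phi> compact_imp_closed[OF K(1)] K(3) that] .
    have "test_function A \<phi>" using K \<phi> BA(1) by (auto simp: test_function_def)
    then have qf: "(\<integral>x. q x \<bullet> gradient \<phi> x \<partial>vol A) = - (\<integral>x. f x * \<phi> x \<partial>vol A)"
      using f by (simp add: has_weak_div_def)
    have e: "A \<inter> space lborel \<in> sets lborel" "B \<inter> space lborel \<in> sets lborel" using BA(2,3) by auto
    have pt: "indicator A x *\<^sub>R (q x \<bullet> gradient \<phi> x) = indicator B x *\<^sub>R (p x \<bullet> gradient \<phi> x)"
      "indicator A x *\<^sub>R (f x * \<phi> x) = indicator B x *\<^sub>R (f x * \<phi> x)" for x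
      using BA(1) K(2,3) g0 p by (cases "x \<in> K"; auto simp: subset_eq)+
    have "(\<integral>x. q x \<bullet> gradient \<phi> x \<partial>vol A) = (\<integral>x. p x \<bullet> gradient \<phi> x \<partial>vol B)"
      "(\<integral>x. f x * \<phi> x \<partial>vol A) = (\<integral>x. f x * \<phi> x \<partial>vol B)"
      unfolding integral_restrict_space[OF e(1)] integral_restrict_space[OF e(2)] pt by (rule refl)+
    then show "(\<integral>x. p x \<bullet> gradient \<phi> x \<partial>vol B) = - (\<integral>x. f x * \<phi> x \<partial>vol B)" using qf by simp
  qed
  then show ?thesis using pB by (rule HdivI)
qed

text \<open>The discrete fields have this property, see \<open>Xh_trace_regular\<close>. On such
  fields the choice made by \<open>mat_normal_trace\<close> is determined up to null sets and is
  linear in that sense.\<close>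

definition trace_regular :: "(real^'n) set \<Rightarrow> (real^'n \<Rightarrow> real^'n^'n) \<Rightarrow> bool" where
  "trace_regular G \<tau> \<longleftrightarrow>
     (\<forall>r. (\<lambda>x. \<tau> x $ r) \<in> Hdiv G \<and> (\<exists>w. has_normal_trace G (\<lambda>x. \<tau> x $ r) w))"

lemma trace_regular_Hdiv: "trace_regular G \<tau> \<Longrightarrow> (\<lambda>x. \<tau> x $ r) \<in> Hdiv G"
  by (simp add: trace_regular_def)

lemma trace_regular_L2_space: "trace_regular G \<tau> \<Longrightarrow> \<tau> \<in> L2_space (vol G)"
  by (subst L2_space_vec_iff) (auto simp: trace_regular_def intro: Hdiv_L2_space)

lemma trace_regular_has_normal_trace:
  assumes "trace_regular G \<tau>"
  shows "has_normal_trace G (\<lambda>x. \<tau> x $ r) (\<lambda>x. mat_normal_trace G \<tau> x $ r)"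
proof -
  obtain w where "has_normal_trace G (\<lambda>x. \<tau> x $ r) w" using assms unfolding trace_regular_def by blast
  from has_normal_trace_normal_trace[OF this] show ?thesis by (simp add: mat_normal_trace_def)
qed

lemma mat_normal_trace_L2_space:
  assumes "trace_regular G \<tau>"
  shows "mat_normal_trace G \<tau> \<in> L2_space (surf (frontier G))"
  using trace_regular_has_normal_trace[OF assms] by (subst L2_space_vec_iff) (simp add: has_normal_trace_def)

lemma mat_normal_trace_eq_AE:
  fixes G :: "(real^'n) set"
  assumes "polyhedral_domain G" and w: "\<And>r. has_normal_trace G (\<lambda>x. \<tau> x $ r) (\<lambda>x. w x $ r)"
  shows "AE x in surf (frontier G). mat_normal_trace G \<tau> x = w x"
proof -
  have "AE x in surf (frontier G). mat_normal_trace G \<tau> x $ r = w x $ r" for r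
    using has_normal_trace_unique[OF has_normal_trace_normal_trace[OF w] w assms(1), of r]
    by (simp add: mat_normal_trace_def)
  then have "AE x in surf (frontier G). \<forall>r. mat_normal_trace G \<tau> x $ r = w x $ r"
    by (simp add: AE_all_countable)
  then show ?thesis by eventually_elim (simp add: vec_eq_iff)
qed

lemma trace_regular_add:
  fixes G :: "(real^'n) set"
  assumes \<tau>: "trace_regular G \<tau>" "trace_regular G \<tau>'" and G: "polyhedral_domain G"
  shows "trace_regular G (\<lambda>x. \<tau> x + \<tau>' x)"
    "AE x in surf (frontier G). mat_normal_trace G (\<lambda>x. \<tau> x + \<tau>' x) x = mat_normal_trace G \<tau> x + mat_normal_trace G \<tau>' x"
proof -
  have o: "open G" using G by (simp add: polyhedral_domain_def)
  have t: "has_normal_trace G (\<lambda>x. (\<tau> x + \<tau>' x) $ r) (\<lambda>x. (mat_normal_trace G \<tau> x + mat_normal_trace G \<tau>' x) $ r)" for r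
    using has_normal_trace_add[OF trace_regular_has_normal_trace[OF \<tau>(1), of r] trace_regular_has_normal_trace[OF \<tau>(2), of r]
      trace_regular_Hdiv[OF \<tau>(1)] trace_regular_Hdiv[OF \<tau>(2)] G] by simp
  show "AE x in surf (frontier G). mat_normal_trace G (\<lambda>x. \<tau> x + \<tau>' x) x = mat_normal_trace G \<tau> x + mat_normal_trace G \<tau>' x"
    by (rule mat_normal_trace_eq_AE[OF G t])
  have "(\<lambda>x. (\<tau> x + \<tau>' x) $ r) \<in> Hdiv G" for r
    using Hdiv_add[OF trace_regular_Hdiv[OF \<tau>(1)] trace_regular_Hdiv[OF \<tau>(2)] polyhedral_domain_bounded[OF G] o, of r r] by simp
  with t show "trace_regular G (\<lambda>x. \<tau> x + \<tau>' x)" unfolding trace_regular_def by blast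
qed

lemma trace_regular_scaleR:
  fixes G :: "(real^'n) set"
  assumes \<tau>: "trace_regular G \<tau>" and G: "polyhedral_domain G"
  shows "trace_regular G (\<lambda>x. s *\<^sub>R \<tau> x)"
    "AE x in surf (frontier G). mat_normal_trace G (\<lambda>x. s *\<^sub>R \<tau> x) x = s *\<^sub>R mat_normal_trace G \<tau> x"
proof -
  have t: "has_normal_trace G (\<lambda>x. (s *\<^sub>R \<tau> x) $ r) (\<lambda>x. (s *\<^sub>R mat_normal_trace G \<tau> x) $ r)" for r
    using has_normal_trace_scaleR[OF trace_regular_has_normal_trace[OF \<tau>, of r] trace_regular_Hdiv[OF \<tau>] G, of s] by simp
  show "AE x in surf (frontier G). mat_normal_trace G (\<lambda>x. s *\<^sub>R \<tau> x) x = s *\<^sub>R mat_normal_trace G \<tau> x"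
    by (rule mat_normal_trace_eq_AE[OF G t])
  have "(\<lambda>x. (s *\<^sub>R \<tau> x) $ r) \<in> Hdiv G" for r
    using Hdiv_scaleR[OF trace_regular_Hdiv[OF \<tau>], of s r] by simp
  with t show "trace_regular G (\<lambda>x. s *\<^sub>R \<tau> x)" unfolding trace_regular_def by blast
qed

lemma mat_normal_trace_AE_zero:
  fixes G :: "(real^'n) set"
  assumes \<tau>: "trace_regular G \<tau>" "AE x in vol G. \<tau> x = 0" and G: "polyhedral_domain G"
  shows "AE x in surf (frontier G). mat_normal_trace G \<tau> x = 0"
proof (rule mat_normal_trace_eq_AE[OF G])
  fix r
  have "AE x in vol G. \<tau> x $ r = 0" using \<tau>(2) by eventually_elim simp
  then show "has_normal_trace G (\<lambda>x. \<tau> x $ r) (\<lambda>x. 0 $ r)"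
    using has_normal_trace_AE_zero[OF Hdiv_L2_space[OF trace_regular_Hdiv[OF \<tau>(1)]] _ G] by simp
qed

section \<open>Projection onto discrete normal traces\<close>

lemma negligible_minus_rel_interior:
  fixes E :: "'a::euclidean_space set"
  assumes "convex E" shows "negligible (E - rel_interior E)"
proof (rule negligible_subset[OF negligible_convex_frontier[OF assms]])
  show "E - rel_interior E \<subseteq> frontier E"
    using closure_subset[of E] interior_subset_rel_interior[of E] by (auto simp: frontier_def)
qed

lemma fe_partition_convex:
  assumes "fe_partition G \<T>" "E \<in> \<T>" shows "convex E"
proof -
  have "(int CARD('a) simplex E) \<or> rectangular_cell E"
    using assms by (auto simp: fe_partition_def)
  then show ?thesis
  proof
    assume "rectangular_cell E"
    then obtain f :: "real^'a \<Rightarrow> real^'a" and p a where E: "orthogonal_transformation f" "E = (\<lambda>x. p + f x) ` cbox 0 a"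
      by (auto simp: rectangular_cell_def)
    have "E = (+) p ` f ` cbox 0 a" using E(2) by (simp add: image_image)
    then show ?thesis
      using E(1) by (auto intro!: convex_translation convex_linear_image simp: orthogonal_transformation_linear)
  qed (rule convex_simplex)
qed

lemma finite_multiindices: "finite {\<alpha> :: 'n::finite \<Rightarrow> nat. sum \<alpha> UNIV \<le> k}"
proof (rule finite_subset)
  show "{\<alpha> :: 'n \<Rightarrow> nat. sum \<alpha> UNIV \<le> k} \<subseteq> PiE UNIV (\<lambda>_. {..k})"
  proof
    fix \<alpha> :: "'n \<Rightarrow> nat" assume "\<alpha> \<in> {\<alpha>. sum \<alpha> UNIV \<le> k}"
    moreover have "\<alpha> j \<le> sum \<alpha> UNIV" for j by (rule member_le_sum) auto
    ultimately show "\<alpha> \<in> PiE UNIV (\<lambda>_. {..k})" by (auto intro: order_trans)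
  qed
qed (simp add: finite_PiE)

text \<open>Up to a null set every element is a combination of monomials on the relative interiors
  of the cells, with one degree bound for the whole space. These truncated monomials may lie outside
  V, as \<open>finite_span_Riesz\<close> permits.\<close>

lemma fe_space_finite_span:
  fixes V :: "(real^'n \<Rightarrow> 'b::euclidean_space) set"
  assumes T: "fe_partition G \<T>" and V: "fe_space \<T> V" and G: "G \<in> sets borel"
  shows "\<exists>(n :: nat) e. \<forall>v\<in>V. \<exists>c. AE x in vol G. v x = (\<Sum>k<n. c k *\<^sub>R e k x)"
proof -
  obtain k where k: "\<And>v. v \<in> V \<Longrightarrow> piecewise_polynomial k \<T> v" using V by (auto simp: fe_space_def)
  have finT: "finite \<T>" and cov: "\<Union>\<T> = closure G" using T by (auto simp: fe_partition_def)
  define I where "I = {\<alpha> :: 'n \<Rightarrow> nat. sum \<alpha> UNIV \<le> k}"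
  define J where "J = \<T> \<times> (Basis :: 'b set) \<times> I"
  have finJ: "finite J" unfolding J_def I_def by (intro finite_cartesian_product finT finite_multiindices) simp
  define e where "e = (\<lambda>(E, b :: 'b, \<alpha>) (x :: real^'n). if x \<in> rel_interior E then (\<Prod>j\<in>UNIV. (x $ j) ^ \<alpha> j) *\<^sub>R b else 0)"
  obtain h where h: "bij_betw h {..<card J} J"
    using ex_bij_betw_nat_finite[OF finJ] by (auto simp: atLeast0LessThan)
  have negl: "negligible (\<Union>E\<in>\<T>. E - rel_interior E)"
    using finT fe_partition_convex[OF T] by (intro negligible_Union) (auto intro!: negligible_minus_rel_interior)
  have "AE x in lborel. x \<notin> (\<Union>E\<in>\<T>. E - rel_interior E)"
    using AE_not_in[OF negl[unfolded negligible_iff_null_sets]] by (simp add: AE_completion_iff)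
  then have ae: "AE x in vol G. \<exists>E\<in>\<T>. x \<in> rel_interior E"
  proof (subst AE_restrict_space_iff)
    show "AE x in lborel. x \<in> G \<longrightarrow> (\<exists>E\<in>\<T>. x \<in> rel_interior E)"
      using \<open>AE x in lborel. x \<notin> (\<Union>E\<in>\<T>. E - rel_interior E)\<close>
    proof (rule eventually_mono, intro impI)
      fix x assume x: "x \<notin> (\<Union>E\<in>\<T>. E - rel_interior E)" and "x \<in> G"
      then have "x \<in> \<Union>\<T>" using closure_subset[of G] unfolding cov by blast
      then show "\<exists>E\<in>\<T>. x \<in> rel_interior E" using x by blast
    qed
  qed (use G in simp)
  show ?thesis
  proof (intro exI[of _ "card J"] exI[of _ "\<lambda>k. e (h k)"] ballI)
    fix v assume v: "v \<in> V"
    define C where "C = (\<lambda>E b. SOME c. \<forall>x\<in>rel_interior E. v x \<bullet> b = (\<Sum>\<alpha>\<in>I. c \<alpha> * (\<Prod>j\<in>UNIV. (x $ j) ^ \<alpha> j)))"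
    have C: "v x \<bullet> b = (\<Sum>\<alpha>\<in>I. C E b \<alpha> * (\<Prod>j\<in>UNIV. (x $ j) ^ \<alpha> j))"
      if Eb: "E \<in> \<T>" "b \<in> Basis" "x \<in> rel_interior E" for E b x
    proof -
      obtain p where p: "polynomial_deg_le k p" "\<forall>x\<in>rel_interior E. v x \<bullet> b = p x"
        using k[OF v] Eb(1,2) unfolding piecewise_polynomial_def by blast
      then obtain c where "\<forall>x. p x = (\<Sum>\<alpha>\<in>I. c \<alpha> * (\<Prod>j\<in>UNIV. (x $ j) ^ \<alpha> j))"
        unfolding polynomial_deg_le_def I_def by blast
      then have "\<exists>c. \<forall>x\<in>rel_interior E. v x \<bullet> b = (\<Sum>\<alpha>\<in>I. c \<alpha> * (\<Prod>j\<in>UNIV. (x $ j) ^ \<alpha> j))"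
        using p(2) by (intro exI[of _ c]) simp
      from someI_ex[OF this] Eb(3) show ?thesis unfolding C_def by blast
    qed
    define c where "c = (\<lambda>(E, b, \<alpha>). C E b \<alpha>)"
    have "v x = (\<Sum>k<card J. c (h k) *\<^sub>R e (h k) x)" if E0: "E0 \<in> \<T>" "x \<in> rel_interior E0" for x E0
    proof -
      \<comment> \<open>Distinct cells have disjoint relative interiors: their intersection is a
        face of each, and a face that meets the relative interior is the whole cell.\<close>
      have other: "x \<notin> rel_interior E" if "E \<in> \<T>" "E \<noteq> E0" for E
      proof
        assume x: "x \<in> rel_interior E"
        have f: "E \<inter> E0 face_of E" "E \<inter> E0 face_of E0" using T that E0 by (auto simp: fe_partition_def)
        have xx: "x \<in> E \<inter> E0" using x E0 rel_interior_subset by blast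
        have "E \<inter> E0 = E" using face_of_disjoint_rel_interior[OF f(1)] x xx by blast
        moreover have "E \<inter> E0 = E0" using face_of_disjoint_rel_interior[OF f(2)] E0 xx by blast
        ultimately show False using that by simp
      qed
      have "(\<Sum>k<card J. c (h k) *\<^sub>R e (h k) x) = (\<Sum>p\<in>J. c p *\<^sub>R e p x)"
        by (rule sum.reindex_bij_betw[OF h, of "\<lambda>p. c p *\<^sub>R e p x"])
      also have "\<dots> = (\<Sum>E\<in>\<T>. \<Sum>q\<in>Basis \<times> I. c (E, q) *\<^sub>R e (E, q) x)"
        unfolding J_def by (simp add: sum.cartesian_product)
      also have "\<dots> = (\<Sum>E\<in>\<T>. if E = E0 then \<Sum>q\<in>Basis \<times> I. c (E0, q) *\<^sub>R e (E0, q) x else 0)"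
      proof (rule sum.cong[OF refl])
        fix E assume E: "E \<in> \<T>"
        have "e (E, q) x = 0" if "E \<noteq> E0" for q using other[OF E that] by (cases q) (simp add: e_def)
        then show "(\<Sum>q\<in>Basis \<times> I. c (E, q) *\<^sub>R e (E, q) x) =
            (if E = E0 then \<Sum>q\<in>Basis \<times> I. c (E0, q) *\<^sub>R e (E0, q) x else 0)" by simp
      qed
      also have "\<dots> = (\<Sum>q\<in>Basis \<times> I. c (E0, q) *\<^sub>R e (E0, q) x)" using finT E0(1) by simp
      also have "\<dots> = (\<Sum>b\<in>Basis. \<Sum>\<alpha>\<in>I. c (E0, b, \<alpha>) *\<^sub>R e (E0, b, \<alpha>) x)"
        by (simp add: sum.cartesian_product)
      also have "\<dots> = (\<Sum>b\<in>Basis. (v x \<bullet> b) *\<^sub>R b)"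
        using E0 by (intro sum.cong refl) (simp add: c_def e_def C[OF E0(1) _ E0(2)] scaleR_sum_left)
      also have "\<dots> = v x" by (rule euclidean_representation)
      finally show ?thesis by simp
    qed
    then have "AE x in vol G. v x = (\<Sum>k<card J. c (h k) *\<^sub>R e (h k) x)"
      using ae by (auto elim!: eventually_mono)
    then show "\<exists>c. AE x in vol G. v x = (\<Sum>k<card J. c k *\<^sub>R e (h k) x)" by (intro exI[of _ "\<lambda>k. c (h k)"])
  qed
qed

text \<open>\<open>L2_projection\<close> is a choice by \<open>SOME\<close>, so existence has to be
  shown. The chosen traces form a linear space just up to null sets; therefore Riesz is applied on V
  to the inner product of traces, a form that is only semidefinite because nonzero fields can have
  zero trace.\<close>

lemma L2_projection_onto_traces:
  fixes V :: "(real^'n \<Rightarrow> real^'n^'n) set"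
  assumes G: "polyhedral_domain G" and T: "fe_partition G \<T>" and V: "fe_space \<T> V"
    and reg: "\<And>\<tau>. \<tau> \<in> V \<Longrightarrow> trace_regular G \<tau>" and f: "f \<in> L2_space (surf (frontier G))"
  shows "is_L2_projection (surf (frontier G)) (mat_normal_trace G ` V) f
    (L2_projection (surf (frontier G)) (mat_normal_trace G ` V) f)"
proof -
  let ?M = "surf (frontier G)" and ?t = "mat_normal_trace G"
  have Gb: "G \<in> sets borel" using G by (auto simp: polyhedral_domain_def)
  obtain n :: nat and e where span: "\<And>v. v \<in> V \<Longrightarrow> \<exists>c. AE x in vol G. v x = (\<Sum>k<n. c k *\<^sub>R e k x)"
    using fe_space_finite_span[OF T V Gb] by blast
  have sub: "function_subspace V" using V by (simp add: fe_space_def)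
  have Vadd: "(\<lambda>x. u x + v x) \<in> V" if "u \<in> V" "v \<in> V" for u v
    using sub that by (simp add: function_subspace_def)
  have Vscale: "(\<lambda>x. s *\<^sub>R u x) \<in> V" if "u \<in> V" for u s
    using sub that by (simp add: function_subspace_def)
  have tL: "?t u \<in> L2_space ?M" if "u \<in> V" for u by (rule mat_normal_trace_L2_space[OF reg[OF that]])
  have t_add: "L2_inner ?M (?t (\<lambda>x. u x + v x)) w = L2_inner ?M (?t u) w + L2_inner ?M (?t v) w"
    if uv: "u \<in> V" "v \<in> V" and w: "w \<in> L2_space ?M" for u v w
  proof -
    have "L2_inner ?M (?t (\<lambda>x. u x + v x)) w = L2_inner ?M (\<lambda>x. ?t u x + ?t v x) w"
      using tL uv w Vadd L2_space_add[OF tL[OF uv(1)] tL[OF uv(2)]]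
      by (intro L2_inner_cong_AE trace_regular_add reg G) (auto intro: L2_space_measurable)
    then show ?thesis using L2_inner_add_left[OF tL[OF uv(1)] tL[OF uv(2)] w] by simp
  qed
  have t_scale: "L2_inner ?M (?t (\<lambda>x. s *\<^sub>R u x)) w = s * L2_inner ?M (?t u) w"
    if u: "u \<in> V" and w: "w \<in> L2_space ?M" for u w s
  proof -
    have "L2_inner ?M (?t (\<lambda>x. s *\<^sub>R u x)) w = L2_inner ?M (\<lambda>x. s *\<^sub>R ?t u x) w"
      using tL u w Vscale L2_space_scaleR[OF tL[OF u], of s]
      by (intro L2_inner_cong_AE trace_regular_scaleR reg G) (auto intro: L2_space_measurable)
    then show ?thesis by (simp add: L2_inner_scaleR_left)
  qed
  have "\<exists>v\<in>V. \<forall>w\<in>V. L2_inner ?M (?t v) (?t w) = L2_inner ?M (?t w) f"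
  proof (rule finite_span_Riesz[where M = "vol G" and e = e and n = n and b = "\<lambda>v w. L2_inner ?M (?t v) (?t w)"
        and l = "\<lambda>w. L2_inner ?M (?t w) f", OF sub span])
    fix u assume u: "u \<in> V"
    show "0 \<le> L2_inner ?M (?t u) (?t u)" by (simp add: L2_inner_self)
    show "L2_inner ?M (?t u) (?t u) = 0" if "AE x in vol G. u x = 0"
    proof -
      have "L2_norm ?M (?t u) = 0"
        using mat_normal_trace_AE_zero[OF reg[OF u] that G] by (simp add: L2_norm_eq_0_iff[OF tL[OF u]])
      then show ?thesis by (simp add: L2_inner_self)
    qed
    show "L2_inner ?M (?t u) f = 0" if "L2_inner ?M (?t u) (?t u) = 0"
      using L2_Cauchy_Schwarz[OF tL[OF u] f] that by (simp add: L2_inner_self)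
  qed (use t_add t_scale tL f L2_inner_commute in auto)
  then obtain v where v: "v \<in> V" "\<And>w. w \<in> V \<Longrightarrow> L2_inner ?M (?t v) (?t w) = L2_inner ?M (?t w) f" by blast
  have "is_L2_projection ?M (?t ` V) f (?t v)"
    unfolding is_L2_projection_def
  proof (intro conjI ballI)
    fix s assume "s \<in> ?t ` V"
    then obtain w where w: "w \<in> V" "s = ?t w" by blast
    show "L2_inner ?M (\<lambda>x. f x - ?t v x) s = 0"
      unfolding w(2) using v(2)[OF w(1)] L2_inner_diff_left[OF f tL[OF v(1)] tL[OF w(1)]]
      by (simp add: L2_inner_commute)
  qed (use v in auto)
  then show ?thesis
    unfolding L2_projection_def by (rule someI[where P = "is_L2_projection ?M (?t ` V) f"])
qed

section \<open>Discrete fluxes on one subdomain\<close>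

lemma valid_discretization_subdomain:
  assumes D: "valid_discretization g D" and i: "i \<in> {1..num_sub g}"
  shows "fe_partition (subdomain g i) (Th D i)" "fe_space (Th D i) (Xh D i)"
    "Xh D i \<subseteq> restrict_functions (subdomain g i) (X_space g)"
    "\<forall>\<tau>\<in>Xh D i. \<forall>r. \<exists>w. has_normal_trace (subdomain g i) (\<lambda>x. \<tau> x $ r) w"
    "fe_space (Th D i) (Vh D i)" "fe_space (Th D i) (Qh D i)"
proof -
  note v = bspec[OF conjunct1[OF D[unfolded valid_discretization_def]] i]
  show "fe_partition (subdomain g i) (Th D i)" using v by (elim conjE)
  show "fe_space (Th D i) (Xh D i)" using v by (elim conjE)
  show "Xh D i \<subseteq> restrict_functions (subdomain g i) (X_space g)" using v by (elim conjE)
  show "\<forall>\<tau>\<in>Xh D i. \<forall>r. \<exists>w. has_normal_trace (subdomain g i) (\<lambda>x. \<tau> x $ r) w" using v by (elim conjE)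
  show "fe_space (Th D i) (Vh D i)" using v by (elim conjE)
  show "fe_space (Th D i) (Qh D i)" using v by (elim conjE)
qed

lemma Xh_trace_regular:
  fixes g :: "'n::finite geometry"
  assumes g: "valid_geometry g" and D: "valid_discretization g D" and i: "i \<in> {1..num_sub g}" and \<tau>: "\<tau> \<in> Xh D i"
  shows "trace_regular (subdomain g i) \<tau>"
proof -
  note geo = valid_geometry_facts[OF g]
  note X = valid_discretization_subdomain(3)[OF D i] and tr = valid_discretization_subdomain(4)[OF D i]
  obtain \<sigma> where \<sigma>: "\<sigma> \<in> X_space g" "\<forall>x\<in>subdomain g i. \<tau> x = \<sigma> x"
    using X \<tau> unfolding restrict_functions_def by blast
  have "(\<lambda>x. \<tau> x $ r) \<in> Hdiv (subdomain g i)" for r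
  proof (rule Hdiv_restrict)
    show "(\<lambda>x. \<sigma> x $ r) \<in> Hdiv (domain g)" using \<sigma>(1) by (simp add: X_space_def mat_Hdiv_def)
    show "subdomain g i \<subseteq> domain g" by (rule geo(6)[OF i])
    show "domain g \<in> sets borel" "subdomain g i \<in> sets borel" using geo(1) geo(4)[OF i] by auto
  qed (use \<sigma>(2) in simp)
  then show ?thesis using tr \<tau> unfolding trace_regular_def by blast
qed

section \<open>Lift of vector-valued interface data\<close>

lemma L2_norm_vec_power2:
  fixes f :: "'a \<Rightarrow> ('b::euclidean_space)^'m"
  assumes "\<And>r. (\<lambda>x. f x $ r) \<in> L2_space M"
  shows "(L2_norm M f)\<^sup>2 = (\<Sum>r\<in>UNIV. (L2_norm M (\<lambda>x. f x $ r))\<^sup>2)"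
  using L2_inner_vec[of f M f] assms L2_space_vec_iff[of f M] by (simp add: L2_inner_self)

lemma slobodeckij_vec:
  fixes f :: "real^'n \<Rightarrow> ('b::euclidean_space)^'m"
  assumes m: "\<And>r. (\<lambda>x. f x $ r) \<in> borel_measurable (vol G)" and G: "G \<in> sets borel" and s: "s \<noteq> 0"
  shows "slobodeckij s G f = (\<Sum>r\<in>UNIV. slobodeckij s G (\<lambda>x. f x $ r))"
proof -
  interpret sigma_finite_measure "vol G"
    using G by (intro sigma_finite_measure_restrict_space sigma_finite_lborel) auto
  note [measurable] = m
  have idm [measurable]: "(\<lambda>x. x) \<in> borel_measurable (vol G)" by (rule measurable_restrict_space1) simp
  have 1: "ennreal ((norm (f x - f y))\<^sup>2 / p) = (\<Sum>r\<in>UNIV. ennreal ((norm (f x $ r - f y $ r))\<^sup>2 / p))" if "0 \<le> p" for x y p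
  proof -
    have "(norm (f x - f y))\<^sup>2 = (\<Sum>r\<in>UNIV. (norm (f x $ r - f y $ r))\<^sup>2)"
      by (simp add: norm_vec_def L2_set_def sum_nonneg)
    then show ?thesis using that by (simp add: sum_divide_distrib)
  qed
  have 2: "(\<lambda>y. ennreal ((norm (f x $ r - f y $ r))\<^sup>2 / dist x y powr (real CARD('n) + 2 * s))) \<in> borel_measurable (vol G)" for x r
    by measurable
  have 3: "(\<lambda>x. \<integral>\<^sup>+y. ennreal ((norm (f x $ r - f y $ r))\<^sup>2 / dist x y powr (real CARD('n) + 2 * s)) \<partial>vol G) \<in> borel_measurable (vol G)" for r
    by measurable
  show ?thesis
    unfolding slobodeckij_def
    by (simp only: s if_False 1[OF powr_ge_zero] nn_integral_sum[OF 2] nn_integral_sum[OF 3])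
qed

text \<open>Row by row from \<open>scalar_lift\<close>; the squared norms and the squared seminorm
  add up over the rows. In the constant, 2 C collects the two parts of the Sobolev norm and C is the
  bound for the divergence.\<close>

lemma tensor_lift:
  fixes g :: "'n::finite geometry"
  assumes g: "valid_geometry g" and i: "i \<in> {1..num_sub g}"
  obtains C where "0 \<le> C"
    "\<And>\<mu> :: real^'n \<Rightarrow> real^'n. \<mu> \<in> L2_space (surf (Gamma_all g)) \<Longrightarrow>
      \<exists>\<tau>. \<tau> \<in> sobolev_space (1/8) (subdomain g i) \<inter> restrict_functions (subdomain g i) (X_space g) \<and>
        (\<forall>r. (\<lambda>x. \<tau> x $ r) \<in> Hdiv (subdomain g i) \<and>
          has_normal_trace (subdomain g i) (\<lambda>x. \<tau> x $ r) (\<lambda>x. extend_by_zero (Gamma_all g) \<mu> x $ r)) \<and>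
        sobolev_norm (1/8) (subdomain g i) \<tau> + L2_norm (vol (subdomain g i)) (mat_div (subdomain g i) \<tau>)
          \<le> C * L2_norm (surf (Gamma_all g)) \<mu>"
proof -
  let ?\<Omega> = "domain g" and ?G = "subdomain g i" and ?S = "Gamma_sub g i" and ?\<Gamma> = "Gamma_all g"
  note geo = valid_geometry_facts[OF g]
  obtain C where C: "0 \<le> C"
    "\<And>f :: real^'n \<Rightarrow> real. f \<in> borel_measurable borel \<Longrightarrow> (\<And>y. y \<notin> ?S \<Longrightarrow> f y = 0) \<Longrightarrow>
       integrable surface_measure (\<lambda>y. (f y)\<^sup>2) \<Longrightarrow>
     \<exists>q D. q \<in> L2_space (vol ?\<Omega>) \<and>
       (\<exists>D0. has_weak_div ?\<Omega> q D0 \<and>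
         (\<forall>\<phi>. C1_function \<phi> \<longrightarrow> (\<integral>x. D0 x * \<phi> x + q x \<bullet> gradient \<phi> x \<partial>vol ?\<Omega>) = 0)) \<and>
       has_weak_div ?G q D \<and>
       (\<forall>\<phi>. C1_function \<phi> \<longrightarrow>
         (\<integral>x. D x * \<phi> x + q x \<bullet> gradient \<phi> x \<partial>vol ?G) = (\<integral>y. f y * \<phi> y \<partial>surface_measure)) \<and>
       (L2_norm (vol ?G) q)\<^sup>2 \<le> C * (\<integral>y. (f y)\<^sup>2 \<partial>surface_measure) \<and>
       slobodeckij (1/8) ?G q \<le> ennreal (C * (\<integral>y. (f y)\<^sup>2 \<partial>surface_measure)) \<and>
       (L2_norm (vol ?G) D)\<^sup>2 \<le> C * (\<integral>y. (f y)\<^sup>2 \<partial>surface_measure)"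
    by (rule scalar_lift[OF g i]) blast
  have Gb: "?G \<in> sets borel" using geo(4)[OF i] by simp
  have Gm: "bounded ?G" "open ?G" using geo(4,5)[OF i] by auto
  have \<Omega>m: "bounded ?\<Omega>" "open ?\<Omega>" using geo(1,2) by auto
  have \<Gamma>b: "?\<Gamma> \<in> sets borel" and Sb: "?S \<in> sets borel"
    using closed_Gamma_all closed_Gamma_sub by (auto intro: borel_closed)
  have S\<Gamma>: "?S \<subseteq> ?\<Gamma>" and SF: "?S \<subseteq> frontier ?G" by (auto simp: Gamma_sub_def)
  show ?thesis
  proof (rule that[of "sqrt (2 * C) + sqrt C"])
    show "0 \<le> sqrt (2 * C) + sqrt C" using C(1) by simp
    fix \<mu> :: "real^'n \<Rightarrow> real^'n" assume \<mu>: "\<mu> \<in> L2_space (surf ?\<Gamma>)"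
    \<comment> \<open>\<open>scalar_lift\<close> asks for Borel functions on the whole space, while
      \<mu> is constrained on the interfaces alone; hence the extension by zero.\<close>
    define \<mu>0 where "\<mu>0 = (\<lambda>x. indicator ?\<Gamma> x *\<^sub>R \<mu> x)"
    have \<mu>0m [measurable]: "\<mu>0 \<in> borel_measurable borel"
      using L2_space_measurable[OF \<mu>] \<Gamma>b unfolding \<mu>0_def
      by (subst (asm) borel_measurable_restrict_space_iff) auto
    have \<mu>2: "integrable surface_measure (\<lambda>x. (norm (\<mu>0 x))\<^sup>2)"
      "(\<integral>x. (norm (\<mu>0 x))\<^sup>2 \<partial>surface_measure) = (L2_norm (surf ?\<Gamma>) \<mu>)\<^sup>2"
    proof -
      have e: "(norm (\<mu>0 x))\<^sup>2 = indicator ?\<Gamma> x *\<^sub>R (norm (\<mu> x))\<^sup>2" for x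
        by (simp add: \<mu>0_def indicator_def)
      show "integrable surface_measure (\<lambda>x. (norm (\<mu>0 x))\<^sup>2)"
        using L2_space_integrable_square[OF \<mu>] \<Gamma>b unfolding e by (subst (asm) integrable_restrict_space) auto
      show "(\<integral>x. (norm (\<mu>0 x))\<^sup>2 \<partial>surface_measure) = (L2_norm (surf ?\<Gamma>) \<mu>)\<^sup>2"
        unfolding L2_norm_power2 e using \<Gamma>b by (subst integral_restrict_space) auto
    qed
    define f where "f = (\<lambda>r y. indicator ?S y * (\<mu>0 y $ r))"
    have fm [measurable]: "f r \<in> borel_measurable borel" for r
      using Sb unfolding f_def by measurable
    have f_le: "(\<Sum>r\<in>UNIV. (f r y)\<^sup>2) \<le> (norm (\<mu>0 y))\<^sup>2" for y
    proof -
      have "(norm (\<mu>0 y))\<^sup>2 = (\<Sum>r\<in>UNIV. (\<mu>0 y $ r)\<^sup>2)" by (simp add: norm_vec_def L2_set_def sum_nonneg)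
      then show ?thesis by (auto simp: f_def indicator_def intro!: sum_nonneg)
    qed
    have f2: "integrable surface_measure (\<lambda>y. (f r y)\<^sup>2)" for r
    proof (rule Bochner_Integration.integrable_bound[OF \<mu>2(1)])
      have "(f r y)\<^sup>2 \<le> (\<Sum>r\<in>UNIV. (f r y)\<^sup>2)" for y by (rule member_le_sum) auto
      then have "(f r y)\<^sup>2 \<le> (norm (\<mu>0 y))\<^sup>2" for y using f_le order_trans by blast
      then show "AE y in surface_measure. norm ((f r y)\<^sup>2) \<le> norm ((norm (\<mu>0 y))\<^sup>2)" by simp
    qed measurable
    define Q where "Q = (\<lambda>r. \<integral>y. (f r y)\<^sup>2 \<partial>surface_measure)"
    have Q_sum: "(\<Sum>r\<in>UNIV. Q r) \<le> (L2_norm (surf ?\<Gamma>) \<mu>)\<^sup>2"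
    proof -
      have "(\<Sum>r\<in>UNIV. Q r) = (\<integral>y. (\<Sum>r\<in>UNIV. (f r y)\<^sup>2) \<partial>surface_measure)"
        unfolding Q_def by (rule Bochner_Integration.integral_sum[symmetric]) (rule f2)
      also have "\<dots> \<le> (\<integral>x. (norm (\<mu>0 x))\<^sup>2 \<partial>surface_measure)"
        by (intro integral_mono Bochner_Integration.integrable_sum f2 \<mu>2(1) f_le)
      finally show ?thesis by (simp add: \<mu>2(2))
    qed
    define R where "R = (\<lambda>r q D D0. q \<in> L2_space (vol ?\<Omega>) \<and> has_weak_div ?\<Omega> q D0 \<and>
         (\<forall>\<phi>. C1_function \<phi> \<longrightarrow> (\<integral>x. D0 x * \<phi> x + q x \<bullet> gradient \<phi> x \<partial>vol ?\<Omega>) = 0) \<and>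
       has_weak_div ?G q D \<and>
       (\<forall>\<phi>. C1_function \<phi> \<longrightarrow>
         (\<integral>x. D x * \<phi> x + q x \<bullet> gradient \<phi> x \<partial>vol ?G) = (\<integral>y. f r y * \<phi> y \<partial>surface_measure)) \<and>
       (L2_norm (vol ?G) q)\<^sup>2 \<le> C * Q r \<and> slobodeckij (1/8) ?G q \<le> ennreal (C * Q r) \<and>
       (L2_norm (vol ?G) D)\<^sup>2 \<le> C * Q r)"
    have "\<exists>q D D0. R r q D D0" for r
    proof -
      have "f r y = 0" if "y \<notin> ?S" for y using that by (simp add: f_def)
      from C(2)[OF fm this f2] show ?thesis unfolding Q_def R_def by blast
    qed
    then obtain q D D0 where R: "\<And>r. R r (q r) (D r) (D0 r)" by metis
    have q: "\<And>r. q r \<in> L2_space (vol ?\<Omega>)" "\<And>r. has_weak_div ?\<Omega> (q r) (D0 r)"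
      "\<And>r \<phi>. C1_function \<phi> \<Longrightarrow> (\<integral>x. D0 r x * \<phi> x + q r x \<bullet> gradient \<phi> x \<partial>vol ?\<Omega>) = 0"
      "\<And>r. has_weak_div ?G (q r) (D r)"
      "\<And>r \<phi>. C1_function \<phi> \<Longrightarrow>
         (\<integral>x. D r x * \<phi> x + q r x \<bullet> gradient \<phi> x \<partial>vol ?G) = (\<integral>y. f r y * \<phi> y \<partial>surface_measure)"
      "\<And>r. (L2_norm (vol ?G) (q r))\<^sup>2 \<le> C * Q r" "\<And>r. slobodeckij (1/8) ?G (q r) \<le> ennreal (C * Q r)"
      "\<And>r. (L2_norm (vol ?G) (D r))\<^sup>2 \<le> C * Q r"
      using R unfolding R_def by simp_all
    define \<tau> where "\<tau> = (\<lambda>x. \<chi> r. q r x)"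
    have row: "(\<lambda>x. \<tau> x $ r) = q r" for r by (simp add: \<tau>_def)
    have qG: "q r \<in> L2_space (vol ?G)" for r
      using L2_space_restrict_mono(1)[OF q(1) geo(6)[OF i]] geo(1) Gb by simp
    have Q0: "0 \<le> Q r" for r by (simp add: Q_def)
    have C_sum: "(\<Sum>r\<in>UNIV. C * Q r) \<le> C * (L2_norm (surf ?\<Gamma>) \<mu>)\<^sup>2"
      unfolding sum_distrib_left[symmetric] using Q_sum C(1) by (rule mult_left_mono)
    have slob: "slobodeckij (1/8) ?G \<tau> \<le> ennreal (C * (L2_norm (surf ?\<Gamma>) \<mu>)\<^sup>2)"
    proof -
      have "slobodeckij (1/8) ?G \<tau> = (\<Sum>r\<in>UNIV. slobodeckij (1/8) ?G (q r))"
        using L2_space_measurable[OF qG] by (subst slobodeckij_vec) (auto simp: row Gb)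
      also have "\<dots> \<le> (\<Sum>r\<in>UNIV. ennreal (C * Q r))" by (intro sum_mono q)
      also have "\<dots> = ennreal (\<Sum>r\<in>UNIV. C * Q r)" using C(1) Q0 by (intro sum_ennreal) auto
      also have "\<dots> \<le> ennreal (C * (L2_norm (surf ?\<Gamma>) \<mu>)\<^sup>2)" by (rule ennreal_leI[OF C_sum])
      finally show ?thesis .
    qed
    have L2\<tau>: "\<tau> \<in> L2_space (vol ?G)" unfolding L2_space_vec_iff[of \<tau>] row using qG by blast
    have n1: "(L2_norm (vol ?G) \<tau>)\<^sup>2 \<le> C * (L2_norm (surf ?\<Gamma>) \<mu>)\<^sup>2"
    proof -
      have "(L2_norm (vol ?G) \<tau>)\<^sup>2 = (\<Sum>r\<in>UNIV. (L2_norm (vol ?G) (q r))\<^sup>2)"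
        using L2_norm_vec_power2[of \<tau> "vol ?G"] qG by (simp add: row)
      also have "\<dots> \<le> (\<Sum>r\<in>UNIV. C * Q r)" by (intro sum_mono q)
      finally show ?thesis using C_sum by simp
    qed
    have Hd: "q r \<in> Hdiv ?G" "q r \<in> Hdiv ?\<Omega>" for r
      by (rule HdivI[OF q(4) qG], rule HdivI[OF q(2) q(1)])
    have n2: "(L2_norm (vol ?G) (mat_div ?G \<tau>))\<^sup>2 \<le> C * (L2_norm (surf ?\<Gamma>) \<mu>)\<^sup>2"
    proof -
      have w: "has_weak_div ?G (q r) (weak_div ?G (q r))" for r by (rule has_weak_div_weak_div[OF Hd(1)])
      have dr: "(\<lambda>x. mat_div ?G \<tau> x $ r) = weak_div ?G (q r)" for r by (simp add: mat_div_def row)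
      have wL: "weak_div ?G (q r) \<in> L2_space (vol ?G)" "D r \<in> L2_space (vol ?G)" for r
        using w q(4) by (auto simp: has_weak_div_def)
      have "(L2_norm (vol ?G) (mat_div ?G \<tau>))\<^sup>2 = (\<Sum>r\<in>UNIV. (L2_norm (vol ?G) (weak_div ?G (q r)))\<^sup>2)"
        using L2_norm_vec_power2[of "mat_div ?G \<tau>" "vol ?G"] wL by (simp add: dr)
      also have "\<dots> = (\<Sum>r\<in>UNIV. (L2_norm (vol ?G) (D r))\<^sup>2)"
      proof (rule sum.cong[OF refl])
        fix r
        have "AE x in vol ?G. weak_div ?G (q r) x = D r x" by (rule has_weak_div_unique[OF w q(4) Gm])
        then show "(L2_norm (vol ?G) (weak_div ?G (q r)))\<^sup>2 = (L2_norm (vol ?G) (D r))\<^sup>2"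
          unfolding L2_inner_self[symmetric]
          by (intro L2_inner_cong_AE) (auto intro: L2_space_measurable wL)
      qed
      also have "\<dots> \<le> (\<Sum>r\<in>UNIV. C * Q r)" by (intro sum_mono q)
      finally show ?thesis using C_sum by simp
    qed
    \<comment> \<open>Green's functional vanishes for every C1 function on the domain, so the
      boundary condition holds whatever part \<open>Gamma_N_sigma\<close> is.\<close>
    have X: "\<tau> \<in> X_space g"
    proof -
      have "green ?\<Omega> (q r) \<phi> = 0" if h: "C1_function \<phi>" for r \<phi>
        using green_eq(1)[OF q(2) h q(1) \<Omega>m] q(3)[OF h] by simp
      then show ?thesis
        unfolding X_space_def mat_Hdiv_def normal_trace_zero_on_def by (simp add: row Hd(2))
    qed
    have tr: "has_normal_trace ?G (q r) (\<lambda>x. extend_by_zero ?\<Gamma> \<mu> x $ r)" for r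
      unfolding has_normal_trace_def
    proof (intro conjI allI impI)
      have ext: "extend_by_zero ?\<Gamma> \<mu> = \<mu>0" by (simp add: extend_by_zero_def \<mu>0_def fun_eq_iff)
      have "\<mu>0 \<in> L2_space surface_measure" using \<mu>2(1) by (simp add: L2_space_def)
      then have "(\<lambda>x. \<mu>0 x $ r) \<in> L2_space surface_measure" by (subst (asm) L2_space_vec_iff) blast
      then show "(\<lambda>x. extend_by_zero ?\<Gamma> \<mu> x $ r) \<in> L2_space (surf (frontier ?G))"
        unfolding ext by (rule L2_space_restrict) simp
      fix \<phi> :: "real^'n \<Rightarrow> real" assume \<phi>: "C1_function \<phi>"
      have "green ?G (q r) \<phi> = (\<integral>y. f r y * \<phi> y \<partial>surface_measure)"
        using green_eq(1)[OF q(4) \<phi> qG Gm] q(5)[OF \<phi>] by simp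
      also have "\<dots> = (\<integral>y. indicator (frontier ?G) y *\<^sub>R (\<mu>0 y $ r * \<phi> y) \<partial>surface_measure)"
        by (intro Bochner_Integration.integral_cong) (auto simp: f_def \<mu>0_def Gamma_sub_def indicator_def)
      also have "\<dots> = (\<integral>y. \<mu>0 y $ r * \<phi> y \<partial>surf (frontier ?G))"
        by (subst integral_restrict_space) auto
      finally show "green ?G (q r) \<phi> = (\<integral>x. extend_by_zero ?\<Gamma> \<mu> x $ r * \<phi> x \<partial>surf (frontier ?G))"
        by (simp add: ext)
    qed
    \<comment> \<open>Order 1/8 is level 0 of the recursive definition of the Sobolev spaces, with
      fractional part 1/8.\<close>
    have fr: "nat \<lfloor>1/8 :: real\<rfloor> = 0" "frac (1/8 :: real) = 1/8" by (auto simp: frac_def)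
    have "slobodeckij (1/8) ?G \<tau> < \<infinity>" using slob by (auto intro: order.strict_trans1)
    then have sob: "\<tau> \<in> sobolev_space (1/8) ?G" using L2\<tau> by (simp add: sobolev_space_def fr)
    have "sobolev_norm (1/8) ?G \<tau> \<le> sqrt (2 * C) * L2_norm (surf ?\<Gamma>) \<mu>"
    proof -
      have "enn2real (slobodeckij (1/8) ?G \<tau>) \<le> C * (L2_norm (surf ?\<Gamma>) \<mu>)\<^sup>2"
        using slob C(1) by (intro enn2real_leI) auto
      then have "(L2_norm (vol ?G) \<tau>)\<^sup>2 + enn2real (slobodeckij (1/8) ?G \<tau>) \<le> 2 * C * (L2_norm (surf ?\<Gamma>) \<mu>)\<^sup>2"
        using n1 by simp
      then have "sobolev_norm (1/8) ?G \<tau> \<le> sqrt (2 * C * (L2_norm (surf ?\<Gamma>) \<mu>)\<^sup>2)"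
        by (simp add: sobolev_norm_def fr)
      then show ?thesis by (simp add: real_sqrt_mult)
    qed
    moreover have "L2_norm (vol ?G) (mat_div ?G \<tau>) \<le> sqrt C * L2_norm (surf ?\<Gamma>) \<mu>"
    proof -
      have "L2_norm (vol ?G) (mat_div ?G \<tau>) \<le> sqrt (C * (L2_norm (surf ?\<Gamma>) \<mu>)\<^sup>2)"
        using n2 by (rule real_le_rsqrt)
      then show ?thesis by (simp add: real_sqrt_mult)
    qed
    ultimately have bound: "sobolev_norm (1/8) ?G \<tau> + L2_norm (vol ?G) (mat_div ?G \<tau>)
        \<le> (sqrt (2 * C) + sqrt C) * L2_norm (surf ?\<Gamma>) \<mu>" by (simp add: distrib_right)
    have Xr: "\<tau> \<in> restrict_functions ?G (X_space g)" using X by (auto simp: restrict_functions_def)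
    show "\<exists>\<tau>. \<tau> \<in> sobolev_space (1/8) ?G \<inter> restrict_functions ?G (X_space g) \<and>
        (\<forall>r. (\<lambda>x. \<tau> x $ r) \<in> Hdiv ?G \<and> has_normal_trace ?G (\<lambda>x. \<tau> x $ r) (\<lambda>x. extend_by_zero ?\<Gamma> \<mu> x $ r)) \<and>
        sobolev_norm (1/8) ?G \<tau> + L2_norm (vol ?G) (mat_div ?G \<tau>) \<le> (sqrt (2 * C) + sqrt C) * L2_norm (surf ?\<Gamma>) \<mu>"
      by (intro exI[of _ \<tau>] conjI allI IntI sob Xr bound, unfold row, rule Hd, rule tr)
  qed
qed

section \<open>From duality pairings to inner products on the boundary\<close>

lemma L2_inner_extend_by_zero:
  assumes "S \<subseteq> F" "S \<in> sets M" "F \<in> sets M"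
  shows "L2_inner (restrict_space M F) f (extend_by_zero S h) = L2_inner (restrict_space M S) f h"
proof -
  have FS: "F \<inter> space M \<in> sets M" "S \<inter> space M \<in> sets M" using assms by auto
  show ?thesis
    unfolding L2_inner_def integral_restrict_space[OF FS(1)] integral_restrict_space[OF FS(2)]
    by (intro Bochner_Integration.integral_cong) (use assms in \<open>auto simp: extend_by_zero_def indicator_def\<close>)
qed

lemma extend_by_zero_L2_space:
  fixes f :: "'a \<Rightarrow> 'b::euclidean_space"
  assumes "f \<in> L2_space (restrict_space M S)" "S \<in> sets M"
  shows "extend_by_zero S f \<in> L2_space M"
proof -
  have S: "S \<inter> space M \<in> sets M" using assms(2) by auto
  have e: "extend_by_zero S f = (\<lambda>x. indicator S x *\<^sub>R f x)"
    by (auto simp: extend_by_zero_def indicator_def)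
  have n: "(norm (extend_by_zero S f x))\<^sup>2 = indicator S x *\<^sub>R (norm (f x))\<^sup>2" for x
    by (auto simp: extend_by_zero_def indicator_def)
  have "extend_by_zero S f \<in> borel_measurable M"
    using L2_space_measurable[OF assms(1)] unfolding e borel_measurable_restrict_space_iff[OF S] .
  moreover have "integrable M (\<lambda>x. (norm (extend_by_zero S f x))\<^sup>2)"
    using L2_space_integrable_square[OF assms(1)] unfolding n integrable_restrict_space[OF S] .
  ultimately show ?thesis by (simp add: L2_space_def)
qed

text \<open>If the normal trace u is square integrable, Green's functional of an approximant is its
  inner product with u. By Cauchy-Schwarz this converges to the inner product with w, and limits are
  unique.\<close>

lemma has_normal_pairing_eq_L2_inner:
  assumes G: "polyhedral_domain G" and u: "has_normal_trace G q u" and p: "has_normal_pairing G q w c"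
  shows "c = L2_inner (surf (frontier G)) u w"
proof -
  let ?M = "surf (frontier G)"
  obtain \<phi> where \<phi>: "\<And>k::nat. C1_function (\<phi> k)" "(\<lambda>k. \<integral>x. (\<phi> k x - w x)\<^sup>2 \<partial>?M) \<longlonglongrightarrow> 0"
    "(\<lambda>k. green G q (\<phi> k)) \<longlonglongrightarrow> c" and w: "w \<in> L2_space ?M"
    using p unfolding has_normal_pairing_def by blast
  have uL: "u \<in> L2_space ?M" using u by (simp add: has_normal_trace_def)
  have \<phi>L: "\<phi> k \<in> L2_space ?M" for k by (rule C1_function_L2_space_surf[OF \<phi>(1) G])
  have gr: "green G q (\<phi> k) = L2_inner ?M (\<phi> k) u" for k
    using u \<phi>(1)[of k] by (simp add: has_normal_trace_def L2_inner_def mult.commute)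
  have n: "L2_norm ?M (\<lambda>x. \<phi> k x - w x) = sqrt (\<integral>x. (\<phi> k x - w x)\<^sup>2 \<partial>?M)" for k
    by (simp add: L2_norm_def)
  have lim: "(\<lambda>k. L2_norm ?M (\<lambda>x. \<phi> k x - w x) * L2_norm ?M u) \<longlonglongrightarrow> 0"
    unfolding n using tendsto_mult_right[OF tendsto_real_sqrt[OF \<phi>(2)], of "L2_norm ?M u"] by simp
  have "(\<lambda>k. green G q (\<phi> k) - L2_inner ?M w u) \<longlonglongrightarrow> 0"
  proof (rule Lim_null_comparison[OF _ lim], rule always_eventually, rule allI)
    fix k
    show "norm (green G q (\<phi> k) - L2_inner ?M w u) \<le> L2_norm ?M (\<lambda>x. \<phi> k x - w x) * L2_norm ?M u"
      using L2_Cauchy_Schwarz[OF L2_space_diff[OF \<phi>L w] uL, of k]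
      by (simp add: gr L2_inner_diff_left[OF \<phi>L w uL])
  qed
  then have "(\<lambda>k. green G q (\<phi> k)) \<longlonglongrightarrow> L2_inner ?M w u" by (subst (asm) LIM_zero_iff)
  then show ?thesis using LIMSEQ_unique[OF \<phi>(3)] by (simp add: L2_inner_commute)
qed

lemma has_mat_normal_pairing_eq_L2_inner:
  fixes G :: "(real^'n) set"
  assumes G: "polyhedral_domain G" and S: "S \<in> sets borel" "S \<subseteq> frontier G"
    and u: "\<And>r. has_normal_trace G (\<lambda>x. \<tau> x $ r) (\<lambda>x. u x $ r)"
    and w: "w \<in> L2_space (surf (frontier G))"
    and p: "has_mat_normal_pairing G S \<tau> w c"
  shows "c = L2_inner (surf S) u w"
proof -
  obtain a where a: "\<And>r. has_normal_pairing G (\<lambda>x. \<tau> x $ r) (extend_by_zero S (\<lambda>x. w x $ r)) (a r)"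
    "c = (\<Sum>r\<in>UNIV. a r)"
    using p unfolding has_mat_normal_pairing_def by blast
  have uL: "u \<in> L2_space (surf (frontier G))"
    unfolding L2_space_vec_iff[of u] using u by (simp add: has_normal_trace_def)
  have r: "f \<in> L2_space (surf S)" if "f \<in> L2_space (surf (frontier G))" for f :: "real^'n \<Rightarrow> real^'n"
    using L2_space_restrict_mono(1)[OF that S(2)] S(1) by simp
  have "a r = L2_inner (surf S) (\<lambda>x. u x $ r) (\<lambda>x. w x $ r)" for r
    using has_normal_pairing_eq_L2_inner[OF G u a(1)] S by (simp add: L2_inner_extend_by_zero)
  then show ?thesis unfolding a(2) L2_inner_vec[OF r[OF uL] r[OF w]] by simp
qed

lemma proj_u_is_L2_projection:
  fixes g :: "'n::finite geometry"
  assumes g: "valid_geometry g" and D: "valid_discretization g D" and i: "i \<in> {1..num_sub g}"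
    and f: "f \<in> L2_space (surf (frontier (subdomain g i)))"
  shows "is_L2_projection (surf (frontier (subdomain g i))) (mat_normal_trace (subdomain g i) ` Xh D i) f
      (proj_u g D i f)"
  unfolding proj_u_def
  by (rule L2_projection_onto_traces[OF valid_geometry_facts(3)[OF g i]
    valid_discretization_subdomain(1,2)[OF D i] Xh_trace_regular[OF g D i] f])

lemma proj_u_L2_space:
  fixes g :: "'n::finite geometry"
  assumes g: "valid_geometry g" and D: "valid_discretization g D" and i: "i \<in> {1..num_sub g}"
    and f: "f \<in> L2_space (surf (frontier (subdomain g i)))"
  shows "proj_u g D i f \<in> L2_space (surf (frontier (subdomain g i)))"
proof -
  obtain \<tau> where "\<tau> \<in> Xh D i" "proj_u g D i f = mat_normal_trace (subdomain g i) \<tau>"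
    using proj_u_is_L2_projection[OF assms] unfolding is_L2_projection_def by blast
  then show ?thesis by (simp add: mat_normal_trace_L2_space[OF Xh_trace_regular[OF g D i]])
qed

text \<open>The orthogonality \<open>orth\<close> is used twice: tested with the discrete field
  behind the projection, and with the interpolant itself. The projection lives on the whole boundary
  and the pairing on the interface; since the extended data vanish off the interface, the inner
  products of data and projection agree. The constant is the product of those for interpolation and
  lift.\<close>

lemma subdomain_flux:
  fixes g :: "'n::finite geometry" and \<D> :: "'n discretization set"
  assumes g: "valid_geometry g" and D: "\<And>D. D \<in> \<D> \<Longrightarrow> valid_discretization g D"
    and ci: "canonical_interpolants g \<D>" and i: "i \<in> {1..num_sub g}"
  shows "\<exists>C\<ge>0. \<forall>D\<in>\<D>. \<forall>\<mu>\<in>L2_space (surf (Gamma_all g)). \<exists>\<tau>\<in>Xh D i.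
    (L2_norm (surf (frontier (subdomain g i))) (proj_u g D i (extend_by_zero (Gamma_all g) \<mu>)))\<^sup>2
      \<le> L2_inner (surf (Gamma_sub g i)) (mat_normal_trace (subdomain g i) \<tau>) \<mu> \<and>
    mat_Hdiv_norm (subdomain g i) \<tau> \<le> C * L2_norm (surf (Gamma_all g)) \<mu>"
proof -
  let ?G = "subdomain g i" and ?S = "Gamma_sub g i" and ?\<Gamma> = "Gamma_all g"
  let ?F = "surf (frontier ?G)" and ?t = "mat_normal_trace ?G"
  note geo = valid_geometry_facts[OF g]
  note G = geo(3)[OF i] and Gm = geo(5)[OF i] geo(4)[OF i]
  have S: "?S \<in> sets borel" "?S \<subseteq> frontier ?G" "?S \<subseteq> ?\<Gamma>"
    using closed_Gamma_sub by (auto intro: borel_closed simp: Gamma_sub_def)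
  have \<Gamma>: "?\<Gamma> \<in> sets borel" by (rule borel_closed[OF closed_Gamma_all])
  obtain C1 where C1: "0 \<le> C1"
    "\<And>\<mu> :: real^'n \<Rightarrow> real^'n. \<mu> \<in> L2_space (surf ?\<Gamma>) \<Longrightarrow>
      \<exists>\<tau>. \<tau> \<in> sobolev_space (1/8) ?G \<inter> restrict_functions ?G (X_space g) \<and>
        (\<forall>r. (\<lambda>x. \<tau> x $ r) \<in> Hdiv ?G \<and>
          has_normal_trace ?G (\<lambda>x. \<tau> x $ r) (\<lambda>x. extend_by_zero ?\<Gamma> \<mu> x $ r)) \<and>
        sobolev_norm (1/8) ?G \<tau> + L2_norm (vol ?G) (mat_div ?G \<tau>) \<le> C1 * L2_norm (surf ?\<Gamma>) \<mu>"
    using tensor_lift[OF g i] by blast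
  obtain C2 where C2: "0 < C2" "\<And>D. D \<in> \<D> \<Longrightarrow> \<exists>P.
        \<forall>\<tau> \<in> sobolev_space (1/8) ?G \<inter> restrict_functions ?G (X_space g).
          P \<tau> \<in> Xh D i \<and>
          (\<forall>\<tau>'\<in>Xh D i. has_mat_normal_pairing ?G ?S (\<lambda>x. P \<tau> x - \<tau> x) (?t \<tau>') 0) \<and>
          mat_Hdiv_norm ?G (P \<tau>) \<le>
            C2 * (sobolev_norm (1/8) ?G \<tau> + L2_norm (vol ?G) (mat_div ?G \<tau>))"
  proof -
    have "(0::real) < 1/8" by simp
    from ci[unfolded canonical_interpolants_def, rule_format, OF this] obtain C where C: "0 < C"
      and P: "\<forall>D\<in>\<D>. \<forall>i\<in>{1..num_sub g}. \<exists>P\<^sub>\<sigma>.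
        \<forall>\<tau> \<in> sobolev_space (1/8) (subdomain g i) \<inter> restrict_functions (subdomain g i) (X_space g).
          P\<^sub>\<sigma> \<tau> \<in> Xh D i \<and>
          (\<forall>v\<in>Vh D i. L2_inner (vol (subdomain g i))
             (mat_div (subdomain g i) (\<lambda>x. P\<^sub>\<sigma> \<tau> x - \<tau> x)) v = 0) \<and>
          (\<forall>\<tau>'\<in>Xh D i. has_mat_normal_pairing (subdomain g i) (Gamma_sub g i)
             (\<lambda>x. P\<^sub>\<sigma> \<tau> x - \<tau> x) (mat_normal_trace (subdomain g i) \<tau>') 0) \<and>
          mat_Hdiv_norm (subdomain g i) (P\<^sub>\<sigma> \<tau>) \<le>
            C * (sobolev_norm (1/8) (subdomain g i) \<tau> +
                 L2_norm (vol (subdomain g i)) (mat_div (subdomain g i) \<tau>))" by auto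
    show ?thesis
    proof (rule that[OF C])
      fix D assume "D \<in> \<D>"
      from bspec[OF bspec[OF P this] i] show "\<exists>P.
        \<forall>\<tau> \<in> sobolev_space (1/8) ?G \<inter> restrict_functions ?G (X_space g).
          P \<tau> \<in> Xh D i \<and>
          (\<forall>\<tau>'\<in>Xh D i. has_mat_normal_pairing ?G ?S (\<lambda>x. P \<tau> x - \<tau> x) (?t \<tau>') 0) \<and>
          mat_Hdiv_norm ?G (P \<tau>) \<le> C * (sobolev_norm (1/8) ?G \<tau> + L2_norm (vol ?G) (mat_div ?G \<tau>))"
        by (rule ex_forward) blast
    qed
  qed
  have main: "\<exists>\<tau>\<in>Xh D i. (L2_norm ?F (proj_u g D i (extend_by_zero ?\<Gamma> \<mu>)))\<^sup>2 \<le> L2_inner (surf ?S) (?t \<tau>) \<mu> \<and>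
      mat_Hdiv_norm ?G \<tau> \<le> C2 * C1 * L2_norm (surf ?\<Gamma>) \<mu>"
    if h: "D \<in> \<D>" and \<mu>: "\<mu> \<in> L2_space (surf ?\<Gamma>)" for D and \<mu> :: "real^'n \<Rightarrow> real^'n"
  proof -
    let ?E = "extend_by_zero ?\<Gamma> \<mu>"
    have reg: "trace_regular ?G \<sigma>" if "\<sigma> \<in> Xh D i" for \<sigma> by (rule Xh_trace_regular[OF g D[OF h] i that])
    obtain P where P: "\<forall>\<tau> \<in> sobolev_space (1/8) ?G \<inter> restrict_functions ?G (X_space g).
          P \<tau> \<in> Xh D i \<and>
          (\<forall>\<tau>'\<in>Xh D i. has_mat_normal_pairing ?G ?S (\<lambda>x. P \<tau> x - \<tau> x) (?t \<tau>') 0) \<and>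
          mat_Hdiv_norm ?G (P \<tau>) \<le> C2 * (sobolev_norm (1/8) ?G \<tau> + L2_norm (vol ?G) (mat_div ?G \<tau>))"
      using C2(2)[OF h] by blast
    obtain \<tau> where \<tau>: "\<tau> \<in> sobolev_space (1/8) ?G \<inter> restrict_functions ?G (X_space g)"
      "\<And>r. (\<lambda>x. \<tau> x $ r) \<in> Hdiv ?G" "\<And>r. has_normal_trace ?G (\<lambda>x. \<tau> x $ r) (\<lambda>x. ?E x $ r)"
      "sobolev_norm (1/8) ?G \<tau> + L2_norm (vol ?G) (mat_div ?G \<tau>) \<le> C1 * L2_norm (surf ?\<Gamma>) \<mu>"
      using C1(2)[OF \<mu>] by blast
    note P\<tau> = bspec[OF P \<tau>(1)]
    have PX: "P \<tau> \<in> Xh D i" using P\<tau> by (rule conjunct1)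
    have pair: "has_mat_normal_pairing ?G ?S (\<lambda>x. P \<tau> x - \<tau> x) (?t \<tau>') 0" if "\<tau>' \<in> Xh D i" for \<tau>'
      using P\<tau> that by blast
    have "mat_Hdiv_norm ?G (P \<tau>) \<le> C2 * (sobolev_norm (1/8) ?G \<tau> + L2_norm (vol ?G) (mat_div ?G \<tau>))"
      using P\<tau> by (elim conjE)
    also have "\<dots> \<le> C2 * (C1 * L2_norm (surf ?\<Gamma>) \<mu>)" using \<tau>(4) C2(1) by (intro mult_left_mono) auto
    finally have bound: "mat_Hdiv_norm ?G (P \<tau>) \<le> C2 * C1 * L2_norm (surf ?\<Gamma>) \<mu>" by (simp add: mult.assoc)
    have EL0: "?E \<in> L2_space surface_measure" by (rule extend_by_zero_L2_space[OF \<mu>]) (simp add: \<Gamma>)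
    have EL: "?E \<in> L2_space ?F" by (rule L2_space_restrict[OF EL0]) simp
    have trace: "has_normal_trace ?G (\<lambda>x. (P \<tau> x - \<tau> x) $ r) (\<lambda>x. (?t (P \<tau>) x - ?E x) $ r)" for r
    proof -
      have "has_normal_trace ?G (\<lambda>x. (-1) *\<^sub>R \<tau> x $ r) (\<lambda>x. (-1) * ?E x $ r)"
        by (rule has_normal_trace_scaleR[OF \<tau>(3) \<tau>(2) G])
      from has_normal_trace_add[OF trace_regular_has_normal_trace[OF reg[OF PX]] this
          trace_regular_Hdiv[OF reg[OF PX]] Hdiv_scaleR[OF \<tau>(2)] G]
      show ?thesis by simp
    qed
    have tL: "?t \<sigma> \<in> L2_space ?F" if "\<sigma> \<in> Xh D i" for \<sigma> by (rule mat_normal_trace_L2_space[OF reg[OF that]])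
    have r: "f \<in> L2_space (surf ?S)" if "f \<in> L2_space ?F" for f :: "real^'n \<Rightarrow> real^'n"
      using L2_space_restrict_mono(1)[OF that S(2)] S(1) by simp
    have E\<mu>: "L2_inner (surf ?S) ?E f = L2_inner (surf ?S) \<mu> f" for f :: "real^'n \<Rightarrow> real^'n"
      unfolding L2_inner_def using S(3)
      by (intro Bochner_Integration.integral_cong) (auto simp: extend_by_zero_def space_restrict_space)
    \<comment> \<open>The normal trace of the interpolation error is square integrable by
      \<open>trace\<close>, so its vanishing pairing is a vanishing inner product.\<close>
    have orth: "L2_inner (surf ?S) (?t (P \<tau>)) (?t \<tau>') = L2_inner (surf ?S) \<mu> (?t \<tau>')" if t': "\<tau>' \<in> Xh D i" for \<tau>'
      using has_mat_normal_pairing_eq_L2_inner[OF G S(1,2) trace tL[OF t'] pair[OF t']]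
        L2_inner_diff_left[OF r[OF tL[OF PX]] r[OF EL] r[OF tL[OF t']]] E\<mu> by simp
    let ?Q = "proj_u g D i ?E"
    have pr: "is_L2_projection ?F (?t ` Xh D i) ?E ?Q"
      by (rule proj_u_is_L2_projection[OF g D[OF h] i EL])
    obtain \<sigma> where \<sigma>: "\<sigma> \<in> Xh D i" "?Q = ?t \<sigma>" using pr unfolding is_L2_projection_def by blast
    have "L2_inner ?F (\<lambda>x. ?E x - ?Q x) ?Q = 0" using pr unfolding is_L2_projection_def by blast
    then have "(L2_norm ?F ?Q)\<^sup>2 = L2_inner ?F ?E ?Q"
      using L2_inner_diff_left[OF EL tL[OF \<sigma>(1)] tL[OF \<sigma>(1)]] by (simp add: \<sigma>(2) L2_inner_self)
    also have "\<dots> = L2_inner (surf ?S) \<mu> ?Q"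
    proof -
      have "L2_inner ?F ?Q ?E = L2_inner ?F ?Q (extend_by_zero ?S \<mu>)"
        unfolding L2_inner_def
        by (intro Bochner_Integration.integral_cong) (auto simp: extend_by_zero_def space_restrict_space Gamma_sub_def)
      also have "\<dots> = L2_inner (surf ?S) ?Q \<mu>" using S by (intro L2_inner_extend_by_zero) auto
      finally show ?thesis by (simp add: L2_inner_commute)
    qed
    also have "\<dots> = L2_inner (surf ?S) (?t (P \<tau>)) ?Q" using orth[OF \<sigma>(1)] by (simp add: \<sigma>(2))
    also have "\<dots> \<le> L2_norm (surf ?S) (?t (P \<tau>)) * L2_norm (surf ?S) ?Q"
      using L2_Cauchy_Schwarz[OF r[OF tL[OF PX]] r[OF tL[OF \<sigma>(1)]]] by (simp add: \<sigma>(2))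
    also have "\<dots> \<le> L2_norm (surf ?S) (?t (P \<tau>)) * L2_norm ?F ?Q"
    proof (rule mult_left_mono)
      have "(L2_norm (surf ?S) ?Q)\<^sup>2 \<le> (L2_norm ?F ?Q)\<^sup>2"
        using L2_space_restrict_mono(2)[OF tL[OF \<sigma>(1)] S(2)] S(1) by (simp add: \<sigma>(2))
      then show "L2_norm (surf ?S) ?Q \<le> L2_norm ?F ?Q" by (rule power2_le_imp_le) simp
    qed simp
    finally have "L2_norm ?F ?Q * L2_norm ?F ?Q \<le> L2_norm (surf ?S) (?t (P \<tau>)) * L2_norm ?F ?Q"
      by (simp add: power2_eq_square)
    then have "L2_norm ?F ?Q \<le> L2_norm (surf ?S) (?t (P \<tau>))"
      by (cases "L2_norm ?F ?Q = 0") (auto simp: less_le)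
    then have "(L2_norm ?F ?Q)\<^sup>2 \<le> (L2_norm (surf ?S) (?t (P \<tau>)))\<^sup>2" by (rule power_mono) simp
    also have "\<dots> = L2_inner (surf ?S) (?t (P \<tau>)) \<mu>"
      using orth[OF PX] by (simp add: L2_inner_self L2_inner_commute)
    finally show ?thesis using bound PX by blast
  qed
  show ?thesis
    by (intro exI[of _ "C2 * C1"] conjI ballI main) (use C1(1) C2(1) in auto)
qed

section \<open>Gluing of the local fluxes\<close>

text \<open>An inequality, so that it covers sets that overlap, as interfaces may at edges and
  vertices, and the disjoint subdomains alike.\<close>

lemma L2_norm_UN_le:
  assumes f: "f \<in> L2_space (restrict_space M (\<Union>i\<in>I. A i))" and I: "finite I" "\<And>i. i \<in> I \<Longrightarrow> A i \<in> sets M"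
  shows "(L2_norm (restrict_space M (\<Union>i\<in>I. A i)) f)\<^sup>2 \<le> (\<Sum>i\<in>I. (L2_norm (restrict_space M (A i)) f)\<^sup>2)"
proof -
  have U: "(\<Union>i\<in>I. A i) \<in> sets M" using I by auto
  have int: "integrable M (\<lambda>x. indicator B x *\<^sub>R (norm (f x))\<^sup>2)" if "B \<subseteq> (\<Union>i\<in>I. A i)" "B \<in> sets M" for B
    using L2_space_integrable_square[OF L2_space_restrict_mono(1)[OF f that(1) U that(2)]] that(2)
    by (subst (asm) integrable_restrict_space) auto
  have eq: "(L2_norm (restrict_space M B) f)\<^sup>2 = (\<integral>x. indicator B x *\<^sub>R (norm (f x))\<^sup>2 \<partial>M)" if "B \<in> sets M" for B
    unfolding L2_norm_power2 using that by (subst integral_restrict_space) auto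
  have "(L2_norm (restrict_space M (\<Union>i\<in>I. A i)) f)\<^sup>2
      \<le> (\<integral>x. (\<Sum>i\<in>I. indicator (A i) x *\<^sub>R (norm (f x))\<^sup>2) \<partial>M)"
    unfolding eq[OF U]
  proof (rule integral_mono)
    fix x
    have "indicator (\<Union>i\<in>I. A i) x \<le> (\<Sum>i\<in>I. indicator (A i) x :: real)"
    proof (cases "x \<in> (\<Union>i\<in>I. A i)")
      case True
      then obtain i where i: "i \<in> I" "x \<in> A i" by blast
      have "indicator (A i) x \<le> (\<Sum>i\<in>I. indicator (A i) x :: real)" using i(1) I(1) by (intro member_le_sum) auto
      then show ?thesis using i True by simp
    qed (simp add: sum_nonneg)
    then show "indicator (\<Union>i\<in>I. A i) x *\<^sub>R (norm (f x))\<^sup>2 \<le> (\<Sum>i\<in>I. indicator (A i) x *\<^sub>R (norm (f x))\<^sup>2)"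
      unfolding real_scaleR_def sum_distrib_right[symmetric] by (rule mult_right_mono) simp
  next
    show "integrable M (\<lambda>x. indicator (\<Union>i\<in>I. A i) x *\<^sub>R (norm (f x))\<^sup>2)" by (rule int[OF order_refl U])
    show "integrable M (\<lambda>x. \<Sum>i\<in>I. indicator (A i) x *\<^sub>R (norm (f x))\<^sup>2)"
      using I(2) by (intro Bochner_Integration.integrable_sum int) auto
  qed
  also have "\<dots> = (\<Sum>i\<in>I. (L2_norm (restrict_space M (A i)) f)\<^sup>2)"
  proof -
    have "integrable M (\<lambda>x. indicator (A i) x *\<^sub>R (norm (f x))\<^sup>2)" if "i \<in> I" for i
      using that I(2) by (intro int) auto
    then show ?thesis using I(2) by (simp add: Bochner_Integration.integral_sum eq)
  qed
  finally show ?thesis .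
qed

text \<open>Fields that agree on G satisfy the same defining predicate, so \<open>SOME\<close> makes
  the same choice: the equality is exact and not just almost everywhere. The same holds for the
  normal trace below.\<close>

lemma weak_div_cong:
  assumes "\<And>x. x \<in> G \<Longrightarrow> p x = q x" shows "weak_div G p = weak_div G q"
proof -
  have "(\<integral>x. p x \<bullet> gradient \<phi> x \<partial>vol G) = (\<integral>x. q x \<bullet> gradient \<phi> x \<partial>vol G)" for \<phi>
    by (intro Bochner_Integration.integral_cong) (auto simp: assms space_restrict_space)
  then show ?thesis by (simp add: weak_div_def has_weak_div_def)
qed

lemma normal_trace_cong:
  assumes "\<And>x. x \<in> G \<Longrightarrow> p x = q x" shows "normal_trace G p = normal_trace G q"
proof -
  have w: "weak_div G p = weak_div G q" by (rule weak_div_cong) (rule assms)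
  have "green G p \<phi> = green G q \<phi>" for \<phi>
    unfolding green_def w by (intro Bochner_Integration.integral_cong) (auto simp: assms space_restrict_space)
  then show ?thesis by (simp add: normal_trace_def has_normal_trace_def)
qed

lemma mat_div_cong:
  assumes "\<And>x. x \<in> G \<Longrightarrow> \<tau> x = \<sigma> x" shows "mat_div G \<tau> = mat_div G \<sigma>"
proof -
  have "weak_div G (\<lambda>y. \<tau> y $ r) = weak_div G (\<lambda>y. \<sigma> y $ r)" for r by (rule weak_div_cong) (simp add: assms)
  then show ?thesis by (simp add: mat_div_def fun_eq_iff)
qed

lemma mat_normal_trace_cong:
  assumes "\<And>x. x \<in> G \<Longrightarrow> \<tau> x = \<sigma> x" shows "mat_normal_trace G \<tau> = mat_normal_trace G \<sigma>"
proof -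
  have "normal_trace G (\<lambda>y. \<tau> y $ r) = normal_trace G (\<lambda>y. \<sigma> y $ r)" for r by (rule normal_trace_cong) (simp add: assms)
  then show ?thesis by (simp add: mat_normal_trace_def fun_eq_iff)
qed

lemma L2_norm_cong:
  assumes "\<And>x. x \<in> space M \<Longrightarrow> f x = h x" shows "L2_norm M f = L2_norm M h"
proof -
  have "(\<integral>x. (norm (f x))\<^sup>2 \<partial>M) = (\<integral>x. (norm (h x))\<^sup>2 \<partial>M)"
    by (intro Bochner_Integration.integral_cong) (auto simp: assms)
  then show ?thesis by (simp add: L2_norm_def)
qed

lemma AE_restrict_space_subset:
  assumes "AE x in restrict_space M A. P x" "B \<subseteq> A" "A \<in> sets M" "B \<in> sets M"
  shows "AE x in restrict_space M B. P x"
  using assms by (auto simp: AE_restrict_space_iff elim!: eventually_mono)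

lemma mat_div_L2_space:
  assumes "trace_regular G \<tau>" shows "mat_div G \<tau> \<in> L2_space (vol G)"
  unfolding L2_space_vec_iff[of "mat_div G \<tau>"]
  using has_weak_div_weak_div[OF trace_regular_Hdiv[OF assms]] by (simp add: mat_div_def has_weak_div_def)

text \<open>At most one summand differs from zero, since the subdomains are disjoint. Off the
  subdomains the value is zero, which keeps the function measurable on the whole space.\<close>

definition glue :: "'n::finite geometry \<Rightarrow> (nat \<Rightarrow> real^'n \<Rightarrow> real^'n^'n) \<Rightarrow> real^'n \<Rightarrow> real^'n^'n" where
  "glue g \<tau> x = (\<Sum>i\<in>{1..num_sub g}. extend_by_zero (subdomain g i) (\<tau> i) x)"

lemma sum_extend_by_zero:
  assumes g: "valid_geometry g" and i: "i \<in> {1..num_sub g}" and x: "x \<in> subdomain g i"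
  shows "(\<Sum>j\<in>{1..num_sub g}. extend_by_zero (subdomain g j) (f j) x) = f i x"
proof -
  have "extend_by_zero (subdomain g j) (f j) x = (if j = i then f i x else 0)" if "j \<in> {1..num_sub g}" for j
    using valid_geometry_facts(7)[OF g i, of j] that x by (auto simp: extend_by_zero_def)
  then show ?thesis using i by (simp add: sum.delta)
qed

context
  fixes g :: "'n::finite geometry" and D :: "'n discretization" and \<tau> :: "nat \<Rightarrow> real^'n \<Rightarrow> real^'n^'n"
  assumes g: "valid_geometry g" and D: "valid_discretization g D" and \<tau>: "\<And>i. i \<in> {1..num_sub g} \<Longrightarrow> \<tau> i \<in> Xh D i"
begin

lemma glue_eq: "i \<in> {1..num_sub g} \<Longrightarrow> x \<in> subdomain g i \<Longrightarrow> glue g \<tau> x = \<tau> i x"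
  unfolding glue_def by (rule sum_extend_by_zero[OF g])

lemma glue_Xh_space: "glue g \<tau> \<in> Xh_space g D"
  unfolding Xh_space_def restrict_functions_def using glue_eq \<tau> by blast

lemma glue_L2_space: "glue g \<tau> \<in> L2_space lborel"
  unfolding glue_def using valid_geometry_facts(4)[OF g]
  by (intro L2_space_sum extend_by_zero_L2_space trace_regular_L2_space Xh_trace_regular[OF g D] \<tau>) auto

lemma glue_div: "i \<in> {1..num_sub g} \<Longrightarrow> mat_div (subdomain g i) (glue g \<tau>) = mat_div (subdomain g i) (\<tau> i)"
  using glue_eq by (intro mat_div_cong)

lemma glue_trace:
  "i \<in> {1..num_sub g} \<Longrightarrow> mat_normal_trace (subdomain g i) (glue g \<tau>) = mat_normal_trace (subdomain g i) (\<tau> i)"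
  using glue_eq by (intro mat_normal_trace_cong)

lemma Xh_norm_glue_le: "(Xh_norm g (glue g \<tau>))\<^sup>2 \<le> (\<Sum>i\<in>{1..num_sub g}. (mat_Hdiv_norm (subdomain g i) (\<tau> i))\<^sup>2)"
proof -
  let ?I = "{1..num_sub g}" and ?U = "\<Union>i\<in>{1..num_sub g}. subdomain g i"
  have b: "subdomain g i \<in> sets borel" if "i \<in> ?I" for i using valid_geometry_facts(4)[OF g that] by simp
  have U: "?U \<in> sets borel" using b by auto
  have div: "div_h g (glue g \<tau>) \<in> L2_space lborel"
    unfolding div_h_def [abs_def]
    using b by (intro L2_space_sum extend_by_zero_L2_space)
      (auto simp: glue_div intro!: mat_div_L2_space Xh_trace_regular[OF g D] \<tau>)
  have r: "f \<in> L2_space (vol ?U)" if "f \<in> L2_space lborel" for f :: "real^'n \<Rightarrow> 'b::euclidean_space"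
    using that U by (intro L2_space_restrict) auto
  have 1: "(L2_norm (vol ?U) (glue g \<tau>))\<^sup>2 \<le> (\<Sum>i\<in>?I. (L2_norm (vol (subdomain g i)) (\<tau> i))\<^sup>2)"
  proof -
    have "(L2_norm (vol ?U) (glue g \<tau>))\<^sup>2 \<le> (\<Sum>i\<in>?I. (L2_norm (vol (subdomain g i)) (glue g \<tau>))\<^sup>2)"
      by (rule L2_norm_UN_le[OF r[OF glue_L2_space]]) (use b in auto)
    also have "\<dots> = (\<Sum>i\<in>?I. (L2_norm (vol (subdomain g i)) (\<tau> i))\<^sup>2)"
      by (intro sum.cong refl arg_cong[where f = "\<lambda>a. a\<^sup>2"] L2_norm_cong) (auto simp: glue_eq space_restrict_space)
    finally show ?thesis .
  qed
  have 2: "(L2_norm (vol ?U) (div_h g (glue g \<tau>)))\<^sup>2 \<le> (\<Sum>i\<in>?I. (L2_norm (vol (subdomain g i)) (mat_div (subdomain g i) (\<tau> i)))\<^sup>2)"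
  proof -
    have "(L2_norm (vol ?U) (div_h g (glue g \<tau>)))\<^sup>2 \<le> (\<Sum>i\<in>?I. (L2_norm (vol (subdomain g i)) (div_h g (glue g \<tau>)))\<^sup>2)"
      by (rule L2_norm_UN_le[OF r[OF div]]) (use b in auto)
    also have "\<dots> = (\<Sum>i\<in>?I. (L2_norm (vol (subdomain g i)) (mat_div (subdomain g i) (\<tau> i)))\<^sup>2)"
    proof (intro sum.cong refl arg_cong[where f = "\<lambda>a. a\<^sup>2"] L2_norm_cong)
      fix i x assume "i \<in> ?I" "x \<in> space (vol (subdomain g i))"
      then show "div_h g (glue g \<tau>) x = mat_div (subdomain g i) (\<tau> i) x"
        unfolding div_h_def by (subst sum_extend_by_zero[OF g]) (auto simp: glue_div space_restrict_space)
    qed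
    finally show ?thesis .
  qed
  show ?thesis using 1 2 by (simp add: Xh_norm_def mat_Hdiv_norm_def sum.distrib)
qed

text \<open>The first claim permits division by the norm; the second puts the field into the index
  set of the supremum.\<close>

lemma Xh_norm_glue_pos:
  assumes "i \<in> {1..num_sub g}" "\<not> (AE x in vol (subdomain g i). \<tau> i x = 0)"
  shows "0 < Xh_norm g (glue g \<tau>)" "\<not> (AE x in vol (domain g). glue g \<tau> x = 0)"
proof -
  let ?U = "\<Union>i\<in>{1..num_sub g}. subdomain g i"
  have b: "subdomain g i \<in> sets borel" if "i \<in> {1..num_sub g}" for i
    using valid_geometry_facts(4)[OF g that] by simp
  have U: "?U \<in> sets borel" using b by auto
  have n: "\<not> (AE x in vol (subdomain g i). glue g \<tau> x = 0)"
  proof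
    assume "AE x in vol (subdomain g i). glue g \<tau> x = 0"
    then have "AE x in vol (subdomain g i). \<tau> i x = 0"
      by (rule AE_mp) (auto simp: glue_eq[OF assms(1)] space_restrict_space intro!: AE_I2)
    then show False using assms(2) by simp
  qed
  show "\<not> (AE x in vol (domain g). glue g \<tau> x = 0)"
  proof
    assume "AE x in vol (domain g). glue g \<tau> x = 0"
    then have "AE x in vol (subdomain g i). glue g \<tau> x = 0"
      using valid_geometry_facts(1)[OF g] b[OF assms(1)]
      by (intro AE_restrict_space_subset[OF _ valid_geometry_facts(6)[OF g assms(1)]]) auto
    then show False using n by simp
  qed
  have L: "glue g \<tau> \<in> L2_space (vol ?U)" using U by (intro L2_space_restrict glue_L2_space) auto
  have "L2_norm (vol ?U) (glue g \<tau>) \<noteq> 0"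
  proof
    assume "L2_norm (vol ?U) (glue g \<tau>) = 0"
    then have "AE x in vol ?U. glue g \<tau> x = 0" by (simp only: L2_norm_eq_0_iff[OF L])
    then have "AE x in vol (subdomain g i). glue g \<tau> x = 0"
      by (rule AE_restrict_space_subset) (use assms(1) b U in auto)
    then show False using n by simp
  qed
  then have "0 < (L2_norm (vol ?U) (glue g \<tau>))\<^sup>2" by simp
  then show "0 < Xh_norm g (glue g \<tau>)" unfolding Xh_norm_def by (intro real_sqrt_gt_zero add_pos_nonneg) auto
qed

end

lemma L2_inner_trace_AE_zero:
  assumes \<tau>: "trace_regular G \<tau>" "AE x in vol G. \<tau> x = 0" and G: "polyhedral_domain G"
    and S: "S \<in> sets borel" "S \<subseteq> frontier G"
  shows "L2_inner (surf S) (mat_normal_trace G \<tau>) \<mu> = 0"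
proof -
  have "AE x in surf S. mat_normal_trace G \<tau> x = 0"
    using mat_normal_trace_AE_zero[OF \<tau> G] S by (intro AE_restrict_space_subset[OF _ S(2)]) auto
  then show ?thesis unfolding L2_inner_def by (intro integral_eq_zero_AE) (auto elim: eventually_mono)
qed

text \<open>If all discrete fields were null, the supremum in the stability condition would be taken
  over the empty set, and for v = 0 and \<xi> = 0 the condition would put 0 below minus
  infinity.\<close>

lemma Xh_nontrivial:
  assumes st: "elasticity_stable g \<D>" and v: "valid_discretization g D" and D: "D \<in> \<D>" and i: "i \<in> {1..num_sub g}"
  shows "\<exists>\<tau>\<in>Xh D i. \<not> (AE x in vol (subdomain g i). \<tau> x = 0)"
proof (rule ccontr)
  assume "\<not> (\<exists>\<tau>\<in>Xh D i. \<not> (AE x in vol (subdomain g i). \<tau> x = 0))"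
  then have e: "{\<tau>\<in>Xh D i. \<not> (AE x in vol (subdomain g i). \<tau> x = 0)} = {}" by blast
  have z: "(\<lambda>x. 0) \<in> Vh D i" "(\<lambda>x. 0) \<in> Qh D i"
    using valid_discretization_subdomain(5,6)[OF v i] by (auto simp: fe_space_def function_subspace_def)
  obtain C where C: "0 < C" and s: "\<forall>D\<in>\<D>. \<forall>i\<in>{1..num_sub g}. \<forall>v\<in>Vh D i. \<forall>\<xi>\<in>Qh D i.
        ereal (L2_norm (vol (subdomain g i)) v + L2_norm (vol (subdomain g i)) \<xi>) \<le>
        ereal C * (SUP \<tau>\<in>{\<tau>\<in>Xh D i. \<not> (AE x in vol (subdomain g i). \<tau> x = 0)}.
          ereal ((L2_inner (vol (subdomain g i)) (mat_div (subdomain g i) \<tau>) v +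
                  L2_inner (vol (subdomain g i)) \<tau> \<xi>) / mat_Hdiv_norm (subdomain g i) \<tau>))"
    using st unfolding elasticity_stable_def by (elim conjE exE)
  from bspec[OF bspec[OF bspec[OF bspec[OF s D] i] z(1)] z(2)] show False
    using C unfolding e by (simp add: bot_ereal_def L2_norm_def)
qed

text \<open>(MC) sees one interface at a time, and each projection norm over an interface is at most
  the one over the full boundary of its subdomain. Squaring a sum of two norms gives the factor 4,
  summation over the interfaces the factor \<open>card (interface_pairs g)\<close>.\<close>

lemma mortar_norm_le:
  fixes g :: "'n::finite geometry"
  assumes g: "valid_geometry g" and D: "valid_discretization g D" and \<mu>: "\<mu> \<in> Lambda_u g D" and c: "0 \<le> c"
    and MC: "\<And>i j. (i, j) \<in> interface_pairs g \<Longrightarrow> L2_norm (surf (interface g i j)) \<mu> \<le>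
        c * (L2_norm (surf (interface g i j)) (proj_u g D i (extend_by_zero (Gamma_all g) \<mu>)) +
             L2_norm (surf (interface g i j)) (proj_u g D j (extend_by_zero (Gamma_all g) \<mu>)))"
  shows "(L2_norm (surf (Gamma_all g)) \<mu>)\<^sup>2 \<le> real (card (interface_pairs g)) * (4 * c\<^sup>2) *
    (\<Sum>i\<in>{1..num_sub g}. (L2_norm (surf (frontier (subdomain g i))) (proj_u g D i (extend_by_zero (Gamma_all g) \<mu>)))\<^sup>2)"
proof -
  let ?I = "{1..num_sub g}" and ?E = "extend_by_zero (Gamma_all g) \<mu>"
  define q where "q = (\<lambda>i. L2_norm (surf (frontier (subdomain g i))) (proj_u g D i ?E))"
  have fin: "finite (interface_pairs g)"
    by (rule finite_subset[of _ "?I \<times> ?I"]) (auto simp: interface_pairs_def)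
  \<comment> \<open>(MC) is stated for i < j, while \<open>Gamma_all\<close> runs over all pairs of
    distinct indices; \<open>interface\<close> is symmetric.\<close>
  have \<Gamma>: "Gamma_all g = (\<Union>p\<in>interface_pairs g. interface g (fst p) (snd p))"
  proof
    show "Gamma_all g \<subseteq> (\<Union>p\<in>interface_pairs g. interface g (fst p) (snd p))"
    proof
      fix x assume "x \<in> Gamma_all g"
      then obtain i j where ij: "i \<in> ?I" "j \<in> ?I" "i \<noteq> j" "x \<in> interface g i j"
        unfolding Gamma_all_def by blast
      then have "(min i j, max i j) \<in> interface_pairs g" "x \<in> interface g (min i j) (max i j)"
        by (auto simp: interface_pairs_def interface_def min_def max_def)
      then show "x \<in> (\<Union>p\<in>interface_pairs g. interface g (fst p) (snd p))" by force
    qed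
    show "(\<Union>p\<in>interface_pairs g. interface g (fst p) (snd p)) \<subseteq> Gamma_all g"
    proof (intro UN_least)
      fix p assume "p \<in> interface_pairs g"
      then have "fst p \<in> ?I" "snd p \<in> ?I - {fst p}" by (auto simp: interface_pairs_def)
      then show "interface g (fst p) (snd p) \<subseteq> Gamma_all g" unfolding Gamma_all_def by blast
    qed
  qed
  have \<mu>L: "\<mu> \<in> L2_space (surf (Gamma_all g))" using \<mu> by (simp add: mortar_space_def)
  have E: "?E \<in> L2_space (surf (frontier (subdomain g i)))" for i
    using closed_Gamma_all by (intro L2_space_restrict extend_by_zero_L2_space[OF \<mu>L]) (auto intro: borel_closed)
  have ib: "interface g i j \<in> sets borel" for i j
    by (rule borel_closed) (simp add: interface_def closed_Int)
  have le: "L2_norm (surf (interface g i j)) (proj_u g D k ?E) \<le> q k"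
    if "k \<in> ?I" "interface g i j \<subseteq> frontier (subdomain g k)" for i j k
  proof (rule power2_le_imp_le)
    show "(L2_norm (surf (interface g i j)) (proj_u g D k ?E))\<^sup>2 \<le> (q k)\<^sup>2"
      unfolding q_def using L2_space_restrict_mono(2)[OF proj_u_L2_space[OF g D that(1) E] that(2)] ib by simp
  qed (simp add: q_def)
  have q_le: "(q k)\<^sup>2 \<le> (\<Sum>i\<in>?I. (q i)\<^sup>2)" if "k \<in> ?I" for k using that by (intro member_le_sum) auto
  have pair: "(L2_norm (surf (interface g (fst p) (snd p))) \<mu>)\<^sup>2 \<le> 4 * c\<^sup>2 * (\<Sum>i\<in>?I. (q i)\<^sup>2)"
    if "p \<in> interface_pairs g" for p
  proof -
    obtain i j where p: "p = (i, j)" by fastforce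
    have ij: "i \<in> ?I" "j \<in> ?I" using that p by (auto simp: interface_pairs_def)
    have "L2_norm (surf (interface g i j)) \<mu> \<le> c * (q i + q j)"
      using order_trans[OF MC[of i j] mult_left_mono[OF add_mono[OF le[OF ij(1)] le[OF ij(2)]] c]] that p
      by (simp add: interface_def)
    then have "(L2_norm (surf (interface g i j)) \<mu>)\<^sup>2 \<le> (c * (q i + q j))\<^sup>2" by (rule power_mono) simp
    also have "\<dots> = c\<^sup>2 * (q i + q j)\<^sup>2" by (simp add: power_mult_distrib)
    also have "\<dots> \<le> c\<^sup>2 * (4 * (\<Sum>i\<in>?I. (q i)\<^sup>2))"
    proof (rule mult_left_mono)
      have "(q i + q j)\<^sup>2 \<le> 2 * (q i)\<^sup>2 + 2 * (q j)\<^sup>2"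
        using zero_le_power2[of "q i - q j"] by (simp add: power2_sum power2_diff)
      then show "(q i + q j)\<^sup>2 \<le> 4 * (\<Sum>i\<in>?I. (q i)\<^sup>2)" using q_le[OF ij(1)] q_le[OF ij(2)] by linarith
    qed simp
    finally show ?thesis using p by simp
  qed
  have "(L2_norm (surf (Gamma_all g)) \<mu>)\<^sup>2 \<le> (\<Sum>p\<in>interface_pairs g. (L2_norm (surf (interface g (fst p) (snd p))) \<mu>)\<^sup>2)"
    using \<mu>L unfolding \<Gamma> by (rule L2_norm_UN_le) (use fin ib in auto)
  also have "\<dots> \<le> (\<Sum>p\<in>interface_pairs g. 4 * c\<^sup>2 * (\<Sum>i\<in>?I. (q i)\<^sup>2))" by (rule sum_mono) (rule pair)
  finally show ?thesis by (simp add: q_def mult.assoc)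
qed

theorem lemma3p2:
  fixes g :: "'n::finite geometry" and \<D> :: "'n discretization set"
  assumes "CARD('n) = 2 \<or> CARD('n) = 3"
    and "valid_geometry g"
    and "\<forall>D\<in>\<D>. valid_discretization g D"
    and "shape_regular_family g \<D>"
    and "elasticity_stable g \<D>"
    and "canonical_interpolants g \<D>"
    and "darcy_stable g \<D>"
    and "mortar_condition g \<D>"
  shows "\<exists>\<beta>\<^sub>E>0. \<forall>D\<in>\<D>. \<forall>\<mu>\<in>Lambda_u g D.
    ereal (L2_norm (surf (Gamma_all g)) \<mu>) \<le>
    ereal \<beta>\<^sub>E * (SUP \<tau>\<in>{\<tau>\<in>Xh_space g D. \<not> (AE x in vol (domain g). \<tau> x = 0)}.
      ereal ((\<Sum>i=1..num_sub g. L2_inner (surf (Gamma_sub g i)) (mat_normal_trace (subdomain g i) \<tau>) \<mu>)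
             / Xh_norm g \<tau>))"
proof -
  note g = assms(2)
  let ?I = "{1..num_sub g}" and ?\<Gamma> = "Gamma_all g"
  let ?q = "\<lambda>D \<mu> i. L2_norm (surf (frontier (subdomain g i))) (proj_u g D i (extend_by_zero ?\<Gamma> \<mu>))"
  have D: "valid_discretization g D" if "D \<in> \<D>" for D using assms(3) that by blast
  obtain c where c: "0 < c" and MC: "\<And>D \<mu> i j. D \<in> \<D> \<Longrightarrow> \<mu> \<in> Lambda_u g D \<Longrightarrow> (i, j) \<in> interface_pairs g \<Longrightarrow>
      L2_norm (surf (interface g i j)) \<mu> \<le>
        c * (L2_norm (surf (interface g i j)) (proj_u g D i (extend_by_zero ?\<Gamma> \<mu>)) +
             L2_norm (surf (interface g i j)) (proj_u g D j (extend_by_zero ?\<Gamma> \<mu>)))"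
    using assms(8) unfolding mortar_condition_def by fast
  \<comment> \<open>The summand 1 keeps K positive even if there is just one subdomain and hence no
    interface; the 1 in B below serves the same purpose.\<close>
  define K where "K = real (card (interface_pairs g)) * (4 * c\<^sup>2) + 1"
  have K: "0 < K" unfolding K_def by (intro add_nonneg_pos) auto
  obtain b where b: "\<And>i. i \<in> ?I \<Longrightarrow> 0 \<le> b i"
    "\<And>i D \<mu>. i \<in> ?I \<Longrightarrow> D \<in> \<D> \<Longrightarrow> \<mu> \<in> L2_space (surf ?\<Gamma>) \<Longrightarrow> \<exists>\<tau>\<in>Xh D i.
      (?q D \<mu> i)\<^sup>2 \<le> L2_inner (surf (Gamma_sub g i)) (mat_normal_trace (subdomain g i) \<tau>) \<mu> \<and>
      mat_Hdiv_norm (subdomain g i) \<tau> \<le> b i * L2_norm (surf ?\<Gamma>) \<mu>"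
  proof -
    have "\<forall>i\<in>?I. \<exists>C\<ge>0. \<forall>D\<in>\<D>. \<forall>\<mu>\<in>L2_space (surf ?\<Gamma>). \<exists>\<tau>\<in>Xh D i.
      (?q D \<mu> i)\<^sup>2 \<le> L2_inner (surf (Gamma_sub g i)) (mat_normal_trace (subdomain g i) \<tau>) \<mu> \<and>
      mat_Hdiv_norm (subdomain g i) \<tau> \<le> C * L2_norm (surf ?\<Gamma>) \<mu>"
      using subdomain_flux[OF g D assms(6)] by blast
    from bchoice[OF this] obtain b where "\<forall>i\<in>?I. 0 \<le> b i \<and> (\<forall>D\<in>\<D>. \<forall>\<mu>\<in>L2_space (surf ?\<Gamma>). \<exists>\<tau>\<in>Xh D i.
      (?q D \<mu> i)\<^sup>2 \<le> L2_inner (surf (Gamma_sub g i)) (mat_normal_trace (subdomain g i) \<tau>) \<mu> \<and>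
      mat_Hdiv_norm (subdomain g i) \<tau> \<le> b i * L2_norm (surf ?\<Gamma>) \<mu>)" by blast
    then show thesis by (intro that[of b]) auto
  qed
  define B where "B = sqrt (\<Sum>i\<in>?I. (b i)\<^sup>2) + 1"
  have B: "0 < B" unfolding B_def by (intro add_nonneg_pos) (auto intro: sum_nonneg)
  have Sub: "Gamma_sub g i \<in> sets borel" "Gamma_sub g i \<subseteq> frontier (subdomain g i)" "Gamma_sub g i \<subseteq> ?\<Gamma>" for i
    using closed_Gamma_sub by (auto intro: borel_closed simp: Gamma_sub_def)
  have main: "ereal (L2_norm (surf ?\<Gamma>) \<mu>) \<le>
      ereal (K * B) * (SUP \<tau>\<in>{\<tau>\<in>Xh_space g D. \<not> (AE x in vol (domain g). \<tau> x = 0)}.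
        ereal ((\<Sum>i=1..num_sub g. L2_inner (surf (Gamma_sub g i)) (mat_normal_trace (subdomain g i) \<tau>) \<mu>)
             / Xh_norm g \<tau>))" (is "_ \<le> _ * (SUP \<tau>\<in>?X. ereal (?S \<tau> / _))")
    if h: "D \<in> \<D>" and \<mu>: "\<mu> \<in> Lambda_u g D" for D \<mu>
  proof -
    let ?m = "L2_norm (surf ?\<Gamma>) \<mu>"
    have \<mu>L: "\<mu> \<in> L2_space (surf ?\<Gamma>)" using \<mu> by (simp add: mortar_space_def)
    have "\<exists>\<sigma>\<in>?X. ?m \<le> K * B * (?S \<sigma> / Xh_norm g \<sigma>)"
    proof (cases "?m = 0")
      \<comment> \<open>Over an empty index set the supremum would be minus infinity, so a field
        that is not null has to be exhibited. Its pairing with the null function \<mu> is 0, which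
        suffices here.\<close>
      case True
      have 1: "1 \<in> ?I" using g by (simp add: valid_geometry_def)
      obtain \<tau>1 where \<tau>1: "\<tau>1 \<in> Xh D 1" "\<not> (AE x in vol (subdomain g 1). \<tau>1 x = 0)"
        using Xh_nontrivial[OF assms(5) D[OF h] h 1] by blast
      define \<tau> where "\<tau> = (\<lambda>i::nat. if i = 1 then \<tau>1 else (\<lambda>x. 0))"
      have \<tau>: "\<tau> i \<in> Xh D i" if "i \<in> ?I" for i
        using \<tau>1(1) valid_discretization_subdomain(2)[OF D[OF h] that] by (simp add: \<tau>_def fe_space_def function_subspace_def)
      have "\<not> (AE x in vol (subdomain g 1). \<tau> 1 x = 0)" using \<tau>1(2) by (simp add: \<tau>_def)
      from Xh_norm_glue_pos(2)[OF g D[OF h] \<tau> 1 this]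
      have X: "glue g \<tau> \<in> ?X" using glue_Xh_space[OF g D[OF h] \<tau>] by simp
      have "AE x in surf ?\<Gamma>. \<mu> x = 0" using True by (simp only: L2_norm_eq_0_iff[OF \<mu>L])
      then have \<mu>0: "AE x in surf (Gamma_sub g i). \<mu> x = 0" for i
        by (rule AE_restrict_space_subset) (simp_all add: Sub borel_closed[OF closed_Gamma_all])
      have "L2_inner (surf (Gamma_sub g i)) f \<mu> = 0" for i f
        unfolding L2_inner_def by (rule integral_eq_zero_AE) (rule eventually_mono[OF \<mu>0], simp)
      then have "?S (glue g \<tau>) = 0" by simp
      then show ?thesis using X True by (intro bexI[of _ "glue g \<tau>"]) auto
    next
      case False
      then have m: "0 < ?m" using L2_norm_nonneg[of "surf ?\<Gamma>" \<mu>] by linarith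
      obtain \<tau> :: "nat \<Rightarrow> real^'n \<Rightarrow> real^'n^'n" where \<tau>: "\<And>i. i \<in> ?I \<Longrightarrow> \<tau> i \<in> Xh D i"
        "\<And>i. i \<in> ?I \<Longrightarrow> (?q D \<mu> i)\<^sup>2 \<le> L2_inner (surf (Gamma_sub g i)) (mat_normal_trace (subdomain g i) (\<tau> i)) \<mu>"
        "\<And>i. i \<in> ?I \<Longrightarrow> mat_Hdiv_norm (subdomain g i) (\<tau> i) \<le> b i * ?m"
      proof -
        have "\<forall>i\<in>?I. \<exists>\<tau>. \<tau> \<in> Xh D i \<and>
          (?q D \<mu> i)\<^sup>2 \<le> L2_inner (surf (Gamma_sub g i)) (mat_normal_trace (subdomain g i) \<tau>) \<mu> \<and>
          mat_Hdiv_norm (subdomain g i) \<tau> \<le> b i * ?m" using b(2)[OF _ h \<mu>L] by blast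
        from bchoice[OF this] show thesis using that by blast
      qed
      let ?\<sigma> = "glue g \<tau>"
      have "?m\<^sup>2 \<le> (K - 1) * (\<Sum>i\<in>?I. (?q D \<mu> i)\<^sup>2)"
        using mortar_norm_le[OF g D[OF h] \<mu> less_imp_le[OF c] MC[OF h \<mu>]] by (simp add: K_def)
      also have "\<dots> \<le> K * (\<Sum>i\<in>?I. (?q D \<mu> i)\<^sup>2)" by (intro mult_right_mono sum_nonneg) auto
      also have "\<dots> \<le> K * ?S ?\<sigma>"
      proof (intro mult_left_mono sum_mono)
        fix i assume "i \<in> ?I"
        then show "(?q D \<mu> i)\<^sup>2 \<le> L2_inner (surf (Gamma_sub g i)) (mat_normal_trace (subdomain g i) ?\<sigma>) \<mu>"
          using \<tau>(2) by (subst glue_trace[OF g D[OF h] \<tau>(1)])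
      qed (use K in simp)
      finally have mS: "?m\<^sup>2 \<le> K * ?S ?\<sigma>" .
      have "0 < ?m\<^sup>2" using m by simp
      then have "0 < K * ?S ?\<sigma>" using mS by linarith
      then have S0: "?S ?\<sigma> \<noteq> 0" using K by auto
      \<comment> \<open>Null fields have null traces, so a nonzero pairing forces one of the local
        fields to be nonzero.\<close>
      have "\<exists>i\<in>?I. \<not> (AE x in vol (subdomain g i). \<tau> i x = 0)"
      proof (rule ccontr)
        assume n: "\<not> ?thesis"
        have "L2_inner (surf (Gamma_sub g i)) (mat_normal_trace (subdomain g i) ?\<sigma>) \<mu> = 0" if i: "i \<in> ?I" for i
        proof -
          have "mat_normal_trace (subdomain g i) ?\<sigma> = mat_normal_trace (subdomain g i) (\<tau> i)"
            by (intro glue_trace[OF g D[OF h] \<tau>(1)] i)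
          moreover have "AE x in vol (subdomain g i). \<tau> i x = 0" using n i by blast
          ultimately show ?thesis
            using L2_inner_trace_AE_zero[OF Xh_trace_regular[OF g D[OF h] i \<tau>(1)[OF i]] _
              valid_geometry_facts(3)[OF g i] Sub(1,2)] by simp
        qed
        then show False using S0 by simp
      qed
      then obtain i where i: "i \<in> ?I" "\<not> (AE x in vol (subdomain g i). \<tau> i x = 0)" by blast
      note pos = Xh_norm_glue_pos[OF g D[OF h] \<tau>(1) i]
      have X: "?\<sigma> \<in> ?X" using glue_Xh_space[OF g D[OF h] \<tau>(1)] pos(2) by simp
      have "(Xh_norm g ?\<sigma>)\<^sup>2 \<le> (\<Sum>i\<in>?I. (b i * ?m)\<^sup>2)"
      proof (rule order_trans[OF Xh_norm_glue_le[OF g D[OF h] \<tau>(1)]])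
        show "(\<Sum>i\<in>?I. (mat_Hdiv_norm (subdomain g i) (\<tau> i))\<^sup>2) \<le> (\<Sum>i\<in>?I. (b i * ?m)\<^sup>2)"
          by (intro sum_mono power_mono \<tau>(3)) (auto simp: mat_Hdiv_norm_def)
      qed
      also have "\<dots> = (\<Sum>i\<in>?I. (b i)\<^sup>2) * ?m\<^sup>2" by (simp add: power_mult_distrib sum_distrib_right)
      finally have "Xh_norm g ?\<sigma> \<le> sqrt ((\<Sum>i\<in>?I. (b i)\<^sup>2) * ?m\<^sup>2)" by (rule real_le_rsqrt)
      then have "Xh_norm g ?\<sigma> \<le> B * ?m" using m by (simp add: real_sqrt_mult B_def distrib_right)
      \<comment> \<open>Multiplied by \<open>?m\<close>, the norm bound meets the lower bound
        \<open>mS\<close> of the pairing in the square of \<open>?m\<close>; division by the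
        positive norm gives the quotient.\<close>
      then have "?m * Xh_norm g ?\<sigma> \<le> ?m * (B * ?m)" using m by (intro mult_left_mono) auto
      also have "\<dots> = B * ?m\<^sup>2" by (simp add: power2_eq_square)
      also have "\<dots> \<le> B * (K * ?S ?\<sigma>)" using mS B by (intro mult_left_mono) auto
      finally have "?m \<le> K * B * (?S ?\<sigma> / Xh_norm g ?\<sigma>)" using pos(1) by (simp add: field_simps)
      then show ?thesis using X by blast
    qed
    then obtain \<sigma> where \<sigma>: "\<sigma> \<in> ?X" "?m \<le> K * B * (?S \<sigma> / Xh_norm g \<sigma>)" by blast
    have "ereal ?m \<le> ereal (K * B) * ereal (?S \<sigma> / Xh_norm g \<sigma>)" using \<sigma>(2) by simp
    also have "\<dots> \<le> ereal (K * B) * (SUP \<tau>\<in>?X. ereal (?S \<tau> / Xh_norm g \<tau>))"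
      using K B by (intro ereal_mult_left_mono SUP_upper \<sigma>(1)) auto
    finally show ?thesis .
  qed
  show ?thesis using K B by (intro exI[of _ "K * B"] conjI ballI main) auto
qed

end
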